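(* Let $p$ be an odd prime, let $k$ be an algebraically closed field of characteristic $p$, and let $\mathcal{F}$ be a nonconstrained saturated fusion system on an extraspecial $p$-group $S$ of order $p^3$ and exponent $p$. Then $\lim\mathcal{A}^2_\mathcal{F}=0$; that is, the only compatible family for $\mathcal{F}$ is the trivial one ($\alpha_Q=0$ for all $\mathcal{F}$-centric $Q$).
   Context: A saturated fusion system $\mathcal{F}$ on $S$ is constrained if it has a normal subgroup $Q$ (i.e. $Q\trianglelefteq\mathcal{F}$) with $C_S(Q)\le Q$; nonconstrained otherwise. $\mathcal{F}^c$ is the set of $\mathcal{F}$-centric subgroups and $\operatorname{Out}_\mathcal{F}(Q)=\operatorname{Aut}_\mathcal{F}(Q)/\operatorname{Inn}(Q)$. $\mathcal{A}^2_\mathcal{F}$ is the functor on the orbit category of $\mathcal{F}^c$ sending $Q$ to $H^2(\operatorname{Out}_\mathcal{F}(Q),k^\times)$, and its inverse limit $\lim\mathcal{A}^2_\mathcal{F}$ is the group of compatible families: families $(\alpha_Q)_{Q\in\mathcal{F}^c}$, $\alpha_Q\in H^2(\operatorname{Out}_\mathcal{F}(Q),k^\times)$, compatible with $\mathcal{F}$-isomorphisms and such that for $Q\le R$ in $\mathcal{F}^c$ the pullbacks of $\alpha_R$ and $\alpha_Q$ to the group of automorphisms in $\operatorname{Aut}_\mathcal{F}(R)$ normalizing $Q$ (via the projection to $\operatorname{Out}_\mathcal{F}(R)$, resp. restriction to $Q$ followed by projection to $\operatorname{Out}_\mathcal{F}(Q)$) coincide. *)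

theory Defs
  imports "HOL-Algebra.Coset" "HOL-Algebra.Generated_Groups" "HOL-Algebra.Multiplicative_Group"
          "HOL-Computational_Algebra.Polynomial"
begin

definition centralizer :: "'g monoid \<Rightarrow> 'g set \<Rightarrow> 'g set" where
  "centralizer G P = {g \<in> carrier G. \<forall>x\<in>P. g \<otimes>\<^bsub>G\<^esub> x = x \<otimes>\<^bsub>G\<^esub> g}"

definition grp_center :: "'g monoid \<Rightarrow> 'g set" where
  "grp_center G = centralizer G (carrier G)"

definition normalizer :: "'g monoid \<Rightarrow> 'g set \<Rightarrow> 'g set" where
  "normalizer G P = {g \<in> carrier G. (\<lambda>x. g \<otimes>\<^bsub>G\<^esub> x \<otimes>\<^bsub>G\<^esub> inv\<^bsub>G\<^esub> g) ` P = P}"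

definition maximal_subgroup :: "'g monoid \<Rightarrow> 'g set \<Rightarrow> bool" where
  "maximal_subgroup G M \<longleftrightarrow> subgroup M G \<and> M \<noteq> carrier G \<and>
     (\<forall>H. subgroup H G \<longrightarrow> M \<subseteq> H \<longrightarrow> H = M \<or> H = carrier G)"

definition frattini :: "'g monoid \<Rightarrow> 'g set" where
  "frattini G = carrier G \<inter> \<Inter>{M. maximal_subgroup G M}"

definition extraspecial :: "'g monoid \<Rightarrow> nat \<Rightarrow> bool" where
  "extraspecial G p \<longleftrightarrow> group G \<and> finite (carrier G) \<and> (\<exists>n. card (carrier G) = p ^ n) \<and>
     card (grp_center G) = p \<and>
     derived G (carrier G) = grp_center G \<and> frattini G = grp_center G"

definition has_exponent :: "'g monoid \<Rightarrow> nat \<Rightarrow> bool" where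
  "has_exponent G e \<longleftrightarrow> e = Lcm {ord. \<exists>x\<in>carrier G. ord = group.ord G x}"

text \<open>Morphisms are represented as functions extensional on their domain.\<close>

definition conjm :: "'g monoid \<Rightarrow> 'g \<Rightarrow> 'g set \<Rightarrow> ('g \<Rightarrow> 'g)" where
  "conjm G g P = (\<lambda>x\<in>P. g \<otimes>\<^bsub>G\<^esub> x \<otimes>\<^bsub>G\<^esub> inv\<^bsub>G\<^esub> g)"

definition Hom_S :: "'g monoid \<Rightarrow> 'g set \<Rightarrow> 'g set \<Rightarrow> ('g \<Rightarrow> 'g) set" where
  "Hom_S G P Q = {conjm G g P | g. g \<in> carrier G \<and>
                    (\<lambda>x. g \<otimes>\<^bsub>G\<^esub> x \<otimes>\<^bsub>G\<^esub> inv\<^bsub>G\<^esub> g) ` P \<subseteq> Q}"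

definition Inj_hom :: "'g monoid \<Rightarrow> 'g set \<Rightarrow> 'g set \<Rightarrow> ('g \<Rightarrow> 'g) set" where
  "Inj_hom G P Q = {\<phi>. \<phi> \<in> extensional P \<and> \<phi> ` P \<subseteq> Q \<and> inj_on \<phi> P \<and>
      (\<forall>x\<in>P. \<forall>y\<in>P. \<phi> (x \<otimes>\<^bsub>G\<^esub> y) = \<phi> x \<otimes>\<^bsub>G\<^esub> \<phi> y)}"

text \<open>A fusion system F on the finite p-group G: F P Q is the set Hom_F(P,Q).\<close>
definition fusion_system :: "'g monoid \<Rightarrow> nat \<Rightarrow> ('g set \<Rightarrow> 'g set \<Rightarrow> ('g \<Rightarrow> 'g) set) \<Rightarrow> bool" where
  "fusion_system G p F \<longleftrightarrow>
     group G \<and> finite (carrier G) \<and> prime p \<and> (\<exists>n. card (carrier G) = p ^ n) \<and>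
     (\<forall>P Q. \<not> (subgroup P G \<and> subgroup Q G) \<longrightarrow> F P Q = {}) \<and>
     (\<forall>P Q. subgroup P G \<longrightarrow> subgroup Q G \<longrightarrow>
        Hom_S G P Q \<subseteq> F P Q \<and> F P Q \<subseteq> Inj_hom G P Q) \<and>
     (\<forall>P Q R \<phi> \<psi>. \<phi> \<in> F P Q \<longrightarrow> \<psi> \<in> F Q R \<longrightarrow> restrict (\<psi> \<circ> \<phi>) P \<in> F P R) \<and>
     (\<forall>P Q P' Q' \<phi>. \<phi> \<in> F P Q \<longrightarrow> subgroup P' G \<longrightarrow> P' \<subseteq> P \<longrightarrow> subgroup Q' G \<longrightarrow>
        \<phi> ` P' \<subseteq> Q' \<longrightarrow> restrict \<phi> P' \<in> F P' Q') \<and>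
     (\<forall>P Q \<phi>. \<phi> \<in> F P Q \<longrightarrow> \<phi> ` P = Q \<longrightarrow> restrict (inv_into P \<phi>) Q \<in> F Q P)"

definition F_conj :: "('g set \<Rightarrow> 'g set \<Rightarrow> ('g \<Rightarrow> 'g) set) \<Rightarrow> 'g set \<Rightarrow> 'g set \<Rightarrow> bool" where
  "F_conj F P P' \<longleftrightarrow> (\<exists>\<phi>\<in>F P P'. \<phi> ` P = P')"

definition fully_centralized where
  "fully_centralized G F P \<longleftrightarrow> subgroup P G \<and>
     (\<forall>P'. F_conj F P P' \<longrightarrow> card (centralizer G P') \<le> card (centralizer G P))"

definition fully_normalized where
  "fully_normalized G F P \<longleftrightarrow> subgroup P G \<and>
     (\<forall>P'. F_conj F P P' \<longrightarrow> card (normalizer G P') \<le> card (normalizer G P))"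

definition Aut_S :: "'g monoid \<Rightarrow> 'g set \<Rightarrow> ('g \<Rightarrow> 'g) set" where
  "Aut_S G P = {conjm G g P | g. g \<in> normalizer G P}"

text \<open>H is a Sylow p-subgroup of the finite group with carrier K (H a subgroup of K).\<close>
definition sylow_in :: "nat \<Rightarrow> 'a set \<Rightarrow> 'a set \<Rightarrow> bool" where
  "sylow_in p H K \<longleftrightarrow> H \<subseteq> K \<and> (\<exists>n. card H = p ^ n) \<and> \<not> p dvd (card K div card H)"

definition N_phi :: "'g monoid \<Rightarrow> 'g set \<Rightarrow> ('g \<Rightarrow> 'g) \<Rightarrow> 'g set" where
  "N_phi G P \<phi> = {g \<in> normalizer G P. \<exists>h\<in>normalizer G (\<phi> ` P).
      \<forall>y\<in>P. \<phi> (g \<otimes>\<^bsub>G\<^esub> y \<otimes>\<^bsub>G\<^esub> inv\<^bsub>G\<^esub> g) = h \<otimes>\<^bsub>G\<^esub> \<phi> y \<otimes>\<^bsub>G\<^esub> inv\<^bsub>G\<^esub> h}"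

text \<open>Saturation (Roberts--Shpectorov form of the axioms).\<close>
definition saturated :: "'g monoid \<Rightarrow> nat \<Rightarrow> ('g set \<Rightarrow> 'g set \<Rightarrow> ('g \<Rightarrow> 'g) set) \<Rightarrow> bool" where
  "saturated G p F \<longleftrightarrow> fusion_system G p F \<and>
     (\<forall>P. subgroup P G \<longrightarrow> fully_normalized G F P \<longrightarrow>
         fully_centralized G F P \<and> sylow_in p (Aut_S G P) (F P P)) \<and>
     (\<forall>P \<phi>. subgroup P G \<longrightarrow> \<phi> \<in> F P (carrier G) \<longrightarrow> fully_centralized G F (\<phi> ` P) \<longrightarrow>
         (\<exists>\<psi>\<in>F (N_phi G P \<phi>) (carrier G). \<forall>x\<in>P. \<psi> x = \<phi> x))"

definition F_normal where
  "F_normal G F Q \<longleftrightarrow> normal Q G \<and>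
     (\<forall>P R \<phi>. \<phi> \<in> F P R \<longrightarrow>
        (\<exists>\<psi>\<in>F (P <#>\<^bsub>G\<^esub> Q) (R <#>\<^bsub>G\<^esub> Q). (\<forall>x\<in>P. \<psi> x = \<phi> x) \<and> \<psi> ` Q = Q))"

definition constrained where
  "constrained G F \<longleftrightarrow> (\<exists>Q. F_normal G F Q \<and> centralizer G Q \<subseteq> Q)"

definition F_centric where
  "F_centric G F P \<longleftrightarrow> subgroup P G \<and> (\<forall>P'. F_conj F P P' \<longrightarrow> centralizer G P' \<subseteq> P')"

definition AutGrp :: "('g set \<Rightarrow> 'g set \<Rightarrow> ('g \<Rightarrow> 'g) set) \<Rightarrow> 'g set \<Rightarrow> ('g \<Rightarrow> 'g) monoid" where
  "AutGrp F P = \<lparr>carrier = F P P, monoid.mult = (\<lambda>a b. restrict (a \<circ> b) P), one = restrict id P\<rparr>"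

definition Inn :: "'g monoid \<Rightarrow> 'g set \<Rightarrow> ('g \<Rightarrow> 'g) set" where
  "Inn G P = {conjm G q P | q. q \<in> P}"

definition OutGrp :: "'g monoid \<Rightarrow> ('g set \<Rightarrow> 'g set \<Rightarrow> ('g \<Rightarrow> 'g) set) \<Rightarrow> 'g set
                        \<Rightarrow> ('g \<Rightarrow> 'g) set monoid" where
  "OutGrp G F P = AutGrp F P Mod Inn G P"

definition out_cls :: "'g monoid \<Rightarrow> ('g set \<Rightarrow> 'g set \<Rightarrow> ('g \<Rightarrow> 'g) set) \<Rightarrow> 'g set
                        \<Rightarrow> ('g \<Rightarrow> 'g) \<Rightarrow> ('g \<Rightarrow> 'g) set" where
  "out_cls G F P a = Inn G P #>\<^bsub>AutGrp F P\<^esub> a"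

definition out_map :: "('g \<Rightarrow> 'g) \<Rightarrow> 'g set \<Rightarrow> 'g set \<Rightarrow> ('g \<Rightarrow> 'g) set \<Rightarrow> ('g \<Rightarrow> 'g) set" where
  "out_map \<phi> Q Q' C = (\<lambda>a. restrict (\<phi> \<circ> a \<circ> inv_into Q \<phi>) Q') ` C"

definition AutGrp_norm :: "('g set \<Rightarrow> 'g set \<Rightarrow> ('g \<Rightarrow> 'g) set) \<Rightarrow> 'g set \<Rightarrow> 'g set \<Rightarrow> ('g \<Rightarrow> 'g) monoid" where
  "AutGrp_norm F R Q = \<lparr>carrier = {a \<in> F R R. a ` Q = Q},
                        monoid.mult = (\<lambda>a b. restrict (a \<circ> b) R), one = restrict id R\<rparr>"

definition cocycle2 :: "'a monoid \<Rightarrow> ('a \<Rightarrow> 'a \<Rightarrow> 'k::field) \<Rightarrow> bool" where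
  "cocycle2 G f \<longleftrightarrow> (\<forall>x\<in>carrier G. \<forall>y\<in>carrier G. f x y \<noteq> 0) \<and>
     (\<forall>x\<in>carrier G. \<forall>y\<in>carrier G. \<forall>z\<in>carrier G.
        f x y * f (x \<otimes>\<^bsub>G\<^esub> y) z = f y z * f x (y \<otimes>\<^bsub>G\<^esub> z))"

definition cohomologous :: "'a monoid \<Rightarrow> ('a \<Rightarrow> 'a \<Rightarrow> 'k::field) \<Rightarrow> ('a \<Rightarrow> 'a \<Rightarrow> 'k) \<Rightarrow> bool" where
  "cohomologous G f g \<longleftrightarrow> (\<exists>c. (\<forall>x\<in>carrier G. c x \<noteq> 0) \<and>
     (\<forall>x\<in>carrier G. \<forall>y\<in>carrier G. f x y * c (x \<otimes>\<^bsub>G\<^esub> y) = g x y * c x * c y))"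

definition trivial_class :: "'a monoid \<Rightarrow> ('a \<Rightarrow> 'a \<Rightarrow> 'k::field) \<Rightarrow> bool" where
  "trivial_class G f \<longleftrightarrow> cohomologous G f (\<lambda>_ _. 1)"

text \<open>Compatible families (elements of lim A^2_F), each alpha_Q given by a representing cocycle.\<close>
definition compatible_family ::
  "'g monoid \<Rightarrow> ('g set \<Rightarrow> 'g set \<Rightarrow> ('g \<Rightarrow> 'g) set)
   \<Rightarrow> ('g set \<Rightarrow> ('g \<Rightarrow> 'g) set \<Rightarrow> ('g \<Rightarrow> 'g) set \<Rightarrow> 'k::field) \<Rightarrow> bool" where
  "compatible_family G F \<alpha> \<longleftrightarrow>
     (\<forall>Q. F_centric G F Q \<longrightarrow> cocycle2 (OutGrp G F Q) (\<alpha> Q)) \<and>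
     (\<forall>Q Q' \<phi>. F_centric G F Q \<longrightarrow> F_centric G F Q' \<longrightarrow> \<phi> \<in> F Q Q' \<longrightarrow> \<phi> ` Q = Q' \<longrightarrow>
        cohomologous (OutGrp G F Q) (\<alpha> Q)
          (\<lambda>x y. \<alpha> Q' (out_map \<phi> Q Q' x) (out_map \<phi> Q Q' y))) \<and>
     (\<forall>Q R. F_centric G F Q \<longrightarrow> F_centric G F R \<longrightarrow> Q \<subseteq> R \<longrightarrow>
        cohomologous (AutGrp_norm F R Q)
          (\<lambda>a b. \<alpha> R (out_cls G F R a) (out_cls G F R b))
          (\<lambda>a b. \<alpha> Q (out_cls G F Q (restrict a Q)) (out_cls G F Q (restrict b Q))))"

end

theory Submission
  imports "HOL-Algebra.Sylow" "HOL-Algebra.Group_Action" "HOL-Number_Theory.Residue_Primitive_Roots" Defs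
begin

text \<open>If no plane (subgroup of order \<open>p\<^sup>2\<close>) has an \<open>F\<close>-automorphism moving the centre \<open>Z\<close>, every
  morphism extends to \<open>S\<close> and \<open>F\<close> is constrained. So some plane \<open>V\<close> is essential: its automorphism
  group contains \<open>SL\<^sub>2(p)\<close>, whose Steinberg presentation kills the class at \<open>V\<close>. The diagonal torus of
  \<open>SL\<^sub>2(p)\<close> fixes \<open>Z\<close> and hence extends to \<open>S\<close>, acting on \<open>S/Z\<close> as \<open>diag(g\<^sup>-\<^sup>1, g\<^sup>2)\<close> with \<open>g\<close> a
  primitive root. A \<open>p'\<close>-subgroup of \<open>GL\<^sub>2(p)\<close> containing this element is so restricted that a class on
  it vanishes once it vanishes on the stabiliser of the line \<open>V/Z\<close>; compatibility with \<open>V\<close> gives just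
  that, so the class at \<open>S\<close> is trivial. At a nonessential plane all automorphisms are restrictions
  from \<open>S\<close> with \<open>p\<close>-torsion kernel, and in characteristic \<open>p\<close> such kernels are invisible to
  coefficients in \<open>k\<^sup>\<times>\<close>.\<close>

text \<open>A class in H^2(A, k^x) is handled as a central extension of A by k^x; it vanishes iff
  the extension splits, and splittings are built by lifting generators and rescaling the lifts by
  roots in k. Two facts about k^x carry this: it is divisible, so a single element can be lifted
  without raising its order, and it has no p-torsion, so p-elements have canonical lifts. Transfer
  reduces splitting over a finite A to splitting over one Sylow subgroup for each prime. The
  obstacle is S itself. Out_F(S) acts faithfully on S/Z as a p'-subgroup of GL_2(p), and such groups
  can have nonzero H^2, for instance a product of two cyclic groups of order q with q dividing p -
  1. So the plane V has to contribute. Its torus element multiplies Z by g and V/Z by 1/g; the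
  commutator pairing identifies the determinant on S/Z with the action on Z, so S/V is multiplied by
  g^2. The e-th power of this element is scalar on S/Z exactly when g^(3e) = 1. This is why the
  prime 3 needs an argument of its own; the prime 2 does as well, because matrices may then
  anticommute.\<close>

lemma (in group) mult_inv_cancel [simp]:
  assumes "x \<in> carrier G" "y \<in> carrier G"
  shows "inv x \<otimes> (x \<otimes> y) = y" "x \<otimes> (inv x \<otimes> y) = y"
  using assms by (simp_all add: m_assoc[symmetric])

lemma (in group) conj_pow:
  assumes "x \<in> carrier G" "y \<in> carrier G"
  shows "(x \<otimes> y \<otimes> inv x) [^] (n::nat) = x \<otimes> y [^] n \<otimes> inv x"
proof (induction n)
  case (Suc n)
  then show ?case using assms by (simp add: m_assoc)
qed (use assms in simp)

section \<open>Central extensions by the multiplicative group of a field\<close>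

text \<open>\<open>\<iota>\<close> is a total function on the field type, with meaning only at
  nonzero arguments, where it identifies k^x with the kernel of \<open>\<pi>\<close>. The field is
  algebraically closed so that scalars have roots.\<close>

locale central_extension = E: group E + A: group A
  for E :: "'e monoid" (structure) and A :: "'a monoid" +
  fixes \<pi> :: "'e \<Rightarrow> 'a" and \<iota> :: "'k::alg_closed_field \<Rightarrow> 'e"
  assumes \<pi>_hom: "\<pi> \<in> hom E A"
    and \<pi>_surj: "\<pi> ` carrier E = carrier A"
    and \<iota>_closed [simp]: "u \<noteq> 0 \<Longrightarrow> \<iota> u \<in> carrier E"
    and \<iota>_mult: "u \<noteq> 0 \<Longrightarrow> v \<noteq> 0 \<Longrightarrow> \<iota> (u * v) = \<iota> u \<otimes> \<iota> v"
    and \<iota>_one_iff: "u \<noteq> 0 \<Longrightarrow> \<iota> u = \<one> \<Longrightarrow> u = 1"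
    and \<iota>_central: "u \<noteq> 0 \<Longrightarrow> e \<in> carrier E \<Longrightarrow> e \<otimes> \<iota> u = \<iota> u \<otimes> e"
    and \<pi>_ker: "e \<in> carrier E \<Longrightarrow> \<pi> e = \<one>\<^bsub>A\<^esub> \<Longrightarrow> \<exists>u. u \<noteq> 0 \<and> e = \<iota> u"
    and \<pi>_\<iota> [simp]: "u \<noteq> 0 \<Longrightarrow> \<pi> (\<iota> u) = \<one>\<^bsub>A\<^esub>"
begin

sublocale \<pi>: group_hom E A \<pi>
  by unfold_locales (rule \<pi>_hom)

lemma \<iota>_1 [simp]: "\<iota> 1 = \<one>"
proof -
  have "\<iota> 1 \<otimes> \<iota> 1 = \<iota> 1" using \<iota>_mult[of 1 1] by simp
  then show ?thesis by (metis E.r_cancel_one \<iota>_closed one_neq_zero)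
qed

lemma \<iota>_pow: "u \<noteq> 0 \<Longrightarrow> \<iota> u [^] (n::nat) = \<iota> (u ^ n)"
  by (induction n) (simp_all add: \<iota>_mult[symmetric] mult.commute)

lemma \<iota>_inv: "u \<noteq> 0 \<Longrightarrow> inv (\<iota> u) = \<iota> (1 / u)"
  by (rule E.inv_equality) (simp_all add: \<iota>_mult[symmetric])

lemma \<iota>_inj: "u \<noteq> 0 \<Longrightarrow> v \<noteq> 0 \<Longrightarrow> \<iota> u = \<iota> v \<Longrightarrow> u = v"
proof -
  assume a: "u \<noteq> 0" "v \<noteq> 0" "\<iota> u = \<iota> v"
  have "\<iota> (u * (1 / v)) = \<iota> u \<otimes> inv (\<iota> v)" using a by (subst \<iota>_mult) (simp_all add: \<iota>_inv)
  also have "\<dots> = \<one>" using a by simp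
  finally have "u * (1 / v) = 1" using a by (intro \<iota>_one_iff) simp_all
  then show "u = v" using a by simp
qed

lemma same_image:
  assumes "e \<in> carrier E" "e' \<in> carrier E" "\<pi> e = \<pi> e'"
  obtains u where "u \<noteq> 0" "e' = \<iota> u \<otimes> e"
proof -
  have "\<pi> (e' \<otimes> inv e) = \<one>\<^bsub>A\<^esub>" using assms by simp
  then obtain u where u: "u \<noteq> 0" "e' \<otimes> inv e = \<iota> u"
    using \<pi>_ker[of "e' \<otimes> inv e"] assms by auto
  then have "e' = \<iota> u \<otimes> e" using assms by (metis E.inv_closed E.inv_solve_right' E.m_closed)
  then show ?thesis using u that by blast
qed

lemma lift_exists: "a \<in> carrier A \<Longrightarrow> \<exists>e\<in>carrier E. \<pi> e = a"
  using \<pi>_surj by (metis imageE)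

lemma scaled_pow:
  assumes "u \<noteq> 0" "e \<in> carrier E"
  shows "(\<iota> u \<otimes> e) [^] (n::nat) = \<iota> (u ^ n) \<otimes> e [^] n"
  using assms by (simp add: E.pow_mult_distrib[OF \<iota>_central[OF assms, symmetric]] \<iota>_pow)

lemma root_exists: "u \<noteq> 0 \<Longrightarrow> n > 0 \<Longrightarrow> \<exists>v. v \<noteq> 0 \<and> v ^ n = (u::'k)"
  by (metis nth_root_exists power_0_left neq0_conv)

text \<open>The n-th power of any lift is a scalar, and an n-th root of the inverse scalar corrects
  the lift.\<close>

lemma lift_of_order:
  assumes "a \<in> carrier A" "a [^]\<^bsub>A\<^esub> (n::nat) = \<one>\<^bsub>A\<^esub>" "n > 0"
  obtains e where "e \<in> carrier E" "\<pi> e = a" "e [^] n = \<one>"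
proof -
  obtain e where e: "e \<in> carrier E" "\<pi> e = a" using lift_exists assms by blast
  have "\<pi> (e [^] n) = \<one>\<^bsub>A\<^esub>" using e assms by (simp add: \<pi>.hom_nat_pow)
  then obtain u where u: "u \<noteq> 0" "e [^] n = \<iota> u" using \<pi>_ker e by blast
  obtain v where v: "v \<noteq> 0" "v ^ n = 1 / u" using root_exists[of "1/u" n] assms u by auto
  have "(\<iota> v \<otimes> e) [^] n = \<one>"
    using scaled_pow[of v e n] v u e by (simp add: \<iota>_mult[symmetric])
  then show ?thesis using that[of "\<iota> v \<otimes> e"] e v assms by simp
qed

text \<open>The commutator of two lifts does not depend on the lifts, because the kernel is central.
  The quantifier over all lifts is therefore equivalent to a single instance, and the notion records
  where the commutator pairing of the extension vanishes.\<close>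

definition commuting_lifts :: "'a \<Rightarrow> 'a \<Rightarrow> bool" where
  "commuting_lifts a b \<longleftrightarrow>
     (\<forall>e\<in>carrier E. \<forall>e'\<in>carrier E. \<pi> e = a \<longrightarrow> \<pi> e' = b \<longrightarrow> e \<otimes> e' = e' \<otimes> e)"

lemma scaled_commute:
  assumes "e \<in> carrier E" "e' \<in> carrier E" "u \<noteq> 0" "v \<noteq> 0" "e \<otimes> e' = e' \<otimes> e"
  shows "(\<iota> u \<otimes> e) \<otimes> (\<iota> v \<otimes> e') = (\<iota> v \<otimes> e') \<otimes> (\<iota> u \<otimes> e)"
proof -
  have "(\<iota> u \<otimes> e) \<otimes> (\<iota> v \<otimes> e') = \<iota> u \<otimes> (e \<otimes> \<iota> v) \<otimes> e'" using assms by (simp add: E.m_assoc)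
  also have "e \<otimes> \<iota> v = \<iota> v \<otimes> e" using assms by (intro \<iota>_central)
  also have "\<iota> u \<otimes> (\<iota> v \<otimes> e) \<otimes> e' = (\<iota> u \<otimes> \<iota> v) \<otimes> (e \<otimes> e')" using assms by (simp add: E.m_assoc)
  also have "\<iota> u \<otimes> \<iota> v = \<iota> v \<otimes> \<iota> u" using assms by (intro \<iota>_central) simp_all
  also have "e \<otimes> e' = e' \<otimes> e" by fact
  also have "\<iota> v \<otimes> \<iota> u \<otimes> (e' \<otimes> e) = \<iota> v \<otimes> (\<iota> u \<otimes> e') \<otimes> e" using assms by (simp add: E.m_assoc)
  also have "\<iota> u \<otimes> e' = e' \<otimes> \<iota> u" using assms by (intro \<iota>_central[symmetric])
  finally show ?thesis using assms by (simp add: E.m_assoc)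
qed

lemma commuting_liftsI:
  assumes "e \<in> carrier E" "e' \<in> carrier E" "e \<otimes> e' = e' \<otimes> e"
  shows "commuting_lifts (\<pi> e) (\<pi> e')"
  unfolding commuting_lifts_def
proof (intro ballI impI)
  fix x y assume xy: "x \<in> carrier E" "y \<in> carrier E" "\<pi> x = \<pi> e" "\<pi> y = \<pi> e'"
  obtain u where u: "u \<noteq> 0" "x = \<iota> u \<otimes> e" using same_image[of e x] assms xy by auto
  obtain v where v: "v \<noteq> 0" "y = \<iota> v \<otimes> e'" using same_image[of e' y] assms xy by auto
  show "x \<otimes> y = y \<otimes> x" using scaled_commute u v assms by simp
qed

definition splits :: "'a set \<Rightarrow> bool" where
  "splits H \<longleftrightarrow> (\<exists>S. subgroup S E \<and> \<pi> ` S = H \<and> (\<forall>s\<in>S. \<pi> s = \<one>\<^bsub>A\<^esub> \<longrightarrow> s = \<one>))"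

text \<open>A splitting is represented by its image, a subgroup of E that meets the kernel
  trivially. Splittings over larger subgroups of A then arise by adjoining elements of E, with no
  section to define.\<close>

definition split_lift :: "'e set \<Rightarrow> bool" where
  "split_lift S \<longleftrightarrow> subgroup S E \<and> (\<forall>s\<in>S. \<pi> s = \<one>\<^bsub>A\<^esub> \<longrightarrow> s = \<one>)"

lemma splits_iff: "splits H \<longleftrightarrow> (\<exists>S. split_lift S \<and> \<pi> ` S = H)"
  by (auto simp: splits_def split_lift_def)

lemma split_lift_inj:
  assumes "split_lift S" "s \<in> S" "t \<in> S" "\<pi> s = \<pi> t"
  shows "s = t"
proof -
  have S: "subgroup S E" using assms by (simp add: split_lift_def)
  have c: "s \<in> carrier E" "t \<in> carrier E" using assms S subgroup.mem_carrier by fastforce+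
  have "s \<otimes> inv t \<in> S" using assms S by (simp add: subgroup.m_closed subgroup.m_inv_closed)
  moreover have "\<pi> (s \<otimes> inv t) = \<one>\<^bsub>A\<^esub>" using assms c by simp
  ultimately have "s \<otimes> inv t = \<one>" using assms by (simp add: split_lift_def)
  then show ?thesis using c by (metis E.inv_closed E.inv_equality E.inv_inv E.l_inv)
qed

lemma split_commuting_lifts:
  assumes "splits H" "a \<in> H" "b \<in> H" "a \<otimes>\<^bsub>A\<^esub> b = b \<otimes>\<^bsub>A\<^esub> a"
  shows "commuting_lifts a b"
proof -
  obtain S where S: "split_lift S" "\<pi> ` S = H" using assms splits_iff by auto
  then obtain s t where st: "s \<in> S" "t \<in> S" "\<pi> s = a" "\<pi> t = b" using assms by blast
  have sg: "subgroup S E" using S by (simp add: split_lift_def)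
  have c: "s \<in> carrier E" "t \<in> carrier E" using st sg subgroup.mem_carrier by fastforce+
  have "s \<otimes> t = t \<otimes> s" using st c assms sg
    by (intro split_lift_inj[OF S(1)]) (simp_all add: subgroup.m_closed)
  then show ?thesis using commuting_liftsI[of s t] st c by simp
qed

lemma splits_subgroup:
  assumes "splits H" "subgroup P A" "P \<subseteq> H"
  shows "splits P"
proof -
  obtain S where S: "split_lift S" "\<pi> ` S = H" using assms splits_iff by auto
  have sg: "subgroup S E" using S by (simp add: split_lift_def)
  have "subgroup {s \<in> S. \<pi> s \<in> P} E"
  proof (rule E.subgroupI)
    show "{s \<in> S. \<pi> s \<in> P} \<subseteq> carrier E" using sg subgroup.subset by blast
    show "{s \<in> S. \<pi> s \<in> P} \<noteq> {}" using subgroup.one_closed[OF sg] subgroup.one_closed[OF assms(2)] by force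
    fix a assume a: "a \<in> {s \<in> S. \<pi> s \<in> P}"
    then have "a \<in> carrier E" using sg subgroup.mem_carrier by fastforce
    then show "inv a \<in> {s \<in> S. \<pi> s \<in> P}" using a sg assms(2)
      by (auto simp: subgroup.m_inv_closed)
    fix b assume b: "b \<in> {s \<in> S. \<pi> s \<in> P}"
    then have "b \<in> carrier E" using sg subgroup.mem_carrier by fastforce
    then show "a \<otimes> b \<in> {s \<in> S. \<pi> s \<in> P}" using a b \<open>a \<in> carrier E\<close> sg assms(2)
      by (auto simp: subgroup.m_closed)
  qed
  moreover have "\<pi> ` {s \<in> S. \<pi> s \<in> P} = P" using S assms(3) by force
  ultimately show ?thesis using S unfolding splits_iff split_lift_def by blast
qed

lemma split_lift_one: "split_lift {\<one>}"
  unfolding split_lift_def by (simp add: E.triv_subgroup)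

text \<open>Splittings grow by one cyclic factor at a time. \<open>norm\<close> and
  \<open>Dn\<close> make the products \<open>s \<otimes> D [^] i\<close> a subgroup, and
  \<open>free\<close> says that n is the order of the image of D modulo the image of S, so a product
  over the identity already lies in S.\<close>

lemma split_lift_cyclic_extension:
  fixes n :: nat
  assumes S: "split_lift S" and D: "D \<in> carrier E" and n: "n > 0"
    and norm: "\<And>s. s \<in> S \<Longrightarrow> D \<otimes> s \<otimes> inv D \<in> S"
    and Dn: "D [^] n \<in> S"
    and free: "\<And>i. 0 < i \<Longrightarrow> i < n \<Longrightarrow> \<pi> (D [^] i) \<notin> \<pi> ` S"
  shows "split_lift {s \<otimes> D [^] i |s (i::nat). s \<in> S}"
proof -
  have sg: "subgroup S E" using S by (simp add: split_lift_def)
  note S_cl = subgroup.m_closed[OF sg] subgroup.m_inv_closed[OF sg] subgroup.one_closed[OF sg]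
  have S_car [simp]: "s \<in> carrier E" if "s \<in> S" for s
    using that sg subgroup.mem_carrier by fastforce
  have swap: "\<exists>s'\<in>S. D [^] i \<otimes> s = s' \<otimes> D [^] i" if "s \<in> S" for s and i :: nat
  proof (induction i)
    case 0
    then show ?case using that by auto
  next
    case (Suc i)
    then obtain s' where s': "s' \<in> S" "D [^] i \<otimes> s = s' \<otimes> D [^] i" by blast
    have "D [^] Suc i \<otimes> s = D \<otimes> (D [^] i \<otimes> s)"
      unfolding E.nat_pow_Suc2[OF D] using D that by (simp add: E.m_assoc)
    also have "\<dots> = (D \<otimes> s' \<otimes> inv D) \<otimes> (D \<otimes> D [^] i)"
      using s' D by (simp add: E.m_assoc)
    also have "D \<otimes> D [^] i = D [^] Suc i" by (rule E.nat_pow_Suc2[OF D, symmetric])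
    finally show ?case using norm[OF s'(1)] by blast
  qed
  have Dnk: "D [^] (n * k) \<in> S" for k
  proof (induction k)
    case 0
    then show ?case using S_cl by simp
  next
    case (Suc k)
    have "D [^] (n * Suc k) = D [^] n \<otimes> D [^] (n * k)" using D by (simp add: E.nat_pow_mult)
    then show ?case using Suc Dn S_cl by simp
  qed
  let ?T = "{s \<otimes> D [^] i |s (i::nat). s \<in> S}"
  have "subgroup ?T E"
  proof (rule E.subgroupI)
    show "?T \<subseteq> carrier E" using D by auto
    show "?T \<noteq> {}" using S_cl by blast
    fix a assume "a \<in> ?T"
    then obtain s i where a: "s \<in> S" "a = s \<otimes> D [^] (i::nat)" by blast
    \<comment> \<open>The inverse of \<open>D [^] i\<close> has to be written with a natural
      exponent: it is \<open>D [^] (n * i - i)\<close> up to the element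
      \<open>D [^] (n * i)\<close> of S.\<close>
    let ?r = "D [^] (n * i)" and ?m = "n * i - i"
    have "D [^] i \<otimes> D [^] ?m = ?r" using D n by (simp add: E.nat_pow_mult)
    then have "D [^] i = ?r \<otimes> inv (D [^] ?m)"
      using D by (metis E.inv_closed E.inv_solve_right E.nat_pow_closed)
    then have "inv (D [^] i) = D [^] ?m \<otimes> inv ?r" using D by (simp add: E.inv_mult_group)
    then have "inv a = D [^] ?m \<otimes> (inv ?r \<otimes> inv s)"
      using a D by (simp add: E.inv_mult_group E.m_assoc)
    moreover have "inv ?r \<otimes> inv s \<in> S" using Dnk a S_cl by blast
    moreover from this obtain s' where "s' \<in> S" "D [^] ?m \<otimes> (inv ?r \<otimes> inv s) = s' \<otimes> D [^] ?m"
      using swap[of "inv ?r \<otimes> inv s" ?m] by blast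
    ultimately show "inv a \<in> ?T" by auto
  next
    fix a b assume "a \<in> ?T" "b \<in> ?T"
    then obtain s i t j where ab: "s \<in> S" "a = s \<otimes> D [^] (i::nat)" "t \<in> S" "b = t \<otimes> D [^] (j::nat)"
      by blast
    obtain t' where t': "t' \<in> S" "D [^] i \<otimes> t = t' \<otimes> D [^] i" using swap ab by blast
    have "a \<otimes> b = s \<otimes> (D [^] i \<otimes> t) \<otimes> D [^] j" using ab D by (simp add: E.m_assoc)
    also have "\<dots> = (s \<otimes> t') \<otimes> D [^] (i + j)" using t' ab D by (simp add: E.m_assoc E.nat_pow_mult)
    finally show "a \<otimes> b \<in> ?T" using S_cl ab t' by blast
  qed
  moreover have "x = \<one>" if "x \<in> ?T" "\<pi> x = \<one>\<^bsub>A\<^esub>" for x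
  proof -
    from that(1) obtain s i where x: "s \<in> S" "x = s \<otimes> D [^] (i::nat)" by blast
    \<comment> \<open>Division with remainder moves the part of the exponent divisible by n into S;
      the remainder is below n and is forced to zero by \<open>free\<close>.\<close>
    have i: "D [^] i = D [^] (n * (i div n)) \<otimes> D [^] (i mod n)" using D by (simp add: E.nat_pow_mult)
    let ?s = "inv (D [^] (n * (i div n))) \<otimes> inv s"
    have "D [^] (i mod n) = inv (D [^] (n * (i div n))) \<otimes> D [^] i" using i D
      by (metis E.mult_inv_cancel(1) E.nat_pow_closed)
    then have "\<pi> (D [^] (i mod n)) = \<pi> (inv (D [^] (n * (i div n)))) \<otimes>\<^bsub>A\<^esub> \<pi> (D [^] i)"
      using D by simp
    moreover have "\<pi> (D [^] i) = \<pi> (inv s)"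
      using that(2) x D
      by (metis A.inv_equality A.inv_inv A.inv_closed E.nat_pow_closed S_car \<pi>.hom_closed \<pi>.hom_inv \<pi>.hom_mult)
    ultimately have "\<pi> (D [^] (i mod n)) = \<pi> ?s" using D x by simp
    moreover have "?s \<in> S" using Dnk x S_cl by blast
    ultimately have "\<pi> (D [^] (i mod n)) \<in> \<pi> ` S" by blast
    then have "i mod n = 0" using free[of "i mod n"] n by auto
    then have "D [^] i \<in> S" using i Dnk by (metis dvd_mult_div_cancel mod_0_imp_dvd)
    then have "x \<in> S" using x S_cl by blast
    then show ?thesis using S that by (simp add: split_lift_def)
  qed
  ultimately show ?thesis unfolding split_lift_def by blast
qed

lemma split_lift_cyclic:
  assumes "D \<in> carrier E" "n > 0" "D [^] (n::nat) = \<one>"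
    and "\<And>i. 0 < i \<Longrightarrow> i < n \<Longrightarrow> \<pi> D [^]\<^bsub>A\<^esub> i \<noteq> \<one>\<^bsub>A\<^esub>"
  shows "split_lift {D [^] i |i::nat. True}"
proof -
  have "split_lift {s \<otimes> D [^] i |s (i::nat). s \<in> {\<one>}}"
    using assms by (intro split_lift_cyclic_extension[OF split_lift_one, of D n])
      (simp_all add: \<pi>.hom_nat_pow)
  moreover have "{s \<otimes> D [^] i |s (i::nat). s \<in> {\<one>}} = {D [^] i |i::nat. True}"
    using assms(1) by auto
  ultimately show ?thesis by simp
qed

text \<open>A homomorphism from E to k^x that is the m-th power map on the kernel exists iff m
  annihilates the class of the extension. The exponents are integers because such m form an
  ideal.\<close>

definition power_character :: "int \<Rightarrow> bool" where
  "power_character m \<longleftrightarrow> (\<exists>T :: 'e \<Rightarrow> 'k. (\<forall>e\<in>carrier E. T e \<noteq> 0) \<and>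
     (\<forall>e\<in>carrier E. \<forall>e'\<in>carrier E. T (e \<otimes> e') = T e * T e') \<and>
     (\<forall>u. u \<noteq> 0 \<longrightarrow> T (\<iota> u) = u powi m))"

lemma power_character_combine:
  assumes "power_character m" "power_character n"
  shows "power_character (a * m + b * n)"
proof -
  from assms(1) obtain T where T: "\<forall>e\<in>carrier E. T e \<noteq> 0"
    "\<forall>e\<in>carrier E. \<forall>e'\<in>carrier E. T (e \<otimes> e') = T e * T e'" "\<forall>u. u \<noteq> 0 \<longrightarrow> T (\<iota> u) = u powi m"
    unfolding power_character_def by blast
  from assms(2) obtain U where U: "\<forall>e\<in>carrier E. U e \<noteq> 0"
    "\<forall>e\<in>carrier E. \<forall>e'\<in>carrier E. U (e \<otimes> e') = U e * U e'" "\<forall>u. u \<noteq> 0 \<longrightarrow> U (\<iota> u) = u powi n"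
    unfolding power_character_def by blast
  show ?thesis unfolding power_character_def
    by (rule exI[of _ "\<lambda>e. T e powi a * U e powi b"])
      (simp add: T U power_int_mult_distrib power_int_add power_int_mult[symmetric] mult.commute)
qed

text \<open>The kernel of a character that is the identity on k^x is a complement to k^x.\<close>

lemma power_character_one_splits:
  assumes "power_character 1"
  shows "splits (carrier A)"
proof -
  from assms obtain T where T': "\<forall>e\<in>carrier E. T e \<noteq> 0"
    "\<forall>e\<in>carrier E. \<forall>e'\<in>carrier E. T (e \<otimes> e') = T e * T e'" "\<forall>u. u \<noteq> 0 \<longrightarrow> T (\<iota> u) = u powi 1"
    unfolding power_character_def by blast
  then have T: "\<And>e. e \<in> carrier E \<Longrightarrow> T e \<noteq> 0"
    "\<And>e e'. e \<in> carrier E \<Longrightarrow> e' \<in> carrier E \<Longrightarrow> T (e \<otimes> e') = T e * T e'"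
    "\<And>u. u \<noteq> 0 \<Longrightarrow> T (\<iota> u) = u" by simp_all
  have T1: "T \<one> = 1" using T(3)[of 1] by simp
  have Tinv: "T (inv e) = 1 / T e" if "e \<in> carrier E" for e
    using T(2)[of "inv e" e] that T1 T(1)[OF that] by (simp add: field_simps)
  let ?S = "{e \<in> carrier E. T e = 1}"
  have "subgroup ?S E"
    by (rule E.subgroupI) (auto simp: T1 T Tinv intro: exI[of _ "\<one>"])
  moreover have "\<pi> ` ?S = carrier A"
  proof (intro equalityI subsetI)
    fix a assume "a \<in> carrier A"
    then obtain e where e: "e \<in> carrier E" "\<pi> e = a" using lift_exists by blast
    have "\<iota> (1 / T e) \<otimes> e \<in> ?S" "\<pi> (\<iota> (1 / T e) \<otimes> e) = a"
      using e T \<open>a \<in> carrier A\<close> by simp_all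
    then show "a \<in> \<pi> ` ?S" by (metis image_eqI)
  qed auto
  moreover have "s = \<one>" if "s \<in> ?S" "\<pi> s = \<one>\<^bsub>A\<^esub>" for s
    using \<pi>_ker[of s] that T(3) by auto
  ultimately show ?thesis unfolding splits_def by blast
qed

text \<open>Transfer: corestriction after restriction is multiplication by the index. A splitting
  over H projects the preimage of H onto k^x; the product of this projection over the Schreier
  factors of a transversal is a character of E, and a scalar contributes one factor per
  coset.\<close>

lemma power_character_index:
  assumes fin: "finite (carrier A)" and H: "subgroup H A" and "splits H"
  shows "power_character (int (card (rcosets\<^bsub>A\<^esub> H)))"
proof -
  obtain S where S: "split_lift S" "\<pi> ` S = H" using assms splits_iff by auto
  have sg: "subgroup S E" using S by (simp add: split_lift_def)
  have S_car [simp]: "s \<in> carrier E" if "s \<in> S" for s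
    using that sg subgroup.mem_carrier by fastforce
  \<comment> \<open>The scalar component of an element over H. By \<open>\<kappa>_eq\<close> there
    is only one candidate, as \<pi> is injective on S.\<close>
  define \<kappa> where "\<kappa> e = (SOME u. u \<noteq> 0 \<and> (\<exists>s\<in>S. e = \<iota> u \<otimes> s))" for e
  have \<kappa>_eq: "\<kappa> (\<iota> u \<otimes> s) = u" if "u \<noteq> 0" "s \<in> S" for u s
  proof -
    have "v = u" if v: "v \<noteq> 0" "t \<in> S" "\<iota> u \<otimes> s = \<iota> v \<otimes> t" for v t
    proof -
      have "\<pi> s = \<pi> t" using arg_cong[OF v(3), of \<pi>] v(1,2) \<open>u \<noteq> 0\<close> \<open>s \<in> S\<close> by simp
      then have "s = t" using split_lift_inj[OF S(1)] v \<open>s \<in> S\<close> by blast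
      then have "\<iota> u = \<iota> v" using v \<open>u \<noteq> 0\<close> \<open>s \<in> S\<close> by simp
      then show ?thesis using \<iota>_inj v \<open>u \<noteq> 0\<close> by blast
    qed
    then show ?thesis unfolding \<kappa>_def using that by (intro some_equality) blast+
  qed
  have decomp: "\<exists>u s. u \<noteq> 0 \<and> s \<in> S \<and> e = \<iota> u \<otimes> s" if "e \<in> carrier E" "\<pi> e \<in> H" for e
  proof -
    from that(2) obtain s where s: "s \<in> S" "\<pi> s = \<pi> e" using S by (metis imageE)
    then show ?thesis using same_image[of s e] that(1) by (metis S_car)
  qed
  have \<kappa>_nz: "\<kappa> e \<noteq> 0" if "e \<in> carrier E" "\<pi> e \<in> H" for e
    using decomp[OF that] \<kappa>_eq by auto
  have \<kappa>_mult: "\<kappa> (e \<otimes> e') = \<kappa> e * \<kappa> e'"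
    if e: "e \<in> carrier E" "\<pi> e \<in> H" "e' \<in> carrier E" "\<pi> e' \<in> H" for e e'
  proof -
    obtain u s where u: "u \<noteq> 0" "s \<in> S" "e = \<iota> u \<otimes> s" using decomp e by blast
    obtain v t where v: "v \<noteq> 0" "t \<in> S" "e' = \<iota> v \<otimes> t" using decomp e by blast
    have "e \<otimes> e' = \<iota> u \<otimes> (s \<otimes> \<iota> v) \<otimes> t" using u v by (simp add: E.m_assoc)
    also have "s \<otimes> \<iota> v = \<iota> v \<otimes> s" using u v by (intro \<iota>_central) auto
    also have "\<iota> u \<otimes> (\<iota> v \<otimes> s) \<otimes> t = \<iota> (u * v) \<otimes> (s \<otimes> t)" using u v by (simp add: E.m_assoc \<iota>_mult)
    finally show ?thesis using u v \<kappa>_eq subgroup.m_closed[OF sg] by simp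
  qed
  let ?I = "rcosets\<^bsub>A\<^esub> H"
  have finI: "finite ?I"
    using fin A.rcosets_part_G[OF H] by (metis finite_UnionD)
  have I_sub: "C \<subseteq> carrier A" if "C \<in> ?I" for C
    using that A.rcosets_part_G[OF H] by blast
  have I_ne: "C \<noteq> {}" if "C \<in> ?I" for C
    using subgroup.rcosets_non_empty[OF H that] .
  define R where "R C = (SOME e. e \<in> carrier E \<and> \<pi> e \<in> C)" for C
  have R: "R C \<in> carrier E \<and> \<pi> (R C) \<in> C" if "C \<in> ?I" for C
  proof -
    obtain a where "a \<in> C" "a \<in> carrier A" using I_ne I_sub \<open>C \<in> ?I\<close> by blast
    then have "\<exists>e. e \<in> carrier E \<and> \<pi> e \<in> C" using lift_exists by blast
    then show ?thesis unfolding R_def by (rule someI_ex)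
  qed
  define mv where "mv C e = C #>\<^bsub>A\<^esub> \<pi> e" for C e
  have Hs: "H \<subseteq> carrier A" using H subgroup.subset by blast
  have mv_closed: "mv C e \<in> ?I" if "C \<in> ?I" "e \<in> carrier E" for C e
  proof -
    from that(1) obtain a where "a \<in> carrier A" "C = H #>\<^bsub>A\<^esub> a" unfolding RCOSETS_def by blast
    then show ?thesis using that Hs unfolding mv_def by (simp add: A.coset_mult_assoc A.rcosetsI)
  qed
  have mv_mult: "mv C (e \<otimes> e') = mv (mv C e) e'" if "C \<in> ?I" "e \<in> carrier E" "e' \<in> carrier E" for C e e'
    using that I_sub unfolding mv_def by (simp add: A.coset_mult_assoc)
  have mv_one: "mv C e = C" if "C \<in> ?I" "\<pi> e = \<one>\<^bsub>A\<^esub>" for C e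
    using that I_sub unfolding mv_def by (simp add: A.coset_mult_one)
  \<comment> \<open>The Schreier factor at C compares the representative of C moved by e with the
    representative of the moved coset. Its cocycle rule \<open>M_mult\<close>, together with the
    fact that e permutes the cosets, makes the product over all cosets multiplicative.\<close>
  define M where "M C e = R C \<otimes> e \<otimes> inv (R (mv C e))" for C e
  have M: "M C e \<in> carrier E \<and> \<pi> (M C e) \<in> H" if "C \<in> ?I" "e \<in> carrier E" for C e
  proof -
    let ?C = "mv C e"
    have C: "?C \<in> ?I" using mv_closed that by blast
    have "\<pi> (R C) \<otimes>\<^bsub>A\<^esub> \<pi> e \<in> ?C" using R[OF that(1)] that unfolding mv_def r_coset_def by blast
    moreover have "\<pi> (R ?C) \<in> ?C" using R[OF C] by blast
    moreover obtain a where a: "a \<in> carrier A" "?C = H #>\<^bsub>A\<^esub> a" using C unfolding RCOSETS_def by blast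
    ultimately obtain h h' where h: "h \<in> H" "h' \<in> H" "\<pi> (R C) \<otimes>\<^bsub>A\<^esub> \<pi> e = h \<otimes>\<^bsub>A\<^esub> a" "\<pi> (R ?C) = h' \<otimes>\<^bsub>A\<^esub> a"
      unfolding r_coset_def by auto
    have hc: "h \<in> carrier A" "h' \<in> carrier A" using h Hs by auto
    have "\<pi> (M C e) = (h \<otimes>\<^bsub>A\<^esub> a) \<otimes>\<^bsub>A\<^esub> inv\<^bsub>A\<^esub> (h' \<otimes>\<^bsub>A\<^esub> a)"
      unfolding M_def using R[OF that(1)] R[OF C] that h by simp
    also have "\<dots> = h \<otimes>\<^bsub>A\<^esub> inv\<^bsub>A\<^esub> h'" using hc a by (simp add: A.inv_mult_group A.m_assoc)
    finally show ?thesis using h H R[OF that(1)] R[OF C] that unfolding M_def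
      by (simp add: subgroup.m_closed subgroup.m_inv_closed)
  qed
  have M_mult: "M C (e \<otimes> e') = M C e \<otimes> M (mv C e) e'"
    if "C \<in> ?I" "e \<in> carrier E" "e' \<in> carrier E" for C e e'
    using R[OF that(1)] R[OF mv_closed[OF that(1,2)]] R[OF mv_closed[OF mv_closed[OF that(1,2)] that(3)]] that
    unfolding M_def by (simp add: mv_mult E.m_assoc)
  define T where "T e = (\<Prod>C\<in>?I. \<kappa> (M C e))" for e
  have "T (e \<otimes> e') = T e * T e'" if e: "e \<in> carrier E" "e' \<in> carrier E" for e e'
  proof -
    have "T (e \<otimes> e') = (\<Prod>C\<in>?I. \<kappa> (M C e) * \<kappa> (M (mv C e) e'))"
      unfolding T_def using e M mv_closed by (intro prod.cong) (auto simp: M_mult \<kappa>_mult)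
    also have "\<dots> = T e * (\<Prod>C\<in>?I. \<kappa> (M (mv C e) e'))" unfolding T_def by (simp add: prod.distrib)
    also have "(\<Prod>C\<in>?I. \<kappa> (M (mv C e) e')) = T e'" unfolding T_def
    proof (rule prod.reindex_bij_betw)
      have 1: "mv (mv C e) (inv e) = C" "mv (mv C (inv e)) e = C" if "C \<in> ?I" for C
        using that e mv_one by (simp_all add: mv_mult[symmetric])
      show "bij_betw (\<lambda>C. mv C e) ?I ?I"
        by (rule bij_betw_byWitness[where f'="\<lambda>C. mv C (inv e)"]) (use 1 e mv_closed in auto)
    qed
    finally show ?thesis .
  qed
  moreover have "T e \<noteq> 0" if "e \<in> carrier E" for e
    unfolding T_def using that M \<kappa>_nz finI by (simp add: prod_zero_iff)
  moreover have "T (\<iota> u) = u powi int (card ?I)" if u: "u \<noteq> 0" for u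
  proof -
    have "\<kappa> (M C (\<iota> u)) = u" if "C \<in> ?I" for C
    proof -
      have "M C (\<iota> u) = \<iota> u \<otimes> \<one>"
        unfolding M_def using R[OF that] u that \<iota>_central[of u "R C"] by (simp add: mv_one E.m_assoc)
      then show ?thesis using \<kappa>_eq u subgroup.one_closed[OF sg] by metis
    qed
    then show ?thesis unfolding T_def by simp
  qed
  ultimately show ?thesis unfolding power_character_def by blast
qed

text \<open>The exponents that admit a power character form an ideal of the integers. Its positive
  generator divides every index provided by \<open>loc\<close>, so no prime divides it and it is
  1.\<close>

lemma splits_local_to_global:
  assumes fin: "finite (carrier A)"
    and loc: "\<And>q. prime (q::nat) \<Longrightarrow> \<exists>H. subgroup H A \<and> splits H \<and> \<not> q dvd card (rcosets\<^bsub>A\<^esub> H)"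
  shows "splits (carrier A)"
proof -
  let ?Q = "\<lambda>d::nat. d > 0 \<and> power_character (int d)"
  have ex: "\<exists>m. power_character (int m) \<and> \<not> q dvd m" if "prime q" for q
    using loc[OF that] power_character_index[OF fin] by blast
  obtain m where "?Q m" using ex[OF two_is_prime_nat] by (metis dvd_0_right gr0I)
  define d where "d = (LEAST d. ?Q d)"
  have d: "?Q d" unfolding d_def by (rule LeastI[of ?Q, OF \<open>?Q m\<close>])
  have d_min: "d \<le> k" if "?Q k" for k unfolding d_def by (rule Least_le[of ?Q, OF that])
  have "d = 1"
  proof (rule ccontr)
    assume "d \<noteq> 1"
    then obtain q where q: "prime q" "q dvd d" using prime_factor_nat by blast
    obtain n where n: "power_character (int n)" "\<not> q dvd n" using ex q by blast
    have "int (n mod d) = 1 * int n + (- int (n div d)) * int d"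
      by (simp add: zmod_int zdiv_int minus_div_mult_eq_mod)
    then have "power_character (int (n mod d))" using power_character_combine[OF n(1), of "int d" 1] d by metis
    moreover have "n mod d < d" using d by simp
    ultimately have "n mod d = 0" using d_min[of "n mod d"] by linarith
    then show False using n q by (meson dvd_trans mod_0_imp_dvd)
  qed
  then show ?thesis using d power_character_one_splits by simp
qed

end

section \<open>Fixed points and Sylow subgroups\<close>

text \<open>Orbit lengths divide q^n, so without a fixed point all of them, and with them the
  cardinality of X, would be multiples of q.\<close>

lemma prime_power_group_fixed_point:
  fixes act :: "'a \<Rightarrow> 'b \<Rightarrow> 'b" and G (structure)
  assumes "group G" "Coset.order G = q ^ n" "prime (q::nat)" "finite X" "\<not> q dvd card X"
    and closed: "\<And>g x. g \<in> carrier G \<Longrightarrow> x \<in> X \<Longrightarrow> act g x \<in> X"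
    and one: "\<And>x. x \<in> X \<Longrightarrow> act \<one>\<^bsub>G\<^esub> x = x"
    and mult: "\<And>g h x. g \<in> carrier G \<Longrightarrow> h \<in> carrier G \<Longrightarrow> x \<in> X \<Longrightarrow>
                 act (g \<otimes>\<^bsub>G\<^esub> h) x = act g (act h x)"
  obtains x where "x \<in> X" "\<And>g. g \<in> carrier G \<Longrightarrow> act g x = x"
proof -
  interpret group G by fact
  define \<phi> where "\<phi> g = restrict (act g) X" for g
  have bij: "\<phi> g \<in> Bij X" if "g \<in> carrier G" for g
  proof -
    have "bij_betw (\<phi> g) X X"
      by (rule bij_betw_byWitness[where f'="act (inv g)"])
        (use that closed one in \<open>auto simp: \<phi>_def mult[symmetric]\<close>)
    then show ?thesis by (simp add: Bij_def \<phi>_def)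
  qed
  interpret group_action G X \<phi>
    unfolding group_action_def group_hom_def group_hom_axioms_def
  proof (intro conjI)
    show "\<phi> \<in> hom G (BijGroup X)"
    proof (rule homI)
      fix g h assume gh: "g \<in> carrier G" "h \<in> carrier G"
      show "\<phi> (g \<otimes> h) = \<phi> g \<otimes>\<^bsub>BijGroup X\<^esub> \<phi> h"
        using bij gh closed by (auto simp: BijGroup_def compose_def \<phi>_def mult fun_eq_iff)
    qed (simp add: BijGroup_def bij)
  qed (simp_all add: group_BijGroup is_group)
  have "\<exists>x\<in>X. card (orbit G \<phi> x) = 1"
  proof (rule ccontr)
    assume *: "\<not> ?thesis"
    have "q dvd card orb" if orb: "orb \<in> orbits G X \<phi>" for orb
    proof -
      from orb obtain x where x: "x \<in> X" "orb = orbit G \<phi> x" unfolding orbits_def by blast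
      then have "card orb dvd q ^ n" using orbit_stabilizer_theorem[OF x(1)] assms(2) by (metis dvd_triv_left)
      then obtain k where "card orb = q ^ k" using \<open>prime q\<close> by (meson divides_primepow_nat)
      moreover have "card orb \<noteq> 1" using * x by blast
      ultimately show ?thesis by (metis dvd_power power_0 not_gr_zero)
    qed
    then have "q dvd (\<Sum>orb\<in>orbits G X \<phi>. card orb)" by (intro dvd_sum) blast
    also have "(\<Sum>orb\<in>orbits G X \<phi>. card orb) = card X"
      using disjoint_sum[OF \<open>finite X\<close>, of "\<lambda>_. 1::nat"] by simp
    finally show False using assms(5) by blast
  qed
  then obtain x where x: "x \<in> X" "card (orbit G \<phi> x) = 1" by blast
  then obtain y where y: "orbit G \<phi> x = {y}" using card_1_singletonE by blast
  have "act g x = x" if "g \<in> carrier G" for g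
  proof -
    have "act g x \<in> orbit G \<phi> x" "act \<one> x \<in> orbit G \<phi> x"
      using that x unfolding orbit_def \<phi>_def by auto
    then show ?thesis using y one x by auto
  qed
  then show ?thesis using that x by blast
qed

text \<open>T acts on the right cosets of a Sylow subgroup P0 by right multiplication with inverses.
  Their number is prime to q, so some coset P0 g is fixed, and then T lies in the conjugate g^-1 P0
  g.\<close>

lemma (in group) sylow_containing:
  assumes fin: "finite (carrier G)" and q: "prime (q::nat)" and T: "subgroup T G" "card T = q ^ b"
  obtains P where "subgroup P G" "T \<subseteq> P" "\<exists>n. card P = q ^ n" "\<not> q dvd card (rcosets P)"
proof -
  have og: "Coset.order G \<noteq> 0" using fin by (simp add: order_gt_0_iff_finite)
  obtain a m where am: "Coset.order G = q ^ a * m" "\<not> q dvd m"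
    using og q by (metis multiplicity_decompose' not_prime_unit)
  obtain P0 where P0: "subgroup P0 G" "card P0 = q ^ a"
    using sylow_thm[OF q is_group am(1) fin] by blast
  have P0s: "P0 \<subseteq> carrier G" using P0 subgroup.subset by blast
  have idx: "card (rcosets H) = m" if H: "subgroup H G" "card H = q ^ a" for H
    using lagrange[OF H(1)] am H q by (simp add: prime_gt_0_nat mult.commute)
  interpret T: group "G\<lparr>carrier := T\<rparr>" using T(1) by (rule subgroup.subgroup_is_group) (rule is_group)
  have Ts: "T \<subseteq> carrier G" using T subgroup.subset by blast
  have inv_act: "C #> inv t \<in> rcosets P0" if C: "C \<in> rcosets P0" and t: "t \<in> T" for C t
  proof -
    from C obtain g where "g \<in> carrier G" "C = P0 #> g" unfolding RCOSETS_def by blast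
    moreover have "t \<in> carrier G" using t Ts by blast
    ultimately show ?thesis using P0s by (simp add: coset_mult_assoc rcosetsI)
  qed
  have Cs: "C \<subseteq> carrier G" if "C \<in> rcosets P0" for C using that rcosets_part_G[OF P0(1)] by blast
  obtain C where C: "C \<in> rcosets P0" "\<And>t. t \<in> T \<Longrightarrow> C #> inv t = C"
  proof (rule prime_power_group_fixed_point[where G="G\<lparr>carrier := T\<rparr>" and X="rcosets P0" and q=q and n=b
           and act="\<lambda>t C. C #> inv t"])
    show "group (G\<lparr>carrier := T\<rparr>)" by (rule T.is_group)
    show "Coset.order (G\<lparr>carrier := T\<rparr>) = q ^ b" using T by (simp add: Coset.order_def)
    show "finite (rcosets P0)" using fin rcosets_part_G[OF P0(1)] by (metis finite_UnionD)
    show "\<not> q dvd card (rcosets P0)" using idx P0 am by simp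
    show "prime q" by fact
  next
    fix g h x assume "g \<in> carrier (G\<lparr>carrier := T\<rparr>)" "h \<in> carrier (G\<lparr>carrier := T\<rparr>)" "x \<in> rcosets P0"
    moreover from this have "g \<in> carrier G" "h \<in> carrier G" using Ts by auto
    ultimately show "x #> inv (g \<otimes>\<^bsub>G\<lparr>carrier := T\<rparr>\<^esub> h) = x #> inv h #> inv g"
      using Cs by (simp add: inv_mult_group coset_mult_assoc)
  qed (use inv_act Cs in \<open>auto simp: coset_mult_one\<close>)
  from C(1) obtain g where g: "g \<in> carrier G" "C = P0 #> g" unfolding RCOSETS_def by blast
  let ?c = "\<lambda>x. inv g \<otimes> x \<otimes> g"
  have tP: "t \<in> ?c ` P0" if t: "t \<in> T" for t
  proof -
    have tc: "t \<in> carrier G" using t Ts by blast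
    have "g \<in> P0 #> g" using P0 g by (simp add: rcos_self)
    then have "g \<in> (P0 #> g) #> inv (inv t)" using C(2)[of "inv t"] g t T by (simp add: subgroup.m_inv_closed)
    then have "g \<in> (P0 #> g) #> t" using tc by simp
    then obtain x where x: "x \<in> P0" "g = x \<otimes> g \<otimes> t" unfolding r_coset_def by auto
    have xc: "x \<in> carrier G" using x P0s by blast
    have "t = inv g \<otimes> inv x \<otimes> (x \<otimes> g \<otimes> t)" using xc tc g by (simp add: m_assoc)
    also have "\<dots> = ?c (inv x)" using x(2) by simp
    finally show ?thesis using subgroup.m_inv_closed[OF P0(1) x(1)] by (rule image_eqI)
  qed
  have inj: "inj_on ?c P0" using P0s g by (auto intro!: inj_onI simp: subset_iff)
  have sg: "subgroup (?c ` P0) G"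
  proof (rule subgroupI)
    show "?c ` P0 \<subseteq> carrier G" using P0s g by auto
    show "?c ` P0 \<noteq> {}" using subgroup.one_closed[OF P0(1)] by blast
    fix x assume "x \<in> ?c ` P0"
    then obtain y where y: "y \<in> P0" "x = ?c y" by blast
    then have yc: "y \<in> carrier G" using P0s by blast
    have "inv x = ?c (inv y)" using y yc g by (simp add: inv_mult_group m_assoc)
    then show "inv x \<in> ?c ` P0" using subgroup.m_inv_closed[OF P0(1) y(1)] by (rule image_eqI)
    fix x' assume "x' \<in> ?c ` P0"
    then obtain y' where y': "y' \<in> P0" "x' = ?c y'" by blast
    then have yc': "y' \<in> carrier G" using P0s by blast
    have "x \<otimes> x' = ?c (y \<otimes> y')" using y y' yc yc' g by (simp add: m_assoc)
    then show "x \<otimes> x' \<in> ?c ` P0" using subgroup.m_closed[OF P0(1) y(1) y'(1)] by (rule image_eqI)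
  qed
  have "card (?c ` P0) = q ^ a" using card_image[OF inj] P0 by simp
  then show ?thesis using that[OF sg] tP idx[OF sg] am by blast
qed

section \<open>Cocycles, their extensions, and p-torsion\<close>

text \<open>The Frobenius map turns u^(p^n) - 1 into (u - 1)^(p^n). So k^x has no p-torsion, which
  makes lifts of p-elements unique and p-torsion kernels harmless.\<close>

lemma char_p_root_of_unity:
  assumes "prime p" "CHAR('k::field) = p" "(u::'k) ^ (p ^ n) = 1"
  shows "u = 1"
proof -
  have "(u - 1 + 1) ^ (p ^ n) = (u - 1) ^ (p ^ n) + 1 ^ (p ^ n)"
    using assms(1,2) by (intro freshmans_dream') auto
  then have "(u - 1) ^ (p ^ n) = 0" using assms by simp
  then show ?thesis by simp
qed

definition trivial_on :: "'a monoid \<Rightarrow> ('a \<Rightarrow> 'a \<Rightarrow> 'k::field) \<Rightarrow> 'a set \<Rightarrow> bool" where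
  "trivial_on A f H \<longleftrightarrow> (\<exists>c. (\<forall>x\<in>H. c x \<noteq> 0) \<and>
     (\<forall>x\<in>H. \<forall>y\<in>H. f x y * c (x \<otimes>\<^bsub>A\<^esub> y) = c x * c y))"

lemma trivial_class_iff: "trivial_class A f \<longleftrightarrow> trivial_on A f (carrier A)"
  by (simp add: trivial_class_def trivial_on_def cohomologous_def)

text \<open>Cocycles are not assumed normalised. Their value at the identity pair is the constant
  that enters the unit of the extension and the embedding of k^x.\<close>

lemma cocycle2_one:
  assumes "group A" "cocycle2 A f" "x \<in> carrier A"
  shows "f \<one>\<^bsub>A\<^esub> x = f \<one>\<^bsub>A\<^esub> \<one>\<^bsub>A\<^esub>" "f x \<one>\<^bsub>A\<^esub> = f \<one>\<^bsub>A\<^esub> \<one>\<^bsub>A\<^esub>"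
proof -
  interpret group A by fact
  have nz: "f y z \<noteq> 0" if "y \<in> carrier A" "z \<in> carrier A" for y z
    using assms that by (simp add: cocycle2_def)
  have co: "f x y * f (x \<otimes>\<^bsub>A\<^esub> y) z = f y z * f x (y \<otimes>\<^bsub>A\<^esub> z)"
    if "x \<in> carrier A" "y \<in> carrier A" "z \<in> carrier A" for x y z
    using assms that by (simp add: cocycle2_def)
  show "f \<one>\<^bsub>A\<^esub> x = f \<one>\<^bsub>A\<^esub> \<one>\<^bsub>A\<^esub>" using co[of "\<one>\<^bsub>A\<^esub>" "\<one>\<^bsub>A\<^esub>" x] nz assms(3) by simp
  show "f x \<one>\<^bsub>A\<^esub> = f \<one>\<^bsub>A\<^esub> \<one>\<^bsub>A\<^esub>" using co[of x "\<one>\<^bsub>A\<^esub>" "\<one>\<^bsub>A\<^esub>"] nz assms(3) by simp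
qed

text \<open>A cochain c that trivialises the inflated class is, up to the constant value of f at the
  identity pair, a homomorphism on the kernel of \<pi>. The kernel consists of elements of p-power
  order, so this homomorphism is trivial; hence c is constant on the fibres of \<pi> and descends to
  the image.\<close>

lemma trivial_on_image:
  fixes f :: "'a \<Rightarrow> 'a \<Rightarrow> 'k::field"
  assumes p: "prime p" "CHAR('k) = p" and "group N" "group A" and hom: "\<pi> \<in> hom N A"
    and f: "cocycle2 A f"
    and ker: "\<And>x. x \<in> carrier N \<Longrightarrow> \<pi> x = \<one>\<^bsub>A\<^esub> \<Longrightarrow> \<exists>n. x [^]\<^bsub>N\<^esub> (p ^ n) = \<one>\<^bsub>N\<^esub>"
    and triv: "trivial_class N (\<lambda>a b. f (\<pi> a) (\<pi> b))"
  shows "trivial_on A f (\<pi> ` carrier N)"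
proof -
  interpret N: group N by fact
  interpret A: group A by fact
  interpret \<pi>: group_hom N A \<pi> by unfold_locales (rule hom)
  obtain c where c: "\<And>x. x \<in> carrier N \<Longrightarrow> c x \<noteq> 0"
    "\<And>x y. x \<in> carrier N \<Longrightarrow> y \<in> carrier N \<Longrightarrow> f (\<pi> x) (\<pi> y) * c (x \<otimes>\<^bsub>N\<^esub> y) = c x * c y"
    using triv unfolding trivial_class_iff trivial_on_def by auto
  let ?w = "f \<one>\<^bsub>A\<^esub> \<one>\<^bsub>A\<^esub>"
  have w: "?w \<noteq> 0" using f by (simp add: cocycle2_def)
  note f1 = cocycle2_one[OF \<open>group A\<close> f]
  have c1: "c \<one>\<^bsub>N\<^esub> = ?w" using c(2)[of "\<one>\<^bsub>N\<^esub>" "\<one>\<^bsub>N\<^esub>"] c(1)[of "\<one>\<^bsub>N\<^esub>"] by simp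
  have pw: "c (x [^]\<^bsub>N\<^esub> (n::nat)) / ?w = (c x / ?w) ^ n" if x: "x \<in> carrier N" "\<pi> x = \<one>\<^bsub>A\<^esub>" for x n
  proof (induction n)
    case (Suc n)
    have "?w * c (x [^]\<^bsub>N\<^esub> Suc n) = c (x [^]\<^bsub>N\<^esub> n) * c x"
      using c(2)[of "x [^]\<^bsub>N\<^esub> n" x] x by (simp add: \<pi>.hom_nat_pow)
    then have "c (x [^]\<^bsub>N\<^esub> Suc n) / ?w = (c (x [^]\<^bsub>N\<^esub> n) / ?w) * (c x / ?w)"
      using w by (simp add: field_simps)
    then show ?case by (simp only: Suc power_Suc2)
  qed (use c1 w in simp)
  have ck: "c x = ?w" if x: "x \<in> carrier N" "\<pi> x = \<one>\<^bsub>A\<^esub>" for x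
  proof -
    from ker[OF x] obtain n where "x [^]\<^bsub>N\<^esub> (p ^ n) = \<one>\<^bsub>N\<^esub>" by blast
    then have "(c x / ?w) ^ (p ^ n) = 1" using pw[OF x, of "p ^ n"] c1 w by simp
    then have "c x / ?w = 1" using char_p_root_of_unity[OF p] by blast
    then show ?thesis using w by simp
  qed
  have cc: "c x = c y" if xy: "x \<in> carrier N" "y \<in> carrier N" "\<pi> x = \<pi> y" for x y
  proof -
    let ?k = "inv\<^bsub>N\<^esub> x \<otimes>\<^bsub>N\<^esub> y"
    have "\<pi> ?k = \<one>\<^bsub>A\<^esub>" using xy by simp
    then have "?w * c (x \<otimes>\<^bsub>N\<^esub> ?k) = c x * ?w" using c(2)[of x ?k] ck[of ?k] f1(2)[of "\<pi> x"] xy by simp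
    moreover have "x \<otimes>\<^bsub>N\<^esub> ?k = y" using xy by (simp add: N.m_assoc[symmetric])
    ultimately show ?thesis using w by simp
  qed
  define c' where "c' a = c (SOME x. x \<in> carrier N \<and> \<pi> x = a)" for a
  have c': "c' (\<pi> x) = c x" if x: "x \<in> carrier N" for x
  proof -
    have "(SOME y. y \<in> carrier N \<and> \<pi> y = \<pi> x) \<in> carrier N \<and> \<pi> (SOME y. y \<in> carrier N \<and> \<pi> y = \<pi> x) = \<pi> x"
      by (rule someI[of _ x]) (simp add: x)
    then show ?thesis unfolding c'_def using cc x by blast
  qed
  show ?thesis unfolding trivial_on_def
    by (rule exI[of _ c']) (auto simp: c' c \<pi>.hom_mult[symmetric] simp del: \<pi>.hom_mult)
qed

text \<open>The twisted product of k^x and A. The reciprocal in the unit accounts for cocycles that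
  are not normalised.\<close>

definition cocycle_extension :: "'a monoid \<Rightarrow> ('a \<Rightarrow> 'a \<Rightarrow> 'k::field) \<Rightarrow> ('k \<times> 'a) monoid" where
  "cocycle_extension A f = \<lparr>carrier = {u. u \<noteq> 0} \<times> carrier A,
     monoid.mult = (\<lambda>(u, x) (v, y). (u * v * f x y, x \<otimes>\<^bsub>A\<^esub> y)), one = (1 / f \<one>\<^bsub>A\<^esub> \<one>\<^bsub>A\<^esub>, \<one>\<^bsub>A\<^esub>)\<rparr>"

lemma cocycle_extension_simps:
  "(u, x) \<otimes>\<^bsub>cocycle_extension A f\<^esub> (v, y) = (u * v * f x y, x \<otimes>\<^bsub>A\<^esub> y)"
  "(u, x) \<in> carrier (cocycle_extension A f) \<longleftrightarrow> u \<noteq> 0 \<and> x \<in> carrier A"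
  by (simp_all add: cocycle_extension_def)

lemma central_extension_cocycle:
  fixes f :: "'a \<Rightarrow> 'a \<Rightarrow> 'k::alg_closed_field"
  assumes "group A" "cocycle2 A f"
  shows "central_extension (cocycle_extension A f) A snd (\<lambda>u. (u / f \<one>\<^bsub>A\<^esub> \<one>\<^bsub>A\<^esub>, \<one>\<^bsub>A\<^esub>))"
proof -
  interpret A: group A by fact
  define w where "w = f \<one>\<^bsub>A\<^esub> \<one>\<^bsub>A\<^esub>"
  note f1 = cocycle2_one[OF assms, folded w_def]
  have nz: "f y z \<noteq> 0" if "y \<in> carrier A" "z \<in> carrier A" for y z
    using assms that by (simp add: cocycle2_def)
  then have wnz: "w \<noteq> 0" unfolding w_def by simp
  have co: "f x y * f (x \<otimes>\<^bsub>A\<^esub> y) z = f y z * f x (y \<otimes>\<^bsub>A\<^esub> z)"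
    if "x \<in> carrier A" "y \<in> carrier A" "z \<in> carrier A" for x y z
    using assms that by (simp add: cocycle2_def)
  let ?E = "cocycle_extension A f"
  have grp: "group ?E"
  proof (rule groupI)
    fix a b c assume "a \<in> carrier ?E" "b \<in> carrier ?E" "c \<in> carrier ?E"
    then obtain u x v y w z where e: "a = (u, x)" "b = (v, y)" "c = (w, z)" "x \<in> carrier A" "y \<in> carrier A" "z \<in> carrier A"
      by (auto simp: cocycle_extension_def)
    show "a \<otimes>\<^bsub>?E\<^esub> b \<otimes>\<^bsub>?E\<^esub> c = a \<otimes>\<^bsub>?E\<^esub> (b \<otimes>\<^bsub>?E\<^esub> c)"
      using e co[of x y z] by (simp add: cocycle_extension_def A.m_assoc)
  next
    fix a assume "a \<in> carrier ?E"
    then obtain u x where e: "a = (u, x)" "u \<noteq> 0" "x \<in> carrier A"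
      by (auto simp: cocycle_extension_def)
    have "(1 / (u * f \<one>\<^bsub>A\<^esub> \<one>\<^bsub>A\<^esub> * f (inv\<^bsub>A\<^esub> x) x), inv\<^bsub>A\<^esub> x) \<otimes>\<^bsub>?E\<^esub> a = \<one>\<^bsub>?E\<^esub>"
      using e nz by (simp add: cocycle_extension_def)
    moreover have "(1 / (u * f \<one>\<^bsub>A\<^esub> \<one>\<^bsub>A\<^esub> * f (inv\<^bsub>A\<^esub> x) x), inv\<^bsub>A\<^esub> x) \<in> carrier ?E"
      using e nz by (simp add: cocycle_extension_def)
    ultimately show "\<exists>b\<in>carrier ?E. b \<otimes>\<^bsub>?E\<^esub> a = \<one>\<^bsub>?E\<^esub>" by blast
  qed (auto simp: cocycle_extension_def nz f1 wnz)
  show ?thesis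
  proof (intro central_extension.intro central_extension_axioms.intro grp \<open>group A\<close>)
    show "snd \<in> hom ?E A" by (rule homI) (auto simp: cocycle_extension_def)
    have "(1::'k) \<in> {u. u \<noteq> 0}" by simp
    then show "snd ` carrier ?E = carrier A" unfolding cocycle_extension_def
      by (metis empty_iff partial_object.select_convs(1) snd_image_times)
    fix e assume "e \<in> carrier ?E" "snd e = \<one>\<^bsub>A\<^esub>"
    then show "\<exists>u. u \<noteq> 0 \<and> e = (u / f \<one>\<^bsub>A\<^esub> \<one>\<^bsub>A\<^esub>, \<one>\<^bsub>A\<^esub>)"
      using nz by (intro exI[of _ "fst e * f \<one>\<^bsub>A\<^esub> \<one>\<^bsub>A\<^esub>"]) (auto simp: cocycle_extension_def)
  qed (auto simp: cocycle_extension_def nz f1 wnz)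
qed

text \<open>If c trivialises f on H, the map sending x to (1 / c x, x) is multiplicative, and its
  image is the required complement.\<close>

lemma trivial_on_imp_splits:
  fixes f :: "'a \<Rightarrow> 'a \<Rightarrow> 'k::alg_closed_field"
  assumes "group A" "cocycle2 A f" "subgroup H A" "trivial_on A f H"
  shows "central_extension.splits (cocycle_extension A f) A snd H"
proof -
  let ?E = "cocycle_extension A f"
  interpret central_extension ?E A snd "\<lambda>u. (u / f \<one>\<^bsub>A\<^esub> \<one>\<^bsub>A\<^esub>, \<one>\<^bsub>A\<^esub>)"
    by (rule central_extension_cocycle) fact+
  obtain c where c: "\<And>x. x \<in> H \<Longrightarrow> c x \<noteq> 0"
    "\<And>x y. x \<in> H \<Longrightarrow> y \<in> H \<Longrightarrow> f x y * c (x \<otimes>\<^bsub>A\<^esub> y) = c x * c y"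
    using assms(4) unfolding trivial_on_def by auto
  interpret H: subgroup H A by fact
  let ?S = "(\<lambda>x. (1 / c x, x)) ` H"
  have c1: "c \<one>\<^bsub>A\<^esub> = f \<one>\<^bsub>A\<^esub> \<one>\<^bsub>A\<^esub>" using c(2)[of "\<one>\<^bsub>A\<^esub>" "\<one>\<^bsub>A\<^esub>"] c(1)[of "\<one>\<^bsub>A\<^esub>"] by simp
  have mul: "(1 / c x, x) \<otimes>\<^bsub>?E\<^esub> (1 / c y, y) = (1 / c (x \<otimes>\<^bsub>A\<^esub> y), x \<otimes>\<^bsub>A\<^esub> y)" if xy: "x \<in> H" "y \<in> H" for x y
  proof -
    have "f x y \<noteq> 0" using c(2)[OF xy] c(1)[OF xy(1)] c(1)[OF xy(2)] by auto
    moreover from this have "c (x \<otimes>\<^bsub>A\<^esub> y) = c x * c y / f x y"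
      using c(2)[OF xy] by (metis nonzero_mult_div_cancel_left)
    ultimately show ?thesis by (simp add: cocycle_extension_simps)
  qed
  have one: "(1 / c \<one>\<^bsub>A\<^esub>, \<one>\<^bsub>A\<^esub>) = \<one>\<^bsub>?E\<^esub>" using c1 by simp
  have sub: "?S \<subseteq> carrier ?E" using c by (auto simp: cocycle_extension_simps)
  have "subgroup ?S ?E"
  proof (rule E.subgroupI[OF sub])
    fix a assume "a \<in> ?S"
    then obtain x where x: "x \<in> H" "a = (1 / c x, x)" by blast
    have "inv\<^bsub>?E\<^esub> a = (1 / c (inv\<^bsub>A\<^esub> x), inv\<^bsub>A\<^esub> x)"
      using x mul[of "inv\<^bsub>A\<^esub> x" x] one sub by (intro E.inv_equality) auto
    then show "inv\<^bsub>?E\<^esub> a \<in> ?S" using x by auto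
    fix b assume "b \<in> ?S"
    then show "a \<otimes>\<^bsub>?E\<^esub> b \<in> ?S" using x mul by auto
  qed (use H.one_closed in blast)
  moreover have "snd ` ?S = H" by (simp add: image_image)
  ultimately show ?thesis unfolding splits_def using one by (intro exI[of _ ?S]) auto
qed

text \<open>The complement is the graph of a function on A, and the reciprocal of that function is a
  trivialising cochain.\<close>

lemma splits_imp_trivial_class:
  fixes f :: "'a \<Rightarrow> 'a \<Rightarrow> 'k::alg_closed_field"
  assumes "group A" "cocycle2 A f"
    "central_extension.splits (cocycle_extension A f) A snd (carrier A)"
  shows "trivial_class A f"
proof -
  let ?E = "cocycle_extension A f"
  interpret central_extension ?E A snd "\<lambda>u. (u / f \<one>\<^bsub>A\<^esub> \<one>\<^bsub>A\<^esub>, \<one>\<^bsub>A\<^esub>)"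
    by (rule central_extension_cocycle) fact+
  obtain S where S: "split_lift S" "snd ` S = carrier A" using assms(3) splits_iff by auto
  have sg: "subgroup S ?E" using S by (simp add: split_lift_def)
  define c where "c x = (SOME u. (u, x) \<in> S)" for x
  have c: "(c x, x) \<in> S" if "x \<in> carrier A" for x
  proof -
    from that obtain u where "(u, x) \<in> S" using S(2) by force
    then show ?thesis unfolding c_def by (rule someI)
  qed
  have nz: "c x \<noteq> 0" if "x \<in> carrier A" for x
    using subgroup.mem_carrier[OF sg c[OF that]] by (simp add: cocycle_extension_simps)
  have cm: "c (x \<otimes>\<^bsub>A\<^esub> y) = c x * c y * f x y" if "x \<in> carrier A" "y \<in> carrier A" for x y
  proof -
    have "(c x * c y * f x y, x \<otimes>\<^bsub>A\<^esub> y) \<in> S"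
      using subgroup.m_closed[OF sg c[OF that(1)] c[OF that(2)]] by (simp add: cocycle_extension_simps)
    from split_lift_inj[OF S(1) this c[of "x \<otimes>\<^bsub>A\<^esub> y"]] that show ?thesis by simp
  qed
  have "f x y * (1 / c (x \<otimes>\<^bsub>A\<^esub> y)) = 1 / c x * (1 / c y)" if xy: "x \<in> carrier A" "y \<in> carrier A" for x y
    using cm[OF xy] nz[OF xy(1)] nz[OF xy(2)] nz[of "x \<otimes>\<^bsub>A\<^esub> y"] xy by simp
  then show ?thesis unfolding trivial_class_iff trivial_on_def
    using nz by (intro exI[of _ "\<lambda>x. 1 / c x"]) simp
qed

section \<open>The prime field inside k\<close>

context
  fixes p :: nat
  assumes p: "prime p" and char: "CHAR('k::field) = p"
begin

lemma of_nat_mod_char: "(of_nat (n mod p) :: 'k) = of_nat n"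
proof -
  have "(of_nat (p * (n div p) + n mod p) :: 'k) = of_nat (n mod p)"
    using of_nat_CHAR[where ?'a='k] char by (simp only: of_nat_add of_nat_mult) simp
  then show ?thesis by simp
qed

lemma of_nat_eq_iff_mod_char: "(of_nat m :: 'k) = of_nat n \<longleftrightarrow> m mod p = n mod p"
proof
  assume eq: "(of_nat m :: 'k) = of_nat n"
  have "a mod p = b mod p" if ab: "a \<le> b" "(of_nat a :: 'k) = of_nat b" for a b :: nat
  proof -
    have "(of_nat (b - a) :: 'k) = 0" using ab by (simp add: of_nat_diff)
    then have "p dvd b - a" using of_nat_eq_0_iff_char_dvd[where ?'a='k] char by metis
    then show ?thesis using ab by (metis mod_eq_dvd_iff_nat)
  qed
  then show "m mod p = n mod p" using eq by (metis nat_le_linear)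
next
  assume "m mod p = n mod p"
  then show "(of_nat m :: 'k) = of_nat n" by (metis of_nat_mod_char)
qed

text \<open>In characteristic p the set \<int> inside k is the prime field. Describing the prime
  field in this way keeps matrices over it and their eigenvectors over k in one type.\<close>

lemma Ints_char_p: "(\<int> :: 'k set) = of_nat ` {..<p}"
proof (intro equalityI subsetI)
  fix a :: 'k assume "a \<in> \<int>"
  then obtain n where "a = of_int n" by (rule Ints_cases)
  have "of_int (int p) = (0::'k)" using of_nat_CHAR[where ?'a='k] char by simp
  then have "of_int (int p * (n div int p) + n mod int p) = (of_int (n mod int p) :: 'k)"
    by (simp only: of_int_add of_int_mult) simp
  then have "a = of_int (n mod int p)" using \<open>a = of_int n\<close> by simp
  also have "\<dots> = of_nat (nat (n mod int p))" using p by (simp add: prime_gt_0_nat)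
  finally show "a \<in> of_nat ` {..<p}" using p
    by (metis Euclidean_Rings.pos_mod_bound Euclidean_Rings.pos_mod_sign image_eqI lessThan_iff nat_less_iff of_nat_0_less_iff prime_gt_0_nat)
qed auto

lemma Ints_char_p_E:
  assumes "(a::'k) \<in> \<int>" obtains n where "n < p" "a = of_nat n"
  using assms unfolding Ints_char_p by auto

lemma inj_of_nat_char: "inj_on (of_nat :: nat \<Rightarrow> 'k) {..<p}"
  by (rule inj_onI) (auto simp: of_nat_eq_iff_mod_char)

lemma card_Ints_char_p: "card (\<int> :: 'k set) = p" and finite_Ints_char_p: "finite (\<int> :: 'k set)"
  unfolding Ints_char_p using card_image[OF inj_of_nat_char] by simp_all

lemma Ints_frobenius:
  assumes "(a::'k) \<in> \<int>" shows "a ^ p = a"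
proof -
  have "(of_nat n :: 'k) ^ p = of_nat n" for n
    by (induction n) (use p char in \<open>simp_all add: freshmans_dream prime_gt_0_nat\<close>)
  then show ?thesis using assms Ints_char_p_E by metis
qed

lemma Ints_fermat:
  assumes "(a::'k) \<in> \<int>" "a \<noteq> 0" shows "a ^ (p - 1) = 1"
proof -
  have "a ^ (p - 1) * a = 1 * a"
    using Ints_frobenius[OF assms(1)] p by (simp flip: power_Suc2 add: prime_gt_0_nat)
  then show ?thesis using assms by (metis mult_right_cancel)
qed

lemma Ints_divide: 
  assumes "(a::'k) \<in> \<int>" "b \<in> \<int>" shows "a / b \<in> \<int>"
proof (cases "b = 0")
  case False
  \<comment> \<open>By Fermat the inverse of b is a power of b, so it stays in the prime
    field.\<close>
  have "b * b ^ (p - 2) = 1"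
    using Ints_fermat[OF assms(2) False] prime_ge_2_nat[OF p]
    by (metis One_nat_def Suc_diff_Suc Suc_1 Suc_le_lessD power_Suc)
  then have "a / b = a * b ^ (p - 2)" using False by (simp add: field_simps)
  then show ?thesis using assms by simp
qed (use assms in simp)

lemma two_neq_zero: "odd p \<Longrightarrow> (2::'k) \<noteq> 0"
  using of_nat_eq_0_iff_char_dvd[where ?'a='k, of 2] char p
  by (metis dvd_refl of_nat_numeral primes_dvd_imp_eq two_is_prime_nat)

text \<open>The generator is the image in k of a primitive residue modulo p. A smaller order than p
  - 1 would leave too few powers to fill the p - 1 nonzero elements.\<close>

lemma Ints_primitive_root:
  obtains g :: 'k where "g \<in> \<int>" "g \<noteq> 0"
    "\<And>a. a \<in> \<int> \<Longrightarrow> a \<noteq> 0 \<Longrightarrow> \<exists>n. a = g ^ n"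
    "\<And>n. g ^ n = 1 \<longleftrightarrow> (p - 1) dvd n"
proof -
  obtain r where r: "residue_primroot p r"
    using prime_primitive_root_exists[OF prime_gt_1_nat[OF p] p] by blast
  define g :: 'k where "g = of_nat r"
  have bij: "bij_betw (\<lambda>i. r ^ i mod p) {..<totient p} (totatives p)"
    using residue_primroot_is_generator[OF _ r] p prime_gt_1_nat by blast
  have gen: "\<exists>n. a = g ^ n" if "a \<in> \<int>" "a \<noteq> 0" for a :: 'k
  proof -
    from that(1) obtain n where n: "n < p" "a = of_nat n" by (rule Ints_char_p_E)
    then have "n \<in> totatives p" using that(2) p by (cases "n = 0") (auto simp: totatives_prime)
    then have "n \<in> (\<lambda>i. r ^ i mod p) ` {..<totient p}" using bij by (simp add: bij_betw_imp_surj_on)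
    then obtain i where "n = r ^ i mod p" by blast
    then have "a = g ^ i" using n(2) of_nat_mod_char[of "r ^ i"] by (simp add: g_def)
    then show ?thesis by blast
  qed
  have gnz: "g \<noteq> 0"
  proof
    assume "g = 0"
    obtain n where "1 = g ^ n" using gen[of 1] by auto
    have "p dvd r" using \<open>g = 0\<close> of_nat_eq_0_iff_char_dvd[where ?'a='k] char unfolding g_def by metis
    moreover have "coprime p r" using r by (simp add: residue_primroot_def)
    ultimately show False using p by (metis coprime_absorb_left not_prime_unit)
  qed
  have gI: "g \<in> \<int>" unfolding g_def by simp
  have fer: "g ^ (p - 1) = 1" using Ints_fermat gI gnz by blast
  have "(p - 1) dvd n" if "g ^ n = 1" for n
  proof (rule ccontr)
    assume nd: "\<not> (p - 1) dvd n"
    let ?m = "n mod (p - 1)"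
    have m: "0 < ?m" "?m < p - 1" using nd p prime_gt_1_nat[OF p] by (auto simp: dvd_eq_mod_eq_0)
    have "g ^ n = (g ^ (p - 1)) ^ (n div (p - 1)) * g ^ ?m"
      by (metis mult_div_mod_eq power_add power_mult)
    then have gm: "g ^ ?m = 1" using that fer by simp
    have "\<int> - {0} \<subseteq> (\<lambda>i. g ^ i) ` {..<?m}"
    proof
      fix a :: 'k assume "a \<in> \<int> - {0}"
      then obtain i where i: "a = g ^ i" using gen by blast
      have "g ^ i = (g ^ ?m) ^ (i div ?m) * g ^ (i mod ?m)"
        by (metis mult_div_mod_eq power_add power_mult)
      then have "a = g ^ (i mod ?m)" using i gm by simp
      then show "a \<in> (\<lambda>i. g ^ i) ` {..<?m}" using m by auto
    qed
    then have "card (\<int> - {0} :: 'k set) \<le> ?m"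
      by (metis card_image_le card_lessThan card_mono finite_imageI finite_lessThan le_trans)
    moreover have "card (\<int> - {0} :: 'k set) = p - 1"
      using card_Ints_char_p finite_Ints_char_p by simp
    ultimately show False using m by simp
  qed
  moreover have "g ^ n = 1" if "(p - 1) dvd n" for n
    using that fer by (auto simp: power_mult)
  ultimately show ?thesis using that[OF gI gnz gen] by blast
qed

text \<open>Counting: \<open>t \<mapsto> 1 - t\<close> cannot map the nonsquares injectively into the squares different from 1.\<close>
lemma nonsquare_pair:
  assumes "odd p"
  obtains n :: 'k where "n \<in> \<int>" "n \<noteq> 0" "1 - n \<noteq> 0"
    "\<And>t. t \<in> \<int> \<Longrightarrow> t \<noteq> 0 \<Longrightarrow> (\<exists>a\<in>\<int>. t = a\<^sup>2) \<or> (\<exists>a\<in>\<int>. t = n * a\<^sup>2)"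
    "\<And>t. t \<in> \<int> \<Longrightarrow> t \<noteq> 0 \<Longrightarrow> (\<exists>a\<in>\<int>. t = a\<^sup>2) \<or> (\<exists>a\<in>\<int>. t = (1 - n) * a\<^sup>2)"
proof -
  obtain g :: 'k where g: "g \<in> \<int>" "g \<noteq> 0"
    "\<And>a. a \<in> \<int> \<Longrightarrow> a \<noteq> 0 \<Longrightarrow> \<exists>n. a = g ^ n" "\<And>n. g ^ n = 1 \<longleftrightarrow> (p - 1) dvd n"
    using Ints_primitive_root by blast
  have gI: "g ^ n \<in> \<int>" for n using g by simp
  \<comment> \<open>Two nonsquares are both odd powers of g, so their quotient is a square;
    \<open>t ^ (p - 2)\<close> serves as the inverse of t.\<close>
  have dich: "\<exists>a\<in>\<int>. s = t * a\<^sup>2" if nt: "\<not> (\<exists>a\<in>\<int>. t = a\<^sup>2)" and ns: "\<not> (\<exists>a\<in>\<int>. s = a\<^sup>2)"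
     and st: "s \<in> \<int>" "s \<noteq> 0" "t \<in> \<int>" "t \<noteq> 0" for s t :: 'k
  proof -
    obtain i j where ij: "s = g ^ i" "t = g ^ j" using g st by blast
    have odd: "odd n" if "\<not> (\<exists>a\<in>\<int>. g ^ n = a\<^sup>2)" for n
    proof
      assume "even n"
      then obtain m where "n = 2 * m" by blast
      then have "g ^ n = (g ^ m)\<^sup>2" by (simp add: power_mult mult.commute)
      then show False using that gI by blast
    qed
    have oi: "odd i" "odd j" using odd ns nt ij by auto
    have "odd (j * (p - 2))" using oi assms prime_ge_2_nat[OF p] by auto
    then obtain m where m: "i + j * (p - 2) = 2 * m" using oi by (metis odd_even_add evenE)
    have "t * t ^ (p - 2) = 1" using Ints_fermat[OF st(3,4)] prime_ge_2_nat[OF p]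
      by (metis One_nat_def Suc_diff_Suc Suc_1 Suc_le_lessD power_Suc)
    then have "s = t * (s * t ^ (p - 2))" by (simp add: algebra_simps)
    also have "s * t ^ (p - 2) = (g ^ m)\<^sup>2"
      unfolding ij using m by (metis power_add power_mult mult.commute)
    finally show ?thesis using gI by blast
  qed
  let ?S = "(\<lambda>a. a\<^sup>2) ` (\<int> - {0}) :: 'k set"
  let ?N = "\<int> - {0} - ?S"
  have gN: "\<not> (\<exists>a\<in>\<int>. g = a\<^sup>2)"
  proof
    assume "\<exists>a\<in>\<int>. g = a\<^sup>2"
    then obtain a where a: "a \<in> \<int>" "g = a\<^sup>2" by blast
    then have "a \<noteq> 0" using g by auto
    then obtain i where "a = g ^ i" using g a by blast
    then have "g = g ^ (2 * i)" using a by (simp add: power_mult mult.commute)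
    moreover have "g ^ (p - 1 + 2 * i) = g ^ (2 * i)" using g(4)[of "p - 1"] by (simp add: power_add)
    moreover have "p - 1 + 2 * i = Suc (p - 2 + 2 * i)" using prime_ge_2_nat[OF p] by simp
    ultimately have "g ^ (p - 2 + 2 * i) * g = 1 * g" by (metis power_Suc2 mult_1)
    then have "g ^ (p - 2 + 2 * i) = 1" using g by (metis mult_right_cancel)
    then have "(p - 1) dvd (p - 2 + 2 * i)" using g by blast
    moreover have "even (p - 1)" "odd (p - 2 + 2 * i)" using assms prime_ge_2_nat[OF p] by auto
    ultimately show False by (meson dvd_trans)
  qed
  have fin: "finite (\<int> :: 'k set)" by (rule finite_Ints_char_p)
  have "(\<lambda>s. g * s) ` ?S \<subseteq> ?N"
  proof
    fix x assume "x \<in> (\<lambda>s. g * s) ` ?S"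
    then obtain a where a: "a \<in> \<int>" "a \<noteq> 0" "x = g * a\<^sup>2" by blast
    have "x \<notin> ?S"
    proof
      assume "x \<in> ?S"
      then obtain b where b: "b \<in> \<int>" "x = b\<^sup>2" by blast
      then have "g = (b / a)\<^sup>2" using a by (simp add: field_simps)
      then show False using gN a b Ints_divide by blast
    qed
    then show "x \<in> ?N" using a g by auto
  qed
  then have "card ((\<lambda>s. g * s) ` ?S) \<le> card ?N" using fin by (intro card_mono) auto
  moreover have "card ((\<lambda>s. g * s) ` ?S) = card ?S" using g by (intro card_image) (auto intro: inj_onI)
  ultimately have le: "card ?S \<le> card ?N" by simp
  \<comment> \<open>There are at least as many nonsquares as nonzero squares, and 1 is a square that
    1 - n never equals, so 1 - n is a nonsquare for some nonsquare n. Such a pair is the input for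
    the Steinberg relation in \<open>H_mult\<close>.\<close>
  have "\<exists>n\<in>?N. 1 - n \<in> ?N"
  proof (rule ccontr)
    assume no: "\<not> ?thesis"
    have one: "1 \<in> ?S" by (rule image_eqI[of _ _ 1]) auto
    have "(\<lambda>n. 1 - n) ` ?N \<subseteq> ?S - {1}"
    proof
      fix x assume "x \<in> (\<lambda>n. 1 - n) ` ?N"
      then obtain n where n: "n \<in> ?N" "x = 1 - n" by blast
      have "x \<in> \<int>" "x \<notin> ?N" "x \<noteq> 1" using n no by auto
      moreover have "x \<noteq> 0" using n one by auto
      ultimately show "x \<in> ?S - {1}" by blast
    qed
    then have "card ((\<lambda>n. 1 - n) ` ?N) \<le> card (?S - {1})" using fin by (intro card_mono) auto
    moreover have "card ((\<lambda>n. 1 - n) ` ?N) = card ?N" by (intro card_image) (auto intro: inj_onI)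
    moreover have "card (?S - {1}) < card ?S" using one fin by (intro card_Diff1_less) auto
    ultimately show False using le by linarith
  qed
  then obtain n where n: "n \<in> ?N" "1 - n \<in> ?N" by blast
  have ns: "\<not> (\<exists>a\<in>\<int>. m = a\<^sup>2)" if "m \<in> ?N" for m
  proof
    assume "\<exists>a\<in>\<int>. m = a\<^sup>2"
    then obtain a where "a \<in> \<int>" "m = a\<^sup>2" by blast
    moreover from this have "a \<noteq> 0" using that by auto
    ultimately show False using that by blast
  qed
  have "(\<exists>a\<in>\<int>. t = a\<^sup>2) \<or> (\<exists>a\<in>\<int>. t = m * a\<^sup>2)" if "t \<in> \<int>" "t \<noteq> 0" "m \<in> ?N" for t m
    using dich[of m t] ns[of m] that by blast
  then show ?thesis using that[of n] n by auto
qed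

end

section \<open>Two by two matrices and extensions of matrix groups\<close>

datatype 'k m2 = M2 'k 'k 'k 'k

fun mtimes :: "'k::field m2 \<Rightarrow> 'k m2 \<Rightarrow> 'k m2" (infixl "\<star>" 70) where
  "M2 a b c d \<star> M2 a' b' c' d' = M2 (a * a' + b * c') (a * b' + b * d') (c * a' + d * c') (c * b' + d * d')"

fun mdet :: "'k::field m2 \<Rightarrow> 'k" where "mdet (M2 a b c d) = a * d - b * c"

fun m2_Ints :: "'k::field m2 \<Rightarrow> bool" where
  "m2_Ints (M2 a b c d) \<longleftrightarrow> a \<in> \<int> \<and> b \<in> \<int> \<and> c \<in> \<int> \<and> d \<in> \<int>"

lemma mdet_mult: "mdet (x \<star> y) = mdet x * mdet y"
  by (cases x; cases y) (simp add: algebra_simps)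

lemma mtimes_assoc: "x \<star> y \<star> z = x \<star> (y \<star> z)"
  by (cases x; cases y; cases z) (simp add: algebra_simps)

lemma mtimes_one: "x \<star> M2 1 0 0 1 = x" "M2 1 0 0 1 \<star> x = x"
  by (cases x; simp)+

text \<open>\<rho> embeds A into GL_2 of the prime field. In the applications A is an outer
  automorphism group, acting on a plane V or on S/Z.\<close>

locale matrix_extension = central_extension E A \<pi> \<iota>
  for E :: "'e monoid" (structure) and A :: "'a monoid" and \<pi> and \<iota> :: "'k::alg_closed_field \<Rightarrow> 'e" +
  fixes \<rho> :: "'a \<Rightarrow> 'k m2" and p :: nat
  assumes p: "prime p" and p_odd: "odd p" and char: "CHAR('k) = p"
    and \<rho>_mult: "x \<in> carrier A \<Longrightarrow> y \<in> carrier A \<Longrightarrow> \<rho> (x \<otimes>\<^bsub>A\<^esub> y) = \<rho> x \<star> \<rho> y"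
    and \<rho>_one: "\<rho> \<one>\<^bsub>A\<^esub> = M2 1 0 0 1"
    and \<rho>_inj: "inj_on \<rho> (carrier A)"
    and \<rho>_Ints: "x \<in> carrier A \<Longrightarrow> m2_Ints (\<rho> x)"
begin

lemma \<rho>_eq: "x \<in> carrier A \<Longrightarrow> y \<in> carrier A \<Longrightarrow> \<rho> x = \<rho> y \<Longrightarrow> x = y"
  using \<rho>_inj by (auto dest: inj_onD)

definition mat :: "'e \<Rightarrow> 'k m2" where "mat e = \<rho> (\<pi> e)"

lemma mat_mult: "e \<in> carrier E \<Longrightarrow> e' \<in> carrier E \<Longrightarrow> mat (e \<otimes> e') = mat e \<star> mat e'"
  by (simp add: mat_def \<rho>_mult)

lemma \<pi>_eq: "e \<in> carrier E \<Longrightarrow> e' \<in> carrier E \<Longrightarrow> mat e = mat e' \<Longrightarrow> \<pi> e = \<pi> e'"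
  by (simp add: mat_def \<rho>_eq)

lemma \<rho>_det_nz: assumes "x \<in> carrier A" shows "mdet (\<rho> x) \<noteq> 0"
proof -
  have "mdet (\<rho> (x \<otimes>\<^bsub>A\<^esub> inv\<^bsub>A\<^esub> x)) = 1" using assms by (simp add: \<rho>_one)
  then have "mdet (\<rho> x) * mdet (\<rho> (inv\<^bsub>A\<^esub> x)) = 1" using assms by (simp only: \<rho>_mult A.inv_closed mdet_mult)
  then show ?thesis by auto
qed

lemma \<rho>_pow_upper:
  assumes "x \<in> carrier A" "\<rho> x = M2 1 s 0 1"
  shows "\<rho> (x [^]\<^bsub>A\<^esub> (n::nat)) = M2 1 (of_nat n * s) 0 1"
  by (induction n) (use assms in \<open>auto simp: \<rho>_one \<rho>_mult algebra_simps\<close>)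

lemma \<rho>_pow_lower:
  assumes "x \<in> carrier A" "\<rho> x = M2 1 0 s 1"
  shows "\<rho> (x [^]\<^bsub>A\<^esub> (n::nat)) = M2 1 0 (of_nat n * s) 1"
  by (induction n) (use assms in \<open>auto simp: \<rho>_one \<rho>_mult algebra_simps\<close>)

lemma \<rho>_pow_diag:
  assumes "x \<in> carrier A" "\<rho> x = M2 s 0 0 t"
  shows "\<rho> (x [^]\<^bsub>A\<^esub> (n::nat)) = M2 (s ^ n) 0 0 (t ^ n)"
  by (induction n) (use assms in \<open>auto simp: \<rho>_one \<rho>_mult algebra_simps\<close>)

lemma Ints_div [simp]: "(a::'k) \<in> \<int> \<Longrightarrow> b \<in> \<int> \<Longrightarrow> a / b \<in> \<int>"
  by (rule Ints_divide[OF p char])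

text \<open>Two lifts of one element differ by a scalar u, and u^p = 1 forces u = 1.\<close>

lemma p_lift_unique:
  assumes "e \<in> carrier E" "e' \<in> carrier E" "mat e = mat e'" "e [^] p = \<one>" "e' [^] p = \<one>"
  shows "e = e'"
proof -
  obtain u where u: "u \<noteq> 0" "e' = \<iota> u \<otimes> e" using same_image[of e e'] \<pi>_eq assms by metis
  then have "\<iota> (u ^ p) = \<one>" using assms scaled_pow[of u e p] by simp
  then have "u ^ (p ^ 1) = 1" using u \<iota>_one_iff[of "u ^ p"] by simp
  then have "u = 1" by (rule char_p_root_of_unity[OF p char])
  then show ?thesis using u assms by simp
qed

end

section \<open>Groups containing SL(2,p)\<close>

locale sl2_extension = matrix_extension E A \<pi> \<iota> \<rho> p
  for E :: "'e monoid" (structure) and A :: "'a monoid" and \<pi> and \<iota> :: "'k::alg_closed_field \<Rightarrow> 'e"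
    and \<rho> and p +
  assumes upper: "s \<in> \<int> \<Longrightarrow> M2 1 s 0 1 \<in> \<rho> ` carrier A"
    and lower: "s \<in> \<int> \<Longrightarrow> M2 1 0 s 1 \<in> \<rho> ` carrier A"
begin

definition unipotent :: "'k m2 \<Rightarrow> bool" where
  "unipotent m \<longleftrightarrow> (\<exists>s\<in>\<int>. m = M2 1 s 0 1 \<or> m = M2 1 0 s 1)"

text \<open>For an elementary unipotent matrix the lift with trivial p-th power exists and is
  unique, so it is a canonical lift.\<close>

definition plift :: "'k m2 \<Rightarrow> 'e" where
  "plift m = (THE e. e \<in> carrier E \<and> mat e = m \<and> e [^] p = \<one>)"

lemma plift_eqI: "e \<in> carrier E \<Longrightarrow> mat e = m \<Longrightarrow> e [^] p = \<one> \<Longrightarrow> plift m = e"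
  unfolding plift_def by (rule the_equality) (auto intro: p_lift_unique)

lemma plift:
  assumes "unipotent m"
  shows "plift m \<in> carrier E" "mat (plift m) = m" "plift m [^] p = \<one>"
proof -
  have p0: "p > 0" using p by (simp add: prime_gt_0_nat)
  have cp: "(of_nat p :: 'k) = 0" using of_nat_CHAR[where ?'a='k] char by simp
  from assms obtain s where s: "s \<in> \<int>" "m = M2 1 s 0 1 \<or> m = M2 1 0 s 1" unfolding unipotent_def by blast
  then have "m \<in> \<rho> ` carrier A" using upper lower by blast
  then obtain x where x: "x \<in> carrier A" "\<rho> x = m" by blast
  have "\<rho> (x [^]\<^bsub>A\<^esub> p) = \<rho> \<one>\<^bsub>A\<^esub>"
    using s x \<rho>_pow_upper[of x s p] \<rho>_pow_lower[of x s p] cp by (auto simp: \<rho>_one)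
  then have "x [^]\<^bsub>A\<^esub> p = \<one>\<^bsub>A\<^esub>" using x by (intro \<rho>_eq) auto
  then obtain e where "e \<in> carrier E" "\<pi> e = x" "e [^] p = \<one>" using lift_of_order x p0 by blast
  then have e: "e \<in> carrier E" "mat e = m" "e [^] p = \<one>" using x by (auto simp: mat_def)
  then have "plift m = e" by (rule plift_eqI)
  then show "plift m \<in> carrier E" "mat (plift m) = m" "plift m [^] p = \<one>" using e by auto
qed

text \<open>A conjugate of a canonical lift again has trivial p-th power, hence is the canonical
  lift of the conjugate matrix. Conjugation relations between root elements therefore hold in E
  without a scalar correction. Writing the relation with products on both sides avoids inverse
  matrices.\<close>

lemma plift_conj:
  assumes "unipotent m" "unipotent m'" "e \<in> carrier E" "mat e \<star> m = m' \<star> mat e"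
  shows "e \<otimes> plift m = plift m' \<otimes> e"
proof -
  note m = plift[OF assms(1)] and m' = plift[OF assms(2)]
  have "\<pi> (e \<otimes> plift m) = \<pi> (plift m' \<otimes> e)"
    using assms m m' by (intro \<pi>_eq) (simp_all add: mat_mult)
  then have "\<pi> e \<otimes>\<^bsub>A\<^esub> \<pi> (plift m) = \<pi> (plift m') \<otimes>\<^bsub>A\<^esub> \<pi> e" using m m' assms by simp
  then have "\<pi> (e \<otimes> plift m \<otimes> inv e) = \<pi> (plift m')"
    using m m' assms by (simp add: A.m_assoc)
  moreover have "(e \<otimes> plift m \<otimes> inv e) [^] p = \<one>" using m assms by (simp add: E.conj_pow)
  ultimately have "plift m' = e \<otimes> plift m \<otimes> inv e"
    using m m' assms by (intro plift_eqI) (auto simp: mat_def)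
  then show ?thesis using m assms by (simp add: E.m_assoc)
qed

definition X :: "'k \<Rightarrow> 'e" where "X s = plift (M2 1 s 0 1)"
definition Y :: "'k \<Rightarrow> 'e" where "Y s = plift (M2 1 0 s 1)"

lemma uniX [simp]: "s \<in> \<int> \<Longrightarrow> unipotent (M2 1 s 0 1)" and uniY [simp]: "s \<in> \<int> \<Longrightarrow> unipotent (M2 1 0 s 1)"
  unfolding unipotent_def by blast+

lemma X [simp]: "s \<in> \<int> \<Longrightarrow> X s \<in> carrier E" "s \<in> \<int> \<Longrightarrow> mat (X s) = M2 1 s 0 1"
  and Y [simp]: "s \<in> \<int> \<Longrightarrow> Y s \<in> carrier E" "s \<in> \<int> \<Longrightarrow> mat (Y s) = M2 1 0 s 1"
  by (simp_all add: X_def Y_def plift)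

lemma X_of_nat: "X (of_nat n) = X 1 [^] n"
proof -
  have "(X 1 [^] n) [^] p = (X 1 [^] p) [^] n" by (simp add: E.nat_pow_pow mult.commute)
  then have "(X 1 [^] n) [^] p = \<one>" by (simp add: X_def plift)
  moreover have "mat (X 1 [^] n) = M2 1 (of_nat n) 0 1"
    using \<rho>_pow_upper[of "\<pi> (X 1)" 1 n] by (simp add: mat_def[symmetric] \<pi>.hom_nat_pow[symmetric])
  ultimately show ?thesis unfolding X_def[of "of_nat n"] by (intro plift_eqI) simp_all
qed

lemma Y_of_nat: "Y (of_nat n) = Y 1 [^] n"
proof -
  have "(Y 1 [^] n) [^] p = (Y 1 [^] p) [^] n" by (simp add: E.nat_pow_pow mult.commute)
  then have "(Y 1 [^] n) [^] p = \<one>" by (simp add: Y_def plift)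
  moreover have "mat (Y 1 [^] n) = M2 1 0 (of_nat n) 1"
    using \<rho>_pow_lower[of "\<pi> (Y 1)" 1 n] by (simp add: mat_def[symmetric] \<pi>.hom_nat_pow[symmetric])
  ultimately show ?thesis unfolding Y_def[of "of_nat n"] by (intro plift_eqI) simp_all
qed

lemma X_add: assumes "s \<in> \<int>" "t \<in> \<int>" shows "X s \<otimes> X t = X (s + t)"
proof -
  obtain m n where "s = of_nat m" "t = of_nat n" using assms Ints_char_p_E[OF p char] by metis
  then show ?thesis using X_of_nat by (metis E.nat_pow_mult X(1) Ints_1 of_nat_add)
qed

lemma Y_add: assumes "s \<in> \<int>" "t \<in> \<int>" shows "Y s \<otimes> Y t = Y (s + t)"
proof -
  obtain m n where "s = of_nat m" "t = of_nat n" using assms Ints_char_p_E[OF p char] by metis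
  then show ?thesis using Y_of_nat by (metis E.nat_pow_mult Y(1) Ints_1 of_nat_add)
qed

lemma X_0 [simp]: "X 0 = \<one>" and Y_0 [simp]: "Y 0 = \<one>"
  using X_of_nat[of 0] Y_of_nat[of 0] by simp_all

lemma X_inv: "s \<in> \<int> \<Longrightarrow> inv (X s) = X (- s)"
  by (rule E.inv_equality) (simp_all add: X_add)

lemma Y_inv: "s \<in> \<int> \<Longrightarrow> inv (Y s) = Y (- s)"
  by (rule E.inv_equality) (simp_all add: Y_add)

lemma X_add': "s \<in> \<int> \<Longrightarrow> t \<in> \<int> \<Longrightarrow> e \<in> carrier E \<Longrightarrow> X s \<otimes> (X t \<otimes> e) = X (s + t) \<otimes> e"
  by (simp add: E.m_assoc[symmetric] X_add)

text \<open>Steinberg's representative of the Weyl group element, as a word in the canonical lifts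
  of the two root subgroups.\<close>

definition W :: "'k \<Rightarrow> 'e" where "W t = X t \<otimes> Y (- (1 / t)) \<otimes> X t"

lemma W [simp]: "t \<in> \<int> \<Longrightarrow> W t \<in> carrier E" "t \<in> \<int> \<Longrightarrow> t \<noteq> 0 \<Longrightarrow> mat (W t) = M2 0 t (- (1 / t)) 0"
  by (simp_all add: W_def mat_mult)

lemma W_inv: "t \<in> \<int> \<Longrightarrow> inv (W t) = W (- t)"
  by (simp add: W_def E.inv_mult_group X_inv Y_inv E.m_assoc)

lemma W_cancel: "t \<in> \<int> \<Longrightarrow> W t \<otimes> W (- t) = \<one>" "t \<in> \<int> \<Longrightarrow> W (- t) \<otimes> W t = \<one>"
  using W_inv[of t] W(1)[of t] by (metis E.r_inv) (metis E.l_inv W(1) W_inv)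

lemma WX: "s \<in> \<int> \<Longrightarrow> t \<in> \<int> \<Longrightarrow> t \<noteq> 0 \<Longrightarrow> W t \<otimes> X s = Y (- (s / t\<^sup>2)) \<otimes> W t"
  unfolding X_def Y_def by (rule plift_conj) (simp_all add: power2_eq_square)

lemma WY: "s \<in> \<int> \<Longrightarrow> t \<in> \<int> \<Longrightarrow> t \<noteq> 0 \<Longrightarrow> W t \<otimes> Y s = X (- (t\<^sup>2 * s)) \<otimes> W t"
  unfolding X_def Y_def by (rule plift_conj) (simp_all add: power2_eq_square)

text \<open>Steinberg's torus element. Conjugation relations come for free from canonical lifts;
  what has to be proved is that H is multiplicative. The defect, a scalar depending on t and u, is
  the Steinberg symbol of the extension.\<close>

definition H :: "'k \<Rightarrow> 'e" where "H t = W t \<otimes> W (- 1)"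

lemma H [simp]: "t \<in> \<int> \<Longrightarrow> H t \<in> carrier E" "t \<in> \<int> \<Longrightarrow> t \<noteq> 0 \<Longrightarrow> mat (H t) = M2 t 0 0 (1 / t)"
  by (simp_all add: H_def mat_mult)

lemma H_1: "H 1 = \<one>"
  unfolding H_def using W_cancel[of 1] by simp

lemma HX: "s \<in> \<int> \<Longrightarrow> t \<in> \<int> \<Longrightarrow> t \<noteq> 0 \<Longrightarrow> H t \<otimes> X s = X (t\<^sup>2 * s) \<otimes> H t"
  unfolding X_def by (rule plift_conj) (simp_all add: power2_eq_square)

lemma HY: "s \<in> \<int> \<Longrightarrow> t \<in> \<int> \<Longrightarrow> t \<noteq> 0 \<Longrightarrow> H t \<otimes> Y s = Y (s / t\<^sup>2) \<otimes> H t"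
  unfolding Y_def by (rule plift_conj) (simp_all add: power2_eq_square)

text \<open>W is a word in root elements, so conjugation of the letters determines conjugation of
  W.\<close>

lemma conj_W:
  assumes e: "e \<in> carrier E" and t: "t \<in> \<int>" and s: "s \<in> \<int>"
    and "e \<otimes> X t = X s \<otimes> e" "e \<otimes> Y (- (1 / t)) = Y (- (1 / s)) \<otimes> e"
  shows "e \<otimes> W t = W s \<otimes> e"
proof -
  have "e \<otimes> W t = (e \<otimes> X t) \<otimes> Y (- (1 / t)) \<otimes> X t" using e t s by (simp add: W_def E.m_assoc)
  also have "\<dots> = X s \<otimes> (e \<otimes> Y (- (1 / t))) \<otimes> X t" using assms by (simp add: E.m_assoc)
  also have "\<dots> = X s \<otimes> Y (- (1 / s)) \<otimes> (e \<otimes> X t)" using assms by (simp add: E.m_assoc)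
  finally show ?thesis using assms by (simp add: W_def E.m_assoc)
qed

lemma HW: "u \<in> \<int> \<Longrightarrow> u \<noteq> 0 \<Longrightarrow> t \<in> \<int> \<Longrightarrow> t \<noteq> 0 \<Longrightarrow> H u \<otimes> W t = W (u\<^sup>2 * t) \<otimes> H u"
  by (rule conj_W) (simp_all add: HX HY mult.commute)

lemma mat_pow_diag: "e \<in> carrier E \<Longrightarrow> mat e = M2 s 0 0 t \<Longrightarrow> mat (e [^] (n::nat)) = M2 (s ^ n) 0 0 (t ^ n)"
  using \<rho>_pow_diag[of "\<pi> e" s t n] by (simp add: mat_def \<pi>.hom_nat_pow)

text \<open>For a primitive root g, the elements \<open>H t\<close> and \<open>H u\<close> lie over
  powers of the matrix of \<open>H g\<close>. Powers of one lift commute, and commutation does not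
  depend on the lifts.\<close>

lemma H_commute:
  assumes "t \<in> \<int>" "t \<noteq> 0" "u \<in> \<int>" "u \<noteq> 0"
  shows "H t \<otimes> H u = H u \<otimes> H t"
proof -
  obtain g :: 'k where g: "g \<in> \<int>" "g \<noteq> 0" "\<And>a. a \<in> \<int> \<Longrightarrow> a \<noteq> 0 \<Longrightarrow> \<exists>n. a = g ^ n"
    using Ints_primitive_root[OF p char] by metis
  obtain i j where ij: "t = g ^ i" "u = g ^ j" using g assms by metis
  have "\<pi> (H t) = \<pi> (H g [^] i)" "\<pi> (H u) = \<pi> (H g [^] j)"
    using assms g ij by (intro \<pi>_eq; simp add: mat_pow_diag power_one_over)+
  moreover have "H g [^] i \<otimes> H g [^] j = H g [^] j \<otimes> H g [^] i"
    using g by (simp add: E.nat_pow_mult add.commute)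
  ultimately have "commuting_lifts (\<pi> (H t)) (\<pi> (H u))"
    using commuting_liftsI[of "H g [^] i" "H g [^] j"] g by simp
  then show ?thesis unfolding commuting_lifts_def using assms H(1) by blast
qed

text \<open>Conjugation by \<open>H u\<close> multiplies the parameter of W by u^2. Commuting
  \<open>H t\<close> past \<open>H u\<close> therefore yields the vanishing of the symbol when one
  argument is a square.\<close>

lemma H_square:
  assumes "t \<in> \<int>" "t \<noteq> 0" "u \<in> \<int>" "u \<noteq> 0"
  shows "H t \<otimes> H (u\<^sup>2) = H (u\<^sup>2 * t)"
proof -
  have "H t \<otimes> H u = H u \<otimes> H t" using H_commute assms by blast
  also have "\<dots> = (H u \<otimes> W t) \<otimes> W (- 1)" using assms by (simp add: H_def[of t] E.m_assoc)
  also have "\<dots> = W (u\<^sup>2 * t) \<otimes> (H u \<otimes> W (- 1))" using assms by (simp add: HW E.m_assoc)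
  also have "\<dots> = (W (u\<^sup>2 * t) \<otimes> W (- (u\<^sup>2))) \<otimes> H u" using assms by (simp add: HW E.m_assoc)
  finally have "H t = W (u\<^sup>2 * t) \<otimes> W (- (u\<^sup>2))" using assms by simp
  then have "H t \<otimes> H (u\<^sup>2) = W (u\<^sup>2 * t) \<otimes> (W (- (u\<^sup>2)) \<otimes> W (u\<^sup>2)) \<otimes> W (- 1)"
    using assms by (simp add: H_def[of "u\<^sup>2"] E.m_assoc)
  also have "\<dots> = H (u\<^sup>2 * t)" using assms by (simp add: W_cancel H_def)
  finally show ?thesis .
qed

text \<open>Both root subgroups give the same Weyl element: moving one factor of
  \<open>W t \<otimes> W t\<close> through the three letters of the other exchanges the roles of X
  and Y.\<close>

lemma W_lower_form: "t \<in> \<int> \<Longrightarrow> t \<noteq> 0 \<Longrightarrow> W t = Y (- (1 / t)) \<otimes> X t \<otimes> Y (- (1 / t))"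
proof -
  assume t: "t \<in> \<int>" "t \<noteq> 0"
  have "W t \<otimes> W t = (W t \<otimes> X t) \<otimes> Y (- (1 / t)) \<otimes> X t" using t by (simp add: W_def[of t] E.m_assoc)
  also have "\<dots> = Y (- (1 / t)) \<otimes> (W t \<otimes> Y (- (1 / t))) \<otimes> X t"
    using t by (simp add: WX E.m_assoc power2_eq_square)
  also have "\<dots> = Y (- (1 / t)) \<otimes> X t \<otimes> (W t \<otimes> X t)" using t by (simp add: WY E.m_assoc power2_eq_square)
  also have "\<dots> = Y (- (1 / t)) \<otimes> X t \<otimes> Y (- (1 / t)) \<otimes> W t" using t by (simp add: WX E.m_assoc power2_eq_square)
  finally show ?thesis using t by simp
qed

text \<open>The Steinberg relation for t and 1 - t. With \<open>W (- 1)\<close> in lower form, the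
  inner parameters t, -1 and 1 - t add up to zero and the middle factor disappears.\<close>

lemma W_steinberg:
  assumes "t \<in> \<int>" "t \<noteq> 0" "1 - t \<noteq> 0"
  shows "W t \<otimes> W (- 1) \<otimes> W (1 - t) = W (t * (1 - t))"
proof -
  define u where "u = 1 - t"
  have u: "u \<in> \<int>" "u \<noteq> 0" using assms by (auto simp: u_def)
  have "W (- u) \<otimes> Y 1 = X (- (u\<^sup>2)) \<otimes> W (- u)" using WY[of 1 "- u"] u by simp
  then have "W u \<otimes> (W (- u) \<otimes> Y 1) \<otimes> W u = W u \<otimes> (X (- (u\<^sup>2)) \<otimes> W (- u)) \<otimes> W u" by simp
  moreover have "W u \<otimes> (W (- u) \<otimes> Y 1) \<otimes> W u = Y 1 \<otimes> W u"
    using u W_cancel[of u] by (simp add: E.m_assoc[symmetric])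
  moreover have "W u \<otimes> (X (- (u\<^sup>2)) \<otimes> W (- u)) \<otimes> W u = W u \<otimes> X (- (u\<^sup>2))"
    using u W_cancel[of u] by (simp add: E.m_assoc)
  ultimately have YW: "Y 1 \<otimes> W u = W u \<otimes> X (- (u\<^sup>2))" by simp
  have "W (- 1) = Y 1 \<otimes> X (- 1) \<otimes> Y 1" using W_lower_form[of "- 1"] by simp
  then have "W t \<otimes> W (- 1) \<otimes> W u = (W t \<otimes> Y 1) \<otimes> X (- 1) \<otimes> (Y 1 \<otimes> W u)"
    using assms u by (simp add: E.m_assoc)
  also have "\<dots> = X (- (t\<^sup>2)) \<otimes> W t \<otimes> X (- 1) \<otimes> (W u \<otimes> X (- (u\<^sup>2)))"
    using assms u WY[of 1 t] YW by simp
  also have "\<dots> = (X (- (t\<^sup>2)) \<otimes> X t) \<otimes> Y (- (1 / t)) \<otimes> (X t \<otimes> (X (- 1) \<otimes> X u)) \<otimes> Y (- (1 / u)) \<otimes> (X u \<otimes> X (- (u\<^sup>2)))"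
    using assms u by (simp add: W_def[of t] W_def[of u] E.m_assoc)
  also have "X t \<otimes> (X (- 1) \<otimes> X u) = \<one>" using assms u by (simp add: X_add) (simp add: u_def)
  also have "X (- (t\<^sup>2)) \<otimes> X t = X (t * u)" using assms u by (simp add: X_add) (simp add: u_def power2_eq_square algebra_simps)
  also have "X u \<otimes> X (- (u\<^sup>2)) = X (t * u)" using assms u by (simp add: X_add) (simp add: u_def power2_eq_square algebra_simps)
  also have "X (t * u) \<otimes> Y (- (1 / t)) \<otimes> \<one> \<otimes> Y (- (1 / u)) \<otimes> X (t * u)
      = X (t * u) \<otimes> (Y (- (1 / t)) \<otimes> Y (- (1 / u))) \<otimes> X (t * u)"
    using assms u by (simp add: E.m_assoc)
  also have "Y (- (1 / t)) \<otimes> Y (- (1 / u)) = Y (- (1 / (t * u)))"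
  proof -
    have "- (1 / t) + - (1 / u) = - ((u + t) / (t * u))" using assms u by (simp add: field_simps)
    also have "u + t = 1" by (simp add: u_def)
    finally show ?thesis using assms u by (simp add: Y_add)
  qed
  finally show ?thesis by (simp add: W_def u_def)
qed

text \<open>Symbols over a finite field are trivial. If t or u is a square, \<open>H_square\<close>
  applies; otherwise t and u are n and 1 - n up to squares, for one fixed n, and the Steinberg
  relation applies.\<close>

lemma H_mult:
  assumes t: "t \<in> \<int>" "t \<noteq> 0" and u: "u \<in> \<int>" "u \<noteq> 0"
  shows "H t \<otimes> H u = H (t * u)"
proof -
  obtain n :: 'k where n: "n \<in> \<int>" "n \<noteq> 0" "1 - n \<noteq> 0"
    "\<And>t. t \<in> \<int> \<Longrightarrow> t \<noteq> 0 \<Longrightarrow> (\<exists>a\<in>\<int>. t = a\<^sup>2) \<or> (\<exists>a\<in>\<int>. t = n * a\<^sup>2)"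
    "\<And>t. t \<in> \<int> \<Longrightarrow> t \<noteq> 0 \<Longrightarrow> (\<exists>a\<in>\<int>. t = a\<^sup>2) \<or> (\<exists>a\<in>\<int>. t = (1 - n) * a\<^sup>2)"
    using nonsquare_pair[OF p char p_odd] by blast
  consider (sq1) a where "a \<in> \<int>" "t = a\<^sup>2" | (sq2) a where "a \<in> \<int>" "u = a\<^sup>2"
    | (ns) a b where "a \<in> \<int>" "t = n * a\<^sup>2" "b \<in> \<int>" "u = (1 - n) * b\<^sup>2"
    using n(4)[OF t] n(5)[OF u] by blast
  then show ?thesis
  proof cases
    case sq1
    then have "a \<noteq> 0" using t by auto
    then show ?thesis using sq1 H_square[OF u, of a] H_commute[OF t u] by simp
  next
    case sq2
    then have "a \<noteq> 0" using u by auto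
    then show ?thesis using sq2 H_square[OF t, of a] by (simp add: mult.commute)
  next
    case ns
    have ab: "a \<noteq> 0" "b \<noteq> 0" using ns t u by auto
    have nI: "1 - n \<in> \<int>" using n by simp
    have st: "H n \<otimes> H (1 - n) = H (n * (1 - n))"
    proof -
      have "H n \<otimes> H (1 - n) = (W n \<otimes> W (- 1) \<otimes> W (1 - n)) \<otimes> W (- 1)"
        using n nI by (simp add: H_def E.m_assoc)
      then show ?thesis using W_steinberg n by (simp add: H_def)
    qed
    have Ht: "H t = H n \<otimes> H (a\<^sup>2)" using H_square[of n a] ns ab n by (simp add: mult.commute)
    have Hu: "H u = H (1 - n) \<otimes> H (b\<^sup>2)" using H_square[of "1 - n" b] ns ab n nI by (simp add: mult.commute)
    have "H t \<otimes> H u = H n \<otimes> (H (a\<^sup>2) \<otimes> H (1 - n)) \<otimes> H (b\<^sup>2)"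
      unfolding Ht Hu using n nI ns by (simp add: E.m_assoc)
    also have "H (a\<^sup>2) \<otimes> H (1 - n) = H (1 - n) \<otimes> H (a\<^sup>2)" using n nI ns ab by (intro H_commute) auto
    also have "H n \<otimes> (H (1 - n) \<otimes> H (a\<^sup>2)) \<otimes> H (b\<^sup>2) = (H n \<otimes> H (1 - n)) \<otimes> H (a\<^sup>2) \<otimes> H (b\<^sup>2)"
      using n nI ns by (simp add: E.m_assoc)
    also have "\<dots> = H (b\<^sup>2 * (a\<^sup>2 * (n * (1 - n))))"
      unfolding st using n nI ns ab by (simp add: H_square)
    also have "b\<^sup>2 * (a\<^sup>2 * (n * (1 - n))) = t * u" unfolding ns(2,4) by (simp only: mult_ac)
    finally show ?thesis .
  qed
qed

lemma WW: "t \<in> \<int> \<Longrightarrow> t \<noteq> 0 \<Longrightarrow> W 1 \<otimes> W t = W (1 / t) \<otimes> W 1"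
proof -
  assume t: "t \<in> \<int>" "t \<noteq> 0"
  have "W 1 \<otimes> W t = (W 1 \<otimes> X t) \<otimes> Y (- (1 / t)) \<otimes> X t" using t by (simp add: W_def[of t] E.m_assoc)
  also have "\<dots> = Y (- t) \<otimes> (W 1 \<otimes> Y (- (1 / t))) \<otimes> X t" using t WX[of t 1] by (simp add: E.m_assoc)
  also have "\<dots> = Y (- t) \<otimes> X (1 / t) \<otimes> (W 1 \<otimes> X t)" using t WY[of "- (1 / t)" 1] by (simp add: E.m_assoc)
  also have "\<dots> = Y (- t) \<otimes> X (1 / t) \<otimes> Y (- t) \<otimes> W 1" using t WX[of t 1] by (simp add: E.m_assoc)
  also have "Y (- t) \<otimes> X (1 / t) \<otimes> Y (- t) = W (1 / t)" using W_lower_form[of "1 / t"] t by simp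
  finally show ?thesis .
qed

lemma W_eq_HW: "t \<in> \<int> \<Longrightarrow> W t = H t \<otimes> W 1"
  using W_cancel(2)[of 1] by (simp add: H_def E.m_assoc)

lemma WH: "u \<in> \<int> \<Longrightarrow> u \<noteq> 0 \<Longrightarrow> W 1 \<otimes> H u = H (1 / u) \<otimes> W 1"
proof -
  assume u: "u \<in> \<int>" "u \<noteq> 0"
  have "W 1 \<otimes> H u = W (1 / u) \<otimes> (W 1 \<otimes> W (- 1))" using u WW[of u] by (simp add: H_def E.m_assoc[symmetric])
  then show ?thesis using u W_cancel(1)[of 1] W_eq_HW[of "1 / u"] by simp
qed

lemma W1_square: "W 1 \<otimes> W 1 = H (- 1)"
proof -
  have "H (- 1) \<otimes> H (- 1) = \<one>" using H_mult[of "- 1" "- 1"] H_1 by simp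
  moreover have "H (- 1) \<otimes> (W 1 \<otimes> W 1) = W (- 1) \<otimes> (W (- 1) \<otimes> W 1) \<otimes> W 1" by (simp add: H_def E.m_assoc)
  then have "H (- 1) \<otimes> (W 1 \<otimes> W 1) = \<one>" using W_cancel(2)[of 1] by simp
  ultimately have "H (- 1) \<otimes> (W 1 \<otimes> W 1) = H (- 1) \<otimes> H (- 1)" by simp
  then show ?thesis by simp
qed

text \<open>The two Bruhat cells: \<open>small\<close> parametrises the lifted upper triangular
  subgroup of SL_2, \<open>big\<close> the double coset of the Weyl element.\<close>

definition small :: "'k \<Rightarrow> 'k \<Rightarrow> 'e" where "small s t = X s \<otimes> H t"
definition big :: "'k \<Rightarrow> 'k \<Rightarrow> 'k \<Rightarrow> 'e" where "big s t r = X s \<otimes> H t \<otimes> W 1 \<otimes> X r"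

text \<open>The Bruhat decomposition of the lift of \<open>SL\<^sub>2(p)\<close>.\<close>
definition SL :: "'e set" where
  "SL = {small s t |s t. s \<in> \<int> \<and> t \<in> \<int> \<and> t \<noteq> 0} \<union>
        {big s t r |s t r. s \<in> \<int> \<and> t \<in> \<int> \<and> t \<noteq> 0 \<and> r \<in> \<int>}"

lemma smallI: "s \<in> \<int> \<Longrightarrow> t \<in> \<int> \<Longrightarrow> t \<noteq> 0 \<Longrightarrow> small s t \<in> SL"
  and bigI: "s \<in> \<int> \<Longrightarrow> t \<in> \<int> \<Longrightarrow> t \<noteq> 0 \<Longrightarrow> r \<in> \<int> \<Longrightarrow> big s t r \<in> SL"
  unfolding SL_def by blast+

lemma SL_cases:
  assumes "e \<in> SL"
  obtains (small) s t where "s \<in> \<int>" "t \<in> \<int>" "t \<noteq> 0" "e = small s t"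
    | (big) s t r where "s \<in> \<int>" "t \<in> \<int>" "t \<noteq> 0" "r \<in> \<int>" "e = big s t r"
  using assms unfolding SL_def by blast

lemma small_big [simp]:
  "s \<in> \<int> \<Longrightarrow> t \<in> \<int> \<Longrightarrow> small s t \<in> carrier E"
  "s \<in> \<int> \<Longrightarrow> t \<in> \<int> \<Longrightarrow> r \<in> \<int> \<Longrightarrow> big s t r \<in> carrier E"
  "s \<in> \<int> \<Longrightarrow> t \<in> \<int> \<Longrightarrow> t \<noteq> 0 \<Longrightarrow> mat (small s t) = M2 t (s / t) 0 (1 / t)"
  "s \<in> \<int> \<Longrightarrow> t \<in> \<int> \<Longrightarrow> t \<noteq> 0 \<Longrightarrow> r \<in> \<int> \<Longrightarrow> mat (big s t r) = M2 (- (s / t)) (t - s * r / t) (- (1 / t)) (- (r / t))"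
  by (simp_all add: small_def big_def mat_mult)

lemma SL_carrier: "e \<in> SL \<Longrightarrow> e \<in> carrier E"
  by (auto elim: SL_cases)

context
  fixes s t :: 'k
  assumes s [simp]: "s \<in> \<int>" and t [simp]: "t \<in> \<int>" "t \<noteq> 0"
begin

lemma small_X: "r \<in> \<int> \<Longrightarrow> small s t \<otimes> X r = small (s + t\<^sup>2 * r) t"
  using HX[of r t] by (simp add: small_def E.m_assoc X_add')

lemma small_H: "u \<in> \<int> \<Longrightarrow> u \<noteq> 0 \<Longrightarrow> small s t \<otimes> H u = small s (t * u)"
  by (simp add: small_def E.m_assoc H_mult)

lemma small_W: "small s t \<otimes> W 1 = big s t 0"
  by (simp add: small_def big_def)

lemma big_X: "r \<in> \<int> \<Longrightarrow> r' \<in> \<int> \<Longrightarrow> big s t r \<otimes> X r' = big s t (r + r')"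
  by (simp add: big_def E.m_assoc X_add)

lemma big_H:
  assumes "r \<in> \<int>" "u \<in> \<int>" "u \<noteq> 0"
  shows "big s t r \<otimes> H u = big s (t / u) (r / u\<^sup>2)"
proof -
  have "X r \<otimes> H u = H u \<otimes> X (r / u\<^sup>2)" using HX[of "r / u\<^sup>2" u] assms by simp
  then have "big s t r \<otimes> H u = X s \<otimes> H t \<otimes> (W 1 \<otimes> H u) \<otimes> X (r / u\<^sup>2)"
    using assms by (simp add: big_def E.m_assoc)
  also have "\<dots> = X s \<otimes> (H t \<otimes> H (1 / u)) \<otimes> W 1 \<otimes> X (r / u\<^sup>2)" using assms by (simp add: WH E.m_assoc)
  also have "H t \<otimes> H (1 / u) = H (t / u)" using assms H_mult[of t "1 / u"] by simp
  finally show ?thesis using assms by (simp add: big_def)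
qed

lemma small_big_mult:
  assumes "a \<in> \<int>" "b \<in> \<int>" "b \<noteq> 0" "c \<in> \<int>"
  shows "small s t \<otimes> big a b c = big (s + t\<^sup>2 * a) (t * b) c"
proof -
  have "small s t \<otimes> big a b c = (small s t \<otimes> X a \<otimes> H b) \<otimes> W 1 \<otimes> X c"
    using assms by (simp add: big_def E.m_assoc)
  also have "small s t \<otimes> X a \<otimes> H b = small (s + t\<^sup>2 * a) t \<otimes> H b" using assms by (simp add: small_X)
  also have "\<dots> = X (s + t\<^sup>2 * a) \<otimes> H (t * b)" using assms by (simp add: small_def E.m_assoc H_mult)
  finally show ?thesis by (simp add: big_def)
qed

text \<open>For r = 0 the product drops into the small cell. For r \<noteq> 0 the inner part
  \<open>W 1 \<otimes> X r \<otimes> W 1\<close> is expressed through \<open>Y (- r)\<close>, and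
  solving the definition of \<open>W (1 / r)\<close> for that letter puts it into the big
  cell.\<close>

lemma big_W:
  assumes "r \<in> \<int>" shows "big s t r \<otimes> W 1 \<in> SL"
proof (cases "r = 0")
  case True
  have "big s t r \<otimes> W 1 = X s \<otimes> H t \<otimes> (W 1 \<otimes> W 1)" using True by (simp add: big_def E.m_assoc)
  also have "\<dots> = small s t \<otimes> H (- 1)" by (simp add: W1_square small_def)
  also have "\<dots> = small s (- t)" using small_H[of "- 1"] by simp
  finally show ?thesis by (simp add: smallI)
next
  case False
  have "W (1 / r) = X (1 / r) \<otimes> Y (- r) \<otimes> X (1 / r)" by (simp add: W_def)
  then have "X (- (1 / r)) \<otimes> W (1 / r) \<otimes> X (- (1 / r)) = Y (- r)"
    using assms by (simp add: E.m_assoc X_add) (simp add: X_add')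
  then have Y: "Y (- r) = X (- (1 / r)) \<otimes> H (1 / r) \<otimes> W 1 \<otimes> X (- (1 / r))"
    using assms by (simp add: W_eq_HW[of "1 / r"] E.m_assoc)
  have "W 1 \<otimes> X r \<otimes> W 1 = Y (- r) \<otimes> (W 1 \<otimes> W 1)" using WX[of r 1] assms by (simp add: E.m_assoc)
  also have "\<dots> = big (- (1 / r)) (1 / r) (- (1 / r)) \<otimes> H (- 1)"
    using assms by (simp add: W1_square Y big_def)
  also have "\<dots> = big (- (1 / r)) (- (1 / r)) (- (1 / r))"
    using sl2_extension.big_H[OF sl2_extension_axioms, of "- (1 / r)" "1 / r" "- (1 / r)" "- 1"] assms False by simp
  finally have "big s t r \<otimes> W 1 = small s t \<otimes> big (- (1 / r)) (- (1 / r)) (- (1 / r))"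
    using assms by (simp add: big_def[of s t r] small_def E.m_assoc)
  then show ?thesis using assms False by (simp add: small_big_mult bigI)
qed

end

lemma SL_X: "e \<in> SL \<Longrightarrow> r \<in> \<int> \<Longrightarrow> e \<otimes> X r \<in> SL"
  by (erule SL_cases) (simp_all add: small_X big_X smallI bigI)

lemma SL_H: "e \<in> SL \<Longrightarrow> u \<in> \<int> \<Longrightarrow> u \<noteq> 0 \<Longrightarrow> e \<otimes> H u \<in> SL"
  by (erule SL_cases) (simp_all add: small_H big_H smallI bigI)

lemma SL_W: "e \<in> SL \<Longrightarrow> e \<otimes> W 1 \<in> SL"
  by (erule SL_cases) (simp_all add: small_W big_W smallI bigI)

lemma SL_one: "\<one> \<in> SL"
  using smallI[of 0 1] by (simp add: small_def H_1)

lemma H_inv: "t \<in> \<int> \<Longrightarrow> t \<noteq> 0 \<Longrightarrow> inv (H t) = H (1 / t)"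
  by (rule E.inv_equality) (simp_all add: H_mult H_1)

text \<open>Every normal form is a product of values of X and H and the element \<open>W 1\<close>,
  and the set of normal forms is stable under right multiplication by these.\<close>

lemma SL_subgroup: "subgroup SL E"
proof (rule E.subgroupI)
  show "SL \<subseteq> carrier E" using SL_carrier by blast
  show "SL \<noteq> {}" using SL_one by blast
next
  fix a b assume "a \<in> SL" "b \<in> SL"
  note a = \<open>a \<in> SL\<close> SL_carrier[OF \<open>a \<in> SL\<close>]
  from \<open>b \<in> SL\<close> show "a \<otimes> b \<in> SL"
  proof (cases rule: SL_cases)
    case (small s t)
    then have "a \<otimes> b = a \<otimes> X s \<otimes> H t" using a by (simp add: small_def E.m_assoc)
    then show ?thesis using a small by (simp add: SL_X SL_H)
  next
    case (big s t r)
    then have "a \<otimes> b = a \<otimes> X s \<otimes> H t \<otimes> W 1 \<otimes> X r" using a by (simp add: big_def E.m_assoc)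
    then show ?thesis using a big by (simp add: SL_X SL_H SL_W)
  qed
next
  fix a assume "a \<in> SL"
  then show "inv a \<in> SL"
  proof (cases rule: SL_cases)
    case (small s t)
    then have "inv a = \<one> \<otimes> H (1 / t) \<otimes> X (- s)" by (simp add: small_def E.inv_mult_group H_inv X_inv)
    then show ?thesis using small SL_one by (simp only: SL_X SL_H Ints_div Ints_minus Ints_1 divide_eq_0_iff one_neq_zero simp_thms)
  next
    case (big s t r)
    have "inv (W 1) = W (- 1)" by (simp add: W_inv)
    also have "\<dots> = H (- 1) \<otimes> W 1" by (simp add: W_eq_HW[of "- 1"])
    finally have "inv a = \<one> \<otimes> X (- r) \<otimes> H (- 1) \<otimes> W 1 \<otimes> H (1 / t) \<otimes> X (- s)"
      using big by (simp add: big_def E.inv_mult_group H_inv X_inv E.m_assoc)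
    moreover have "\<one> \<otimes> X (- r) \<otimes> H (- 1) \<otimes> W 1 \<otimes> H (1 / t) \<otimes> X (- s) \<in> SL"
      using big SL_one by (intro SL_X SL_H SL_W) simp_all
    ultimately show ?thesis by simp
  qed
qed

text \<open>The matrix decides: a big element has a nonzero lower left entry, and a small one over
  the identity has s = 0 and t = 1.\<close>

lemma SL_split: "split_lift SL"
  unfolding split_lift_def
proof (intro conjI SL_subgroup ballI impI)
  fix e assume e: "e \<in> SL" "\<pi> e = \<one>\<^bsub>A\<^esub>"
  then have m: "mat e = M2 1 0 0 1" by (simp add: mat_def \<rho>_one)
  from e(1) show "e = \<one>"
  proof (cases rule: SL_cases)
    case (small s t)
    then have "t = 1" "s = 0" using m by auto
    then show ?thesis using small by (simp add: small_def H_1)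
  qed (use m in auto)
qed

lemma SL_det: "e \<in> SL \<Longrightarrow> mdet (mat e) = 1"
  by (erule SL_cases) (simp_all add: field_simps)

text \<open>Bruhat decomposition of a matrix: its lower left entry selects the cell, and the
  parameters are solved from the entries.\<close>

lemma SL_surj:
  assumes "m2_Ints m" "mdet m = 1"
  obtains e where "e \<in> SL" "mat e = m"
proof -
  obtain a b c d where m: "m = M2 a b c d" by (cases m)
  have I: "a \<in> \<int>" "b \<in> \<int>" "c \<in> \<int>" "d \<in> \<int>" and det: "a * d - b * c = 1" using assms m by auto
  show ?thesis
  proof (cases "c = 0")
    case True
    then have "a * d = 1" using det by simp
    moreover from this have "a \<noteq> 0" by auto
    ultimately have a: "a \<noteq> 0" "d = 1 / a" by (auto simp: nonzero_eq_divide_eq mult.commute)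
    then have "mat (small (a * b) a) = m" using I m True by simp
    moreover have "small (a * b) a \<in> SL" using a I by (intro smallI) auto
    ultimately show ?thesis using that by blast
  next
    case False
    have "b = (a * d - 1) / c" using det False by (simp add: field_simps)
    then have "mat (big (a / c) (- (1 / c)) (d / c)) = m"
      using I m False by (simp add: field_simps)
    moreover have "big (a / c) (- (1 / c)) (d / c) \<in> SL" using False I by (intro bigI) auto
    ultimately show ?thesis using that by blast
  qed
qed

text \<open>The image of \<rho> lies between SL_2 and GL_2 of the prime field and is generated by
  SL_2 and one matrix diag(1, g^n0). A lift D of that matrix with the same order normalises the
  lifted SL_2, so the splitting extends over the cyclic quotient.\<close>

theorem sl2_splits: "splits (carrier A)"
proof -
  obtain g :: 'k where g: "g \<in> \<int>" "g \<noteq> 0" "\<And>a. a \<in> \<int> \<Longrightarrow> a \<noteq> 0 \<Longrightarrow> \<exists>n. a = g ^ n"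
    "\<And>n. g ^ n = 1 \<longleftrightarrow> (p - 1) dvd n"
    using Ints_primitive_root[OF p char] by metis
  \<comment> \<open>The exponents n with diag(1, g^n) in the image include p - 1, where the matrix
    is the identity; the least positive one, n0, divides all of them.\<close>
  let ?Q = "\<lambda>n. n > 0 \<and> M2 1 0 0 (g ^ n) \<in> \<rho> ` carrier A"
  have p1: "p - 1 > 0" using prime_gt_1_nat[OF p] by simp
  have "?Q (p - 1)" using p1 g(4)[of "p - 1"] \<rho>_one by (metis A.one_closed dvd_refl image_eqI)
  define n0 where "n0 = (LEAST n. ?Q n)"
  have n0: "?Q n0" unfolding n0_def by (rule LeastI[of ?Q, OF \<open>?Q (p - 1)\<close>])
  have n0_min: "n0 \<le> n" if "?Q n" for n unfolding n0_def by (rule Least_le[of ?Q, OF that])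
  obtain d where d: "d \<in> carrier A" "\<rho> d = M2 1 0 0 (g ^ n0)" using n0 by force
  have dpow: "\<rho> (d [^]\<^bsub>A\<^esub> k) = M2 1 0 0 (g ^ (n0 * k))" for k :: nat
    using \<rho>_pow_diag[OF d, of k] by (simp add: power_mult)
  have dvd: "n0 dvd n" if "M2 1 0 0 (g ^ n) \<in> \<rho> ` carrier A" for n
  proof -
    from that obtain x where x: "x \<in> carrier A" "\<rho> x = M2 1 0 0 (g ^ n)" by auto
    let ?y = "x \<otimes>\<^bsub>A\<^esub> inv\<^bsub>A\<^esub> (d [^]\<^bsub>A\<^esub> (n div n0))"
    have "?y \<otimes>\<^bsub>A\<^esub> d [^]\<^bsub>A\<^esub> (n div n0) = x" using x d by (simp add: A.m_assoc)
    then have "\<rho> ?y \<star> \<rho> (d [^]\<^bsub>A\<^esub> (n div n0)) = M2 1 0 0 (g ^ n)"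
      using x d by (metis A.inv_closed A.m_closed A.nat_pow_closed \<rho>_mult)
    then have *: "\<rho> ?y \<star> M2 1 0 0 (g ^ (n0 * (n div n0))) = M2 1 0 0 (g ^ n)" by (simp add: dpow)
    have gn: "g ^ n = g ^ (n mod n0) * g ^ (n0 * (n div n0))" by (metis mod_mult_div_eq power_add)
    have "\<rho> ?y = M2 1 0 0 (g ^ (n mod n0))"
      using * g(2) unfolding gn by (cases "\<rho> ?y") auto
    moreover have "?y \<in> carrier A" using x d by simp
    ultimately have "M2 1 0 0 (g ^ (n mod n0)) \<in> \<rho> ` carrier A" by (metis image_eqI)
    moreover have "n mod n0 < n0" using n0 by simp
    ultimately have "n mod n0 = 0" using n0_min[of "n mod n0"] by linarith
    then show ?thesis by blast
  qed
  then have "n0 dvd p - 1" using \<open>?Q (p - 1)\<close> by blast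
  then obtain n where n: "p - 1 = n0 * n" by blast
  have "n > 0" using n p1 by (metis gr0I mult_0_right)
  have "\<rho> (d [^]\<^bsub>A\<^esub> n) = \<rho> \<one>\<^bsub>A\<^esub>" using dpow[of n] g(4)[of "n0 * n"] n by (simp add: \<rho>_one)
  then have "d [^]\<^bsub>A\<^esub> n = \<one>\<^bsub>A\<^esub>" using d by (intro \<rho>_eq) auto
  then obtain D where D: "D \<in> carrier E" "\<pi> D = d" "D [^] n = \<one>" using lift_of_order d \<open>n > 0\<close> by blast
  define \<delta> where "\<delta> = g ^ n0"
  have \<delta> [simp]: "\<delta> \<in> \<int>" "\<delta> \<noteq> 0" using g by (auto simp: \<delta>_def)
  have mD: "mat D = M2 1 0 0 \<delta>" using D d by (simp add: mat_def \<delta>_def)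
  have DX: "D \<otimes> X s = X (s / \<delta>) \<otimes> D" if "s \<in> \<int>" for s
    unfolding X_def using that D mD by (intro plift_conj) simp_all
  have DY: "D \<otimes> Y s = Y (s * \<delta>) \<otimes> D" if "s \<in> \<int>" for s
    unfolding Y_def using that D mD by (intro plift_conj) simp_all
  have DW: "D \<otimes> W t = W (t / \<delta>) \<otimes> D" if "t \<in> \<int>" for t
    using that D by (intro conj_W) (simp_all add: DX DY)
  \<comment> \<open>Conjugation by D divides the parameters of both factors W by \<delta>; the
    common factor cancels because H is multiplicative.\<close>
  have DH: "D \<otimes> H t = H t \<otimes> D" if t: "t \<in> \<int>" "t \<noteq> 0" for t
  proof -
    have "D \<otimes> H t = (D \<otimes> W t) \<otimes> W (- 1)" using D t by (simp add: H_def E.m_assoc)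
    also have "\<dots> = W (t / \<delta>) \<otimes> (D \<otimes> W (- 1))" using D t by (simp add: DW E.m_assoc)
    also have "\<dots> = W (t / \<delta>) \<otimes> W (- (1 / \<delta>)) \<otimes> D" using D t by (simp add: DW E.m_assoc)
    also have "W (t / \<delta>) \<otimes> W (- (1 / \<delta>)) = H (t / \<delta>) \<otimes> inv (H (1 / \<delta>))"
    proof -
      have "inv (H (1 / \<delta>)) = W 1 \<otimes> W (- (1 / \<delta>))" by (simp add: H_def E.inv_mult_group W_inv)
      then show ?thesis using t by (simp add: W_eq_HW[of "t / \<delta>"] E.m_assoc)
    qed
    also have "\<dots> = H (t / \<delta>) \<otimes> H \<delta>" by (simp add: H_inv)
    also have "\<dots> = H t" using t by (simp add: H_mult)
    finally show ?thesis .
  qed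
  have norm: "D \<otimes> e \<otimes> inv D \<in> SL" if "e \<in> SL" for e
    using that
  proof (cases rule: SL_cases)
    case (small s t)
    have "D \<otimes> e = (D \<otimes> X s) \<otimes> H t" using D small by (simp add: small_def E.m_assoc)
    also have "\<dots> = X (s / \<delta>) \<otimes> (D \<otimes> H t)" using D small by (simp add: DX E.m_assoc)
    also have "\<dots> = small (s / \<delta>) t \<otimes> D" using D small by (simp add: DH small_def E.m_assoc)
    finally show ?thesis using D small by (simp add: E.m_assoc smallI)
  next
    case (big s t r)
    have "D \<otimes> e = (D \<otimes> X s) \<otimes> H t \<otimes> W 1 \<otimes> X r" using D big by (simp add: big_def E.m_assoc)
    also have "\<dots> = X (s / \<delta>) \<otimes> (D \<otimes> H t) \<otimes> W 1 \<otimes> X r" using D big by (simp add: DX E.m_assoc)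
    also have "\<dots> = X (s / \<delta>) \<otimes> H t \<otimes> (D \<otimes> W 1) \<otimes> X r" using D big by (simp add: DH E.m_assoc)
    also have "\<dots> = X (s / \<delta>) \<otimes> H t \<otimes> W (1 / \<delta>) \<otimes> (D \<otimes> X r)" using D big by (simp add: DW E.m_assoc)
    also have "\<dots> = X (s / \<delta>) \<otimes> (H t \<otimes> H (1 / \<delta>)) \<otimes> W 1 \<otimes> X (r / \<delta>) \<otimes> D"
      using D big by (simp add: DX E.m_assoc W_eq_HW[of "1 / \<delta>"])
    also have "H t \<otimes> H (1 / \<delta>) = H (t / \<delta>)" using big by (simp add: H_mult)
    also have "X (s / \<delta>) \<otimes> H (t / \<delta>) \<otimes> W 1 \<otimes> X (r / \<delta>) \<otimes> D = big (s / \<delta>) (t / \<delta>) (r / \<delta>) \<otimes> D" by (simp add: big_def)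
    finally show ?thesis using D big by (simp add: E.m_assoc bigI)
  qed
  have "split_lift {s \<otimes> D [^] i |s (i::nat). s \<in> SL}" (is "split_lift ?T")
  proof (rule split_lift_cyclic_extension[OF SL_split D(1) \<open>n > 0\<close> norm])
    show "D [^] n \<in> SL" using D SL_one by simp
    fix i assume i: "0 < i" "i < n"
    show "\<pi> (D [^] i) \<notin> \<pi> ` SL"
    proof
      assume "\<pi> (D [^] i) \<in> \<pi> ` SL"
      then obtain e where "e \<in> SL" "\<pi> (D [^] i) = \<pi> e" by blast
      then have "mdet (mat (D [^] i)) = 1" using SL_det[of e] by (simp add: mat_def)
      then have "g ^ (n0 * i) = 1" using dpow[of i] D by (simp add: mat_def \<pi>.hom_nat_pow)
      then have "n0 * n dvd n0 * i" using g(4)[of "n0 * i"] n by simp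
      then show False using i n0 by (simp add: nat_dvd_not_less)
    qed
  qed
  moreover have "\<pi> ` ?T = carrier A"
  proof (intro equalityI subsetI)
    fix a assume "a \<in> \<pi> ` ?T" then show "a \<in> carrier A" using D SL_carrier by auto
  next
    fix a assume a: "a \<in> carrier A"
    define \<epsilon> where "\<epsilon> = mdet (\<rho> a)"
    have e: "\<epsilon> \<in> \<int>" "\<epsilon> \<noteq> 0" using \<rho>_Ints[OF a] \<rho>_det_nz[OF a] unfolding \<epsilon>_def by (cases "\<rho> a"; simp)+
    \<comment> \<open>Dividing the second column by the determinant leaves a matrix of SL_2. The
      remaining factor diag(1, \<epsilon>) is again in the image of \<rho>, hence is matched by a
      power of D.\<close>
    let ?m = "\<rho> a \<star> M2 1 0 0 (1 / \<epsilon>)"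
    have "m2_Ints ?m" using \<rho>_Ints[OF a] e by (cases "\<rho> a") simp
    moreover have "mdet ?m = 1" using e by (simp add: mdet_mult \<epsilon>_def[symmetric])
    ultimately obtain s where s: "s \<in> SL" "mat s = ?m" by (rule SL_surj)
    have sc: "s \<in> carrier E" using s SL_carrier by blast
    have as: "\<rho> a = mat s \<star> M2 1 0 0 \<epsilon>" using s e by (simp add: mtimes_assoc mtimes_one)
    have "\<rho> (inv\<^bsub>A\<^esub> (\<pi> s) \<otimes>\<^bsub>A\<^esub> a) = \<rho> (inv\<^bsub>A\<^esub> (\<pi> s)) \<star> mat s \<star> M2 1 0 0 \<epsilon>"
      using a sc by (simp add: \<rho>_mult as mtimes_assoc)
    also have "\<rho> (inv\<^bsub>A\<^esub> (\<pi> s)) \<star> mat s = M2 1 0 0 1"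
      using sc by (simp add: mat_def \<rho>_mult[symmetric] \<rho>_one)
    finally have "M2 1 0 0 \<epsilon> \<in> \<rho> ` carrier A" using a sc
      by (metis A.inv_closed A.m_closed \<pi>.hom_closed image_eqI mtimes_one(2))
    moreover obtain m where m: "\<epsilon> = g ^ m" using g e by blast
    ultimately obtain q where q: "m = n0 * q" using dvd by blast
    have "\<pi> (s \<otimes> D [^] q) = a"
      using sc D d(1) a as m q dpow[of q] by (intro \<rho>_eq) (simp_all add: \<rho>_mult mat_def \<pi>.hom_nat_pow)
    then show "a \<in> \<pi> ` ?T" using s by blast
  qed
  ultimately show ?thesis unfolding splits_iff by blast
qed

end

section \<open>Commutants and eigenvectors\<close>

fun mneg :: "'k::field m2 \<Rightarrow> 'k m2" where "mneg (M2 a b c d) = M2 (- a) (- b) (- c) (- d)"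

fun mscalar :: "'k::field m2 \<Rightarrow> bool" where "mscalar (M2 a b c d) \<longleftrightarrow> a = d \<and> b = 0 \<and> c = 0"

fun mvec :: "'k::field m2 \<Rightarrow> 'k \<times> 'k \<Rightarrow> 'k \<times> 'k" where
  "mvec (M2 a b c d) (x, y) = (a * x + b * y, c * x + d * y)"

lemma mvec_mult: "mvec (x \<star> y) v = mvec x (mvec y v)"
  by (cases x; cases y; cases v) (simp add: algebra_simps)

lemma mvec_one: "mvec (M2 1 0 0 1) v = v"
  by (cases v) simp

lemma mneg_mult: "mneg x \<star> y = mneg (x \<star> y)" "x \<star> mneg y = mneg (x \<star> y)"
  by (cases x; cases y; simp add: algebra_simps)+

lemma mscalar_commute: "mscalar x \<Longrightarrow> x \<star> y = y \<star> x"
  by (cases x; cases y) (simp add: algebra_simps)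

lemma diff_eq_mult_diff: "x - y = b * (c - d) \<Longrightarrow> y = (x - b * c) + b * (d::'k::field)"
  by (simp add: algebra_simps)

text \<open>The commutant of a nonscalar matrix of size two consists of the polynomials in it. The
  coefficient \<beta> is read off from whichever of c2, c3 and c1 - c4 is nonzero.\<close>

lemma commutant_span:
  fixes c1 :: "'k::field"
  assumes ns: "\<not> mscalar (M2 c1 c2 c3 c4)"
    and com: "M2 x1 x2 x3 x4 \<star> M2 c1 c2 c3 c4 = M2 c1 c2 c3 c4 \<star> M2 x1 x2 x3 x4"
  obtains \<alpha> \<beta> where "x1 = \<alpha> + \<beta> * c1" "x2 = \<beta> * c2" "x3 = \<beta> * c3" "x4 = \<alpha> + \<beta> * c4"
    "\<beta> = x2 / c2 \<or> \<beta> = x3 / c3 \<or> \<beta> = (x1 - x4) / (c1 - c4)"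
proof -
  have X: "x1 * c1 + x2 * c3 = c1 * x1 + c2 * x3" "x1 * c2 + x2 * c4 = c1 * x2 + c2 * x4"
    "x3 * c1 + x4 * c3 = c3 * x1 + c4 * x3"
    using com by (simp_all only: mtimes.simps m2.inject)
  have X1: "x2 * c3 = c2 * x3" using X(1) by (simp add: mult.commute)
  have X2: "c2 * (x1 - x4) = x2 * (c1 - c4)" using X(2) by (simp add: algebra_simps)
  have X3: "c3 * (x1 - x4) = x3 * (c1 - c4)" using X(3) by (simp add: algebra_simps)
  consider "c2 \<noteq> 0" | "c3 \<noteq> 0" | "c2 = 0" "c3 = 0" "c1 - c4 \<noteq> 0" using ns by auto
  then show ?thesis
  proof cases
    case 1
    have "x3 = x2 / c2 * c3" using X1 1 by (simp add: field_simps)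
    moreover have "x1 - x4 = x2 / c2 * (c1 - c4)" using X2 1 by (simp add: nonzero_eq_divide_eq mult.commute)
    then have "x4 = (x1 - x2 / c2 * c1) + x2 / c2 * c4" by (rule diff_eq_mult_diff)
    ultimately show ?thesis using that[of "x1 - x2 / c2 * c1" "x2 / c2"] 1 by simp
  next
    case 2
    have "x2 = x3 / c3 * c2" using X1 2 by (simp add: field_simps)
    moreover have "x1 - x4 = x3 / c3 * (c1 - c4)" using X3 2 by (simp add: nonzero_eq_divide_eq mult.commute)
    then have "x4 = (x1 - x3 / c3 * c1) + x3 / c3 * c4" by (rule diff_eq_mult_diff)
    ultimately show ?thesis using that[of "x1 - x3 / c3 * c1" "x3 / c3"] 2 by simp
  next
    case 3
    let ?b = "(x1 - x4) / (c1 - c4)"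
    have "x2 = 0" "x3 = 0" using X2 X3 3 by auto
    moreover have "x1 - x4 = ?b * (c1 - c4)" using 3 by simp
    then have "x4 = (x1 - ?b * c1) + ?b * c4" by (rule diff_eq_mult_diff)
    ultimately show ?thesis using that[of "x1 - ?b * c1" ?b] 3 by simp
  qed
qed

lemma commutant_commutative:
  assumes "\<not> mscalar c" "x \<star> c = c \<star> x" "y \<star> c = c \<star> y"
  shows "x \<star> y = y \<star> x"
proof -
  obtain c1 c2 c3 c4 where c: "c = M2 c1 c2 c3 c4" by (cases c)
  obtain x1 x2 x3 x4 where x: "x = M2 x1 x2 x3 x4" by (cases x)
  obtain y1 y2 y3 y4 where y: "y = M2 y1 y2 y3 y4" by (cases y)
  obtain \<alpha> \<beta> where X: "x1 = \<alpha> + \<beta> * c1" "x2 = \<beta> * c2" "x3 = \<beta> * c3" "x4 = \<alpha> + \<beta> * c4"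
    using commutant_span[of c1 c2 c3 c4 x1 x2 x3 x4] assms(1,2) unfolding c x by metis
  obtain \<gamma> \<delta> where Y: "y1 = \<gamma> + \<delta> * c1" "y2 = \<delta> * c2" "y3 = \<delta> * c3" "y4 = \<gamma> + \<delta> * c4"
    using commutant_span[of c1 c2 c3 c4 y1 y2 y3 y4] assms(1,3) unfolding c y by metis
  show ?thesis unfolding x y X Y mtimes.simps m2.inject by (simp add: algebra_simps)
qed

text \<open>An eigenspace of a nonscalar matrix of size two is a line, so everything that commutes
  with the matrix preserves it. The eigenvector may have coordinates outside the prime
  field.\<close>

lemma common_eigenvector:
  fixes c :: "'k::alg_closed_field m2"
  assumes "\<not> mscalar c"
  obtains v \<mu> where "v \<noteq> (0, 0)" "mvec c v = (\<mu> * fst v, \<mu> * snd v)"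
    "\<And>x. x \<star> c = c \<star> x \<Longrightarrow> \<exists>\<mu>. mvec x v = (\<mu> * fst v, \<mu> * snd v)"
proof -
  obtain a b e d where c: "c = M2 a b e d" by (cases c)
  let ?P = "[:a * d - b * e, - (a + d), 1:]"
  have "degree ?P > 0" by simp
  then obtain \<mu> where "poly ?P \<mu> = 0" using alg_closed_imp_poly_has_root by blast
  then have det: "(a - \<mu>) * (d - \<mu>) = b * e" by (simp add: algebra_simps)
  \<comment> \<open>v is annihilated by the first row of c - \<mu>, or by the second row when the
    first one is zero.\<close>
  define v where "v = (if a - \<mu> = 0 \<and> b = 0 then (d - \<mu>, - e) else (b, - (a - \<mu>)))"
  have v0: "v \<noteq> (0, 0)" using assms by (auto simp: v_def c)
  have ker: "mvec c w = (\<mu> * fst w, \<mu> * snd w) \<longleftrightarrow> (a - \<mu>) * fst w + b * snd w = 0 \<and> e * fst w + (d - \<mu>) * snd w = 0" for w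
    by (cases w) (auto simp: c algebra_simps)
  have kv: "mvec c v = (\<mu> * fst v, \<mu> * snd v)" unfolding ker v_def using det by (auto simp: algebra_simps)
  have one: "\<exists>\<nu>. w = (\<nu> * fst v, \<nu> * snd v)" if "mvec c w = (\<mu> * fst w, \<mu> * snd w)" for w
  proof -
    have w: "(a - \<mu>) * fst w + b * snd w = 0" "e * fst w + (d - \<mu>) * snd w = 0" using that ker by auto
    have cr: "fst w * snd v = snd w * fst v"
    proof (cases "a - \<mu> = 0 \<and> b = 0")
      case True
      then have vv: "v = (d - \<mu>, - e)" unfolding v_def by (rule if_P)
      show ?thesis unfolding vv fst_conv snd_conv using w(2) by (simp add: algebra_simps)
    next
      case False
      then have vv: "v = (b, - (a - \<mu>))" unfolding v_def by (rule if_not_P)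
      show ?thesis unfolding vv fst_conv snd_conv using w(1) by (simp add: algebra_simps)
    qed
    show ?thesis
    proof (cases "fst v = 0")
      case True
      then have "snd v \<noteq> 0" using v0 by (metis prod.collapse)
      then show ?thesis using cr True by (intro exI[of _ "snd w / snd v"]) (auto intro!: prod_eqI)
    next
      case False
      then show ?thesis using cr by (intro exI[of _ "fst w / fst v"]) (auto intro!: prod_eqI simp: field_simps)
    qed
  qed
  have "\<exists>\<nu>. mvec x v = (\<nu> * fst v, \<nu> * snd v)" if x: "x \<star> c = c \<star> x" for x
  proof (rule one)
    have lin: "mvec x (\<mu> * fst v, \<mu> * snd v) = (\<mu> * fst (mvec x v), \<mu> * snd (mvec x v))"
      by (cases x; cases v) (simp add: algebra_simps)
    have "mvec c (mvec x v) = mvec x (mvec c v)" using x by (simp flip: mvec_mult)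
    then show "mvec c (mvec x v) = (\<mu> * fst (mvec x v), \<mu> * snd (mvec x v))" using kv lin by simp
  qed
  then show ?thesis using that v0 kv by blast
qed

text \<open>Applying the adjugate of the matrix minus \<mu> to the eigenvector equation multiplies
  each coordinate of v by the characteristic polynomial at \<mu>.\<close>

lemma eigenvalue_char_poly:
  assumes "v \<noteq> (0, 0)" "mvec (M2 a b c d) v = (\<mu> * fst v, \<mu> * snd v)"
  shows "\<mu>\<^sup>2 - (a + d) * \<mu> + (a * d - b * c) = (0 :: 'k::field)"
proof -
  obtain x y where v: "v = (x, y)" by (cases v)
  have e: "a * x + b * y = \<mu> * x" "c * x + d * y = \<mu> * y" using assms v by auto
  have "(\<mu>\<^sup>2 - (a + d) * \<mu> + (a * d - b * c)) * x = (d - \<mu>) * (a * x + b * y - \<mu> * x) - b * (c * x + d * y - \<mu> * y)"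
    by (simp add: algebra_simps power2_eq_square)
  also have "\<dots> = 0" using e by simp
  finally have "(\<mu>\<^sup>2 - (a + d) * \<mu> + (a * d - b * c)) * x = 0" .
  moreover have "(\<mu>\<^sup>2 - (a + d) * \<mu> + (a * d - b * c)) * y = (a - \<mu>) * (c * x + d * y - \<mu> * y) - c * (a * x + b * y - \<mu> * x)"
    by (simp add: algebra_simps power2_eq_square)
  then have "(\<mu>\<^sup>2 - (a + d) * \<mu> + (a * d - b * c)) * y = 0" using e by simp
  ultimately show ?thesis using assms v by auto
qed

text \<open>If no element had order q^b, all q^b values of \<epsilon> would be roots of X^(q^(b-1))
  - 1. The order is delivered as a divisibility criterion, the form in which the splitting lemmas
  consume it.\<close>

lemma (in group) cyclic_if_embeds_in_field:
  fixes \<epsilon> :: "'a \<Rightarrow> 'k::field"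
  assumes Q: "subgroup Q G" and q: "prime (q::nat)" and card: "card Q = q ^ b"
    and mult: "\<And>x y. x \<in> Q \<Longrightarrow> y \<in> Q \<Longrightarrow> \<epsilon> (x \<otimes> y) = \<epsilon> x * \<epsilon> y"
    and inj: "inj_on \<epsilon> Q" and nz: "\<And>x. x \<in> Q \<Longrightarrow> \<epsilon> x \<noteq> 0"
  obtains d where "d \<in> Q" "Q = {d [^] i |i::nat. True}" "\<And>i::nat. d [^] i = \<one> \<longleftrightarrow> q ^ b dvd i"
proof -
  have fin: "finite Q" using card q by (metis card_gt_0_iff prime_gt_0_nat zero_less_power)
  have Qc: "x \<in> carrier G" if "x \<in> Q" for x using Q that by (rule subgroup.mem_carrier)
  have one: "\<one> \<in> Q" using Q by (rule subgroup.one_closed)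
  have e1: "\<epsilon> \<one> = 1" using mult[OF one one] nz[OF one] by simp
  have powQ: "x [^] (n::nat) \<in> Q" if "x \<in> Q" for x n
    by (induction n) (use that one subgroup.m_closed[OF Q] in auto)
  have epow: "\<epsilon> (x [^] (n::nat)) = \<epsilon> x ^ n" if "x \<in> Q" for x n
    by (induction n) (use that e1 mult powQ in auto)
  have Qord: "x [^] (q ^ b) = \<one>" if x: "x \<in> Q" for x
  proof -
    interpret Q: group "G\<lparr>carrier := Q\<rparr>" using Q by (rule subgroup.subgroup_is_group) (rule is_group)
    have "x [^]\<^bsub>G\<lparr>carrier := Q\<rparr>\<^esub> Coset.order (G\<lparr>carrier := Q\<rparr>) = \<one>\<^bsub>G\<lparr>carrier := Q\<rparr>\<^esub>"
      using x by (intro Q.pow_order_eq_1) simp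
    then show ?thesis using card by (simp add: Coset.order_def nat_pow_consistent[symmetric])
  qed
  \<comment> \<open>For b = 0 truncated subtraction would demand a nontrivial element of the trivial
    group; hence the guard.\<close>
  have "\<exists>d\<in>Q. b > 0 \<longrightarrow> d [^] (q ^ (b - 1)) \<noteq> \<one>"
  proof (rule ccontr)
    assume no: "\<not> ?thesis"
    then have b: "b > 0" and all: "\<And>x. x \<in> Q \<Longrightarrow> x [^] (q ^ (b - 1)) = \<one>" using one by blast+
    let ?n = "q ^ (b - 1)"
    let ?P = "monom 1 ?n - 1 :: 'k poly"
    have n0: "?n > 0" using prime_gt_0_nat[OF q] by simp
    have deg: "degree ?P \<le> ?n" by (intro degree_diff_le) (auto simp: degree_monom_le)
    have "coeff ?P ?n = 1" using prime_gt_0_nat[OF q] by (simp add: coeff_1)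
    then have P0: "?P \<noteq> 0" by (metis coeff_0 zero_neq_one)
    have "\<epsilon> ` Q \<subseteq> {x. poly ?P x = 0}"
    proof
      fix y assume "y \<in> \<epsilon> ` Q"
      then obtain x where x: "x \<in> Q" "y = \<epsilon> x" by blast
      then have "y ^ ?n = 1" using all[OF x(1)] epow[OF x(1), of ?n] e1 by simp
      then show "y \<in> {x. poly ?P x = 0}" by (simp add: poly_monom)
    qed
    then have "card (\<epsilon> ` Q) \<le> card {x. poly ?P x = 0}" using poly_roots_finite[OF P0] by (rule card_mono[rotated])
    also have "\<dots> \<le> degree ?P" by (rule card_poly_roots_bound[OF P0])
    finally have "q ^ b \<le> ?n" using card_image[OF inj] card deg by simp
    moreover have "?n < q ^ b" using b prime_gt_1_nat[OF q] by (intro power_strict_increasing) auto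
    ultimately show False by simp
  qed
  then obtain d where d: "d \<in> Q" "b > 0 \<Longrightarrow> d [^] (q ^ (b - 1)) \<noteq> \<one>" by blast
  have dc: "d \<in> carrier G" using d Qc by blast
  have "ord d dvd q ^ b" using Qord[OF d(1)] dc by (simp add: pow_eq_id)
  then obtain k where k: "k \<le> b" "ord d = q ^ k" using q by (metis divides_primepow_nat)
  have "k = b"
  proof (rule ccontr)
    assume "k \<noteq> b"
    then have "k \<le> b - 1" "b > 0" using k by auto
    then have "ord d dvd q ^ (b - 1)" using k by (simp add: le_imp_power_dvd)
    then show False using d(2) \<open>b > 0\<close> dc by (simp add: pow_eq_id)
  qed
  then have iff: "d [^] i = \<one> \<longleftrightarrow> q ^ b dvd i" for i :: nat using k dc by (simp add: pow_eq_id)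
  let ?D = "{d [^] i |i::nat. True}"
  have inj': "inj_on (\<lambda>i::nat. d [^] i) {..<q ^ b}"
  proof (rule inj_onI)
    fix i j :: nat assume ij: "i \<in> {..<q ^ b}" "j \<in> {..<q ^ b}" "d [^] i = d [^] j"
    have *: "i = j" if "i \<le> j" "j < q ^ b" "d [^] i = d [^] j" for i j :: nat
    proof -
      have "d [^] i \<otimes> d [^] (j - i) = d [^] j" using that(1) dc by (simp add: nat_pow_mult)
      then have "d [^] i \<otimes> d [^] (j - i) = d [^] i \<otimes> \<one>" using that(3) dc by simp
      then have "d [^] (j - i) = \<one>" using dc by (metis l_cancel_one nat_pow_closed r_one)
      then have "q ^ b dvd j - i" using iff by blast
      then show ?thesis using that by (metis diff_is_0_eq dvd_imp_le le_antisym less_imp_diff_less linorder_not_le neq0_conv)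
    qed
    show "i = j"
    proof (cases "i \<le> j")
      case True
      then show ?thesis using *[OF True _ ij(3)] ij(2) by simp
    next
      case False
      then show ?thesis using *[OF _ _ ij(3)[symmetric]] ij(1) by simp
    qed
  qed
  have sub: "?D \<subseteq> Q" using powQ d by blast
  have "q ^ b = card ((\<lambda>i::nat. d [^] i) ` {..<q ^ b})" using card_image[OF inj'] by simp
  also have "\<dots> \<le> card ?D" using sub fin by (intro card_mono) (auto intro: finite_subset)
  finally have "?D = Q" using sub fin card by (intro card_seteq) auto
  then show ?thesis using that[of d] d iff by blast
qed

section \<open>Subgroups of GL(2,p) containing a torus element\<close>

text \<open>In the application the matrices give the action on S/Z, with V/Z spanned by the first
  basis vector, so that upper triangular means stabilising V. The determinant of \<tau> is the
  generator g, so every determinant is attained by a power of \<tau>.\<close>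

locale torus_extension = matrix_extension E A \<pi> \<iota> \<rho> p
  for E :: "'e monoid" (structure) and A :: "'a monoid" and \<pi> and \<iota> :: "'k::alg_closed_field \<Rightarrow> 'e"
    and \<rho> and p +
  fixes \<tau> :: 'a and g :: 'k
  assumes fin: "finite (carrier A)" and p_not_dvd: "\<not> p dvd card (carrier A)"
    and g: "g \<in> \<int>" "g \<noteq> 0" "\<And>a. a \<in> \<int> \<Longrightarrow> a \<noteq> 0 \<Longrightarrow> \<exists>n. a = g ^ n"
      "\<And>n. g ^ n = 1 \<longleftrightarrow> (p - 1) dvd n"
    and \<tau>: "\<tau> \<in> carrier A" "\<rho> \<tau> = M2 (1 / g) 0 0 (g\<^sup>2)"
    and borel_splits: "splits {x \<in> carrier A. \<exists>a b d. \<rho> x = M2 a b 0 d}"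
begin

abbreviation B :: "'a set" where "B \<equiv> {x \<in> carrier A. \<exists>a b d. \<rho> x = M2 a b 0 d}"

text \<open>Trace 2 and determinant 1 make N = \<rho> x - 1 square to zero, so the n-th power of
  \<rho> x is 1 + n N. Thus the order of x divides p, and p does not divide the order of A.\<close>

lemma unipotent_trivial:
  assumes x: "x \<in> carrier A" "\<rho> x = M2 a b c d" and tr: "a + d = 2" and det: "a * d - b * c = 1"
  shows "x = \<one>\<^bsub>A\<^esub>"
proof -
  have d: "d = 2 - a" using tr by (simp add: algebra_simps eq_diff_eq)
  have bc: "b * c = - ((a - 1) * (a - 1))" using det unfolding d by (simp add: algebra_simps)
  have "\<rho> (x [^]\<^bsub>A\<^esub> n) = M2 (1 + of_nat n * (a - 1)) (of_nat n * b) (of_nat n * c) (1 - of_nat n * (a - 1))" for n :: nat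
  proof (induction n)
    case 0
    then show ?case by (simp add: \<rho>_one)
  next
    case (Suc n)
    let ?n = "of_nat n :: 'k"
    have e1: "(1 + ?n * (a - 1)) * a + ?n * b * c = 1 + (1 + ?n) * (a - 1)"
    proof -
      have "?n * b * c = ?n * (- ((a - 1) * (a - 1)))" using bc by (simp add: mult.assoc)
      then show ?thesis by (simp add: algebra_simps)
    qed
    have e2: "?n * c * b + (1 - ?n * (a - 1)) * (2 - a) = 1 - (1 + ?n) * (a - 1)"
    proof -
      have "?n * c * b = ?n * (b * c)" by (simp only: mult_ac)
      then have "?n * c * b = ?n * (- ((a - 1) * (a - 1)))" unfolding bc .
      then show ?thesis by (simp add: algebra_simps)
    qed
    have e3: "(1 + ?n * (a - 1)) * b + ?n * b * (2 - a) = (1 + ?n) * b"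
      "?n * c * a + (1 - ?n * (a - 1)) * c = (1 + ?n) * c" by (simp_all add: algebra_simps)
    have "\<rho> (x [^]\<^bsub>A\<^esub> Suc n) = \<rho> (x [^]\<^bsub>A\<^esub> n) \<star> M2 a b c (2 - a)" using x d by (simp add: \<rho>_mult)
    then show ?case unfolding Suc by (simp only: mtimes.simps e1 e2 e3 of_nat_Suc)
  qed
  from this[of p] have "\<rho> (x [^]\<^bsub>A\<^esub> p) = \<rho> \<one>\<^bsub>A\<^esub>"
    using of_nat_CHAR[where ?'a='k] char by (simp add: \<rho>_one)
  then have "x [^]\<^bsub>A\<^esub> p = \<one>\<^bsub>A\<^esub>" using x by (intro \<rho>_eq) auto
  then have "A.ord x dvd p" using x by (simp add: A.pow_eq_id)
  moreover have "A.ord x dvd card (carrier A)"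
    using A.ord_dvd_group_order[OF x(1)] by (simp add: Coset.order_def)
  ultimately have "A.ord x = 1" using p p_not_dvd by (metis prime_nat_iff)
  then show ?thesis using x A.ord_eq_1 by blast
qed

lemma \<rho>_commute: "x \<in> carrier A \<Longrightarrow> y \<in> carrier A \<Longrightarrow> x \<otimes>\<^bsub>A\<^esub> y = y \<otimes>\<^bsub>A\<^esub> x \<longleftrightarrow> \<rho> x \<star> \<rho> y = \<rho> y \<star> \<rho> x"
  by (metis A.m_closed \<rho>_eq \<rho>_mult)

text \<open>A fixed point of a \<open>q\<close>-group acting on its nontrivial cosets modulo scalars is an element that
  commutes with the group up to sign, by comparing determinants.\<close>
lemma commuting_up_to_sign:
  assumes P: "subgroup P A" and q: "prime (q::nat)" "card P = q ^ n" and ns: "\<exists>x\<in>P. \<not> mscalar (\<rho> x)"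
  obtains c where "c \<in> P" "\<not> mscalar (\<rho> c)"
    "\<And>x. x \<in> P \<Longrightarrow> \<rho> x \<star> \<rho> c = \<rho> c \<star> \<rho> x \<or> \<rho> x \<star> \<rho> c = mneg (\<rho> c \<star> \<rho> x)"
proof -
  let ?P = "A\<lparr>carrier := P\<rparr>"
  interpret P: group ?P using P by (rule subgroup.subgroup_is_group) (rule A.is_group)
  have Pc: "x \<in> carrier A" if "x \<in> P" for x using P that by (rule subgroup.mem_carrier)
  note Pcl = subgroup.m_closed[OF P] subgroup.m_inv_closed[OF P] subgroup.one_closed[OF P]
  have invP: "inv\<^bsub>?P\<^esub> x = inv\<^bsub>A\<^esub> x" if "x \<in> P" for x using that P by (simp add: A.m_inv_consistent)
  let ?Z = "{x \<in> P. mscalar (\<rho> x)}"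
  have Zcom: "z \<otimes>\<^bsub>A\<^esub> x = x \<otimes>\<^bsub>A\<^esub> z" if "z \<in> ?Z" "x \<in> P" for z x
    using that Pc mscalar_commute by (subst \<rho>_commute) auto
  have Z: "subgroup ?Z ?P"
  proof (rule P.subgroupI)
    show "?Z \<noteq> {}" using Pcl \<rho>_one by force
    fix x y assume "x \<in> ?Z" "y \<in> ?Z"
    then have "mscalar (\<rho> x \<star> \<rho> y)" by (cases "\<rho> x"; cases "\<rho> y") auto
    then show "x \<otimes>\<^bsub>?P\<^esub> y \<in> ?Z" using \<open>x \<in> ?Z\<close> \<open>y \<in> ?Z\<close> Pc Pcl by (simp add: \<rho>_mult)
  next
    fix x assume x: "x \<in> ?Z"
    have "\<rho> x \<star> \<rho> (inv\<^bsub>A\<^esub> x) = M2 1 0 0 1" using x Pc by (simp add: \<rho>_mult[symmetric] \<rho>_one)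
    then have "mscalar (\<rho> (inv\<^bsub>A\<^esub> x))" using x
      by (cases "\<rho> x"; cases "\<rho> (inv\<^bsub>A\<^esub> x)") (auto, metis mult_cancel_left mult_zero_left zero_neq_one)
    then show "inv\<^bsub>?P\<^esub> x \<in> ?Z" using x invP Pcl by simp
  qed auto
  have rc: "?Z #>\<^bsub>?P\<^esub> c = {z \<otimes>\<^bsub>A\<^esub> c |z. z \<in> ?Z}" for c unfolding r_coset_def by auto
  \<comment> \<open>The nontrivial cosets modulo scalars. The number of all cosets is a power of q
    larger than 1, so this set has -1 elements modulo q.\<close>
  let ?X = "rcosets\<^bsub>?P\<^esub> ?Z - {?Z}"
  have finP: "finite P" using fin Pc by (meson finite_subset subsetI)
  have ZX: "?Z \<in> rcosets\<^bsub>?P\<^esub> ?Z" using subgroup.subgroup_in_rcosets[OF Z P.is_group] .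
  have lag: "card ?Z * card (rcosets\<^bsub>?P\<^esub> ?Z) = q ^ n"
    using P.lagrange[OF Z] q by (simp add: Coset.order_def mult.commute)
  have finX: "finite (rcosets\<^bsub>?P\<^esub> ?Z)" 
  proof -
    have "\<Union> (rcosets\<^bsub>?P\<^esub> ?Z) = P" using P.rcosets_part_G[OF Z] by simp
    then show ?thesis using finP by (intro finite_UnionD) simp
  qed
  have "card (rcosets\<^bsub>?P\<^esub> ?Z) \<noteq> 1"
  proof
    assume "card (rcosets\<^bsub>?P\<^esub> ?Z) = 1"
    then have "card ?Z = card P" using lag q by simp
    then have "?Z = P" using finP by (intro card_subset_eq) auto
    then show False using ns by blast
  qed
  moreover have "card (rcosets\<^bsub>?P\<^esub> ?Z) dvd q ^ n" unfolding lag[symmetric] by simp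
  then obtain k where k: "card (rcosets\<^bsub>?P\<^esub> ?Z) = q ^ k" using divides_primepow_nat[OF q(1)] by blast
  ultimately have "k \<noteq> 0" by auto
  then have dv: "q dvd card (rcosets\<^bsub>?P\<^esub> ?Z)" unfolding k by simp
  have c1: "card ?X = card (rcosets\<^bsub>?P\<^esub> ?Z) - 1" using ZX finX by simp
  have c2: "card (rcosets\<^bsub>?P\<^esub> ?Z) > 0" unfolding k using prime_gt_0_nat[OF q(1)] by simp
  have X: "\<not> q dvd card ?X"
  proof
    assume "q dvd card ?X"
    then have "q dvd card (rcosets\<^bsub>?P\<^esub> ?Z) - (card (rcosets\<^bsub>?P\<^esub> ?Z) - 1)" unfolding c1 by (rule dvd_diff_nat[OF dv])
    moreover have "card (rcosets\<^bsub>?P\<^esub> ?Z) - (card (rcosets\<^bsub>?P\<^esub> ?Z) - 1) = 1" using c2 by simp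
    ultimately show False using q(1) by simp
  qed
  let ?act = "\<lambda>x C. (\<lambda>y. x \<otimes>\<^bsub>A\<^esub> y \<otimes>\<^bsub>A\<^esub> inv\<^bsub>A\<^esub> x) ` C"
  have act: "?act x {z \<otimes>\<^bsub>A\<^esub> c |z. z \<in> ?Z} = {z \<otimes>\<^bsub>A\<^esub> (x \<otimes>\<^bsub>A\<^esub> c \<otimes>\<^bsub>A\<^esub> inv\<^bsub>A\<^esub> x) |z. z \<in> ?Z}" if "x \<in> P" "c \<in> P" for x c
  proof -
    have "x \<otimes>\<^bsub>A\<^esub> (z \<otimes>\<^bsub>A\<^esub> c) \<otimes>\<^bsub>A\<^esub> inv\<^bsub>A\<^esub> x = z \<otimes>\<^bsub>A\<^esub> (x \<otimes>\<^bsub>A\<^esub> c \<otimes>\<^bsub>A\<^esub> inv\<^bsub>A\<^esub> x)" if z: "z \<in> ?Z" for z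
    proof -
      have zc: "z \<in> carrier A" using z Pc by blast
      have "x \<otimes>\<^bsub>A\<^esub> (z \<otimes>\<^bsub>A\<^esub> c) \<otimes>\<^bsub>A\<^esub> inv\<^bsub>A\<^esub> x = (x \<otimes>\<^bsub>A\<^esub> z) \<otimes>\<^bsub>A\<^esub> c \<otimes>\<^bsub>A\<^esub> inv\<^bsub>A\<^esub> x"
        using zc Pc \<open>x \<in> P\<close> \<open>c \<in> P\<close> by (simp add: A.m_assoc)
      also have "x \<otimes>\<^bsub>A\<^esub> z = z \<otimes>\<^bsub>A\<^esub> x" by (rule Zcom[OF z \<open>x \<in> P\<close>, symmetric])
      finally show ?thesis using zc Pc \<open>x \<in> P\<close> \<open>c \<in> P\<close> by (simp add: A.m_assoc)
    qed
    then show ?thesis unfolding Setcompr_eq_image image_image by (intro image_cong) auto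
  qed
  have X_rep: "\<exists>c\<in>P. \<not> mscalar (\<rho> c) \<and> C = {z \<otimes>\<^bsub>A\<^esub> c |z. z \<in> ?Z}" if C: "C \<in> ?X" for C
  proof -
    from C obtain c where c: "c \<in> P" "C = ?Z #>\<^bsub>?P\<^esub> c" unfolding RCOSETS_def by auto
    have "c \<notin> ?Z"
    proof
      assume "c \<in> ?Z"
      then have "C = ?Z" using c P.coset_join2[OF _ Z, of c] by simp
      then show False using C by blast
    qed
    then show ?thesis using c rc by blast
  qed
  have X_rep': "{z \<otimes>\<^bsub>A\<^esub> c |z. z \<in> ?Z} \<in> ?X" if c: "c \<in> P" "\<not> mscalar (\<rho> c)" for c
  proof -
    have "?Z #>\<^bsub>?P\<^esub> c \<in> rcosets\<^bsub>?P\<^esub> ?Z" using c by (intro P.rcosetsI) auto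
    moreover have "c \<in> ?Z #>\<^bsub>?P\<^esub> c" using P.rcos_self[OF _ Z, of c] c by simp
    then have "?Z #>\<^bsub>?P\<^esub> c \<noteq> ?Z" using c by blast
    ultimately show ?thesis unfolding rc by blast
  qed
  have conj_ns: "\<not> mscalar (\<rho> (x \<otimes>\<^bsub>A\<^esub> c \<otimes>\<^bsub>A\<^esub> inv\<^bsub>A\<^esub> x))" if xc: "x \<in> P" "c \<in> P" "\<not> mscalar (\<rho> c)" for x c
  proof
    let ?y = "x \<otimes>\<^bsub>A\<^esub> c \<otimes>\<^bsub>A\<^esub> inv\<^bsub>A\<^esub> x"
    assume "mscalar (\<rho> ?y)"
    then have "?y \<in> ?Z" using xc Pcl by simp
    then have "x \<otimes>\<^bsub>A\<^esub> ?y = ?y \<otimes>\<^bsub>A\<^esub> x" using Zcom[of ?y x] xc by simp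
    also have "\<dots> = x \<otimes>\<^bsub>A\<^esub> c" using xc Pc by (simp add: A.m_assoc)
    finally have "?y = c" using xc Pc Pcl by simp
    then show False using \<open>mscalar (\<rho> ?y)\<close> xc by simp
  qed
  obtain C where C: "C \<in> ?X" "\<And>x. x \<in> P \<Longrightarrow> ?act x C = C"
  proof (rule prime_power_group_fixed_point[where G="?P" and X="?X" and q=q and n=n and act="?act"])
    show "group ?P" by (rule P.is_group)
    show "Coset.order ?P = q ^ n" using q by (simp add: Coset.order_def)
    show "finite ?X" using finX by simp
    show "prime q" by (fact q(1))
    show "\<not> q dvd card ?X" by (fact X)
    fix x C assume "x \<in> carrier ?P" "C \<in> ?X"
    then obtain c where c: "x \<in> P" "c \<in> P" "\<not> mscalar (\<rho> c)" "C = {z \<otimes>\<^bsub>A\<^esub> c |z. z \<in> ?Z}" using X_rep[of C] by auto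
    show "?act x C \<in> ?X" unfolding c(4) act[OF c(1,2)]
      by (rule X_rep'[OF _ conj_ns[OF c(1-3)]]) (intro Pcl c)
  next
    fix C assume "C \<in> ?X"
    then obtain c where "c \<in> P" "C = {z \<otimes>\<^bsub>A\<^esub> c |z. z \<in> ?Z}" using X_rep[of C] by auto
    then have "C \<subseteq> carrier A" using Pc by auto
    then have "\<one>\<^bsub>A\<^esub> \<otimes>\<^bsub>A\<^esub> y \<otimes>\<^bsub>A\<^esub> inv\<^bsub>A\<^esub> \<one>\<^bsub>A\<^esub> = y" if "y \<in> C" for y using that by auto
    then show "?act \<one>\<^bsub>?P\<^esub> C = C" by simp
    fix x y assume xy: "x \<in> carrier ?P" "y \<in> carrier ?P"
    have "(x \<otimes>\<^bsub>A\<^esub> y) \<otimes>\<^bsub>A\<^esub> w \<otimes>\<^bsub>A\<^esub> inv\<^bsub>A\<^esub> (x \<otimes>\<^bsub>A\<^esub> y) = x \<otimes>\<^bsub>A\<^esub> (y \<otimes>\<^bsub>A\<^esub> w \<otimes>\<^bsub>A\<^esub> inv\<^bsub>A\<^esub> y) \<otimes>\<^bsub>A\<^esub> inv\<^bsub>A\<^esub> x" if "w \<in> C" for w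
      using that \<open>C \<subseteq> carrier A\<close> xy Pc by (auto simp: A.m_assoc A.inv_mult_group subset_iff)
    then show "?act (x \<otimes>\<^bsub>?P\<^esub> y) C = ?act x (?act y C)" by (simp add: image_image)
  next
    fix C assume "C \<in> ?X" "\<And>x. x \<in> carrier ?P \<Longrightarrow> ?act x C = C"
    then show thesis by (intro that[of C]) simp_all
  qed
  obtain c where c: "c \<in> P" "\<not> mscalar (\<rho> c)" "C = {z \<otimes>\<^bsub>A\<^esub> c |z. z \<in> ?Z}" using X_rep[OF C(1)] by blast
  have "\<rho> x \<star> \<rho> c = \<rho> c \<star> \<rho> x \<or> \<rho> x \<star> \<rho> c = mneg (\<rho> c \<star> \<rho> x)" if x: "x \<in> P" for x
  proof -
    have "x \<otimes>\<^bsub>A\<^esub> c \<otimes>\<^bsub>A\<^esub> inv\<^bsub>A\<^esub> x \<in> ?act x C"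
    proof -
      have "\<one>\<^bsub>A\<^esub> \<in> ?Z" using Pcl \<rho>_one by simp
      then have "\<one>\<^bsub>A\<^esub> \<otimes>\<^bsub>A\<^esub> c \<in> C" unfolding c(3) by blast
      then have "c \<in> C" using c(1) Pc by simp
      then show ?thesis by (rule imageI)
    qed
    then obtain z where z: "z \<in> ?Z" "x \<otimes>\<^bsub>A\<^esub> c \<otimes>\<^bsub>A\<^esub> inv\<^bsub>A\<^esub> x = z \<otimes>\<^bsub>A\<^esub> c" using C(2)[OF x] c by auto
    have zc: "z \<in> carrier A" using z Pc by blast
    have "x \<otimes>\<^bsub>A\<^esub> c = (x \<otimes>\<^bsub>A\<^esub> c \<otimes>\<^bsub>A\<^esub> inv\<^bsub>A\<^esub> x) \<otimes>\<^bsub>A\<^esub> x" using x c Pc by (simp add: A.m_assoc)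
    also have "\<dots> = z \<otimes>\<^bsub>A\<^esub> (c \<otimes>\<^bsub>A\<^esub> x)" unfolding z using zc x c Pc by (simp add: A.m_assoc)
    finally have "\<rho> (x \<otimes>\<^bsub>A\<^esub> c) = \<rho> (z \<otimes>\<^bsub>A\<^esub> (c \<otimes>\<^bsub>A\<^esub> x))" by simp
    then have eq: "\<rho> x \<star> \<rho> c = \<rho> z \<star> (\<rho> c \<star> \<rho> x)" using zc Pc[OF x] Pc[OF c(1)] by (simp add: \<rho>_mult)
    obtain s where s: "\<rho> z = M2 s 0 0 s" using z by (cases "\<rho> z") auto
    \<comment> \<open>The scalar s measures the failure to commute. Determinants do not see the
      order of factors, so s^2 = 1.\<close>
    have "mdet (\<rho> x) * mdet (\<rho> c) = s * s * (mdet (\<rho> c) * mdet (\<rho> x))"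
      using arg_cong[OF eq, of mdet] s by (simp add: mdet_mult)
    then have "s * s = 1" using \<rho>_det_nz x c Pc by (simp add: mult.commute)
    then have "s = 1 \<or> s = - 1" by (simp add: square_eq_1_iff)
    then show ?thesis
    proof
      assume "s = 1" then show ?thesis using eq s by (simp add: mtimes_one)
    next
      assume "s = - 1"
      then show ?thesis using eq s by (cases "\<rho> c \<star> \<rho> x") auto
    qed
  qed
  then show ?thesis using that c by blast
qed

end

context torus_extension
begin

definition act :: "'a \<Rightarrow> 'k \<times> 'k \<Rightarrow> 'k \<times> 'k" where "act x v = mvec (\<rho> x) v"

abbreviation smul :: "'k \<Rightarrow> 'k \<times> 'k \<Rightarrow> 'k \<times> 'k" where "smul s v \<equiv> (s * fst v, s * snd v)"

abbreviation e1 :: "'k \<times> 'k" where "e1 \<equiv> (1, 0)"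

lemma act_mult: "x \<in> carrier A \<Longrightarrow> y \<in> carrier A \<Longrightarrow> act (x \<otimes>\<^bsub>A\<^esub> y) v = act x (act y v)"
  by (simp add: act_def \<rho>_mult mvec_mult)

lemma act_one: "act \<one>\<^bsub>A\<^esub> v = v"
  by (simp add: act_def \<rho>_one mvec_one)

lemma act_inv: "x \<in> carrier A \<Longrightarrow> act (inv\<^bsub>A\<^esub> x) (act x v) = v" "x \<in> carrier A \<Longrightarrow> act x (act (inv\<^bsub>A\<^esub> x) v) = v"
  by (simp_all flip: act_mult add: act_one)

lemma act_smul: "act x (smul s v) = smul s (act x v)"
  unfolding act_def by (cases "\<rho> x"; cases v) (simp add: algebra_simps)

lemma act_e1_B: "x \<in> carrier A \<Longrightarrow> snd (act x e1) = 0 \<Longrightarrow> x \<in> B"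
  by (cases "\<rho> x") (auto simp: act_def)

lemma act_Ints: "x \<in> carrier A \<Longrightarrow> v \<in> \<int> \<times> \<int> \<Longrightarrow> act x v \<in> \<int> \<times> \<int>"
  using \<rho>_Ints[of x] unfolding act_def by (cases "\<rho> x"; cases v) auto

lemma act_nonzero: "x \<in> carrier A \<Longrightarrow> v \<noteq> (0, 0) \<Longrightarrow> act x v \<noteq> (0, 0)"
proof
  assume x: "x \<in> carrier A" "v \<noteq> (0, 0)" "act x v = (0, 0)"
  have "act (inv\<^bsub>A\<^esub> x) (0, 0) = (0, 0)" unfolding act_def by (cases "\<rho> (inv\<^bsub>A\<^esub> x)") simp
  then show False using act_inv(1)[OF x(1), of v] x by simp
qed

lemma \<tau>_pow: "\<rho> (\<tau> [^]\<^bsub>A\<^esub> (i::nat)) = M2 (1 / g ^ i) 0 0 (g ^ (2 * i))"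
  using \<rho>_pow_diag[OF \<tau>, of i] by (simp add: power_one_over power_mult)

lemma \<tau>_B: "\<tau> [^]\<^bsub>A\<^esub> (i::nat) \<in> B"
  using \<tau>_pow[of i] \<tau>(1) by auto

text \<open>Three disjoint equally large sets of vectors, at least one of them away from the axes, leave
  no room in the plane unless \<open>p = 7\<close>; there the three conjugate reflections would make
  \<open>- 1\<close> a square.\<close>
lemma no_index_three_subgroup:
  assumes three: "3 dvd p - 1" and N: "subgroup N A"
    and normal: "\<And>x n. x \<in> carrier A \<Longrightarrow> n \<in> N \<Longrightarrow> x \<otimes>\<^bsub>A\<^esub> n \<otimes>\<^bsub>A\<^esub> inv\<^bsub>A\<^esub> x \<in> N"
    and BN: "B \<subseteq> N" and d: "d \<in> carrier A" "d [^]\<^bsub>A\<^esub> (3::nat) \<in> N"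
  shows "d \<in> N"
proof (rule ccontr)
  assume dN: "d \<notin> N"
  have Nc [simp]: "n \<in> carrier A" if "n \<in> N" for n using N that by (rule subgroup.mem_carrier)
  note Ncl = subgroup.m_closed[OF N] subgroup.m_inv_closed[OF N] subgroup.one_closed[OF N]
  have normal': "inv\<^bsub>A\<^esub> x \<otimes>\<^bsub>A\<^esub> n \<otimes>\<^bsub>A\<^esub> x \<in> N" if "x \<in> carrier A" "n \<in> N" for x n
    using normal[of "inv\<^bsub>A\<^esub> x" n] that by simp
  define D where "D j = d [^]\<^bsub>A\<^esub> (j::nat)" for j
  have Dc [simp]: "D j \<in> carrier A" for j using d by (simp add: D_def)
  have D0: "D 0 = \<one>\<^bsub>A\<^esub>" and D1: "D 1 = d" using d by (simp_all add: D_def)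
  have D2: "D 2 \<notin> N"
  proof
    assume "D 2 \<in> N"
    have "d [^]\<^bsub>A\<^esub> (3::nat) = d \<otimes>\<^bsub>A\<^esub> D 2" using d unfolding D_def by (simp add: numeral_3_eq_3 numeral_2_eq_2 A.m_assoc)
    then have "d = d [^]\<^bsub>A\<^esub> (3::nat) \<otimes>\<^bsub>A\<^esub> inv\<^bsub>A\<^esub> (D 2)" using d by (simp add: A.m_assoc)
    then show False using dN Ncl d(2) \<open>D 2 \<in> N\<close> by metis
  qed
  have D12: "inv\<^bsub>A\<^esub> (D 1) \<otimes>\<^bsub>A\<^esub> D 2 = d" using d unfolding D_def by (simp add: numeral_2_eq_2)
  have sep: "inv\<^bsub>A\<^esub> (D i) \<otimes>\<^bsub>A\<^esub> D j \<notin> N" if "i < j" "j \<le> 2" for i j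
  proof -
    have "(i = 0 \<and> j = 1) \<or> (i = 0 \<and> j = 2) \<or> (i = 1 \<and> j = 2)" using that by auto
    then show ?thesis using dN D2 D12 D0 D1 by auto
  qed
  define Sat where "Sat v = {smul s (act n v) |s n. s \<in> \<int> \<and> s \<noteq> 0 \<and> n \<in> N}" for v
  have Sat_self: "v \<in> Sat v" for v
    unfolding Sat_def using Ncl(3) act_one[of v] by (intro CollectI exI[of _ 1] exI[of _ "\<one>\<^bsub>A\<^esub>"]) auto
  have Sat_closed: "smul s (act n w) \<in> Sat v" if w: "w \<in> Sat v" and s: "s \<in> \<int>" "s \<noteq> 0" and n: "n \<in> N" for s n w v
  proof -
    obtain s' n' where w': "w = smul s' (act n' v)" "s' \<in> \<int>" "s' \<noteq> 0" "n' \<in> N" using w unfolding Sat_def by blast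
    have "smul s (act n w) = smul (s * s') (act (n \<otimes>\<^bsub>A\<^esub> n') v)" using w' n by (simp add: act_smul act_mult mult.assoc)
    moreover have "s * s' \<in> \<int>" "s * s' \<noteq> 0" "n \<otimes>\<^bsub>A\<^esub> n' \<in> N" using w' s n Ncl by auto
    ultimately show ?thesis unfolding Sat_def by blast
  qed
  \<comment> \<open>The sets belong to the cosets of N represented by 1, d and d^2. Since N is
    normal, d^j carries the first set onto the others.\<close>
  define O' where "O' j = Sat (act (D j) e1)" for j
  have in_O: "\<exists>s n. s \<in> \<int> \<and> s \<noteq> 0 \<and> n \<in> N \<and> w = smul s (act (n \<otimes>\<^bsub>A\<^esub> D j) e1)" if "w \<in> O' j" for w j
  proof -
    from that obtain s n where w: "w = smul s (act n (act (D j) e1))" "s \<in> \<int>" "s \<noteq> 0" "n \<in> N"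
      unfolding O'_def Sat_def by blast
    then have "w = smul s (act (n \<otimes>\<^bsub>A\<^esub> D j) e1)" by (simp add: act_mult)
    then show ?thesis using w by blast
  qed
  \<comment> \<open>Two elements that send the first basis vector to the same line differ by an
    element of its stabiliser B, which lies in N. This separates the three sets.\<close>
  have proj: "inv\<^bsub>A\<^esub> x \<otimes>\<^bsub>A\<^esub> y \<in> N" if xy: "x \<in> carrier A" "y \<in> carrier A" "s \<noteq> 0" "s' \<noteq> 0"
      "smul s (act x e1) = smul s' (act y e1)" for x y s s'
  proof -
    have "smul s' (act (inv\<^bsub>A\<^esub> x \<otimes>\<^bsub>A\<^esub> y) e1) = act (inv\<^bsub>A\<^esub> x) (smul s' (act y e1))"
      using xy by (simp only: act_smul act_mult A.inv_closed)
    also have "\<dots> = smul s e1" unfolding xy(5)[symmetric] act_smul act_inv(1)[OF xy(1)] ..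
    finally have "snd (act (inv\<^bsub>A\<^esub> x \<otimes>\<^bsub>A\<^esub> y) e1) = 0" using xy(4) by simp
    then have "inv\<^bsub>A\<^esub> x \<otimes>\<^bsub>A\<^esub> y \<in> B" using xy by (intro act_e1_B) simp_all
    then show ?thesis using BN by blast
  qed
  have disj: "O' i \<inter> O' j = {}" if "i < j" "j \<le> 2" for i j
  proof (rule ccontr)
    assume "O' i \<inter> O' j \<noteq> {}"
    then obtain w where "w \<in> O' i" "w \<in> O' j" by blast
    then obtain s n s' n' where w: "s \<noteq> 0" "s' \<noteq> 0" "n \<in> N" "n' \<in> N"
        "smul s (act (n \<otimes>\<^bsub>A\<^esub> D i) e1) = smul s' (act (n' \<otimes>\<^bsub>A\<^esub> D j) e1)"
      using in_O[of w i] in_O[of w j] by metis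
    have "inv\<^bsub>A\<^esub> (n \<otimes>\<^bsub>A\<^esub> D i) \<otimes>\<^bsub>A\<^esub> (n' \<otimes>\<^bsub>A\<^esub> D j) \<in> N"
      using w by (intro proj[OF _ _ w(1,2) w(5)]) simp_all
    moreover have "inv\<^bsub>A\<^esub> (n \<otimes>\<^bsub>A\<^esub> D i) \<otimes>\<^bsub>A\<^esub> (n' \<otimes>\<^bsub>A\<^esub> D j)
        = (inv\<^bsub>A\<^esub> (D i) \<otimes>\<^bsub>A\<^esub> (inv\<^bsub>A\<^esub> n \<otimes>\<^bsub>A\<^esub> n') \<otimes>\<^bsub>A\<^esub> D i) \<otimes>\<^bsub>A\<^esub> (inv\<^bsub>A\<^esub> (D i) \<otimes>\<^bsub>A\<^esub> D j)"
      using w by (simp add: A.inv_mult_group A.m_assoc)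
    moreover have m: "inv\<^bsub>A\<^esub> (D i) \<otimes>\<^bsub>A\<^esub> (inv\<^bsub>A\<^esub> n \<otimes>\<^bsub>A\<^esub> n') \<otimes>\<^bsub>A\<^esub> D i \<in> N"
      using w Ncl by (intro normal') auto
    ultimately have "inv\<^bsub>A\<^esub> (D i) \<otimes>\<^bsub>A\<^esub> D j \<in> N"
      using Ncl(1)[OF Ncl(2)[OF m], of "(inv\<^bsub>A\<^esub> (D i) \<otimes>\<^bsub>A\<^esub> (inv\<^bsub>A\<^esub> n \<otimes>\<^bsub>A\<^esub> n') \<otimes>\<^bsub>A\<^esub> D i) \<otimes>\<^bsub>A\<^esub> (inv\<^bsub>A\<^esub> (D i) \<otimes>\<^bsub>A\<^esub> D j)"] m
      by simp
    then show False using sep that by blast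
  qed
  let ?V = "\<int> \<times> \<int> - {(0, 0)} :: ('k \<times> 'k) set"
  have finI: "finite (\<int> :: 'k set)" by (rule finite_Ints_char_p[OF p char])
  have finV: "finite ?V" using finI by simp
  have cardI: "card (\<int> - {0} :: 'k set) = p - 1" using card_Ints_char_p[OF p char] finI by simp
  have cardV: "card ?V = p * p - 1" using card_Ints_char_p[OF p char] finI by (simp add: card_cartesian_product)
  have SatV: "Sat v \<subseteq> ?V" if v: "v \<in> ?V" for v
  proof
    fix w assume "w \<in> Sat v"
    then obtain s n where w: "w = smul s (act n v)" "s \<in> \<int>" "s \<noteq> 0" "n \<in> N" unfolding Sat_def by blast
    have "act n v \<in> \<int> \<times> \<int>" "act n v \<noteq> (0, 0)" using act_Ints act_nonzero w(4) v by auto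
    then show "w \<in> ?V" using w by (cases "act n v") auto
  qed
  have OV: "O' j \<subseteq> ?V" for j
    unfolding O'_def using act_Ints[of "D j" e1] act_nonzero[of "D j" e1] by (intro SatV) auto
  have finO: "finite (O' j)" for j using OV finV by (rule finite_subset)
  have cardO: "card (O' j) = card (O' 0)" for j
  proof -
    have "O' j = act (D j) ` O' 0"
    proof (intro equalityI subsetI)
      fix w assume "w \<in> O' j"
      then obtain s n where w: "s \<in> \<int>" "s \<noteq> 0" "n \<in> N" "w = smul s (act (n \<otimes>\<^bsub>A\<^esub> D j) e1)" using in_O by blast
      let ?n = "inv\<^bsub>A\<^esub> (D j) \<otimes>\<^bsub>A\<^esub> n \<otimes>\<^bsub>A\<^esub> D j"
      have n: "?n \<in> N" using w by (intro normal') auto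
      have "n \<otimes>\<^bsub>A\<^esub> D j = D j \<otimes>\<^bsub>A\<^esub> ?n" using w by (simp add: A.m_assoc)
      then have "w = act (D j) (smul s (act ?n e1))" using w n by (simp only: act_smul act_mult Dc Nc)
      moreover have "smul s (act ?n e1) \<in> O' 0"
        unfolding O'_def D0 act_one using w n Sat_closed[OF Sat_self] by blast
      ultimately show "w \<in> act (D j) ` O' 0" by blast
    next
      fix w assume "w \<in> act (D j) ` O' 0"
      then obtain s n where w: "s \<in> \<int>" "s \<noteq> 0" "n \<in> N" "w = act (D j) (smul s (act n e1))"
        unfolding O'_def D0 act_one Sat_def by blast
      let ?n = "D j \<otimes>\<^bsub>A\<^esub> n \<otimes>\<^bsub>A\<^esub> inv\<^bsub>A\<^esub> (D j)"
      have n: "?n \<in> N" using w by (intro normal) auto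
      have "D j \<otimes>\<^bsub>A\<^esub> n = ?n \<otimes>\<^bsub>A\<^esub> D j" using w by (simp add: A.m_assoc)
      then have "w = smul s (act ?n (act (D j) e1))" using w n
        by (simp only: act_smul) (simp only: act_mult[symmetric] Dc Nc)
      then show "w \<in> O' j" unfolding O'_def using w n Sat_closed[OF Sat_self] by blast
    qed
    moreover have "inj_on (act (D j)) (O' 0)" by (rule inj_onI) (metis act_inv(1) Dc)
    ultimately show ?thesis by (simp add: card_image)
  qed
  define m where "m = card (O' 0)"
  \<comment> \<open>The order of \<tau> modulo scalars: \<open>1 / g ^ i\<close> and
    \<open>g ^ (2 * i)\<close> agree exactly when g^(3 i) = 1. With p - 1 scalars, a torus orbit off
    the axes has (p - 1) r vectors.\<close>
  define r where "r = (p - 1) div 3"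
  have r: "p - 1 = 3 * r" using three by (simp add: r_def)
  have r0: "r > 0" using r prime_gt_1_nat[OF p] by (cases r) auto
  have "card (O' 0 \<union> O' 1 \<union> O' 2) = 3 * m"
    using disj[of 0 1] disj[of 0 2] disj[of 1 2] finO cardO[of 1] cardO[of 2]
    by (subst card_Un_disjoint; auto simp: card_Un_disjoint m_def)
  moreover have "card (O' 0 \<union> O' 1 \<union> O' 2) \<le> card ?V" using OV finV by (intro card_mono) auto
  ultimately have m_le: "3 * m \<le> p * p - 1" using cardV by simp
  text \<open>The part of a saturated set off the axes is a union of torus orbits.\<close>
  let ?T = "\<lambda>v. (\<lambda>(s, i). (s / g ^ i * fst v, s * g ^ (2 * i) * snd v)) ` ((\<int> - {0}) \<times> {..<r})"
  have torus: "card (?T v) = (p - 1) * r" if v: "fst v \<noteq> 0" "snd v \<noteq> 0" for v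
  proof -
    have "inj_on (\<lambda>(s, i). (s / g ^ i * fst v, s * g ^ (2 * i) * snd v)) ((\<int> - {0}) \<times> {..<r})"
    proof (rule inj_onI)
      fix x x' :: "'k \<times> nat"
      assume xx: "x \<in> (\<int> - {0}) \<times> {..<r}" "x' \<in> (\<int> - {0}) \<times> {..<r}"
        "(\<lambda>(s, i). (s / g ^ i * fst v, s * g ^ (2 * i) * snd v)) x = (\<lambda>(s, i). (s / g ^ i * fst v, s * g ^ (2 * i) * snd v)) x'"
      obtain s i s' i' where x: "x = (s, i)" "x' = (s', i')" by (cases x; cases x')
      have a: "s \<noteq> 0" "s' \<noteq> 0" "i < r" "i' < r"
        "s / g ^ i * fst v = s' / g ^ i' * fst v" "s * g ^ (2 * i) * snd v = s' * g ^ (2 * i') * snd v"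
        using xx unfolding x by simp_all
      have 1: "s * g ^ i' = s' * g ^ i" using a(5) v g(2) by (simp add: field_simps)
      have 2: "s * g ^ (2 * i) = s' * g ^ (2 * i')" using a(6) v by simp
      have "s * s' * (g ^ (2 * i) * g ^ i) = (s * g ^ (2 * i)) * (s' * g ^ i)" by (simp add: ac_simps)
      also have "\<dots> = (s' * g ^ (2 * i')) * (s * g ^ i')" using 1 2 by simp
      also have "\<dots> = s * s' * (g ^ (2 * i') * g ^ i')" by (simp add: ac_simps)
      finally have g3: "g ^ (3 * i) = g ^ (3 * i')" using a by (simp flip: power_add)
      have aux: "k = l" if "k \<le> l" "l < r" "g ^ (3 * k) = g ^ (3 * l)" for k l
      proof -
        have "3 * k + 3 * (l - k) = 3 * l" using that(1) by simp
        then have "g ^ (3 * k) * g ^ (3 * (l - k)) = g ^ (3 * l)" by (simp only: power_add[symmetric])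
        then have "g ^ (3 * k) * g ^ (3 * (l - k)) = g ^ (3 * k) * 1" using that(3) by (simp only: mult_1_right)
        then have "g ^ (3 * (l - k)) = 1" using g(2) by simp
        then have "3 * r dvd 3 * (l - k)" using g(4) r by simp
        then have "r dvd l - k" by simp
        then show ?thesis using that by (metis diff_is_0_eq dvd_imp_le le_antisym less_imp_diff_less linorder_not_le neq0_conv)
      qed
      have "i = i'" using aux[of i i'] aux[of i' i] g3 a by (cases "i \<le> i'") auto
      then show "x = x'" using 1 g(2) x by simp
    qed
    then show ?thesis using cardI by (simp add: card_image card_cartesian_product)
  qed
  have torus_sub: "?T v \<subseteq> O' j" if v: "v \<in> O' j" for v j
  proof
    fix w assume "w \<in> ?T v"
    then obtain s i where s: "s \<in> \<int>" "s \<noteq> 0" and w: "w = (s / g ^ i * fst v, s * g ^ (2 * i) * snd v)" by auto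
    have "smul s (act (\<tau> [^]\<^bsub>A\<^esub> i) v) \<in> O' j"
      using v s \<tau>_B[of i] BN unfolding O'_def by (intro Sat_closed) auto
    moreover have "smul s (act (\<tau> [^]\<^bsub>A\<^esub> i) v) = w"
      unfolding w by (cases v) (simp add: act_def \<tau>_pow mult.assoc)
    ultimately show "w \<in> O' j" by simp
  qed
  have e1O: "e1 \<in> O' 0" unfolding O'_def D0 act_one by (rule Sat_self)
  have scale: "smul s v \<in> O' j" if "v \<in> O' j" "s \<in> \<int>" "s \<noteq> 0" for s v j
    using Sat_closed[of v _ s "\<one>\<^bsub>A\<^esub>"] that Ncl(3) unfolding O'_def by (simp add: act_one)
  \<comment> \<open>The first axis belongs to O' 0, so the other two sets avoid it. If both stayed
    on the axes, both would contain (0, 1).\<close>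
  have "\<exists>j\<in>{1,2}. \<exists>v\<in>O' j. fst v \<noteq> 0 \<and> snd v \<noteq> 0"
  proof (rule ccontr)
    assume no: "\<not> ?thesis"
    have "(0, 1) \<in> O' j" if j: "j \<in> {1,2}" for j
    proof -
      have v: "act (D j) e1 \<in> O' j" unfolding O'_def by (rule Sat_self)
      obtain x y where xy: "act (D j) e1 = (x, y)" by (cases "act (D j) e1")
      have I: "x \<in> \<int>" "y \<in> \<int>" "(x, y) \<noteq> (0, 0)" using v OV[of j] xy by auto
      have "y \<noteq> 0"
      proof
        assume "y = 0"
        then have "x \<noteq> 0" using I by auto
        then have "smul (1 / x) (x, y) \<in> O' j" using scale[of "(x, y)" j "1 / x"] v xy I by simp
        then have "e1 \<in> O' j" using \<open>y = 0\<close> \<open>x \<noteq> 0\<close> by simp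
        moreover have "O' 0 \<inter> O' j = {}" using disj[of 0 j] j by auto
        ultimately show False using e1O by blast
      qed
      moreover from this have "x = 0" using no j v xy by auto
      ultimately have "smul (1 / y) (x, y) \<in> O' j" using scale[of "(x, y)" j "1 / y"] v xy I by simp
      then show ?thesis using \<open>y \<noteq> 0\<close> \<open>x = 0\<close> by simp
    qed
    then have "(0, 1) \<in> O' 1" "(0, 1) \<in> O' 2" by auto
    then show False using disj[of 1 2] by auto
  qed
  then obtain j v where v: "v \<in> O' j" "fst v \<noteq> 0" "snd v \<noteq> 0" by blast
  have m_ge: "(p - 1) * r \<le> m"
    using card_mono[OF finO torus_sub[OF v(1)]] torus[OF v(2,3)] cardO[of j] by (simp add: m_def)
  have p2: "p = 3 * r + 1" using r prime_gt_1_nat[OF p] by simp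
  \<comment> \<open>A vector of O' 0 off the axes would add a whole torus orbit to the p - 1 vectors
    of the first axis. Three sets of that size do not fit: with p = 3 r + 1 the bound would read 9
    r^2 + 9 r \<le> 9 r^2 + 6 r.\<close>
  have axes: "fst w = 0 \<or> snd w = 0" if w: "w \<in> O' 0" for w
  proof (rule ccontr)
    assume "\<not> ?thesis"
    then have nz: "fst w \<noteq> 0" "snd w \<noteq> 0" by auto
    let ?L = "(\<lambda>s. smul s e1) ` (\<int> - {0})"
    have "card ?L = p - 1" using cardI by (subst card_image) (auto intro: inj_onI)
    moreover have "?L \<inter> ?T w = {}" using nz g(2) by auto
    moreover have "?L \<subseteq> O' 0" using scale[OF e1O] by auto
    ultimately have "(p - 1) + (p - 1) * r \<le> m"
      using card_mono[OF finO, of "?L \<union> ?T w" 0] torus_sub[OF w] torus[OF nz] finI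
      by (simp add: card_Un_disjoint m_def)
    then have "3 * (3 * r + 3 * r * r) \<le> (3 * r + 1) * (3 * r + 1) - 1" using m_le p2 by simp
    then show False using r0 by (simp add: algebra_simps)
  qed
  let ?L1 = "(\<lambda>s. (s, 0)) ` (\<int> - {0}) :: ('k \<times> 'k) set" and ?L2 = "(\<lambda>s. (0, s)) ` (\<int> - {0}) :: ('k \<times> 'k) set"
  have Osub: "O' 0 \<subseteq> ?L1 \<union> ?L2"
  proof
    fix w assume w: "w \<in> O' 0"
    then have "w \<in> ?V" using OV by blast
    then show "w \<in> ?L1 \<union> ?L2" using axes[OF w] by (cases w) auto
  qed
  have cL: "card (?L1 \<union> ?L2) \<le> 2 * (p - 1)"
  proof -
    have "card ?L1 \<le> p - 1" "card ?L2 \<le> p - 1" using finI unfolding cardI[symmetric] by (intro card_image_le; simp)+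
    then show ?thesis using card_Un_le[of ?L1 ?L2] by linarith
  qed
  have m_le2: "m \<le> card (?L1 \<union> ?L2)" unfolding m_def using Osub finI by (intro card_mono) auto
  \<comment> \<open>O' 0 has at least (p - 1) r and at most 2 (p - 1) vectors, so r is 1 or 2, and r
    = 1 would give p = 4. For r = 2 the bounds coincide and O' 0 fills both axes.\<close>
  then have "(p - 1) * r \<le> (p - 1) * 2" using m_ge cL by linarith
  then have "r \<le> 2" using prime_gt_1_nat[OF p] by simp
  then have p7: "p = 7" using p2 r0 p_odd by (cases "r = 1"; cases "r = 2") auto
  then have r2: "r = 2" using p2 by simp
  have Oeq: "O' 0 = ?L1 \<union> ?L2"
    using Osub m_ge cL finI r2 by (intro card_seteq) (auto simp: m_def)
  have g6: "g ^ 6 = 1" using g(4)[of 6] p7 by simp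
  have "g ^ 3 \<noteq> 1" using g(4)[of 3] p7 by simp
  moreover have "(g ^ 3) * (g ^ 3) = 1" using g6 by (simp flip: power_add)
  then have "g ^ 3 = 1 \<or> g ^ 3 = - 1" by (rule iffD1[OF square_eq_1_iff])
  ultimately have g3: "g ^ 3 = - 1" by blast
  \<comment> \<open>For p = 7 the cube of g is -1, and the cube of \<tau> is the reflection diag(-1,
    1).\<close>
  define t where "t = \<tau> [^]\<^bsub>A\<^esub> (3::nat)"
  have t: "t \<in> carrier A" "\<rho> t = M2 (- 1) 0 0 1" "t \<in> N"
    using \<tau>(1) \<tau>_pow[of 3] g3 g6 \<tau>_B[of 3] BN by (auto simp: t_def)
  \<comment> \<open>Conjugates of t lie in N and therefore preserve the pair of axes. If the
    conjugate by x fixed the first axis, x^-1 would carry that axis to an eigenline of t, which is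
    an axis and lies in O' 0; this would put x into N.\<close>
  have anti: "\<exists>b c. \<rho> (x \<otimes>\<^bsub>A\<^esub> t \<otimes>\<^bsub>A\<^esub> inv\<^bsub>A\<^esub> x) = M2 0 b c 0 \<and> b \<in> \<int> \<and> c \<in> \<int> \<and> b * c = 1"
    if x: "x \<in> carrier A" "x \<notin> N" for x
  proof -
    let ?y = "x \<otimes>\<^bsub>A\<^esub> t \<otimes>\<^bsub>A\<^esub> inv\<^bsub>A\<^esub> x"
    have y: "?y \<in> N" using normal x t by blast
    obtain a b c e where m: "\<rho> ?y = M2 a b c e" by (cases "\<rho> ?y")
    have I: "b \<in> \<int>" "c \<in> \<int>" using \<rho>_Ints[of ?y] y m by auto
    have "?y \<otimes>\<^bsub>A\<^esub> x = x \<otimes>\<^bsub>A\<^esub> t" using x t by (simp add: A.m_assoc)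
    then have "\<rho> ?y \<star> \<rho> x = \<rho> x \<star> \<rho> t" using \<rho>_mult[OF Nc[OF y] x(1)] \<rho>_mult[OF x(1) t(1)] by simp
    from arg_cong[OF this, of mdet] have "mdet (\<rho> ?y) * mdet (\<rho> x) = (- 1) * mdet (\<rho> x)" using t(2) by (simp add: mdet_mult)
    then have "mdet (\<rho> ?y) = - 1" using \<rho>_det_nz[OF x(1)] by (metis mult_right_cancel)
    then have det: "a * e - b * c = - 1" using m by simp
    have pres: "smul 1 (act ?y w) \<in> O' 0" if "w \<in> O' 0" for w
      using that y unfolding O'_def by (intro Sat_closed) auto
    have "c \<noteq> 0"
    proof
      assume "c = 0"
      obtain w1 w2 where w: "act (inv\<^bsub>A\<^esub> x) e1 = (w1, w2)" by (cases "act (inv\<^bsub>A\<^esub> x) e1")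
      have "act ?y e1 = smul a e1" using m \<open>c = 0\<close> by (simp add: act_def)
      moreover have "act ?y e1 = act x (act t (act (inv\<^bsub>A\<^esub> x) e1))" using x t by (simp add: act_mult)
      ultimately have "act t (act (inv\<^bsub>A\<^esub> x) e1) = act (inv\<^bsub>A\<^esub> x) (smul a e1)" using x act_inv(1)[OF x(1)] by metis
      also have "\<dots> = smul a (act (inv\<^bsub>A\<^esub> x) e1)" by (rule act_smul)
      finally have "- w1 = a * w1" "w2 = a * w2" using t w by (simp_all add: act_def)
      have "w1 = 0 \<or> w2 = 0"
      proof (rule ccontr)
        assume nz: "\<not> ?thesis"
        have "a = 1" using \<open>w2 = a * w2\<close> nz by simp
        then have "- w1 = w1" using \<open>- w1 = a * w1\<close> by (simp only: mult_1)
        then have "w1 + w1 = 0" by (metis add.right_inverse)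
        then have "2 * w1 = 0" by (simp only: mult_2)
        then show False using nz two_neq_zero[OF p char p_odd] by simp
      qed
      moreover have "act (inv\<^bsub>A\<^esub> x) e1 \<in> ?V" using act_Ints[of "inv\<^bsub>A\<^esub> x" e1] act_nonzero[of "inv\<^bsub>A\<^esub> x" e1] x by auto
      ultimately have "act (inv\<^bsub>A\<^esub> x) e1 \<in> O' 0" unfolding Oeq using w by auto
      then obtain s n where n: "s \<in> \<int>" "s \<noteq> 0" "n \<in> N" "act (inv\<^bsub>A\<^esub> x) e1 = smul s (act (n \<otimes>\<^bsub>A\<^esub> D 0) e1)"
        using in_O by blast
      then have "smul 1 (act (inv\<^bsub>A\<^esub> x) e1) = smul s (act n e1)" using D0 by simp
      then have "inv\<^bsub>A\<^esub> (inv\<^bsub>A\<^esub> x) \<otimes>\<^bsub>A\<^esub> n \<in> N" using x n by (intro proj[of _ _ 1 s]) auto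
      then have "x \<otimes>\<^bsub>A\<^esub> n \<otimes>\<^bsub>A\<^esub> inv\<^bsub>A\<^esub> n \<in> N" using x n Ncl by simp
      then show False using x n by (simp add: A.m_assoc)
    qed
    moreover have "smul 1 (act ?y e1) \<in> ?L1 \<union> ?L2" using pres[OF e1O] Oeq by simp
    ultimately have a0: "a = 0" using m by (auto simp: act_def)
    have "b \<noteq> 0" using det a0 by auto
    moreover have "(0, 1) \<in> O' 0" unfolding Oeq by auto
    then have "smul 1 (act ?y (0, 1)) \<in> ?L1 \<union> ?L2" using pres Oeq by blast
    ultimately have "e = 0" using m by (auto simp: act_def)
    then show ?thesis using m a0 I det by auto
  qed
  define t1 where "t1 = d \<otimes>\<^bsub>A\<^esub> t \<otimes>\<^bsub>A\<^esub> inv\<^bsub>A\<^esub> d"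
  define t2 where "t2 = D 2 \<otimes>\<^bsub>A\<^esub> t \<otimes>\<^bsub>A\<^esub> inv\<^bsub>A\<^esub> (D 2)"
  have tc: "t1 \<in> carrier A" "t2 \<in> carrier A" using d t by (auto simp: t1_def t2_def)
  obtain b c where bc: "\<rho> t1 = M2 0 b c 0" "b \<in> \<int>" "c \<in> \<int>" "b * c = 1" using anti[OF d(1) dN] unfolding t1_def by blast
  obtain b' c' where bc': "\<rho> t2 = M2 0 b' c' 0" "b' \<in> \<int>" "c' \<in> \<int>" using anti[OF Dc D2] unfolding t2_def by blast
  have t2': "t2 = d \<otimes>\<^bsub>A\<^esub> t1 \<otimes>\<^bsub>A\<^esub> inv\<^bsub>A\<^esub> d"
    unfolding t1_def t2_def D_def using d t by (simp add: numeral_2_eq_2 A.m_assoc A.inv_mult_group)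
  \<comment> \<open>The antidiagonal involution t1 anticommutes with t. Transporting this relation
    by d, which takes t to t1 and t1 to t2, gives the same relation between t2 and t1; in matrix
    entries it makes -1 a square modulo 7.\<close>
  have u: "\<rho> (t1 \<otimes>\<^bsub>A\<^esub> t \<otimes>\<^bsub>A\<^esub> t1) = mneg (\<rho> t)" using bc t tc by (simp add: \<rho>_mult mult.commute)
  have "t2 \<otimes>\<^bsub>A\<^esub> t1 \<otimes>\<^bsub>A\<^esub> t2 = d \<otimes>\<^bsub>A\<^esub> (t1 \<otimes>\<^bsub>A\<^esub> t \<otimes>\<^bsub>A\<^esub> t1) \<otimes>\<^bsub>A\<^esub> inv\<^bsub>A\<^esub> d"
  proof -
    have "t2 \<otimes>\<^bsub>A\<^esub> t1 \<otimes>\<^bsub>A\<^esub> t2 = (d \<otimes>\<^bsub>A\<^esub> t1 \<otimes>\<^bsub>A\<^esub> inv\<^bsub>A\<^esub> d) \<otimes>\<^bsub>A\<^esub> (d \<otimes>\<^bsub>A\<^esub> t \<otimes>\<^bsub>A\<^esub> inv\<^bsub>A\<^esub> d) \<otimes>\<^bsub>A\<^esub> (d \<otimes>\<^bsub>A\<^esub> t1 \<otimes>\<^bsub>A\<^esub> inv\<^bsub>A\<^esub> d)"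
      unfolding t2' by (subst (2) t1_def) (rule refl)
    then show ?thesis using d t tc by (simp add: A.m_assoc)
  qed
  then have "\<rho> (t2 \<otimes>\<^bsub>A\<^esub> t1 \<otimes>\<^bsub>A\<^esub> t2) = \<rho> d \<star> \<rho> (t1 \<otimes>\<^bsub>A\<^esub> t \<otimes>\<^bsub>A\<^esub> t1) \<star> \<rho> (inv\<^bsub>A\<^esub> d)"
    by (simp only: \<rho>_mult A.m_closed A.inv_closed d(1) t(1) tc)
  also have "\<dots> = mneg (\<rho> d \<star> \<rho> t \<star> \<rho> (inv\<^bsub>A\<^esub> d))" by (simp only: u mneg_mult)
  also have "\<rho> d \<star> \<rho> t \<star> \<rho> (inv\<^bsub>A\<^esub> d) = \<rho> t1"
    by (simp only: t1_def \<rho>_mult A.m_closed A.inv_closed d(1) t(1))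
  finally have "\<rho> t2 \<star> \<rho> t1 \<star> \<rho> t2 = mneg (\<rho> t1)" by (simp only: \<rho>_mult A.m_closed tc)
  then have "b' * c * b' = - b" unfolding bc(1) bc'(1) by simp
  then have "(b' * c * b') * c = - (b * c)" by simp
  then have "(b' * c) * (b' * c) = - 1" unfolding bc(4) by (simp only: mult.assoc)
  then have sq: "(b' * c)\<^sup>2 = - 1" by (simp only: power2_eq_square)
  have "b' * c \<in> \<int>" using bc(3) bc'(2) by simp
  moreover have "b' * c \<noteq> 0"
  proof
    assume "b' * c = 0"
    then have "(b' * c)\<^sup>2 = 0\<^sup>2" by (rule arg_cong)
    then have "(- 1 :: 'k) = 0" unfolding sq by simp
    then show False by simp
  qed
  ultimately have "(b' * c) ^ (p - 1) = 1" by (rule Ints_fermat[OF p char])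
  then have "(b' * c) ^ 6 = 1" unfolding p7 by simp
  moreover have "(b' * c) ^ 6 = ((b' * c)\<^sup>2) ^ 3" by (simp flip: power_mult)
  ultimately have "(- 1 :: 'k) = 1" unfolding sq by simp
  then show False using two_neq_zero[OF p char p_odd] by (metis add.inverse_inverse neg_eq_iff_add_eq_0 one_add_one)
qed

end

section \<open>Commuting lifts and dihedral groups\<close>

context central_extension
begin

lemma commuting_liftsD:
  "commuting_lifts x y \<Longrightarrow> e \<in> carrier E \<Longrightarrow> e' \<in> carrier E \<Longrightarrow> \<pi> e = x \<Longrightarrow> \<pi> e' = y \<Longrightarrow> e \<otimes> e' = e' \<otimes> e"
  unfolding commuting_lifts_def by blast

lemma commuting_lifts_sym: "commuting_lifts x y \<Longrightarrow> commuting_lifts y x"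
  unfolding commuting_lifts_def by (intro ballI impI) (rule sym, blast)

text \<open>For fixed z, the elements whose lifts commute with the lifts of z form a subgroup, which
  is normal when z is central in A; this and the next facts supply the pieces.\<close>

lemma commuting_lifts_mult:
  assumes "x \<in> carrier A" "y \<in> carrier A" "z \<in> carrier A" "commuting_lifts z x" "commuting_lifts z y"
  shows "commuting_lifts z (x \<otimes>\<^bsub>A\<^esub> y)"
proof -
  obtain e f h where e: "e \<in> carrier E" "\<pi> e = x" "f \<in> carrier E" "\<pi> f = y" "h \<in> carrier E" "\<pi> h = z"
    using lift_exists assms by metis
  have 1: "h \<otimes> e = e \<otimes> h" "h \<otimes> f = f \<otimes> h" using commuting_liftsD assms e by blast+
  have "h \<otimes> (e \<otimes> f) = (h \<otimes> e) \<otimes> f" using e by (simp add: E.m_assoc)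
  also have "\<dots> = e \<otimes> (h \<otimes> f)" unfolding 1(1) using e by (simp add: E.m_assoc)
  also have "\<dots> = (e \<otimes> f) \<otimes> h" unfolding 1(2) using e by (simp add: E.m_assoc)
  finally show ?thesis using commuting_liftsI[of h "e \<otimes> f"] e by simp
qed

lemma commuting_lifts_conj:
  assumes "a \<in> carrier A" "x \<in> carrier A" "y \<in> carrier A" "commuting_lifts x y"
  shows "commuting_lifts (a \<otimes>\<^bsub>A\<^esub> x \<otimes>\<^bsub>A\<^esub> inv\<^bsub>A\<^esub> a) (a \<otimes>\<^bsub>A\<^esub> y \<otimes>\<^bsub>A\<^esub> inv\<^bsub>A\<^esub> a)"
proof -
  obtain e f h where e: "e \<in> carrier E" "\<pi> e = x" "f \<in> carrier E" "\<pi> f = y" "h \<in> carrier E" "\<pi> h = a"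
    using lift_exists assms by metis
  have 1: "e \<otimes> f = f \<otimes> e" using commuting_liftsD assms e by blast
  have "(h \<otimes> e \<otimes> inv h) \<otimes> (h \<otimes> f \<otimes> inv h) = h \<otimes> (e \<otimes> f) \<otimes> inv h" using e by (simp add: E.m_assoc)
  also have "\<dots> = (h \<otimes> f \<otimes> inv h) \<otimes> (h \<otimes> e \<otimes> inv h)" unfolding 1 using e by (simp add: E.m_assoc)
  finally show ?thesis using commuting_liftsI[of "h \<otimes> e \<otimes> inv h" "h \<otimes> f \<otimes> inv h"] e by simp
qed

lemma commuting_lifts_inv:
  assumes "x \<in> carrier A" "z \<in> carrier A" "commuting_lifts z x"
  shows "commuting_lifts z (inv\<^bsub>A\<^esub> x)"
proof -
  obtain e h where e: "e \<in> carrier E" "\<pi> e = x" "h \<in> carrier E" "\<pi> h = z"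
    using lift_exists assms by metis
  have "h \<otimes> e = e \<otimes> h" using commuting_liftsD assms e by blast
  then have "inv e \<otimes> (h \<otimes> e) \<otimes> inv e = inv e \<otimes> (e \<otimes> h) \<otimes> inv e" by simp
  then have "inv e \<otimes> h = h \<otimes> inv e" using e by (simp add: E.m_assoc)
  then show ?thesis using commuting_liftsI[of h "inv e"] e by simp
qed

lemma commuting_lifts_one: "x \<in> carrier A \<Longrightarrow> commuting_lifts x \<one>\<^bsub>A\<^esub>"
  using lift_exists[of x] commuting_liftsI[of _ "\<one>"] by auto

text \<open>The commutator of lifts of z and x is a scalar u. As z has a lift with trivial n-th
  power, u^n = 1, and u^n is the commutator with the n-th power of the lift of x.\<close>

lemma commuting_lifts_pow_order:
  assumes z: "z \<in> carrier A" "z [^]\<^bsub>A\<^esub> n = \<one>\<^bsub>A\<^esub>" "n > 0" and x: "x \<in> carrier A" "z \<otimes>\<^bsub>A\<^esub> x = x \<otimes>\<^bsub>A\<^esub> z"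
  shows "commuting_lifts z (x [^]\<^bsub>A\<^esub> (n::nat))"
proof -
  obtain h where h: "h \<in> carrier E" "\<pi> h = z" "h [^] n = \<one>" using lift_of_order z by metis
  obtain e where e: "e \<in> carrier E" "\<pi> e = x" using lift_exists x by blast
  obtain u where u: "u \<noteq> 0" "h \<otimes> e = \<iota> u \<otimes> (e \<otimes> h)"
    using same_image[of "e \<otimes> h" "h \<otimes> e"] e h x by auto
  have 1: "h [^] k \<otimes> e = \<iota> (u ^ k) \<otimes> (e \<otimes> h [^] k)" for k :: nat
  proof (induction k)
    case (Suc k)
    have "h [^] Suc k \<otimes> e = h [^] k \<otimes> (h \<otimes> e)" using h e by (simp add: E.m_assoc)
    also have "\<dots> = (h [^] k \<otimes> \<iota> u) \<otimes> (e \<otimes> h)" unfolding u(2) using h e u(1) by (simp add: E.m_assoc)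
    also have "h [^] k \<otimes> \<iota> u = \<iota> u \<otimes> h [^] k" using h u(1) by (intro \<iota>_central) auto
    also have "\<iota> u \<otimes> h [^] k \<otimes> (e \<otimes> h) = \<iota> u \<otimes> (h [^] k \<otimes> e) \<otimes> h" using h e u(1) by (simp add: E.m_assoc)
    also have "\<dots> = \<iota> u \<otimes> \<iota> (u ^ k) \<otimes> (e \<otimes> (h [^] k \<otimes> h))" unfolding Suc using h e u(1) by (simp add: E.m_assoc)
    finally show ?case using u(1) by (simp add: \<iota>_mult)
  qed (use e in simp)
  have 2: "h \<otimes> e [^] k = \<iota> (u ^ k) \<otimes> (e [^] k \<otimes> h)" for k :: nat
  proof (induction k)
    case (Suc k)
    have "h \<otimes> e [^] Suc k = (h \<otimes> e [^] k) \<otimes> e" using h e by (simp add: E.m_assoc)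
    also have "\<dots> = \<iota> (u ^ k) \<otimes> e [^] k \<otimes> (h \<otimes> e)" unfolding Suc using h e u(1) by (simp add: E.m_assoc)
    also have "\<dots> = \<iota> (u ^ k) \<otimes> (e [^] k \<otimes> \<iota> u) \<otimes> (e \<otimes> h)" unfolding u(2) using h e u(1) by (simp add: E.m_assoc)
    also have "e [^] k \<otimes> \<iota> u = \<iota> u \<otimes> e [^] k" using e u(1) by (intro \<iota>_central) auto
    also have "\<iota> (u ^ k) \<otimes> (\<iota> u \<otimes> e [^] k) \<otimes> (e \<otimes> h) = (\<iota> (u ^ k) \<otimes> \<iota> u) \<otimes> (e [^] k \<otimes> e \<otimes> h)"
      using h e u(1) by (simp add: E.m_assoc)
    finally show ?case using u(1) by (simp add: \<iota>_mult[symmetric] mult.commute)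
  qed (use h in simp)
  have "e = \<iota> (u ^ n) \<otimes> e" using 1[of n] h(3) e by simp
  then have "\<iota> (u ^ n) = \<one>" using e u(1) by (metis E.r_cancel_one' \<iota>_closed power_not_zero)
  then have "h \<otimes> e [^] n = e [^] n \<otimes> h" using 2[of n] e h by simp
  then show ?thesis using commuting_liftsI[of h "e [^] n"] e h by (simp add: \<pi>.hom_nat_pow)
qed

text \<open>Dihedral and semidihedral groups: after rescaling, the lifts satisfy \<open>t c t\<^sup>-\<^sup>1 = c\<^sup>M\<close>, and then
  \<open>c\<^sup>N\<close> is a scalar of odd order, which a further rescaling removes.\<close>
lemma split_dihedral:
  fixes N :: nat
  assumes c: "c \<in> carrier A" "\<And>i::nat. c [^]\<^bsub>A\<^esub> i = \<one>\<^bsub>A\<^esub> \<longleftrightarrow> N dvd i"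
    and t: "t \<in> carrier A" "t \<otimes>\<^bsub>A\<^esub> t = \<one>\<^bsub>A\<^esub>" "\<And>i::nat. t \<noteq> c [^]\<^bsub>A\<^esub> i"
    and tc: "t \<otimes>\<^bsub>A\<^esub> c \<otimes>\<^bsub>A\<^esub> inv\<^bsub>A\<^esub> t = c [^]\<^bsub>A\<^esub> (2 * o' + 1)"
    and N: "N = 2 * N'" "N' > 0" "coprime N o'" "o' > 0"
    and com: "commuting_lifts t (c [^]\<^bsub>A\<^esub> N')"
  shows "splits {c [^]\<^bsub>A\<^esub> i \<otimes>\<^bsub>A\<^esub> t [^]\<^bsub>A\<^esub> j |(i::nat) (j::nat). True}"
proof -
  let ?M = "2 * o' + 1"
  have "t [^]\<^bsub>A\<^esub> (2::nat) = \<one>\<^bsub>A\<^esub>" using t by (simp add: numeral_2_eq_2)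
  then obtain T where T: "T \<in> carrier E" "\<pi> T = t" "T [^] (2::nat) = \<one>" using lift_of_order[of t 2] t by auto
  obtain C where C: "C \<in> carrier E" "\<pi> C = c" using lift_exists c by blast
  have sc: "T \<otimes> (\<iota> u \<otimes> e) \<otimes> inv T = \<iota> u \<otimes> (T \<otimes> e \<otimes> inv T)" if "u \<noteq> 0" "e \<in> carrier E" for u e
  proof -
    have "T \<otimes> (\<iota> u \<otimes> e) \<otimes> inv T = (T \<otimes> \<iota> u) \<otimes> e \<otimes> inv T" using that T by (simp add: E.m_assoc)
    also have "T \<otimes> \<iota> u = \<iota> u \<otimes> T" using that T by (intro \<iota>_central)
    finally show ?thesis using that T by (simp add: E.m_assoc)
  qed
  obtain \<kappa> where \<kappa>: "\<kappa> \<noteq> 0" "T \<otimes> C \<otimes> inv T = \<iota> \<kappa> \<otimes> C [^] ?M"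
    using same_image[of "C [^] ?M" "T \<otimes> C \<otimes> inv T"] C T tc by (auto simp: \<pi>.hom_nat_pow simp del: E.nat_pow_Suc)
  \<comment> \<open>Scaling C by \<eta> changes the two sides by \<eta> and \<eta>^(2 o' + 1), so
    \<eta>^(2 o') has to absorb \<kappa>.\<close>
  obtain \<eta> where \<eta>: "\<eta> \<noteq> 0" "\<eta> ^ (2 * o') = \<kappa>" using root_exists[of \<kappa> "2 * o'"] \<kappa> N by auto
  define C1 where "C1 = \<iota> \<eta> \<otimes> C"
  have C1: "C1 \<in> carrier E" "\<pi> C1 = c" using C \<eta> c by (auto simp: C1_def)
  have TC1: "T \<otimes> C1 \<otimes> inv T = C1 [^] ?M"
  proof -
    have "T \<otimes> C1 \<otimes> inv T = \<iota> \<eta> \<otimes> (\<iota> \<kappa> \<otimes> C [^] ?M)" unfolding C1_def using sc C \<eta> \<kappa>(2) by simp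
    also have "\<dots> = \<iota> (\<eta> * \<kappa>) \<otimes> C [^] ?M" using \<eta>(1) \<kappa>(1) C by (simp add: \<iota>_mult E.m_assoc del: E.nat_pow_Suc)
    also have "\<eta> * \<kappa> = \<eta> ^ ?M" using \<eta> by simp
    finally show ?thesis unfolding C1_def using scaled_pow[OF \<eta>(1) C(1), of ?M] by simp
  qed
  \<comment> \<open>Z lies over the involution \<open>c [^] N'\<close>, whose lifts commute with T
    by hypothesis. So Z equals its power with exponent 2 o' + 1, and the scalar
    \<open>C1 [^] N\<close>, the square of Z, has order dividing o'.\<close>
  define Z where "Z = C1 [^] N'"
  have Z: "Z \<in> carrier E" "\<pi> Z = c [^]\<^bsub>A\<^esub> N'" using C1 by (auto simp: Z_def \<pi>.hom_nat_pow)
  have "T \<otimes> Z = Z \<otimes> T" using commuting_liftsD[OF com] T Z by blast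
  then have "T \<otimes> Z \<otimes> inv T = Z" using T Z by (simp add: E.m_assoc)
  moreover have "T \<otimes> Z \<otimes> inv T = Z [^] ?M"
  proof -
    have "T \<otimes> Z \<otimes> inv T = (T \<otimes> C1 \<otimes> inv T) [^] N'" unfolding Z_def using T C1 by (simp only: E.conj_pow)
    also have "\<dots> = Z [^] ?M" unfolding TC1 Z_def using C1(1) by (simp only: E.nat_pow_pow mult.commute)
    finally show ?thesis .
  qed
  ultimately have "Z [^] (2 * o') \<otimes> Z = \<one> \<otimes> Z" using Z by (simp add: E.nat_pow_Suc)
  then have Zo: "Z [^] (2 * o') = \<one>" using Z by simp
  have "\<pi> (C1 [^] N) = \<one>\<^bsub>A\<^esub>" using C1 c(2)[of N] by (simp add: \<pi>.hom_nat_pow)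
  then obtain s where s: "s \<noteq> 0" "C1 [^] N = \<iota> s" using \<pi>_ker C1 by blast
  have "\<iota> (s ^ o') = (C1 [^] N) [^] o'" using s by (simp add: \<iota>_pow)
  also have "\<dots> = Z [^] (2 * o')" unfolding Z_def N(1) using C1(1) by (simp add: E.nat_pow_pow ac_simps)
  finally have so: "s ^ o' = 1" using Zo \<iota>_one_iff[of "s ^ o'"] s(1) by simp
  \<comment> \<open>N is invertible modulo o', so a power of s is an N-th root of the inverse of s.
    Scaling by it keeps the conjugation relation, because that power has order dividing o'
    too.\<close>
  obtain j where j: "s ^ (j * N + 1) = 1"
  proof -
    obtain x y where xy: "N * x = o' * y + 1" using N(3,4) bezout_nat[of N o'] N(1,2)
      by (metis bezout_nat coprime_imp_gcd_eq_1 mult_eq_0_iff neq0_conv zero_neq_numeral)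
    have "s ^ (((o' - 1) * x) * N + 1) = (s ^ (N * x)) ^ (o' - 1) * s" by (simp add: power_mult[symmetric] ac_simps)
    also have "s ^ (N * x) = s" unfolding xy by (simp add: power_add power_mult so)
    also have "s ^ (o' - 1) * s = s ^ o'" using N(4) by (simp flip: power_Suc2)
    finally show ?thesis using that so by metis
  qed
  define C2 where "C2 = \<iota> (s ^ j) \<otimes> C1"
  have C2: "C2 \<in> carrier E" "\<pi> C2 = c" using C1 s c by (auto simp: C2_def)
  have C2N: "C2 [^] N = \<one>"
  proof -
    have "C2 [^] N = \<iota> ((s ^ j) ^ N) \<otimes> \<iota> s" unfolding C2_def using scaled_pow[of "s ^ j" C1 N] s C1 by simp
    also have "\<dots> = \<iota> (s ^ (j * N + 1))" using s(1) by (simp add: \<iota>_mult[symmetric] power_mult[symmetric] mult.commute)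
    finally show ?thesis using j by simp
  qed
  have TC2: "T \<otimes> C2 \<otimes> inv T = C2 [^] ?M"
  proof -
    have "(s ^ j) ^ ?M = s ^ j * (s ^ o') ^ (2 * j)" by (simp add: power_add power_mult[symmetric] ac_simps)
    then have sj: "(s ^ j) ^ ?M = s ^ j" using so by simp
    have "T \<otimes> C2 \<otimes> inv T = \<iota> (s ^ j) \<otimes> C1 [^] ?M" unfolding C2_def using sc[of "s ^ j" C1] C1(1) s(1) TC1 by simp
    also have "\<dots> = C2 [^] ?M" unfolding C2_def using scaled_pow[of "s ^ j" C1 ?M] C1(1) s(1) sj by simp
    finally show ?thesis .
  qed
  have S1: "split_lift {C2 [^] i |i::nat. True}"
    using C2 C2N N c(2) by (intro split_lift_cyclic[of C2 N]) (auto dest: nat_dvd_not_less)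
  have S: "split_lift {s \<otimes> T [^] i |s (i::nat). s \<in> {C2 [^] i |i::nat. True}}" (is "split_lift ?S")
  proof (rule split_lift_cyclic_extension[OF S1 T(1), of 2])
    show "T [^] (2::nat) \<in> {C2 [^] i |i::nat. True}" unfolding T(3) by (intro CollectI exI[of _ "0::nat"]) simp
    fix x assume "x \<in> {C2 [^] i |i::nat. True}"
    then obtain i :: nat where i: "x = C2 [^] i" by blast
    have "T \<otimes> x \<otimes> inv T = (C2 [^] ?M) [^] i" unfolding i TC2[symmetric] using T C2 by (simp only: E.conj_pow)
    also have "\<dots> = C2 [^] (?M * i)" using C2(1) by (simp only: E.nat_pow_pow)
    finally show "T \<otimes> x \<otimes> inv T \<in> {C2 [^] i |i::nat. True}" by blast
  next
    fix i :: nat assume "0 < i" "i < 2"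
    then have i: "i = 1" by simp
    show "\<pi> (T [^] i) \<notin> \<pi> ` {C2 [^] i |i::nat. True}"
    proof
      assume "\<pi> (T [^] i) \<in> \<pi> ` {C2 [^] i |i::nat. True}"
      then obtain k :: nat where "t = \<pi> (C2 [^] k)" using i T by auto
      then show False using t(3)[of k] C2 by (simp add: \<pi>.hom_nat_pow)
    qed
  qed simp
  have "\<pi> ` ?S = {c [^]\<^bsub>A\<^esub> i \<otimes>\<^bsub>A\<^esub> t [^]\<^bsub>A\<^esub> j |(i::nat) (j::nat). True}"
  proof -
    have eq: "\<pi> (C2 [^] i \<otimes> T [^] j) = c [^]\<^bsub>A\<^esub> i \<otimes>\<^bsub>A\<^esub> t [^]\<^bsub>A\<^esub> j" for i j :: nat using C2 T by (simp add: \<pi>.hom_nat_pow)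
    show ?thesis
    proof (intro equalityI subsetI)
      fix x assume "x \<in> \<pi> ` ?S"
      then show "x \<in> {c [^]\<^bsub>A\<^esub> i \<otimes>\<^bsub>A\<^esub> t [^]\<^bsub>A\<^esub> j |(i::nat) (j::nat). True}" using eq by blast
    next
      fix x assume "x \<in> {c [^]\<^bsub>A\<^esub> i \<otimes>\<^bsub>A\<^esub> t [^]\<^bsub>A\<^esub> j |(i::nat) (j::nat). True}"
      then obtain i j :: nat where "x = \<pi> (C2 [^] i \<otimes> T [^] j)" using eq by auto
      then show "x \<in> \<pi> ` ?S" by blast
    qed
  qed
  then show ?thesis using S splits_iff by auto
qed

end

section \<open>Splitting over Sylow subgroups\<close>

context torus_extension
begin

lemma \<tau>_det: "mdet (\<rho> (\<tau> [^]\<^bsub>A\<^esub> (i::nat))) = g ^ i"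
  unfolding \<tau>_pow using g(2) by (simp add: power_mult power2_eq_square power_mult_distrib)

lemma \<tau>_pow_one: "\<tau> [^]\<^bsub>A\<^esub> (i::nat) = \<one>\<^bsub>A\<^esub> \<longleftrightarrow> (p - 1) dvd i"
proof
  assume "\<tau> [^]\<^bsub>A\<^esub> i = \<one>\<^bsub>A\<^esub>"
  then have "g ^ i = 1" using \<tau>_det[of i] by (simp add: \<rho>_one)
  then show "(p - 1) dvd i" using g(4) by blast
next
  assume "(p - 1) dvd i"
  then have "g ^ i = 1" "g ^ (2 * i) = 1" using g(4) by auto
  then have "\<rho> (\<tau> [^]\<^bsub>A\<^esub> i) = \<rho> \<one>\<^bsub>A\<^esub>" unfolding \<tau>_pow by (simp add: \<rho>_one)
  then show "\<tau> [^]\<^bsub>A\<^esub> i = \<one>\<^bsub>A\<^esub>" using \<tau>(1) by (intro \<rho>_eq) auto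
qed

lemma mat_neg_neq: "x \<in> carrier A \<Longrightarrow> \<rho> x \<noteq> mneg (\<rho> x)"
proof
  assume x: "x \<in> carrier A" "\<rho> x = mneg (\<rho> x)"
  obtain a b c d where m: "\<rho> x = M2 a b c d" by (cases "\<rho> x")
  have z: "y = 0" if "y = - y" for y :: 'k
  proof -
    have "y + y = 0" using that by (metis add.right_inverse)
    then have "2 * y = 0" by (simp only: mult_2)
    then show ?thesis using two_neq_zero[OF p char p_odd] by simp
  qed
  have "a = 0" "b = 0" "c = 0" "d = 0" using x(2) m by (auto intro: z)
  then show False using \<rho>_det_nz[OF x(1)] m by simp
qed

lemma prime_power_pow:
  assumes P: "subgroup P A" "card P = q ^ n" and x: "x \<in> P"
  shows "x [^]\<^bsub>A\<^esub> (q ^ n) = \<one>\<^bsub>A\<^esub>"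
proof -
  interpret P: group "A\<lparr>carrier := P\<rparr>" using P(1) by (rule subgroup.subgroup_is_group) (rule A.is_group)
  have "x [^]\<^bsub>A\<lparr>carrier := P\<rparr>\<^esub> Coset.order (A\<lparr>carrier := P\<rparr>) = \<one>\<^bsub>A\<lparr>carrier := P\<rparr>\<^esub>"
    using x by (intro P.pow_order_eq_1) simp
  then show ?thesis using P(2) by (simp add: Coset.order_def A.nat_pow_consistent[symmetric])
qed

text \<open>In the cyclic group generated by g, of order q^k m with m prime to q, the elements of
  q-power order are powers of g^m.\<close>

lemma Ints_prime_power_root:
  assumes a: "a \<in> \<int>" "a ^ (q ^ n) = 1" and q: "prime (q::nat)" and m: "p - 1 = q ^ k * m" "\<not> q dvd m"
  shows "\<exists>j. a = g ^ (m * j)"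
proof -
  have "q ^ n > 0" using prime_gt_0_nat[OF q] by simp
  then have "(0::'k) ^ (q ^ n) = 0" by (rule zero_power)
  then have "a \<noteq> 0" using a(2) by (metis zero_neq_one)
  then obtain i where i: "a = g ^ i" using a g(3) by blast
  then have "g ^ (i * q ^ n) = 1" using a(2) by (simp add: power_mult)
  then have "q ^ k * m dvd i * q ^ n" using g(4) m(1) by metis
  then have "m dvd i * q ^ n" by (metis dvd_mult_right)
  moreover have "coprime m (q ^ n)" using prime_imp_coprime[OF q m(2)] by (simp add: coprime_commute)
  ultimately have "m dvd i" by (simp add: coprime_dvd_mult_left_iff)
  then show ?thesis using i by blast
qed

lemma \<rho>_pow_det: "x \<in> carrier A \<Longrightarrow> mdet (\<rho> (x [^]\<^bsub>A\<^esub> (n::nat))) = mdet (\<rho> x) ^ n"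
  by (induction n) (simp_all add: \<rho>_one \<rho>_mult mdet_mult)

lemma det_Ints: "x \<in> carrier A \<Longrightarrow> mdet (\<rho> x) \<in> \<int>"
  using \<rho>_Ints[of x] by (cases "\<rho> x") auto

text \<open>Determinants in a q-subgroup are determinants of powers of the m-th power of \<tau>. A
  q-subgroup containing that element is thus the product of its determinant one part and a cyclic
  group.\<close>

lemma det_prime_power:
  assumes P: "subgroup P A" "card P = q ^ n" "x \<in> P" and q: "prime (q::nat)" and m: "p - 1 = q ^ k * m" "\<not> q dvd m"
  shows "\<exists>j. mdet (\<rho> x) = g ^ (m * j)"
proof (rule Ints_prime_power_root[OF _ _ q m])
  have x: "x \<in> carrier A" using subgroup.mem_carrier[OF P(1,3)] .
  show "mdet (\<rho> x) \<in> \<int>" using det_Ints x by blast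
  show "mdet (\<rho> x) ^ (q ^ n) = 1" using prime_power_pow[OF P] \<rho>_pow_det[OF x, of "q ^ n"] by (simp add: \<rho>_one)
qed

lemma diag_commute_B:
  assumes "x \<in> carrier A" "\<rho> x \<star> M2 u 0 0 v = M2 u 0 0 v \<star> \<rho> x" "u \<noteq> v"
  shows "x \<in> B"
proof -
  obtain a b c d where m: "\<rho> x = M2 a b c d" by (cases "\<rho> x")
  have "c * u = v * c" using assms(2) m by simp
  then have "c * (u - v) = 0" by (simp add: algebra_simps)
  then have "c = 0" using assms(3) by simp
  then show ?thesis using assms(1) m by blast
qed

text \<open>Commuting matrices act on a common eigenvector through a character, which is faithful in determinant one.\<close>
lemma det_one_cyclic:
  assumes Q: "subgroup Q A" "card Q = q ^ b" "prime (q::nat)"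
    and c: "\<not> mscalar c" "\<And>x. x \<in> Q \<Longrightarrow> \<rho> x \<star> c = c \<star> \<rho> x"
    and faith: "\<And>x v. x \<in> Q \<Longrightarrow> v \<noteq> (0, 0) \<Longrightarrow> mvec (\<rho> x) v = v \<Longrightarrow> x = \<one>\<^bsub>A\<^esub>"
  obtains d where "d \<in> Q" "Q = {d [^]\<^bsub>A\<^esub> i |i::nat. True}" "\<And>i::nat. d [^]\<^bsub>A\<^esub> i = \<one>\<^bsub>A\<^esub> \<longleftrightarrow> q ^ b dvd i"
proof -
  have Qc: "x \<in> carrier A" if "x \<in> Q" for x using Q(1) that by (rule subgroup.mem_carrier)
  obtain v \<mu> where v: "v \<noteq> (0, 0)" "\<And>x. x \<star> c = c \<star> x \<Longrightarrow> \<exists>\<mu>. mvec x v = (\<mu> * fst v, \<mu> * snd v)"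
    using common_eigenvector[OF c(1)] by metis
  define \<epsilon> where "\<epsilon> x = (SOME \<mu>. mvec (\<rho> x) v = (\<mu> * fst v, \<mu> * snd v))" for x
  have e: "mvec (\<rho> x) v = (\<epsilon> x * fst v, \<epsilon> x * snd v)" if "x \<in> Q" for x
    unfolding \<epsilon>_def by (rule someI_ex) (rule v(2)[OF c(2)[OF that]])
  have uniq: "\<nu> = \<nu>'" if "(\<nu> * fst v, \<nu> * snd v) = (\<nu>' * fst v, \<nu>' * snd v)" for \<nu> \<nu>'
    using that v(1) by (cases v) auto
  have mult: "\<epsilon> (x \<otimes>\<^bsub>A\<^esub> y) = \<epsilon> x * \<epsilon> y" if xy: "x \<in> Q" "y \<in> Q" for x y
  proof (rule uniq)
    have lin: "mvec (\<rho> x) (\<epsilon> y * fst v, \<epsilon> y * snd v) = (\<epsilon> y * fst (mvec (\<rho> x) v), \<epsilon> y * snd (mvec (\<rho> x) v))"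
      by (cases "\<rho> x"; cases v) (simp add: algebra_simps)
    have "mvec (\<rho> (x \<otimes>\<^bsub>A\<^esub> y)) v = mvec (\<rho> x) (mvec (\<rho> y) v)" using xy Qc by (simp add: \<rho>_mult mvec_mult)
    also have "\<dots> = (\<epsilon> x * \<epsilon> y * fst v, \<epsilon> x * \<epsilon> y * snd v)" unfolding e[OF xy(2)] lin e[OF xy(1)] by (simp add: ac_simps)
    finally show "(\<epsilon> (x \<otimes>\<^bsub>A\<^esub> y) * fst v, \<epsilon> (x \<otimes>\<^bsub>A\<^esub> y) * snd v) = (\<epsilon> x * \<epsilon> y * fst v, \<epsilon> x * \<epsilon> y * snd v)"
      using e[OF subgroup.m_closed[OF Q(1) xy]] by simp
  qed
  have one: "\<one>\<^bsub>A\<^esub> \<in> Q" using Q(1) by (rule subgroup.one_closed)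
  have e1: "\<epsilon> \<one>\<^bsub>A\<^esub> = 1"
  proof (rule uniq)
    show "(\<epsilon> \<one>\<^bsub>A\<^esub> * fst v, \<epsilon> \<one>\<^bsub>A\<^esub> * snd v) = (1 * fst v, 1 * snd v)" using e[OF one] by (simp add: \<rho>_one mvec_one)
  qed
  have inv: "\<epsilon> (inv\<^bsub>A\<^esub> x) * \<epsilon> x = 1" if x: "x \<in> Q" for x
    using mult[OF subgroup.m_inv_closed[OF Q(1) x] x] e1 Qc[OF x] by simp
  have nz: "\<epsilon> x \<noteq> 0" if "x \<in> Q" for x using inv[OF that] by auto
  have "inj_on \<epsilon> Q"
  proof (rule inj_onI)
    fix x y assume xy: "x \<in> Q" "y \<in> Q" "\<epsilon> x = \<epsilon> y"
    let ?z = "inv\<^bsub>A\<^esub> x \<otimes>\<^bsub>A\<^esub> y"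
    have z: "?z \<in> Q" using xy subgroup.m_closed[OF Q(1)] subgroup.m_inv_closed[OF Q(1)] by blast
    have "\<epsilon> ?z = 1" using mult[OF subgroup.m_inv_closed[OF Q(1) xy(1)] xy(2)] inv[OF xy(1)] xy(3) by simp
    then have "mvec (\<rho> ?z) v = v" using e[OF z] by simp
    then have "?z = \<one>\<^bsub>A\<^esub>" using faith z v(1) by blast
    then have "x \<otimes>\<^bsub>A\<^esub> ?z = x \<otimes>\<^bsub>A\<^esub> \<one>\<^bsub>A\<^esub>" by (simp only:)
    then show "x = y" using Qc[OF xy(1)] Qc[OF xy(2)] by simp
  qed
  then show ?thesis using A.cyclic_if_embeds_in_field[OF Q(1) Q(3) Q(2) mult _ nz] that by blast
qed

text \<open>If P is not scalar, it is abelian, because anticommuting elements cannot have odd order.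
  It is the product of a cyclic determinant one part, generated by d, and the powers of t, the m-th
  power of \<tau>, which meet that part trivially. The question is whether lifts of t and d commute.
  If t is not scalar, d is upper triangular and the splitting over B decides. If t is scalar, its
  order divides 3, and \<open>no_index_three_subgroup\<close> puts d into the normal subgroup of
  elements whose lifts commute with those of t.\<close>

lemma odd_sylow_splits:
  assumes P: "subgroup P A" "card P = q ^ n" and q: "prime (q::nat)" "odd q"
    and m: "p - 1 = q ^ k * m" "\<not> q dvd m" and \<tau>P: "\<tau> [^]\<^bsub>A\<^esub> m \<in> P"
  shows "splits P"
proof (cases "\<exists>x\<in>P. \<not> mscalar (\<rho> x)")
  case False
  have "P \<subseteq> B"
  proof
    fix x assume x: "x \<in> P"
    then have "mscalar (\<rho> x)" using False by blast
    then show "x \<in> B" using subgroup.mem_carrier[OF P(1) x] by (cases "\<rho> x") auto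
  qed
  then show ?thesis using splits_subgroup[OF borel_splits P(1)] by blast
next
  case True
  have Pc: "x \<in> carrier A" if "x \<in> P" for x using P(1) that by (rule subgroup.mem_carrier)
  note Pcl = subgroup.m_closed[OF P(1)] subgroup.m_inv_closed[OF P(1)] subgroup.one_closed[OF P(1)]
  have m0: "m > 0" using m(2) by (cases m) auto
  obtain c where c: "c \<in> P" "\<not> mscalar (\<rho> c)"
    "\<And>x. x \<in> P \<Longrightarrow> \<rho> x \<star> \<rho> c = \<rho> c \<star> \<rho> x \<or> \<rho> x \<star> \<rho> c = mneg (\<rho> c \<star> \<rho> x)"
    using commuting_up_to_sign[OF P(1) q(1) P(2) True] by metis
  have com: "\<rho> x \<star> \<rho> c = \<rho> c \<star> \<rho> x" if x: "x \<in> P" for x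
  proof (rule ccontr)
    assume "\<rho> x \<star> \<rho> c \<noteq> \<rho> c \<star> \<rho> x"
    then have an: "\<rho> x \<star> \<rho> c = mneg (\<rho> c \<star> \<rho> x)" using c(3)[OF x] by blast
    have mm: "mneg (mneg y) = y" for y :: "'k m2" by (cases y) simp
    have "\<rho> (x [^]\<^bsub>A\<^esub> i) \<star> \<rho> c = (if even i then \<rho> c \<star> \<rho> (x [^]\<^bsub>A\<^esub> i) else mneg (\<rho> c \<star> \<rho> (x [^]\<^bsub>A\<^esub> i)))" for i :: nat
    proof (induction i)
      case 0
      then show ?case by (simp add: \<rho>_one mtimes_one)
    next
      case (Suc i)
      have r: "\<rho> (x [^]\<^bsub>A\<^esub> Suc i) = \<rho> (x [^]\<^bsub>A\<^esub> i) \<star> \<rho> x" using Pc[OF x] by (simp add: \<rho>_mult)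
      have "\<rho> (x [^]\<^bsub>A\<^esub> Suc i) \<star> \<rho> c = mneg ((\<rho> (x [^]\<^bsub>A\<^esub> i) \<star> \<rho> c) \<star> \<rho> x)"
        unfolding r mtimes_assoc an by (simp only: mneg_mult mtimes_assoc)
      also have "\<dots> = mneg ((if even i then \<rho> c \<star> \<rho> (x [^]\<^bsub>A\<^esub> i) else mneg (\<rho> c \<star> \<rho> (x [^]\<^bsub>A\<^esub> i))) \<star> \<rho> x)" unfolding Suc ..
      finally show ?case unfolding r by (simp add: mneg_mult mm mtimes_assoc)
    qed
    \<comment> \<open>The exponent is odd, so the sign would survive in the power, which is the
      identity.\<close>
    from this[of "q ^ n"] have "\<rho> c = mneg (\<rho> c)"
      using prime_power_pow[OF P x] q(2) by (simp add: \<rho>_one mtimes_one)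
    then show False using mat_neg_neq Pc[OF c(1)] by blast
  qed
  have commP: "x \<otimes>\<^bsub>A\<^esub> y = y \<otimes>\<^bsub>A\<^esub> x" if "x \<in> P" "y \<in> P" for x y
    using commutant_commutative[OF c(2) com[OF that(1)] com[OF that(2)]] \<rho>_commute[OF Pc[OF that(1)] Pc[OF that(2)]] by blast
  let ?Q = "{x \<in> P. mdet (\<rho> x) = 1}"
  have Q: "subgroup ?Q A"
  proof (rule A.subgroupI)
    show "?Q \<noteq> {}" using Pcl \<rho>_one by force
    fix x assume x: "x \<in> ?Q"
    have "mdet (\<rho> x) * mdet (\<rho> (inv\<^bsub>A\<^esub> x)) = mdet (\<rho> (x \<otimes>\<^bsub>A\<^esub> inv\<^bsub>A\<^esub> x))" using x Pc by (simp only: \<rho>_mult mdet_mult A.inv_closed mem_Collect_eq)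
    then show "inv\<^bsub>A\<^esub> x \<in> ?Q" using x Pc Pcl by (simp add: \<rho>_one)
    fix y assume "y \<in> ?Q"
    then show "x \<otimes>\<^bsub>A\<^esub> y \<in> ?Q" using x Pc Pcl by (simp add: \<rho>_mult mdet_mult)
  qed (use Pc in auto)
  obtain b where b: "card ?Q = q ^ b"
  proof -
    interpret P: group "A\<lparr>carrier := P\<rparr>" using P(1) by (rule subgroup.subgroup_is_group) (rule A.is_group)
    have "subgroup ?Q (A\<lparr>carrier := P\<rparr>)" using Q P(1) by (intro A.subgroup_incl) auto
    from P.lagrange[OF this] have "card (rcosets\<^bsub>A\<lparr>carrier := P\<rparr>\<^esub> ?Q) * card ?Q = q ^ n"
      using P(2) by (simp add: Coset.order_def)
    then have "card ?Q dvd q ^ n" by (rule dvdI[OF trans[OF sym mult.commute]])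
    then show ?thesis using that divides_primepow_nat[OF q(1)] by blast
  qed
  obtain d where d: "d \<in> ?Q" "?Q = {d [^]\<^bsub>A\<^esub> i |i::nat. True}" "\<And>i::nat. d [^]\<^bsub>A\<^esub> i = \<one>\<^bsub>A\<^esub> \<longleftrightarrow> q ^ b dvd i"
  proof (rule det_one_cyclic[OF Q b q(1) c(2)])
    show "\<rho> x \<star> \<rho> c = \<rho> c \<star> \<rho> x" if "x \<in> ?Q" for x using com that by blast
    show "x = \<one>\<^bsub>A\<^esub>" if x: "x \<in> ?Q" "v \<noteq> (0, 0)" "mvec (\<rho> x) v = v" for x v
    proof -
      obtain x1 x2 x3 x4 where xm: "\<rho> x = M2 x1 x2 x3 x4" by (cases "\<rho> x")
      have "1\<^sup>2 - (x1 + x4) * 1 + (x1 * x4 - x2 * x3) = 0"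
        using x xm by (intro eigenvalue_char_poly[of v]) auto
      moreover have det: "x1 * x4 - x2 * x3 = 1" using x xm by simp
      ultimately have "1 - (x1 + x4) + 1 = 0" by (simp only: power_one mult_1_right)
      then have "2 - (x1 + x4) = 0" by (simp add: algebra_simps)
      then have "x1 + x4 = 2" by (simp only: right_minus_eq)
      then show ?thesis using unipotent_trivial[OF _ xm _ det] x Pc by blast
    qed
  qed blast
  have dP: "d \<in> P" "d \<in> carrier A" using d(1) Pc by auto
  have q0: "q ^ b > 0" "q ^ k > 0" using prime_gt_0_nat[OF q(1)] by auto
  have "d [^]\<^bsub>A\<^esub> (q ^ b) = \<one>\<^bsub>A\<^esub>" using d(3) by simp
  then obtain D where D: "D \<in> carrier E" "\<pi> D = d" "D [^] (q ^ b) = \<one>" using lift_of_order dP q0 by metis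
  define t where "t = \<tau> [^]\<^bsub>A\<^esub> m"
  have t: "t \<in> P" "t \<in> carrier A" "t \<in> B" using \<tau>P Pc \<tau>_B by (auto simp: t_def)
  have tpow: "t [^]\<^bsub>A\<^esub> i = \<tau> [^]\<^bsub>A\<^esub> (m * i)" for i :: nat unfolding t_def using \<tau>(1) by (simp add: A.nat_pow_pow)
  have tq: "t [^]\<^bsub>A\<^esub> (q ^ k) = \<one>\<^bsub>A\<^esub>" unfolding tpow \<tau>_pow_one m(1) by (simp add: mult.commute)
  obtain T where T: "T \<in> carrier E" "\<pi> T = t" "T [^] (q ^ k) = \<one>" by (rule lift_of_order[OF t(2) tq q0(2)])
  have dt: "commuting_lifts t d"
  proof (cases "mscalar (\<rho> t)")
    case False
    have "\<rho> d \<star> \<rho> t = \<rho> t \<star> \<rho> d" using commP[OF dP(1) t(1)] \<rho>_commute[OF dP(2) t(2)] by blast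
    then have "d \<in> B" using diag_commute_B[OF dP(2), of "1 / g ^ m" "g ^ (2 * m)"] False unfolding t_def \<tau>_pow by auto
    then show ?thesis using split_commuting_lifts[OF borel_splits t(3) \<open>d \<in> B\<close>] commP dP t by blast
  next
    case True
    \<comment> \<open>Equality of the two eigenvalues of t means g^(3 m) = 1; this singles out the
      prime 3.\<close>
    then have "1 / g ^ m = g ^ (2 * m)" unfolding t_def \<tau>_pow by simp
    then have "g ^ (2 * m) * g ^ m = 1" using g(2) by (simp add: field_simps)
    then have "g ^ (3 * m) = 1" by (simp flip: power_add)
    then have "q ^ k * m dvd 3 * m" using g(4) m(1) by metis
    then have "q ^ k dvd 3" using m0 by simp
    then have "q ^ k = 1 \<or> q ^ k = 3" using prime_nat_iff[of 3] by auto
    then show ?thesis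
    proof
      assume "q ^ k = 1"
      then have "t = \<one>\<^bsub>A\<^esub>" unfolding t_def \<tau>_pow_one m(1) by simp
      then show ?thesis using commuting_lifts_sym[OF commuting_lifts_one[OF dP(2)]] by simp
    next
      assume k3: "q ^ k = 3"
      let ?N = "{x \<in> carrier A. commuting_lifts t x}"
      have tcen: "t \<otimes>\<^bsub>A\<^esub> x = x \<otimes>\<^bsub>A\<^esub> t" if "x \<in> carrier A" for x
        using \<rho>_commute[OF t(2) that] mscalar_commute[OF True] by blast
      have "d \<in> ?N"
      proof (rule no_index_three_subgroup)
        show "3 dvd p - 1" unfolding m(1) k3 by simp
        show "subgroup ?N A"
        proof (rule A.subgroupI)
          show "?N \<noteq> {}" using commuting_lifts_one[OF t(2)] by blast
          fix x assume x: "x \<in> ?N"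
          then show "inv\<^bsub>A\<^esub> x \<in> ?N" using commuting_lifts_inv[of x t] t(2) by simp
          fix y assume "y \<in> ?N"
          then show "x \<otimes>\<^bsub>A\<^esub> y \<in> ?N" using commuting_lifts_mult[of x y t] t(2) x by simp
        qed blast
        show "x \<otimes>\<^bsub>A\<^esub> n \<otimes>\<^bsub>A\<^esub> inv\<^bsub>A\<^esub> x \<in> ?N" if x: "x \<in> carrier A" "n \<in> ?N" for x n
        proof -
          have "x \<otimes>\<^bsub>A\<^esub> t \<otimes>\<^bsub>A\<^esub> inv\<^bsub>A\<^esub> x = t" using tcen[OF x(1), symmetric] x t by (simp add: A.m_assoc)
          then show ?thesis using commuting_lifts_conj[of x t n] x t by auto
        qed
        show "B \<subseteq> ?N" using split_commuting_lifts[OF borel_splits t(3)] tcen by auto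
        show "d [^]\<^bsub>A\<^esub> (3::nat) \<in> ?N"
          using commuting_lifts_pow_order[OF t(2) tq q0(2) dP(2) tcen[OF dP(2)]] dP k3 by simp
      qed (rule dP(2))
      then show ?thesis by blast
    qed
  qed
  have TD: "T \<otimes> D = D \<otimes> T" using commuting_liftsD[OF dt T(1) D(1) T(2) D(2)] .
  have S1: "split_lift {D [^] i |i::nat. True}"
    using D d(3) q0 by (intro split_lift_cyclic[of D "q ^ b"]) (auto dest: nat_dvd_not_less)
  have piS1: "\<pi> ` {D [^] i |i::nat. True} = ?Q"
  proof -
    have eq: "\<pi> (D [^] i) = d [^]\<^bsub>A\<^esub> i" for i :: nat using D by (simp add: \<pi>.hom_nat_pow)
    show ?thesis unfolding d(2)
    proof (intro equalityI subsetI)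
      fix x assume "x \<in> {d [^]\<^bsub>A\<^esub> i |i::nat. True}"
      then obtain i :: nat where "x = \<pi> (D [^] i)" using eq by auto
      then show "x \<in> \<pi> ` {D [^] i |i::nat. True}" by blast
    qed (use eq in blast)
  qed
  have S: "split_lift {s \<otimes> T [^] i |s (i::nat). s \<in> {D [^] i |i::nat. True}}" (is "split_lift ?S")
  proof (rule split_lift_cyclic_extension[OF S1 T(1) q0(2)])
    show "T [^] (q ^ k) \<in> {D [^] i |i::nat. True}" unfolding T(3) by (intro CollectI exI[of _ "0::nat"]) simp
    fix x assume x: "x \<in> {D [^] i |i::nat. True}"
    then obtain i :: nat where i: "x = D [^] i" by blast
    have "T \<otimes> D \<otimes> inv T = D" unfolding TD using T D by (simp add: E.m_assoc)
    then have "T \<otimes> x \<otimes> inv T = x" unfolding i using E.conj_pow[OF T(1) D(1), of i] by simp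
    then show "T \<otimes> x \<otimes> inv T \<in> {D [^] i |i::nat. True}" using x by simp
  next
    fix i :: nat assume i: "0 < i" "i < q ^ k"
    show "\<pi> (T [^] i) \<notin> \<pi> ` {D [^] i |i::nat. True}" unfolding piS1
    proof
      assume "\<pi> (T [^] i) \<in> ?Q"
      then have "mdet (\<rho> (t [^]\<^bsub>A\<^esub> i)) = 1" using T by (simp add: \<pi>.hom_nat_pow)
      then have "g ^ (m * i) = 1" unfolding tpow \<tau>_det .
      then have "m * q ^ k dvd m * i" using g(4) m(1) by (metis mult.commute)
      then have "q ^ k dvd i" using m0 by simp
      then show False using i by (simp add: nat_dvd_not_less)
    qed
  qed
  have "\<pi> ` ?S = P"
  proof (intro equalityI subsetI)
    fix x assume "x \<in> \<pi> ` ?S"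
    then obtain y i where x: "x = \<pi> (y \<otimes> T [^] (i::nat))" "y \<in> {D [^] i |i::nat. True}" by blast
    have y: "y \<in> carrier E" "\<pi> y \<in> P" using x(2) D piS1 by auto
    have tP: "t [^]\<^bsub>A\<^esub> i \<in> P" by (induction i) (use t Pcl in auto)
    have "x = \<pi> y \<otimes>\<^bsub>A\<^esub> t [^]\<^bsub>A\<^esub> i" using x(1) y T by (simp add: \<pi>.hom_nat_pow)
    then show "x \<in> P" using Pcl(1) y tP by simp
  next
    fix x assume x: "x \<in> P"
    obtain j where j: "mdet (\<rho> x) = g ^ (m * j)" using det_prime_power[OF P x q(1) m] by blast
    have tj: "t [^]\<^bsub>A\<^esub> j \<in> P" by (induction j) (use t Pcl in auto)
    let ?y = "x \<otimes>\<^bsub>A\<^esub> inv\<^bsub>A\<^esub> (t [^]\<^bsub>A\<^esub> j)"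
    have yP: "?y \<in> P" using Pcl(1)[OF x Pcl(2)[OF tj]] .
    have yx: "?y \<otimes>\<^bsub>A\<^esub> t [^]\<^bsub>A\<^esub> j = x" using Pc[OF x] t by (simp add: A.m_assoc)
    have "mdet (\<rho> ?y) * mdet (\<rho> (t [^]\<^bsub>A\<^esub> j)) = mdet (\<rho> x)"
      using \<rho>_mult[OF Pc[OF yP] Pc[OF tj]] unfolding yx by (simp add: mdet_mult)
    then have "mdet (\<rho> ?y) * g ^ (m * j) = g ^ (m * j)" unfolding tpow \<tau>_det j .
    then have "mdet (\<rho> ?y) = 1" using g(2) by simp
    then have "?y \<in> \<pi> ` {D [^] i |i::nat. True}" unfolding piS1 using yP by blast
    then obtain e where e: "e \<in> {D [^] i |i::nat. True}" "?y = \<pi> e" by blast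
    have "\<pi> (e \<otimes> T [^] j) = x" using e D T yx by (auto simp: \<pi>.hom_nat_pow)
    then show "x \<in> \<pi> ` ?S" using e(1) by blast
  qed
  then show ?thesis using S splits_iff by auto
qed

end

context torus_extension
begin

text \<open>The diagonal part of P is generated by diag(u^3, 1) and diag(1, u^3), where u has order
  2^k; cubing is harmless as 3 is odd. The antidiagonal w exchanges the two. Their lifts, conjugate
  under a lift W of w, commute by the splitting over B, and W is rescaled until its square lies in
  the group they generate.\<close>

lemma split_monomial:
  assumes P: "subgroup P A" "card P = 2 ^ n" and m: "p - 1 = 2 ^ k * m" "\<not> 2 dvd m" and \<tau>P: "\<tau> [^]\<^bsub>A\<^esub> m \<in> P"
    and mono: "\<And>x. x \<in> P \<Longrightarrow> (\<exists>a d. \<rho> x = M2 a 0 0 d) \<or> (\<exists>b c. \<rho> x = M2 0 b c 0)"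
    and w: "w \<in> P" "\<rho> w = M2 0 wb wc 0"
  shows "splits P"
proof -
  have Pc: "x \<in> carrier A" if "x \<in> P" for x using P(1) that by (rule subgroup.mem_carrier)
  note Pcl = subgroup.m_closed[OF P(1)] subgroup.m_inv_closed[OF P(1)] subgroup.one_closed[OF P(1)]
  have wA: "w \<in> carrier A" using Pc w by blast
  have wbc: "wb \<noteq> 0" "wc \<noteq> 0" using \<rho>_det_nz[OF wA] w(2) by auto
  have winv: "\<rho> (inv\<^bsub>A\<^esub> w) = M2 0 (1 / wc) (1 / wb) 0"
  proof -
    obtain a b c d where i: "\<rho> (inv\<^bsub>A\<^esub> w) = M2 a b c d" by (cases "\<rho> (inv\<^bsub>A\<^esub> w)")
    have "\<rho> w \<star> \<rho> (inv\<^bsub>A\<^esub> w) = M2 1 0 0 1" using wA by (simp add: \<rho>_mult[symmetric] \<rho>_one)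
    then have e: "wb * c = 1" "wb * d = 0" "wc * a = 0" "wc * b = 1" unfolding i w(2) by simp_all
    have "c = 1 / wb" "b = 1 / wc" using e(1,4) wbc by (metis nonzero_mult_div_cancel_left)+
    moreover have "d = 0" "a = 0" using e(2,3) wbc by simp_all
    ultimately show ?thesis unfolding i by simp
  qed
  have wdiag: "\<rho> (w \<otimes>\<^bsub>A\<^esub> x \<otimes>\<^bsub>A\<^esub> inv\<^bsub>A\<^esub> w) = M2 d 0 0 a" if "x \<in> carrier A" "\<rho> x = M2 a 0 0 d" for x a d
    using that wA wbc by (simp add: \<rho>_mult winv w(2))
  define u where "u = g ^ m"
  have u0: "u \<noteq> 0" using g(2) by (simp add: u_def)
  have upow: "u ^ i = 1 \<longleftrightarrow> 2 ^ k dvd i" for i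
  proof -
    have "m > 0" using m(2) by (cases m) auto
    have "u ^ i = 1 \<longleftrightarrow> m * 2 ^ k dvd m * i" unfolding u_def power_mult[symmetric] g(4) m(1) by (simp only: mult.commute)
    then show ?thesis using \<open>m > 0\<close> by simp
  qed
  define s where "s = \<tau> [^]\<^bsub>A\<^esub> m"
  have s: "s \<in> P" "s \<in> carrier A" "\<rho> s = M2 (1 / u) 0 0 (u\<^sup>2)"
    using \<tau>P Pc \<tau>_pow[of m] by (auto simp: s_def u_def power_mult[symmetric] mult.commute)
  define s' where "s' = w \<otimes>\<^bsub>A\<^esub> s \<otimes>\<^bsub>A\<^esub> inv\<^bsub>A\<^esub> w"
  have s': "s' \<in> P" "s' \<in> carrier A" "\<rho> s' = M2 (u\<^sup>2) 0 0 (1 / u)"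
    using Pcl s w Pc wdiag[OF s(2,3)] by (auto simp: s'_def)
  \<comment> \<open>The exponents make the second entry cancel, u^2 / u^2 = 1, while the first
    becomes u^4 / u = u^3.\<close>
  define a1 where "a1 = s \<otimes>\<^bsub>A\<^esub> s' \<otimes>\<^bsub>A\<^esub> s'"
  have a1: "a1 \<in> P" "a1 \<in> carrier A" "\<rho> a1 = M2 (u ^ 3) 0 0 1"
  proof -
    show "a1 \<in> P" unfolding a1_def by (intro Pcl s s')
    then show "a1 \<in> carrier A" by (rule Pc)
    have "\<rho> a1 = M2 (1 / u * u\<^sup>2 * u\<^sup>2) 0 0 (u\<^sup>2 * (1 / u) * (1 / u))" unfolding a1_def using s(2,3) s'(2,3) by (simp add: \<rho>_mult)
    moreover have "1 / u * u\<^sup>2 * u\<^sup>2 = u ^ 3" "u\<^sup>2 * (1 / u) * (1 / u) = 1" using u0 by (simp_all add: power2_eq_square power3_eq_cube)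
    ultimately show "\<rho> a1 = M2 (u ^ 3) 0 0 1" by (simp only:)
  qed
  define a2 where "a2 = w \<otimes>\<^bsub>A\<^esub> a1 \<otimes>\<^bsub>A\<^esub> inv\<^bsub>A\<^esub> w"
  have a2: "a2 \<in> P" "a2 \<in> carrier A" "\<rho> a2 = M2 1 0 0 (u ^ 3)"
    using Pcl a1 w Pc wdiag[OF a1(2,3)] by (auto simp: a2_def)
  have a1p: "\<rho> (a1 [^]\<^bsub>A\<^esub> i) = M2 (u ^ (3 * i)) 0 0 1" for i :: nat using \<rho>_pow_diag[OF a1(2,3), of i] by (simp add: power_mult)
  have a2p: "\<rho> (a2 [^]\<^bsub>A\<^esub> i) = M2 1 0 0 (u ^ (3 * i))" for i :: nat using \<rho>_pow_diag[OF a2(2,3), of i] by (simp add: power_mult)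
  have dvd3: "2 ^ k dvd 3 * i \<longleftrightarrow> 2 ^ k dvd i" for i :: nat
  proof -
    have "coprime (2 ^ k) (3::nat)" by simp
    then show ?thesis by (rule coprime_dvd_mult_right_iff)
  qed
  have K0: "(2::nat) ^ k > 0" by simp
  have a1one: "a1 [^]\<^bsub>A\<^esub> i = \<one>\<^bsub>A\<^esub> \<longleftrightarrow> 2 ^ k dvd i" for i :: nat
  proof -
    have "a1 [^]\<^bsub>A\<^esub> i = \<one>\<^bsub>A\<^esub> \<longleftrightarrow> \<rho> (a1 [^]\<^bsub>A\<^esub> i) = \<rho> \<one>\<^bsub>A\<^esub>" using \<rho>_eq[of "a1 [^]\<^bsub>A\<^esub> i" "\<one>\<^bsub>A\<^esub>"] a1(2) by auto
    then show ?thesis unfolding a1p \<rho>_one using upow[of "3 * i"] dvd3 by simp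
  qed
  obtain S1 where S1: "S1 \<in> carrier E" "\<pi> S1 = a1" "S1 [^] ((2::nat) ^ k) = \<one>"
  proof -
    have "a1 [^]\<^bsub>A\<^esub> ((2::nat) ^ k) = \<one>\<^bsub>A\<^esub>" using a1one by simp
    then show ?thesis using that lift_of_order[OF a1(2) _ K0] by metis
  qed
  obtain W where W: "W \<in> carrier E" "\<pi> W = w" using lift_exists wA by blast
  define S2 where "S2 = W \<otimes> S1 \<otimes> inv W"
  have S2: "S2 \<in> carrier E" "\<pi> S2 = a2" "S2 [^] ((2::nat) ^ k) = \<one>"
    using W S1 by (simp_all add: S2_def a2_def E.conj_pow)
  have diagB: "x \<in> B" if "x \<in> carrier A" "\<rho> x = M2 a 0 0 d" for x a d using that by blast
  have diag_com: "commuting_lifts x y" if xy: "x \<in> carrier A" "\<rho> x = M2 a 0 0 d" "y \<in> carrier A" "\<rho> y = M2 a' 0 0 d'" for x y a d a' d'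
    using xy by (intro split_commuting_lifts[OF borel_splits] diagB) (simp_all add: \<rho>_commute mult.commute)
  have S12: "S2 \<otimes> S1 = S1 \<otimes> S2" using commuting_liftsD[OF diag_com[OF a2(2,3) a1(2,3)] S2(1) S1(1) S2(2) S1(2)] .
  have w2: "\<rho> (w \<otimes>\<^bsub>A\<^esub> w) = M2 (wb * wc) 0 0 (wc * wb)" using wA w(2) by (simp add: \<rho>_mult)
  \<comment> \<open>The square of w is scalar, and its lifts commute with S1 by the splitting over
    B, so conjugating twice by W does nothing.\<close>
  have WS2: "W \<otimes> S2 \<otimes> inv W = S1"
  proof -
    have "commuting_lifts (w \<otimes>\<^bsub>A\<^esub> w) a1" by (rule diag_com[OF _ w2 a1(2,3)]) (use wA in simp)
    then have "(W \<otimes> W) \<otimes> S1 = S1 \<otimes> (W \<otimes> W)" using commuting_liftsD[of "w \<otimes>\<^bsub>A\<^esub> w" a1 "W \<otimes> W" S1] W S1 by simp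
    then have "(W \<otimes> W) \<otimes> S1 \<otimes> inv (W \<otimes> W) = S1" using W S1 by (simp add: E.m_assoc)
    then show ?thesis unfolding S2_def using W S1 by (simp add: E.inv_mult_group E.m_assoc)
  qed
  have L1: "split_lift {S1 [^] i |i::nat. True}"
    using S1 a1one K0 by (intro split_lift_cyclic[of S1 "2 ^ k"]) (auto dest: nat_dvd_not_less)
  let ?L = "{s \<otimes> S2 [^] i |s (i::nat). s \<in> {S1 [^] i |i::nat. True}}"
  have Lalt: "?L = {S1 [^] i \<otimes> S2 [^] j |(i::nat) (j::nat). True}" by blast
  have L2: "split_lift ?L"
  proof (rule split_lift_cyclic_extension[OF L1 S2(1) K0])
    show "S2 [^] ((2::nat) ^ k) \<in> {S1 [^] i |i::nat. True}" unfolding S2(3) by (intro CollectI exI[of _ "0::nat"]) simp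
    fix x assume x: "x \<in> {S1 [^] i |i::nat. True}"
    then obtain i :: nat where i: "x = S1 [^] i" by blast
    have "S2 \<otimes> S1 \<otimes> inv S2 = S1" unfolding S12 using S1 S2 by (simp add: E.m_assoc)
    then have "S2 \<otimes> x \<otimes> inv S2 = x" unfolding i using E.conj_pow[OF S2(1) S1(1), of i] by simp
    then show "S2 \<otimes> x \<otimes> inv S2 \<in> {S1 [^] i |i::nat. True}" using x by simp
  next
    fix i :: nat assume i: "0 < i" "i < 2 ^ k"
    show "\<pi> (S2 [^] i) \<notin> \<pi> ` {S1 [^] i |i::nat. True}"
    proof
      assume "\<pi> (S2 [^] i) \<in> \<pi> ` {S1 [^] i |i::nat. True}"
      then obtain j :: nat where "\<pi> (S2 [^] i) = \<pi> (S1 [^] j)" by blast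
      then have "\<rho> (a2 [^]\<^bsub>A\<^esub> i) = \<rho> (a1 [^]\<^bsub>A\<^esub> j)" using S1 S2 by (simp add: \<pi>.hom_nat_pow)
      then have "u ^ (3 * i) = 1" unfolding a1p a2p by simp
      then show False using upow dvd3 i by (auto dest: nat_dvd_not_less)
    qed
  qed
  have piL: "\<pi> (S1 [^] i \<otimes> S2 [^] j) = a1 [^]\<^bsub>A\<^esub> i \<otimes>\<^bsub>A\<^esub> a2 [^]\<^bsub>A\<^esub> j" for i j :: nat
    using S1 S2 by (simp add: \<pi>.hom_nat_pow)
  have root: "\<exists>i. a = u ^ (3 * i)" if a: "a \<in> \<int>" "a ^ (2 ^ n) = 1" for a
  proof -
    obtain j where j: "a = g ^ (m * j)" using Ints_prime_power_root[OF a two_is_prime_nat m] by blast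
    obtain x y :: nat where xy: "3 * x = 2 ^ k * y + gcd 3 (2 ^ k)" using bezout_nat[of 3 "2 ^ k"] by auto
    have "gcd 3 ((2::nat) ^ k) = 1" by (simp add: coprime_imp_gcd_eq_1)
    then have "u ^ (3 * x) = (u ^ (2 ^ k)) ^ y * u" unfolding xy by (simp add: power_add power_mult)
    then have ux: "u ^ (3 * x) = u" using upow[of "2 ^ k"] by simp
    have "u ^ (3 * (x * j)) = (u ^ (3 * x)) ^ j" by (simp only: power_mult mult.assoc)
    also have "\<dots> = a" unfolding ux unfolding j u_def by (simp only: power_mult)
    finally have "a = u ^ (3 * (x * j))" by (rule sym)
    then show ?thesis by blast
  qed
  have diag_image: "\<exists>y\<in>?L. \<pi> y = x" if x: "x \<in> P" "\<rho> x = M2 a 0 0 d" for x a d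
  proof -
    have "\<rho> (x [^]\<^bsub>A\<^esub> ((2::nat) ^ n)) = M2 (a ^ (2 ^ n)) 0 0 (d ^ (2 ^ n))" using \<rho>_pow_diag[OF Pc[OF x(1)] x(2)] .
    then have "a ^ (2 ^ n) = 1" "d ^ (2 ^ n) = 1" using prime_power_pow[OF P x(1)] by (simp_all add: \<rho>_one)
    moreover have "a \<in> \<int>" "d \<in> \<int>" using \<rho>_Ints[OF Pc[OF x(1)]] x(2) by auto
    ultimately obtain i j where ij: "a = u ^ (3 * i)" "d = u ^ (3 * j)" using root by blast
    have "\<pi> (S1 [^] i \<otimes> S2 [^] j) = x"
      unfolding piL using a1 a2 Pc[OF x(1)] by (intro \<rho>_eq) (simp_all add: \<rho>_mult a1p a2p x(2) ij)
    then show ?thesis unfolding Lalt by blast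
  qed
  have L_diag: "\<exists>a d. \<rho> (\<pi> y) = M2 a 0 0 d" "y \<in> carrier E" "\<pi> y \<in> P" if y: "y \<in> ?L" for y
  proof -
    obtain i j :: nat where y': "y = S1 [^] i \<otimes> S2 [^] j" using y unfolding Lalt by blast
    have "\<rho> (\<pi> y) = M2 (u ^ (3 * i)) 0 0 (u ^ (3 * j))" unfolding y' piL using a1 a2 by (simp add: \<rho>_mult a1p a2p)
    then show "\<exists>a d. \<rho> (\<pi> y) = M2 a 0 0 d" by blast
    show "y \<in> carrier E" unfolding y' using S1 S2 by simp
    have "a1 [^]\<^bsub>A\<^esub> i \<in> P" "a2 [^]\<^bsub>A\<^esub> j \<in> P" by (induction i; use a1 Pcl in auto) (induction j; use a2 Pcl in auto)
    then show "\<pi> y \<in> P" unfolding y' piL using Pcl by blast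
  qed
  obtain y where y: "y \<in> ?L" "\<pi> y = w \<otimes>\<^bsub>A\<^esub> w" using diag_image[OF Pcl(1)[OF w(1) w(1)] w2] by blast
  obtain \<kappa> where \<kappa>: "\<kappa> \<noteq> 0" "W \<otimes> W = \<iota> \<kappa> \<otimes> y"
    using same_image[of y "W \<otimes> W"] L_diag(2)[OF y(1)] W y(2) by auto
  \<comment> \<open>The square of W agrees with an element y of the lifted diagonal group up to
    \<kappa>; a square root of the inverse of \<kappa> removes the scalar.\<close>
  obtain \<eta> where \<eta>: "\<eta> \<noteq> 0" "\<eta> ^ 2 = 1 / \<kappa>" using root_exists[of "1 / \<kappa>" 2] \<kappa> by auto
  define V where "V = \<iota> \<eta> \<otimes> W"
  have V: "V \<in> carrier E" "\<pi> V = w" using W \<eta> wA by (auto simp: V_def)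
  have V2: "V [^] (2::nat) = y"
  proof -
    have "V [^] (2::nat) = \<iota> (1 / \<kappa>) \<otimes> (W \<otimes> W)"
      unfolding V_def using scaled_pow[OF \<eta>(1) W(1), of 2] \<eta>(2) W by (simp add: numeral_2_eq_2)
    also have "\<dots> = \<iota> (1 / \<kappa> * \<kappa>) \<otimes> y" unfolding \<kappa>(2) using \<kappa>(1) L_diag(2)[OF y(1)] by (simp only: \<iota>_mult divide_eq_0_iff one_neq_zero simp_thms E.m_assoc \<iota>_closed not_False_eq_True)
    finally show ?thesis using \<kappa>(1) L_diag(2)[OF y(1)] by simp
  qed
  have Vconj: "V \<otimes> e \<otimes> inv V = W \<otimes> e \<otimes> inv W" if e: "e \<in> carrier E" for e
  proof -
    have "V \<otimes> e \<otimes> inv V = \<iota> \<eta> \<otimes> (W \<otimes> e \<otimes> inv W) \<otimes> inv (\<iota> \<eta>)"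
      unfolding V_def using W e \<eta>(1) by (simp add: E.inv_mult_group E.m_assoc)
    also have "\<iota> \<eta> \<otimes> (W \<otimes> e \<otimes> inv W) = (W \<otimes> e \<otimes> inv W) \<otimes> \<iota> \<eta>" using W e \<eta>(1) by (intro \<iota>_central[symmetric]) auto
    finally show ?thesis using W e \<eta>(1) by (simp add: E.m_assoc)
  qed
  let ?S = "{s \<otimes> V [^] i |s (i::nat). s \<in> ?L}"
  have S: "split_lift ?S"
  proof (rule split_lift_cyclic_extension[OF L2 V(1), of 2])
    show "V [^] (2::nat) \<in> ?L" unfolding V2 by (rule y(1))
    fix x assume "x \<in> ?L"
    then obtain i j :: nat where x: "x = S1 [^] i \<otimes> S2 [^] j" unfolding Lalt by blast
    have "V \<otimes> x \<otimes> inv V = (W \<otimes> S1 [^] i \<otimes> inv W) \<otimes> (W \<otimes> S2 [^] j \<otimes> inv W)"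
      unfolding x using Vconj[of "S1 [^] i \<otimes> S2 [^] j"] W S1 S2 by (simp add: E.m_assoc)
    also have "\<dots> = S2 [^] i \<otimes> S1 [^] j"
      using E.conj_pow[OF W(1) S1(1), of i] E.conj_pow[OF W(1) S2(1), of j] WS2 S2_def by simp
    also have "\<dots> = S1 [^] j \<otimes> S2 [^] i"
    proof -
      have "commuting_lifts (a2 [^]\<^bsub>A\<^esub> i) (a1 [^]\<^bsub>A\<^esub> j)" by (rule diag_com[OF _ a2p _ a1p]) (use a1 a2 in auto)
      then show ?thesis using S1 S2 by (intro commuting_liftsD[of "a2 [^]\<^bsub>A\<^esub> i" "a1 [^]\<^bsub>A\<^esub> j"]) (simp_all add: \<pi>.hom_nat_pow)
    qed
    finally show "V \<otimes> x \<otimes> inv V \<in> ?L" unfolding Lalt by blast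
  next
    fix i :: nat assume "0 < i" "i < 2"
    then have i: "i = 1" by simp
    show "\<pi> (V [^] i) \<notin> \<pi> ` ?L"
    proof
      assume "\<pi> (V [^] i) \<in> \<pi> ` ?L"
      then obtain y where "y \<in> ?L" "w = \<pi> y" using i V by auto
      then show False using L_diag(1)[of y] w(2) wbc by auto
    qed
  qed simp
  have "\<pi> ` ?S = P"
  proof (intro equalityI subsetI)
    fix x assume "x \<in> \<pi> ` ?S"
    then obtain s i where x: "x = \<pi> (s \<otimes> V [^] (i::nat))" "s \<in> ?L" by blast
    have wi: "w [^]\<^bsub>A\<^esub> i \<in> P" by (induction i) (use w Pcl in auto)
    have "x = \<pi> s \<otimes>\<^bsub>A\<^esub> w [^]\<^bsub>A\<^esub> i" unfolding x(1) using L_diag(2)[OF x(2)] V by (simp add: \<pi>.hom_nat_pow)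
    then show "x \<in> P" using Pcl(1) L_diag(3)[OF x(2)] wi by simp
  next
    fix x assume x: "x \<in> P"
    from mono[OF x] show "x \<in> \<pi> ` ?S"
    proof
      assume "\<exists>a d. \<rho> x = M2 a 0 0 d"
      then obtain y where y: "y \<in> ?L" "\<pi> y = x" using diag_image[OF x] by blast
      have "y = y \<otimes> V [^] (0::nat)" using L_diag(2)[OF y(1)] by simp
      then show ?thesis using y by blast
    next
      assume "\<exists>b c. \<rho> x = M2 0 b c 0"
      then obtain b c where bc: "\<rho> x = M2 0 b c 0" by blast
      let ?z = "x \<otimes>\<^bsub>A\<^esub> inv\<^bsub>A\<^esub> w"
      have z: "?z \<in> P" using Pcl x w by blast
      have "\<rho> ?z = M2 (b * (1 / wb)) 0 0 (c * (1 / wc))" using Pc[OF x] wA bc by (simp add: \<rho>_mult winv)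
      then obtain y where y: "y \<in> ?L" "\<pi> y = ?z" using diag_image[OF z] by blast
      have "\<pi> (y \<otimes> V [^] (1::nat)) = x" using L_diag(2)[OF y(1)] V y(2) Pc[OF x] wA by (simp add: A.m_assoc)
      then show ?thesis using y(1) by blast
    qed
  qed
  then show ?thesis using S splits_iff by auto
qed

end

lemma mneg_mneg: "mneg (mneg x) = x"
  by (cases x) simp

lemma square_commute_up_to_sign:
  assumes "y \<star> c = c \<star> y \<or> y \<star> c = mneg (c \<star> y)"
  shows "y \<star> y \<star> c = c \<star> (y \<star> y)"
  using assms
proof
  assume c: "y \<star> c = c \<star> y"
  have "y \<star> y \<star> c = y \<star> (y \<star> c)" by (rule mtimes_assoc)
  also have "\<dots> = y \<star> (c \<star> y)" by (simp only: c)
  also have "\<dots> = (y \<star> c) \<star> y" by (rule mtimes_assoc[symmetric])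
  also have "\<dots> = (c \<star> y) \<star> y" by (simp only: c)
  finally show ?thesis by (simp only: mtimes_assoc)
next
  assume c: "y \<star> c = mneg (c \<star> y)"
  have "y \<star> y \<star> c = y \<star> (y \<star> c)" by (rule mtimes_assoc)
  also have "\<dots> = mneg (y \<star> (c \<star> y))" by (simp only: c mneg_mult)
  also have "y \<star> (c \<star> y) = (y \<star> c) \<star> y" by (rule mtimes_assoc[symmetric])
  also have "\<dots> = mneg ((c \<star> y) \<star> y)" by (simp only: c mneg_mult)
  finally show ?thesis by (simp only: mneg_mneg mtimes_assoc)
qed

context torus_extension
begin

lemma eigenvector_pow:
  assumes x: "x \<in> carrier A" "mvec (\<rho> x) v = (\<mu> * fst v, \<mu> * snd v)"
  shows "mvec (\<rho> (x [^]\<^bsub>A\<^esub> (i::nat))) v = (\<mu> ^ i * fst v, \<mu> ^ i * snd v)"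
proof (induction i)
  case 0
  then show ?case by (simp add: \<rho>_one mvec_one)
next
  case (Suc i)
  have lin: "mvec y (\<mu> * fst v, \<mu> * snd v) = (\<mu> * fst (mvec y v), \<mu> * snd (mvec y v))" for y
    by (cases y; cases v) (simp add: algebra_simps)
  have "mvec (\<rho> (x [^]\<^bsub>A\<^esub> Suc i)) v = mvec (\<rho> (x [^]\<^bsub>A\<^esub> i)) (mvec (\<rho> x) v)" using x(1) by (simp add: \<rho>_mult mvec_mult)
  also have "\<dots> = (\<mu> ^ Suc i * fst v, \<mu> ^ Suc i * snd v)" unfolding x(2) lin Suc by simp
  finally show ?case .
qed

text \<open>Let t be the involution diag(-1, 1), a power of \<tau>. If P is not monomial, an element
  c that commutes with P up to sign has to anticommute with t, so c is antidiagonal and t is not a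
  square in P. This forces p = 3 modulo 4; the centraliser of c in P is then cyclic, inside a
  nonsplit torus on which t acts as the Frobenius map, and P is dihedral or semidihedral.\<close>

lemma two_sylow_splits:
  assumes P: "subgroup P A" "card P = 2 ^ n" and m: "p - 1 = 2 ^ k * m" "\<not> 2 dvd m" and \<tau>P: "\<tau> [^]\<^bsub>A\<^esub> m \<in> P"
  shows "splits P"
proof -
  have Pc: "x \<in> carrier A" if "x \<in> P" for x using P(1) that by (rule subgroup.mem_carrier)
  note Pcl = subgroup.m_closed[OF P(1)] subgroup.m_inv_closed[OF P(1)] subgroup.one_closed[OF P(1)]
  have powP: "x [^]\<^bsub>A\<^esub> i \<in> P" if "x \<in> P" for x and i :: nat by (induction i) (use that Pcl in auto)
  have two: "(2::'k) \<noteq> 0" by (rule two_neq_zero[OF p char p_odd])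
  have dbl: "y = 0" if "y = - y" for y :: 'k
  proof -
    have "y + y = 0" using that by (metis add.right_inverse)
    then have "2 * y = 0" by (simp only: mult_2)
    then show ?thesis using two by simp
  qed
  have m0: "m > 0" using m(2) by (cases m) auto
  have "even (p - 1)" using p_odd prime_gt_1_nat[OF p] by simp
  then have k0: "k > 0" using m by (cases k) auto
  define t where "t = \<tau> [^]\<^bsub>A\<^esub> (m * 2 ^ (k - 1))"
  have "t = (\<tau> [^]\<^bsub>A\<^esub> m) [^]\<^bsub>A\<^esub> ((2::nat) ^ (k - 1))" unfolding t_def using \<tau>(1) by (simp add: A.nat_pow_pow)
  then have tP: "t \<in> P" using powP[OF \<tau>P] by simp
  then have tA: "t \<in> carrier A" by (rule Pc)
  let ?h = "m * 2 ^ (k - 1)"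
  have h2: "2 * ?h = p - 1" unfolding m(1) using k0 by (cases k) auto
  have gh: "g ^ ?h = - 1"
  proof -
    have "(g ^ ?h) * (g ^ ?h) = 1" using g(4)[of "2 * ?h"] h2 by (simp add: mult_2 power_add)
    then have "g ^ ?h = 1 \<or> g ^ ?h = - 1" by (rule iffD1[OF square_eq_1_iff])
    moreover have "\<not> (p - 1) dvd ?h" using h2 m0 nat_dvd_not_less[of ?h "p - 1"] by auto
    then have "g ^ ?h \<noteq> 1" using g(4) by blast
    ultimately show ?thesis by blast
  qed
  have \<rho>t: "\<rho> t = M2 (- 1) 0 0 1" unfolding t_def \<tau>_pow gh using g(4)[of "2 * ?h"] h2 by simp
  have tB: "t \<in> B" using tA \<rho>t by blast
  have tt: "t \<otimes>\<^bsub>A\<^esub> t = \<one>\<^bsub>A\<^esub>" using tA by (intro \<rho>_eq) (simp_all add: \<rho>_mult \<rho>t \<rho>_one)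
  define mono where "mono x \<longleftrightarrow> (\<exists>a d. \<rho> x = M2 a 0 0 d) \<or> (\<exists>b c. \<rho> x = M2 0 b c 0)" for x
  show ?thesis
  proof (cases "\<forall>x\<in>P. mono x")
    case True
    show ?thesis
    proof (cases "\<exists>w\<in>P. \<exists>b c. \<rho> w = M2 0 b c 0")
      case w: True
      then obtain w b c where "w \<in> P" "\<rho> w = M2 0 b c 0" by blast
      then show ?thesis using split_monomial[OF P m \<tau>P] True unfolding mono_def by blast
    next
      case False
      then have "P \<subseteq> B" using True Pc unfolding mono_def by blast
      then show ?thesis using splits_subgroup[OF borel_splits P(1)] by blast
    qed
  next
    case notmono: False
    have neg: "(- 1 :: 'k) \<noteq> 1" using dbl[of 1] by auto
    have "\<not> mscalar (\<rho> t)" unfolding \<rho>t using neg by simp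
    then have "\<exists>x\<in>P. \<not> mscalar (\<rho> x)" using tP by blast
    then obtain c where c: "c \<in> P" "\<not> mscalar (\<rho> c)"
      "\<And>x. x \<in> P \<Longrightarrow> \<rho> x \<star> \<rho> c = \<rho> c \<star> \<rho> x \<or> \<rho> x \<star> \<rho> c = mneg (\<rho> c \<star> \<rho> x)"
      using commuting_up_to_sign[OF P(1) two_is_prime_nat P(2)] by metis
    have cA: "c \<in> carrier A" using Pc c(1) .
    \<comment> \<open>If c commuted with t it would be diagonal with distinct entries, and any
      matrix that commutes with such a c up to sign is monomial.\<close>
    have t_ncom: "\<rho> t \<star> \<rho> c \<noteq> \<rho> c \<star> \<rho> t"
    proof
      assume tc: "\<rho> t \<star> \<rho> c = \<rho> c \<star> \<rho> t"
      obtain c1 c2 c3 c4 where cm: "\<rho> c = M2 c1 c2 c3 c4" by (cases "\<rho> c")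
      have "- c2 = c2" "c3 = - c3" using tc unfolding \<rho>t cm by simp_all
      then have c23: "c2 = 0" "c3 = 0" using dbl[of c2] dbl[of c3] by metis+
      have c14: "c1 \<noteq> c4" using c(2) cm c23 by simp
      have cnz: "c1 \<noteq> 0" "c4 \<noteq> 0" using \<rho>_det_nz[OF cA] cm c23 by auto
      have "mono x" if x: "x \<in> P" for x
      proof -
        obtain x1 x2 x3 x4 where xm: "\<rho> x = M2 x1 x2 x3 x4" by (cases "\<rho> x")
        from c(3)[OF x] show ?thesis
        proof
          assume "\<rho> x \<star> \<rho> c = \<rho> c \<star> \<rho> x"
          then have "x2 * c4 = c1 * x2" "x3 * c1 = c4 * x3" unfolding cm xm c23 by simp_all
          then have "x2 = 0" "x3 = 0" using c14 by (metis mult.commute mult_left_cancel)+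
          then show ?thesis unfolding mono_def xm by blast
        next
          assume "\<rho> x \<star> \<rho> c = mneg (\<rho> c \<star> \<rho> x)"
          then have "x1 * c1 = - (c1 * x1)" "x4 * c4 = - (c4 * x4)" unfolding cm xm c23 by simp_all
          then have "x1 * c1 = 0" "x4 * c4 = 0" using dbl by (metis mult.commute)+
          then have "x1 = 0" "x4 = 0" using cnz by simp_all
          then show ?thesis unfolding mono_def xm by blast
        qed
      qed
      then show False using notmono by blast
    qed
    then have t_anti: "\<rho> t \<star> \<rho> c = mneg (\<rho> c \<star> \<rho> t)" using c(3)[OF tP] by blast
    obtain c2 c3 where cm: "\<rho> c = M2 0 c2 c3 0"
    proof -
      obtain c1 c2 c3 c4 where cm: "\<rho> c = M2 c1 c2 c3 c4" by (cases "\<rho> c")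
      have "- c1 = c1" "c4 = - c4" using t_anti unfolding \<rho>t cm by simp_all
      then have "c1 = 0" "c4 = 0" using dbl[of c1] dbl[of c4] by metis+
      then show ?thesis using that cm by blast
    qed
    \<comment> \<open>For k > 1 the involution t would be a square in P, and squares commute with
      c.\<close>
    have k1: "k = 1"
    proof (rule ccontr)
      assume "k \<noteq> 1"
      then have k2: "k - 1 = Suc (k - 2)" using k0 by simp
      define y where "y = (\<tau> [^]\<^bsub>A\<^esub> m) [^]\<^bsub>A\<^esub> ((2::nat) ^ (k - 2))"
      have yP: "y \<in> P" unfolding y_def by (rule powP[OF \<tau>P])
      have "t = y \<otimes>\<^bsub>A\<^esub> y"
        unfolding \<open>t = (\<tau> [^]\<^bsub>A\<^esub> m) [^]\<^bsub>A\<^esub> ((2::nat) ^ (k - 1))\<close> y_def k2 using \<tau>(1) by (simp add: A.nat_pow_mult mult_2)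
      then have ty: "\<rho> t = \<rho> y \<star> \<rho> y" using Pc[OF yP] by (simp add: \<rho>_mult)
      have "\<rho> t \<star> \<rho> c = \<rho> c \<star> \<rho> t" unfolding ty by (rule square_commute_up_to_sign[OF c(3)[OF yP]])
      then show False using t_ncom by blast
    qed
    have gm: "g ^ m = - 1" using gh k1 by simp
    have m_odd: "odd m" using m(2) .
    have sgn: "a = 1 \<or> a = - 1" if "a \<in> \<int>" "a ^ (2 ^ i) = 1" for a :: 'k and i :: nat
    proof -
      from Ints_prime_power_root[OF that two_is_prime_nat m] obtain j where "a = g ^ (m * j)" by blast
      then have "a = (- 1) ^ j" by (simp add: power_mult gm)
      then show ?thesis by (cases "even j") auto
    qed
    \<comment> \<open>With k = 1, half of p - 1 is odd, so -1 is not a square in the prime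
      field.\<close>
    have nosq: "a\<^sup>2 \<noteq> - 1" if "a \<in> \<int>" for a :: 'k
    proof
      assume a: "a\<^sup>2 = - 1"
      have "a \<noteq> 0" using a by auto
      then have "a ^ (p - 1) = 1" using Ints_fermat[OF p char that] by blast
      moreover have "a ^ (p - 1) = (a\<^sup>2) ^ m" unfolding m(1) k1 by (simp add: power_mult)
      ultimately have "(- 1 :: 'k) ^ m = 1" unfolding a by simp
      then show False using m_odd neg by simp
    qed
    have I: "c2 \<in> \<int>" "c3 \<in> \<int>" "c2 \<noteq> 0" "c3 \<noteq> 0" using \<rho>_Ints[OF cA] \<rho>_det_nz[OF cA] cm by auto
    let ?C = "{x \<in> P. \<rho> x \<star> \<rho> c = \<rho> c \<star> \<rho> x}"
    have Cform: "\<exists>\<alpha> \<beta>. \<alpha> \<in> \<int> \<and> \<beta> \<in> \<int> \<and> \<rho> x = M2 \<alpha> (\<beta> * c2) (\<beta> * c3) \<alpha>" if x: "x \<in> ?C" for x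
    proof -
      obtain x1 x2 x3 x4 where xm: "\<rho> x = M2 x1 x2 x3 x4" by (cases "\<rho> x")
      have ns: "\<not> mscalar (M2 0 c2 c3 0)" using I by simp
      have "M2 x1 x2 x3 x4 \<star> M2 0 c2 c3 0 = M2 0 c2 c3 0 \<star> M2 x1 x2 x3 x4" using x xm cm by simp
      then obtain \<alpha> \<beta> where ab: "x1 = \<alpha> + \<beta> * 0" "x2 = \<beta> * c2" "x3 = \<beta> * c3" "x4 = \<alpha> + \<beta> * 0"
        using commutant_span[OF ns] by metis
      have xI: "x1 \<in> \<int>" "x2 \<in> \<int>" using \<rho>_Ints[of x] x Pc xm by auto
      have "\<beta> = x2 / c2" using ab(2) I by simp
      then have "\<beta> \<in> \<int>" using xI I by simp
      moreover have "\<alpha> \<in> \<int>" using xI(1) ab(1) by simp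
      moreover have "\<rho> x = M2 \<alpha> (\<beta> * c2) (\<beta> * c3) \<alpha>" unfolding xm using ab by simp
      ultimately show ?thesis by blast
    qed
    have xtC: "x \<otimes>\<^bsub>A\<^esub> t \<in> ?C" if x: "x \<in> P" "x \<notin> ?C" for x
    proof -
      have 1: "\<rho> x \<star> \<rho> c = mneg (\<rho> c \<star> \<rho> x)" using c(3)[OF x(1)] x by blast
      have mm: "mneg (mneg z) = z" for z :: "'k m2" by (cases z) simp
      have r: "\<rho> (x \<otimes>\<^bsub>A\<^esub> t) = \<rho> x \<star> \<rho> t" using Pc[OF x(1)] tA by (rule \<rho>_mult)
      have "\<rho> x \<star> \<rho> t \<star> \<rho> c = mneg ((\<rho> x \<star> \<rho> c) \<star> \<rho> t)" unfolding mtimes_assoc t_anti mneg_mult ..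
      also have "\<dots> = \<rho> c \<star> (\<rho> x \<star> \<rho> t)" unfolding 1 mneg_mult mm mtimes_assoc ..
      finally show ?thesis using Pcl(1)[OF x(1) tP] r by simp
    qed
    have xtt: "x \<otimes>\<^bsub>A\<^esub> t \<otimes>\<^bsub>A\<^esub> t = x" if "x \<in> P" for x using Pc[OF that] tA tt by (simp add: A.m_assoc)
    \<comment> \<open>The determinant of c is a sign. If c2 c3 were 1, elements commuting with c
      would have eigenvalues \<alpha> + \<beta> and \<alpha> - \<beta> in the prime field, of
      2-power order and hence signs. Then \<alpha> or \<beta> vanishes, and all of P would be
      monomial.\<close>
    have c23: "c2 * c3 = - 1"
    proof -
      have "mdet (\<rho> c) ^ (2 ^ n) = 1" using prime_power_pow[OF P c(1)] \<rho>_pow_det[OF cA, of "2 ^ n"] by (simp add: \<rho>_one)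
      then have "mdet (\<rho> c) = 1 \<or> mdet (\<rho> c) = - 1" using sgn det_Ints[OF cA] by blast
      then have "- (c2 * c3) = 1 \<or> - (c2 * c3) = - 1" unfolding cm by simp
      then have "c2 * c3 = - 1 \<or> c2 * c3 = 1" by (metis minus_minus)
      moreover have "c2 * c3 \<noteq> 1"
      proof
        assume one: "c2 * c3 = 1"
        have monoC: "mono x" if x: "x \<in> ?C" for x
        proof -
          obtain \<alpha> \<beta> where ab: "\<alpha> \<in> \<int>" "\<beta> \<in> \<int>" "\<rho> x = M2 \<alpha> (\<beta> * c2) (\<beta> * c3) \<alpha>" using Cform[OF x] by blast
          have xP: "x \<in> P" "x \<in> carrier A" using x Pc by auto
          have ev: "\<mu> ^ (2 ^ n) = 1" if "v = (w, 1)" "mvec (\<rho> x) v = (\<mu> * fst v, \<mu> * snd v)" for \<mu> v w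
            using eigenvector_pow[OF xP(2) that(2), of "2 ^ n"] prime_power_pow[OF P xP(1)] that(1) by (simp add: \<rho>_one)
          have b23: "\<beta> * c3 * c2 = \<beta>" using one by (metis mult.assoc mult.commute mult_1_right)
          have "(\<alpha> + \<beta>) ^ (2 ^ n) = 1" using b23 by (intro ev[of "(c2, 1)"]) (simp_all add: ab(3) algebra_simps)
          moreover have "(\<alpha> - \<beta>) ^ (2 ^ n) = 1" using b23 by (intro ev[of "(- c2, 1)"]) (simp_all add: ab(3) algebra_simps)
          ultimately have "\<alpha> + \<beta> = 1 \<or> \<alpha> + \<beta> = - 1" "\<alpha> - \<beta> = 1 \<or> \<alpha> - \<beta> = - 1"
            using sgn[of "\<alpha> + \<beta>" n] sgn[of "\<alpha> - \<beta>" n] Ints_add[OF ab(1,2)] Ints_diff[OF ab(1,2)] by blast+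
          then have "\<alpha> + \<beta> = \<alpha> - \<beta> \<or> \<alpha> + \<beta> = - (\<alpha> - \<beta>)" by (metis minus_minus)
          then have "\<beta> = - \<beta> \<or> \<alpha> = - \<alpha>" by (auto simp: algebra_simps)
          then have "\<beta> = 0 \<or> \<alpha> = 0" using dbl by blast
          then show ?thesis unfolding mono_def ab(3) by auto
        qed
        have "mono x" if x: "x \<in> P" for x
        proof (cases "x \<in> ?C")
          case False
          then have "mono (x \<otimes>\<^bsub>A\<^esub> t)" using monoC xtC x by blast
          moreover have "\<rho> x = \<rho> (x \<otimes>\<^bsub>A\<^esub> t) \<star> \<rho> t" using xtt[OF x] \<rho>_mult[OF Pc[OF Pcl(1)[OF x tP]] tA] by simp
          ultimately show ?thesis unfolding mono_def \<rho>t by auto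
        qed (rule monoC)
        then show False using notmono by blast
      qed
      ultimately show ?thesis by blast
    qed
    have C: "subgroup ?C A"
    proof (rule A.subgroupI)
      have "\<one>\<^bsub>A\<^esub> \<in> ?C" using Pcl(3) by (simp add: \<rho>_one mtimes_one)
      then show "?C \<noteq> {}" by blast
      fix x assume x: "x \<in> ?C"
      have xA: "x \<in> carrier A" using x Pc by blast
      have "x \<otimes>\<^bsub>A\<^esub> c = c \<otimes>\<^bsub>A\<^esub> x" using x \<rho>_commute[OF xA cA] by blast
      then have "inv\<^bsub>A\<^esub> x \<otimes>\<^bsub>A\<^esub> (x \<otimes>\<^bsub>A\<^esub> c) \<otimes>\<^bsub>A\<^esub> inv\<^bsub>A\<^esub> x = inv\<^bsub>A\<^esub> x \<otimes>\<^bsub>A\<^esub> (c \<otimes>\<^bsub>A\<^esub> x) \<otimes>\<^bsub>A\<^esub> inv\<^bsub>A\<^esub> x" by simp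
      then have "inv\<^bsub>A\<^esub> x \<otimes>\<^bsub>A\<^esub> c = c \<otimes>\<^bsub>A\<^esub> inv\<^bsub>A\<^esub> x" using xA cA by (simp add: A.m_assoc)
      then show "inv\<^bsub>A\<^esub> x \<in> ?C" using x Pcl(2) \<rho>_commute[OF A.inv_closed[OF xA] cA] by blast
      fix y assume y: "y \<in> ?C"
      have yA: "y \<in> carrier A" using y Pc by blast
      have 1: "\<rho> x \<star> \<rho> c = \<rho> c \<star> \<rho> x" "\<rho> y \<star> \<rho> c = \<rho> c \<star> \<rho> y" using x y by auto
      have "\<rho> x \<star> \<rho> y \<star> \<rho> c = (\<rho> x \<star> \<rho> c) \<star> \<rho> y" unfolding mtimes_assoc 1(2) ..
      also have "\<dots> = \<rho> c \<star> (\<rho> x \<star> \<rho> y)" unfolding 1(1) mtimes_assoc ..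
      finally show "x \<otimes>\<^bsub>A\<^esub> y \<in> ?C" using x y Pcl(1) \<rho>_mult[OF xA yA] by simp
    qed (use Pc in blast)
    obtain b where b: "card ?C = 2 ^ b"
    proof -
      interpret P: group "A\<lparr>carrier := P\<rparr>" using P(1) by (rule subgroup.subgroup_is_group) (rule A.is_group)
      have "subgroup ?C (A\<lparr>carrier := P\<rparr>)" using C P(1) by (intro A.subgroup_incl) auto
      from P.lagrange[OF this] have "card (rcosets\<^bsub>A\<lparr>carrier := P\<rparr>\<^esub> ?C) * card ?C = 2 ^ n"
        using P(2) by (simp add: Coset.order_def)
      then have "card ?C dvd 2 ^ n" by (rule dvdI[OF trans[OF sym mult.commute]])
      then show ?thesis using that divides_primepow_nat[OF two_is_prime_nat] by blast
    qed
    have bcc: "\<beta> * c2 * (\<beta> * c3) = - (\<beta> * \<beta>)" for \<beta>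
    proof -
      have "\<beta> * c2 * (\<beta> * c3) = \<beta> * \<beta> * (c2 * c3)" by (simp only: ac_simps)
      then show ?thesis unfolding c23 by simp
    qed
    obtain d where d: "d \<in> ?C" "?C = {d [^]\<^bsub>A\<^esub> i |i::nat. True}" "\<And>i::nat. d [^]\<^bsub>A\<^esub> i = \<one>\<^bsub>A\<^esub> \<longleftrightarrow> 2 ^ b dvd i"
    proof (rule det_one_cyclic[OF C b two_is_prime_nat c(2)])
      show "\<rho> x \<star> \<rho> c = \<rho> c \<star> \<rho> x" if "x \<in> ?C" for x using that by blast
      show "x = \<one>\<^bsub>A\<^esub>" if x: "x \<in> ?C" "v \<noteq> (0, 0)" "mvec (\<rho> x) v = v" for x v
      proof -
        obtain \<alpha> \<beta> where ab: "\<alpha> \<in> \<int>" "\<beta> \<in> \<int>" "\<rho> x = M2 \<alpha> (\<beta> * c2) (\<beta> * c3) \<alpha>" using Cform[OF x(1)] by blast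
        have "1\<^sup>2 - (\<alpha> + \<alpha>) * 1 + (\<alpha> * \<alpha> - \<beta> * c2 * (\<beta> * c3)) = 0"
          using x ab(3) by (intro eigenvalue_char_poly[of v]) auto
        \<comment> \<open>The characteristic polynomial at 1 is (1 - \<alpha>)^2 + \<beta>^2. As -1
          is not a square, it vanishes only for \<alpha> = 1 and \<beta> = 0.\<close>
        then have e: "(1 - \<alpha>) * (1 - \<alpha>) + \<beta> * \<beta> = 0" unfolding bcc by (simp add: algebra_simps)
        have "\<beta> = 0"
        proof (rule ccontr)
          assume "\<beta> \<noteq> 0"
          have "(1 - \<alpha>) * (1 - \<alpha>) = - (\<beta> * \<beta>)" using e by (simp add: eq_neg_iff_add_eq_0)
          then have "((1 - \<alpha>) / \<beta>)\<^sup>2 = - 1" using \<open>\<beta> \<noteq> 0\<close> by (simp add: power2_eq_square)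
          moreover have "(1 - \<alpha>) / \<beta> \<in> \<int>" using ab by simp
          ultimately show False using nosq by blast
        qed
        then have "\<alpha> = 1" using e by simp
        then show ?thesis using ab(3) \<open>\<beta> = 0\<close> x(1) Pc by (intro \<rho>_eq) (auto simp: \<rho>_one)
      qed
    qed blast
    have dA: "d \<in> carrier A" "d \<in> P" using d(1) Pc by auto
    have powC: "d [^]\<^bsub>A\<^esub> i \<in> ?C" for i :: nat unfolding d(2) by blast
    have tC: "t \<notin> ?C" using t_ncom by blast
    \<comment> \<open>c lies in this cyclic group and its square is -1, so the order is at least
      4.\<close>
    have b2: "b \<ge> 2"
    proof (rule ccontr)
      assume "\<not> b \<ge> 2"
      then have "b = 0 \<or> b = 1" by linarith
      then have "(2::nat) ^ b dvd 2" by auto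
      have "c \<in> ?C" using c(1) by simp
      then obtain i :: nat where i: "c = d [^]\<^bsub>A\<^esub> i" unfolding d(2) by blast
      have "c \<otimes>\<^bsub>A\<^esub> c = d [^]\<^bsub>A\<^esub> (2 * i)" unfolding i using dA by (simp add: A.nat_pow_mult mult_2)
      also have "\<dots> = \<one>\<^bsub>A\<^esub>" using d(3)[of "2 * i"] \<open>2 ^ b dvd 2\<close> by (simp add: dvd_mult2)
      finally have "\<rho> c \<star> \<rho> c = M2 1 0 0 1" using cA by (metis \<rho>_mult \<rho>_one)
      then have "c2 * c3 = 1" unfolding cm by simp
      then show False using c23 neg by simp
    qed
    define N' where "N' = (2::nat) ^ (b - 1)"
    have N: "(2::nat) ^ b = 2 * N'" unfolding N'_def using b2 by (cases b) auto
    have N'4: "N' = 2 * 2 ^ (b - 2)" unfolding N'_def using b2 by (metis One_nat_def Suc_1 Suc_diff_le diff_Suc_Suc power_Suc)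
    have N'0: "N' > 0" unfolding N'_def by simp
    \<comment> \<open>The involution of the cyclic group is -1: an involution with \<alpha> = 0
      would make -1 a square.\<close>
    have \<rho>z: "\<rho> (d [^]\<^bsub>A\<^esub> N') = M2 (- 1) 0 0 (- 1)"
    proof -
      let ?x = "d [^]\<^bsub>A\<^esub> N'"
      obtain \<alpha> \<beta> where ab: "\<alpha> \<in> \<int>" "\<beta> \<in> \<int>" "\<rho> ?x = M2 \<alpha> (\<beta> * c2) (\<beta> * c3) \<alpha>" using Cform[OF powC] by blast
      have "?x \<otimes>\<^bsub>A\<^esub> ?x = d [^]\<^bsub>A\<^esub> ((2::nat) ^ b)" unfolding N using dA by (simp add: A.nat_pow_mult mult_2)
      also have "\<dots> = \<one>\<^bsub>A\<^esub>" using d(3) by simp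
      finally have "\<rho> ?x \<star> \<rho> ?x = M2 1 0 0 1" using dA by (metis A.nat_pow_closed \<rho>_mult \<rho>_one)
      then have e: "\<alpha> * \<alpha> + \<beta> * c2 * (\<beta> * c3) = 1" "\<alpha> * (\<beta> * c2) + \<beta> * c2 * \<alpha> = 0" unfolding ab(3) by simp_all
      have "?x \<noteq> \<one>\<^bsub>A\<^esub>" using d(3)[of N'] N N'0 by (auto dest: dvd_imp_le)
      have "\<alpha> * \<beta> * c2 = - (\<alpha> * \<beta> * c2)" using e(2) by (simp add: eq_neg_iff_add_eq_0 ac_simps)
      then have "\<alpha> * \<beta> * c2 = 0" by (rule dbl)
      then have "\<alpha> = 0 \<or> \<beta> = 0" using I by simp
      moreover have "\<alpha> \<noteq> 0"
      proof
        assume "\<alpha> = 0"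
        then have "- (\<beta> * \<beta>) = 1" using e(1) unfolding bcc by simp
        then have "\<beta>\<^sup>2 = - 1" by (simp add: power2_eq_square minus_equation_iff[of _ 1])
        then show False using nosq ab by blast
      qed
      ultimately have "\<beta> = 0" by blast
      then have "\<alpha> * \<alpha> = 1" using e(1) by simp
      then have "\<alpha> = 1 \<or> \<alpha> = - 1" by (rule iffD1[OF square_eq_1_iff])
      moreover have "\<alpha> \<noteq> 1"
      proof
        assume "\<alpha> = 1"
        then have "\<rho> ?x = \<rho> \<one>\<^bsub>A\<^esub>" using ab(3) \<open>\<beta> = 0\<close> by (simp add: \<rho>_one)
        then show False using \<open>?x \<noteq> \<one>\<^bsub>A\<^esub>\<close> \<rho>_eq[of ?x "\<one>\<^bsub>A\<^esub>"] dA by simp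
      qed
      ultimately show ?thesis using ab(3) \<open>\<beta> = 0\<close> by simp
    qed
    have com: "commuting_lifts t (d [^]\<^bsub>A\<^esub> N')"
    proof (rule split_commuting_lifts[OF borel_splits tB])
      show "d [^]\<^bsub>A\<^esub> N' \<in> B" using dA \<rho>z by auto
      show "t \<otimes>\<^bsub>A\<^esub> d [^]\<^bsub>A\<^esub> N' = d [^]\<^bsub>A\<^esub> N' \<otimes>\<^bsub>A\<^esub> t" using \<rho>_commute[OF tA, of "d [^]\<^bsub>A\<^esub> N'"] dA \<rho>z \<rho>t by simp
    qed
    have tinv: "inv\<^bsub>A\<^esub> t = t" using A.inv_equality[OF tt tA tA] .
    \<comment> \<open>d' is the Galois conjugate of d in the nonsplit torus, so
      \<open>d \<otimes> d'\<close> acts as the scalar given by the determinant of d, which is a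
      sign.\<close>
    define d' where "d' = t \<otimes>\<^bsub>A\<^esub> d \<otimes>\<^bsub>A\<^esub> inv\<^bsub>A\<^esub> t"
    have d'A: "d' \<in> carrier A" unfolding d'_def using tA dA by simp
    obtain \<alpha> \<beta> where ab: "\<alpha> \<in> \<int>" "\<beta> \<in> \<int>" "\<rho> d = M2 \<alpha> (\<beta> * c2) (\<beta> * c3) \<alpha>" using Cform[OF d(1)] by blast
    have "\<rho> d' = M2 \<alpha> (- (\<beta> * c2)) (- (\<beta> * c3)) \<alpha>" unfolding d'_def tinv using tA dA by (simp add: \<rho>_mult \<rho>t ab(3))
    then have dd': "\<rho> (d \<otimes>\<^bsub>A\<^esub> d') = M2 (mdet (\<rho> d)) 0 0 (mdet (\<rho> d))"
      using dA d'A by (simp add: \<rho>_mult ab(3) ac_simps)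
    have "mdet (\<rho> d) ^ (2 ^ n) = 1" using prime_power_pow[OF P dA(2)] \<rho>_pow_det[OF dA(1), of "2 ^ n"] by (simp add: \<rho>_one)
    then have dets: "mdet (\<rho> d) = 1 \<or> mdet (\<rho> d) = - 1" using sgn det_Ints[OF dA(1)] by blast
    have odd1: "coprime (2 ^ i) j" if "odd j" for i j :: nat using that by (simp add: coprime_left_2_iff_odd)
    \<comment> \<open>Determinant 1 makes d' the inverse of d, with exponent 2 N' - 1 (dihedral);
      determinant -1 gives the exponent N' - 1 (semidihedral). Both have the form 2 o' + 1 with o'
      odd, as \<open>split_dihedral\<close> requires.\<close>
    have "\<exists>o'::nat. o' > 0 \<and> odd o' \<and> d' = d [^]\<^bsub>A\<^esub> (2 * o' + 1)"
      using dets
    proof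
      assume "mdet (\<rho> d) = 1"
      then have "d \<otimes>\<^bsub>A\<^esub> d' = \<one>\<^bsub>A\<^esub>" using dd' dA d'A by (intro \<rho>_eq) (simp_all add: \<rho>_one)
      also have "\<one>\<^bsub>A\<^esub> = d \<otimes>\<^bsub>A\<^esub> d [^]\<^bsub>A\<^esub> (2 * (N' - 1) + 1)"
      proof -
        have "Suc (2 * (N' - 1) + 1) = 2 ^ b" using N N'0 by simp
        then show ?thesis using d(3)[of "2 ^ b"] A.nat_pow_Suc2[OF dA(1), of "2 * (N' - 1) + 1"] by simp
      qed
      finally have "d' = d [^]\<^bsub>A\<^esub> (2 * (N' - 1) + 1)" using dA d'A by (simp del: A.nat_pow_Suc)
      moreover have "1 \<le> (2::nat) ^ (b - 2)" by simp
      then have "odd (N' - 1)" "0 < N' - 1" unfolding N'4 by (simp, linarith)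
      ultimately show ?thesis by (intro exI[of _ "N' - 1"] conjI)
    next
      assume "mdet (\<rho> d) = - 1"
      then have "d \<otimes>\<^bsub>A\<^esub> d' = d [^]\<^bsub>A\<^esub> N'" using dd' dA d'A \<rho>z by (intro \<rho>_eq) simp_all
      also have "\<dots> = d \<otimes>\<^bsub>A\<^esub> d [^]\<^bsub>A\<^esub> (N' - 1)" using A.nat_pow_Suc2[OF dA(1), of "N' - 1"] N'0 by simp
      finally have d'e: "d' = d [^]\<^bsub>A\<^esub> (N' - 1)" using dA d'A by simp
      \<comment> \<open>For b = 2 the formula would read d' = d, so t would commute with d, and
        therefore with c.\<close>
      have "b \<noteq> 2"
      proof
        assume "b = 2"
        then have "d' = d" using d'e N'4 dA by simp
        then have "t \<otimes>\<^bsub>A\<^esub> d = d \<otimes>\<^bsub>A\<^esub> t" unfolding d'_def using tA dA by (metis A.inv_closed A.inv_solve_right' A.m_closed)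
        then have td: "\<rho> t \<star> \<rho> d = \<rho> d \<star> \<rho> t" using \<rho>_commute[OF tA dA(1)] by blast
        have "\<rho> d \<star> \<rho> c = \<rho> c \<star> \<rho> d" using d(1) by blast
        moreover have "\<not> mscalar (\<rho> d)"
        proof
          assume "mscalar (\<rho> d)"
          then have "\<rho> (d [^]\<^bsub>A\<^esub> i) \<star> \<rho> t = \<rho> t \<star> \<rho> (d [^]\<^bsub>A\<^esub> i)" for i :: nat
          proof -
            obtain s where "\<rho> d = M2 s 0 0 s" using \<open>mscalar (\<rho> d)\<close> by (cases "\<rho> d") auto
            then show ?thesis using \<rho>_pow_diag[OF dA(1), of s s i] \<rho>t by simp
          qed
          moreover have "c \<in> ?C" using c(1) by simp
          then obtain i :: nat where "c = d [^]\<^bsub>A\<^esub> i" unfolding d(2) by blast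
          ultimately show False using t_ncom by simp
        qed
        ultimately have "\<rho> c \<star> \<rho> t = \<rho> t \<star> \<rho> c"
          using commutant_commutative[of "\<rho> d" "\<rho> c" "\<rho> t"] td by simp
        then show False using t_ncom by simp
      qed
      then have b3: "b - 2 = Suc (b - 3)" using b2 by simp
      obtain y where y: "(2::nat) ^ (b - 3) = Suc y" by (metis gr0_implies_Suc zero_less_numeral zero_less_power)
      then have y2: "(2::nat) ^ (b - 2) = 2 * Suc y" unfolding b3 by simp
      have "d' = d [^]\<^bsub>A\<^esub> (2 * (2 * y + 1) + 1)" unfolding d'e N'4 y2 by simp
      then show ?thesis by (intro exI[of _ "2 * y + 1"] conjI) simp_all
    qed
    then obtain o' :: nat where o': "o' > 0" "odd o'" "d' = d [^]\<^bsub>A\<^esub> (2 * o' + 1)" by blast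
    have "splits {d [^]\<^bsub>A\<^esub> i \<otimes>\<^bsub>A\<^esub> t [^]\<^bsub>A\<^esub> j |(i::nat) (j::nat). True}"
    proof (rule split_dihedral[OF dA(1) d(3) tA tt _ _ N N'0 _ o'(1) com])
      show "t \<noteq> d [^]\<^bsub>A\<^esub> i" for i :: nat using powC[of i] tC by metis
      show "t \<otimes>\<^bsub>A\<^esub> d \<otimes>\<^bsub>A\<^esub> inv\<^bsub>A\<^esub> t = d [^]\<^bsub>A\<^esub> (2 * o' + 1)" using o'(3) unfolding d'_def .
      show "coprime (2 ^ b) o'" using odd1 o'(2) .
    qed
    also have "{d [^]\<^bsub>A\<^esub> i \<otimes>\<^bsub>A\<^esub> t [^]\<^bsub>A\<^esub> j |(i::nat) (j::nat). True} = P"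
    proof (intro equalityI subsetI)
      fix x assume "x \<in> {d [^]\<^bsub>A\<^esub> i \<otimes>\<^bsub>A\<^esub> t [^]\<^bsub>A\<^esub> j |(i::nat) (j::nat). True}"
      then obtain i j :: nat where "x = d [^]\<^bsub>A\<^esub> i \<otimes>\<^bsub>A\<^esub> t [^]\<^bsub>A\<^esub> j" by blast
      then show "x \<in> P" using Pcl(1) powP[OF dA(2), of i] powP[OF tP, of j] by simp
    next
      fix x assume x: "x \<in> P"
      show "x \<in> {d [^]\<^bsub>A\<^esub> i \<otimes>\<^bsub>A\<^esub> t [^]\<^bsub>A\<^esub> j |(i::nat) (j::nat). True}"
      proof (cases "x \<in> ?C")
        case True
        then obtain i :: nat where "x = d [^]\<^bsub>A\<^esub> i" unfolding d(2) by blast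
        then have "x = d [^]\<^bsub>A\<^esub> i \<otimes>\<^bsub>A\<^esub> t [^]\<^bsub>A\<^esub> (0::nat)" using dA by simp
        then show ?thesis by blast
      next
        case False
        then have "x \<otimes>\<^bsub>A\<^esub> t \<in> ?C" using xtC x by blast
        then obtain i :: nat where "x \<otimes>\<^bsub>A\<^esub> t = d [^]\<^bsub>A\<^esub> i" unfolding d(2) by blast
        then have "x = d [^]\<^bsub>A\<^esub> i \<otimes>\<^bsub>A\<^esub> t [^]\<^bsub>A\<^esub> (1::nat)" using xtt[OF x] tA by simp
        then show ?thesis by blast
      qed
    qed
    finally show ?thesis .
  qed
qed

text \<open>With p - 1 = q^k m and m prime to q, the m-th power of \<tau> has order q^k. For each q
  a Sylow subgroup containing that power is used, since the splitting arguments start from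
  it.\<close>

theorem torus_splits: "splits (carrier A)"
proof (rule splits_local_to_global[OF fin])
  fix q :: nat assume q: "prime q"
  have "p - 1 \<noteq> 0" using prime_gt_1_nat[OF p] by simp
  then obtain k m where m: "p - 1 = q ^ k * m" "\<not> q dvd m"
    using q by (metis multiplicity_decompose' not_prime_unit)
  have m0: "m > 0" using m(2) by (cases m) auto
  let ?x = "\<tau> [^]\<^bsub>A\<^esub> m"
  have xA: "?x \<in> carrier A" using \<tau>(1) by simp
  have iff: "?x [^]\<^bsub>A\<^esub> i = \<one>\<^bsub>A\<^esub> \<longleftrightarrow> q ^ k dvd i" for i :: nat
  proof -
    have "?x [^]\<^bsub>A\<^esub> i = \<tau> [^]\<^bsub>A\<^esub> (m * i)" using \<tau>(1) by (simp add: A.nat_pow_pow)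
    then have "?x [^]\<^bsub>A\<^esub> i = \<one>\<^bsub>A\<^esub> \<longleftrightarrow> (p - 1) dvd m * i" by (simp only: \<tau>_pow_one)
    then show ?thesis unfolding m(1) mult.commute[of "q ^ k" m] nat_mult_dvd_cancel1[OF m0] .
  qed
  have "A.ord ?x dvd q ^ k" using iff[of "q ^ k"] xA by (simp add: A.pow_eq_id)
  moreover have "q ^ k dvd A.ord ?x" using iff[of "A.ord ?x"] A.pow_ord_eq_1[OF xA] by blast
  ultimately have ord: "A.ord ?x = q ^ k" by (rule dvd_antisym)
  let ?T = "generate A {?x}"
  have T: "subgroup ?T A" using A.generate_is_subgroup[of "{?x}"] xA by simp
  have "card ?T = q ^ k" using A.generate_pow_card[OF xA] ord by simp
  then obtain P where P: "subgroup P A" "?T \<subseteq> P" "\<exists>n. card P = q ^ n" "\<not> q dvd card (rcosets\<^bsub>A\<^esub> P)"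
    using A.sylow_containing[OF fin q T] by metis
  have xP: "?x \<in> P" using P(2) generate.incl[of ?x "{?x}" A] by blast
  obtain n where n: "card P = q ^ n" using P(3) by blast
  have "splits P"
  proof (cases "q = 2")
    case True
    then show ?thesis using two_sylow_splits[OF P(1) _ _ _ xP] n m by blast
  next
    case False
    then have "odd q" using q by (metis primes_dvd_imp_eq two_is_prime_nat)
    then show ?thesis using odd_sylow_splits[OF P(1) n q _ m xP] by blast
  qed
  then show "\<exists>H. subgroup H A \<and> splits H \<and> \<not> q dvd card (rcosets\<^bsub>A\<^esub> H)" using P by blast
qed

end

section \<open>Fusion systems\<close>

locale fusion = group G for G :: "'g monoid" (structure) +
  fixes p :: nat and F :: "'g set \<Rightarrow> 'g set \<Rightarrow> ('g \<Rightarrow> 'g) set"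
  assumes fusion: "fusion_system G p F"
begin

lemma fin: "finite (carrier G)" and p: "prime p"
  using fusion by (simp_all add: fusion_system_def)

lemma fusion_ax:
  "\<forall>P Q. \<not> (subgroup P G \<and> subgroup Q G) \<longrightarrow> F P Q = {}"
  "\<forall>P Q. subgroup P G \<longrightarrow> subgroup Q G \<longrightarrow> Hom_S G P Q \<subseteq> F P Q \<and> F P Q \<subseteq> Inj_hom G P Q"
  "\<forall>P Q R \<phi> \<psi>. \<phi> \<in> F P Q \<longrightarrow> \<psi> \<in> F Q R \<longrightarrow> restrict (\<psi> \<circ> \<phi>) P \<in> F P R"
  "\<forall>P Q P' Q' \<phi>. \<phi> \<in> F P Q \<longrightarrow> subgroup P' G \<longrightarrow> P' \<subseteq> P \<longrightarrow> subgroup Q' G \<longrightarrow> \<phi> ` P' \<subseteq> Q' \<longrightarrow> restrict \<phi> P' \<in> F P' Q'"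
  "\<forall>P Q \<phi>. \<phi> \<in> F P Q \<longrightarrow> \<phi> ` P = Q \<longrightarrow> restrict (inv_into P \<phi>) Q \<in> F Q P"
proof -
  note f = fusion[unfolded fusion_system_def, THEN conjunct2, THEN conjunct2, THEN conjunct2, THEN conjunct2]
  note f' = f[THEN conjunct2] f[THEN conjunct2, THEN conjunct2]
  note f'' = f'(2)[THEN conjunct2] f'(2)[THEN conjunct2, THEN conjunct2]
  show "\<forall>P Q. \<not> (subgroup P G \<and> subgroup Q G) \<longrightarrow> F P Q = {}" by (rule f[THEN conjunct1])
  show "\<forall>P Q. subgroup P G \<longrightarrow> subgroup Q G \<longrightarrow> Hom_S G P Q \<subseteq> F P Q \<and> F P Q \<subseteq> Inj_hom G P Q"
    by (rule f'(1)[THEN conjunct1])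
  show "\<forall>P Q R \<phi> \<psi>. \<phi> \<in> F P Q \<longrightarrow> \<psi> \<in> F Q R \<longrightarrow> restrict (\<psi> \<circ> \<phi>) P \<in> F P R"
    by (rule f'(2)[THEN conjunct1])
  show "\<forall>P Q P' Q' \<phi>. \<phi> \<in> F P Q \<longrightarrow> subgroup P' G \<longrightarrow> P' \<subseteq> P \<longrightarrow> subgroup Q' G \<longrightarrow> \<phi> ` P' \<subseteq> Q' \<longrightarrow> restrict \<phi> P' \<in> F P' Q'"
    by (rule f''(1)[THEN conjunct1])
  show "\<forall>P Q \<phi>. \<phi> \<in> F P Q \<longrightarrow> \<phi> ` P = Q \<longrightarrow> restrict (inv_into P \<phi>) Q \<in> F Q P"
    by (rule f''(2))
qed

lemma F_subgroup: assumes "\<phi> \<in> F P Q" shows "subgroup P G" "subgroup Q G"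
  using fusion_ax(1)[rule_format, of P Q] assms by blast+

lemma Hom_S_F: "subgroup P G \<Longrightarrow> subgroup Q G \<Longrightarrow> \<phi> \<in> Hom_S G P Q \<Longrightarrow> \<phi> \<in> F P Q"
  using fusion_ax(2)[rule_format, of P Q] by blast

lemma F_Inj_hom: assumes "\<phi> \<in> F P Q" shows "\<phi> \<in> Inj_hom G P Q"
  using fusion_ax(2)[rule_format, OF F_subgroup[OF assms]] assms by blast

lemmas F_comp = fusion_ax(3)[rule_format]

lemmas F_restrict = fusion_ax(4)[rule_format]

lemmas F_inv = fusion_ax(5)[rule_format]

lemma F_ext: "\<phi> \<in> F P Q \<Longrightarrow> \<phi> \<in> extensional P"
  and F_image: "\<phi> \<in> F P Q \<Longrightarrow> x \<in> P \<Longrightarrow> \<phi> x \<in> Q"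
  and F_inj: "\<phi> \<in> F P Q \<Longrightarrow> inj_on \<phi> P"
  and F_mult: "\<phi> \<in> F P Q \<Longrightarrow> x \<in> P \<Longrightarrow> y \<in> P \<Longrightarrow> \<phi> (x \<otimes> y) = \<phi> x \<otimes> \<phi> y"
  using F_Inj_hom unfolding Inj_hom_def by blast+

lemma sub_carrier: "subgroup P G \<Longrightarrow> x \<in> P \<Longrightarrow> x \<in> carrier G"
  by (rule subgroup.mem_carrier)

lemma F_carrier: "\<phi> \<in> F P Q \<Longrightarrow> x \<in> P \<Longrightarrow> x \<in> carrier G" "\<phi> \<in> F P Q \<Longrightarrow> x \<in> P \<Longrightarrow> \<phi> x \<in> carrier G"
  using F_subgroup sub_carrier F_image by blast+

lemma F_one: assumes "\<phi> \<in> F P Q" shows "\<phi> \<one> = \<one>"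
proof -
  have 1: "\<one> \<in> P" using F_subgroup(1)[OF assms] by (rule subgroup.one_closed)
  have "\<phi> \<one> \<otimes> \<phi> \<one> = \<phi> \<one>" using F_mult[OF assms 1 1] by simp
  then show ?thesis using F_carrier(2)[OF assms 1] by simp
qed

lemma F_invm: assumes "\<phi> \<in> F P Q" "x \<in> P" shows "\<phi> (inv x) = inv (\<phi> x)"
proof -
  have ix: "inv x \<in> P" using F_subgroup(1)[OF assms(1)] assms(2) by (rule subgroup.m_inv_closed)
  have "\<phi> (inv x) \<otimes> \<phi> x = \<one>" using F_mult[OF assms(1) ix assms(2)] F_one[OF assms(1)] F_carrier(1)[OF assms] by simp
  then show ?thesis using inv_equality F_carrier(2)[OF assms(1)] ix assms(2) by metis
qed

lemma pow_closed: "subgroup P G \<Longrightarrow> x \<in> P \<Longrightarrow> x [^] (n::nat) \<in> P"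
  by (induction n) (auto simp: subgroup.one_closed subgroup.m_closed)

lemma F_pow: assumes "\<phi> \<in> F P Q" "x \<in> P" shows "\<phi> (x [^] (n::nat)) = \<phi> x [^] n"
proof (induction n)
  case (Suc n)
  have "x [^] n \<in> P" using pow_closed[OF F_subgroup(1)[OF assms(1)] assms(2)] .
  then show ?case using Suc F_mult[OF assms(1) _ assms(2)] by simp
qed (use F_one[OF assms(1)] in simp)

lemma sub_finite: "subgroup P G \<Longrightarrow> finite P"
  using fin subgroup.subset finite_subset by blast

lemma F_surj: assumes "\<phi> \<in> F P P" shows "\<phi> ` P = P"
  using F_image[OF assms] F_inj[OF assms] sub_finite[OF F_subgroup(1)[OF assms]]
  by (intro endo_inj_surj) auto

lemma F_codomain:
  assumes "\<phi> \<in> F P Q" "subgroup R G" "\<phi> ` P \<subseteq> R"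
  shows "\<phi> \<in> F P R"
proof -
  have "restrict \<phi> P \<in> F P R" using F_restrict[OF assms(1) F_subgroup(1)[OF assms(1)] subset_refl assms(2,3)] .
  then show ?thesis using F_ext[OF assms(1)] by (simp add: extensional_restrict)
qed

lemma F_image_subgroup: assumes "\<phi> \<in> F P Q" "subgroup R G" "R \<subseteq> P" shows "subgroup (\<phi> ` R) G"
proof (rule subgroupI)
  show "\<phi> ` R \<subseteq> carrier G" using F_carrier(2)[OF assms(1)] assms(3) by blast
  show "\<phi> ` R \<noteq> {}" using subgroup.one_closed[OF assms(2)] by blast
  fix a assume "a \<in> \<phi> ` R"
  then obtain x where x: "x \<in> R" "a = \<phi> x" by blast
  then have "inv a = \<phi> (inv x)" using F_invm[OF assms(1)] assms(3) by auto
  then show "inv a \<in> \<phi> ` R" using subgroup.m_inv_closed[OF assms(2) x(1)] by blast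
  fix b assume "b \<in> \<phi> ` R"
  then obtain y where y: "y \<in> R" "b = \<phi> y" by blast
  then have "a \<otimes> b = \<phi> (x \<otimes> y)" using F_mult[OF assms(1) subsetD[OF assms(3) x(1)] subsetD[OF assms(3) y(1)]] x by simp
  then show "a \<otimes> b \<in> \<phi> ` R" using subgroup.m_closed[OF assms(2) x(1) y(1)] by blast
qed

lemma conjm_F:
  assumes "subgroup P G" "h \<in> carrier G" "\<And>x. x \<in> P \<Longrightarrow> h \<otimes> x \<otimes> inv h \<in> P"
  shows "conjm G h P \<in> F P P"
  using assms by (intro Hom_S_F) (auto simp: Hom_S_def)

lemma id_F: "subgroup P G \<Longrightarrow> restrict id P \<in> F P P"
proof -
  assume P: "subgroup P G"
  have "conjm G \<one> P = restrict id P" using sub_carrier[OF P] by (auto simp: conjm_def)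
  then show ?thesis using conjm_F[OF P one_closed] sub_carrier[OF P] by simp
qed

lemma AutGrp_simps:
  "carrier (AutGrp F P) = F P P" "a \<otimes>\<^bsub>AutGrp F P\<^esub> b = restrict (a \<circ> b) P" "\<one>\<^bsub>AutGrp F P\<^esub> = restrict id P"
  by (simp_all add: AutGrp_def)

lemma AutGrp_group: assumes P: "subgroup P G" shows "group (AutGrp F P)"
proof (rule groupI)
  fix a b assume "a \<in> carrier (AutGrp F P)" "b \<in> carrier (AutGrp F P)"
  then show "a \<otimes>\<^bsub>AutGrp F P\<^esub> b \<in> carrier (AutGrp F P)" using F_comp[of b P P a P] unfolding AutGrp_simps by blast
next
  show "\<one>\<^bsub>AutGrp F P\<^esub> \<in> carrier (AutGrp F P)" unfolding AutGrp_simps by (rule id_F[OF P])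
next
  fix a b c assume abc: "a \<in> carrier (AutGrp F P)" "b \<in> carrier (AutGrp F P)" "c \<in> carrier (AutGrp F P)"
  then have "c x \<in> P" "b (c x) \<in> P" if "x \<in> P" for x using F_image that unfolding AutGrp_simps by blast+
  then show "a \<otimes>\<^bsub>AutGrp F P\<^esub> b \<otimes>\<^bsub>AutGrp F P\<^esub> c = a \<otimes>\<^bsub>AutGrp F P\<^esub> (b \<otimes>\<^bsub>AutGrp F P\<^esub> c)"
    unfolding AutGrp_simps by (auto simp: restrict_def)
next
  fix a assume "a \<in> carrier (AutGrp F P)"
  then have a: "a \<in> F P P" unfolding AutGrp_simps .
  then show "\<one>\<^bsub>AutGrp F P\<^esub> \<otimes>\<^bsub>AutGrp F P\<^esub> a = a"
    unfolding AutGrp_simps using F_image[OF a] F_ext[OF a] by (auto simp: restrict_def extensional_def)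
  have "restrict (inv_into P a) P \<otimes>\<^bsub>AutGrp F P\<^esub> a = \<one>\<^bsub>AutGrp F P\<^esub>"
    unfolding AutGrp_simps using F_image[OF a] F_inj[OF a] by (auto simp: restrict_def)
  then show "\<exists>b\<in>carrier (AutGrp F P). b \<otimes>\<^bsub>AutGrp F P\<^esub> a = \<one>\<^bsub>AutGrp F P\<^esub>"
    using F_inv[OF a F_surj[OF a]] unfolding AutGrp_simps(1) by blast
qed

lemma conjm_apply: "x \<in> P \<Longrightarrow> conjm G h P x = h \<otimes> x \<otimes> inv h"
  by (simp add: conjm_def)

lemma sub_conj: assumes "subgroup P G" "q \<in> P" "x \<in> P" shows "q \<otimes> x \<otimes> inv q \<in> P"
  using subgroup.m_closed[OF assms(1) subgroup.m_closed[OF assms] subgroup.m_inv_closed[OF assms(1,2)]] .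

lemma Inn_normal: assumes P: "subgroup P G" shows "normal (Inn G P) (AutGrp F P)"
proof -
  interpret A: group "AutGrp F P" by (rule AutGrp_group[OF P])
  have sub: "Inn G P \<subseteq> F P P" unfolding Inn_def using conjm_F[OF P] sub_conj[OF P] sub_carrier[OF P] by blast
  have mult: "conjm G q P \<otimes>\<^bsub>AutGrp F P\<^esub> conjm G r P = conjm G (q \<otimes> r) P" if "q \<in> P" "r \<in> P" for q r
  proof -
    have c: "q \<in> carrier G" "r \<in> carrier G" using that sub_carrier[OF P] by auto
    show ?thesis unfolding AutGrp_simps conjm_def using sub_conj[OF P that(2)] c sub_carrier[OF P]
      by (auto simp: restrict_def fun_eq_iff inv_mult_group m_assoc)
  qed
  have one: "conjm G \<one> P = \<one>\<^bsub>AutGrp F P\<^esub>" unfolding AutGrp_simps using sub_carrier[OF P] by (auto simp: conjm_def)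
  have oneP: "\<one> \<in> P" using P by (rule subgroup.one_closed)
  have invc: "inv\<^bsub>AutGrp F P\<^esub> conjm G q P = conjm G (inv q) P" if q: "q \<in> P" for q
  proof (rule A.inv_equality)
    have iq: "inv q \<in> P" using P q by (rule subgroup.m_inv_closed)
    show "conjm G (inv q) P \<otimes>\<^bsub>AutGrp F P\<^esub> conjm G q P = \<one>\<^bsub>AutGrp F P\<^esub>" using mult[OF iq q] one sub_carrier[OF P q] by simp
    show "conjm G q P \<in> carrier (AutGrp F P)" "conjm G (inv q) P \<in> carrier (AutGrp F P)"
      using sub q iq unfolding AutGrp_simps Inn_def by blast+
  qed
  have sg: "subgroup (Inn G P) (AutGrp F P)"
  proof (rule A.subgroupI)
    show "Inn G P \<subseteq> carrier (AutGrp F P)" using sub unfolding AutGrp_simps .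
    show "Inn G P \<noteq> {}" using oneP unfolding Inn_def by blast
    fix a assume "a \<in> Inn G P"
    then obtain q where q: "q \<in> P" "a = conjm G q P" unfolding Inn_def by blast
    then show "inv\<^bsub>AutGrp F P\<^esub> a \<in> Inn G P" using invc subgroup.m_inv_closed[OF P q(1)] unfolding Inn_def by auto
    fix b assume "b \<in> Inn G P"
    then obtain r where r: "r \<in> P" "b = conjm G r P" unfolding Inn_def by blast
    then show "a \<otimes>\<^bsub>AutGrp F P\<^esub> b \<in> Inn G P" using q mult subgroup.m_closed[OF P q(1) r(1)] unfolding Inn_def by auto
  qed
  have cj: "a \<otimes>\<^bsub>AutGrp F P\<^esub> h \<otimes>\<^bsub>AutGrp F P\<^esub> inv\<^bsub>AutGrp F P\<^esub> a \<in> Inn G P"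
    if a: "a \<in> carrier (AutGrp F P)" and h: "h \<in> Inn G P" for a h
  proof -
    obtain q where q: "q \<in> P" "h = conjm G q P" using h unfolding Inn_def by blast
    have aF: "a \<in> F P P" using a unfolding AutGrp_simps .
    have hA: "h \<in> carrier (AutGrp F P)" using sub h unfolding AutGrp_simps by blast
    have aq: "a q \<in> P" using F_image[OF aF q(1)] .
    have kA: "conjm G (a q) P \<in> carrier (AutGrp F P)" using sub aq unfolding AutGrp_simps Inn_def by blast
    have "a \<otimes>\<^bsub>AutGrp F P\<^esub> h = conjm G (a q) P \<otimes>\<^bsub>AutGrp F P\<^esub> a"
    proof -
      have "a (q \<otimes> x \<otimes> inv q) = a q \<otimes> a x \<otimes> inv (a q)" if x: "x \<in> P" for x
        using F_mult[OF aF subgroup.m_closed[OF P q(1) x] subgroup.m_inv_closed[OF P q(1)]] F_mult[OF aF q(1) x] F_invm[OF aF q(1)] by simp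
      then show ?thesis unfolding AutGrp_simps q(2) using F_image[OF aF] by (auto simp: restrict_def fun_eq_iff conjm_def)
    qed
    then have "a \<otimes>\<^bsub>AutGrp F P\<^esub> h \<otimes>\<^bsub>AutGrp F P\<^esub> inv\<^bsub>AutGrp F P\<^esub> a = conjm G (a q) P" using a kA by (simp add: A.m_assoc)
    then show ?thesis using aq unfolding Inn_def by auto
  qed
  show ?thesis using A.normal_inv_iff sg cj by blast
qed

lemma OutGrp_group: "subgroup P G \<Longrightarrow> group (OutGrp G F P)"
  unfolding OutGrp_def by (rule normal.factorgroup_is_group[OF Inn_normal])

lemma out_cls_hom: assumes P: "subgroup P G" shows "out_cls G F P \<in> hom (AutGrp F P) (OutGrp G F P)"
proof -
  interpret N: normal "Inn G P" "AutGrp F P" by (rule Inn_normal[OF P])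
  show ?thesis
  proof (rule homI)
    fix a b assume "a \<in> carrier (AutGrp F P)" "b \<in> carrier (AutGrp F P)"
    then show "out_cls G F P (a \<otimes>\<^bsub>AutGrp F P\<^esub> b) = out_cls G F P a \<otimes>\<^bsub>OutGrp G F P\<^esub> out_cls G F P b"
      unfolding out_cls_def OutGrp_def FactGroup_def by (simp add: N.rcos_sum)
  qed (simp add: out_cls_def OutGrp_def FactGroup_def N.rcosetsI N.subset)
qed

lemma out_cls_surj: "subgroup P G \<Longrightarrow> out_cls G F P ` F P P = carrier (OutGrp G F P)"
  unfolding out_cls_def OutGrp_def FactGroup_def RCOSETS_def by (auto simp: AutGrp_simps)

lemma out_cls_one_iff:
  assumes P: "subgroup P G" and a: "a \<in> F P P"
  shows "out_cls G F P a = \<one>\<^bsub>OutGrp G F P\<^esub> \<longleftrightarrow> a \<in> Inn G P"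
proof -
  interpret N: normal "Inn G P" "AutGrp F P" by (rule Inn_normal[OF P])
  have aA: "a \<in> carrier (AutGrp F P)" using a unfolding AutGrp_simps .
  have "Inn G P #>\<^bsub>AutGrp F P\<^esub> a = Inn G P \<longleftrightarrow> a \<in> Inn G P"
    using N.coset_join1[OF _ aA N.subgroup_axioms] N.coset_join2[OF aA N.subgroup_axioms] by blast
  then show ?thesis unfolding out_cls_def OutGrp_def FactGroup_def by simp
qed

lemma out_cls_eq:
  assumes P: "subgroup P G" and a: "a \<in> F P P" "b \<in> F P P" "out_cls G F P a = out_cls G F P b"
  obtains q where "q \<in> P" "\<And>x. x \<in> P \<Longrightarrow> a x = q \<otimes> b x \<otimes> inv q"
proof -
  interpret N: normal "Inn G P" "AutGrp F P" by (rule Inn_normal[OF P])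
  have "a \<in> Inn G P #>\<^bsub>AutGrp F P\<^esub> a" using N.rcos_self[OF _ N.subgroup_axioms] a unfolding AutGrp_simps by blast
  then have "a \<in> Inn G P #>\<^bsub>AutGrp F P\<^esub> b" using a(3) unfolding out_cls_def by simp
  then obtain h where h: "h \<in> Inn G P" "a = restrict (h \<circ> b) P" unfolding r_coset_def AutGrp_simps by blast
  then obtain q where q: "q \<in> P" "h = conjm G q P" unfolding Inn_def by blast
  have "a x = q \<otimes> b x \<otimes> inv q" if "x \<in> P" for x
    unfolding h(2) q(2) using that F_image[OF a(2)] by (simp add: conjm_def)
  then show ?thesis using that q by blast
qed

lemma AutGrp_norm_simps:
  "carrier (AutGrp_norm F R Q) = {a \<in> F R R. a ` Q = Q}" "a \<otimes>\<^bsub>AutGrp_norm F R Q\<^esub> b = restrict (a \<circ> b) R"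
  "\<one>\<^bsub>AutGrp_norm F R Q\<^esub> = restrict id R"
  by (simp_all add: AutGrp_norm_def)

lemma AutGrp_norm_group:
  assumes R: "subgroup R G" and Q: "subgroup Q G" "Q \<subseteq> R"
  shows "group (AutGrp_norm F R Q)" "subgroup {a \<in> F R R. a ` Q = Q} (AutGrp F R)"
    "AutGrp_norm F R Q = (AutGrp F R)\<lparr>carrier := {a \<in> F R R. a ` Q = Q}\<rparr>"
proof -
  interpret A: group "AutGrp F R" by (rule AutGrp_group[OF R])
  let ?N = "{a \<in> F R R. a ` Q = Q}"
  have img: "restrict f R ` Q = f ` Q" for f using Q(2) by auto
  show sg: "subgroup ?N (AutGrp F R)"
  proof (rule A.subgroupI)
    show "?N \<subseteq> carrier (AutGrp F R)" unfolding AutGrp_simps by blast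
    have "restrict id R \<in> ?N" using id_F[OF R] img[of id] by simp
    then show "?N \<noteq> {}" by blast
    fix a assume a: "a \<in> ?N"
    have aA: "a \<in> carrier (AutGrp F R)" using a unfolding AutGrp_simps by blast
    let ?b = "inv\<^bsub>AutGrp F R\<^esub> a"
    have bF: "?b \<in> F R R" using A.inv_closed[OF aA] unfolding AutGrp_simps .
    have "restrict (?b \<circ> a) R = restrict id R" using A.l_inv[OF aA] unfolding AutGrp_simps .
    then have ba: "restrict (?b \<circ> a) R x = restrict id R x" for x by (rule fun_cong)
    have "?b (a x) = x" if "x \<in> Q" for x using ba[of x] that Q(2) by auto
    then have "?b ` (a ` Q) = Q" unfolding image_image by simp
    then show "?b \<in> ?N" using a bF by auto
    fix b assume b: "b \<in> ?N"
    have "restrict (a \<circ> b) R ` Q = a ` (b ` Q)" unfolding img image_comp ..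
    then have "restrict (a \<circ> b) R ` Q = Q" using a b by simp
    then show "a \<otimes>\<^bsub>AutGrp F R\<^esub> b \<in> ?N" unfolding AutGrp_simps using a b F_comp[of b R R a R] by blast
  qed
  show eq: "AutGrp_norm F R Q = (AutGrp F R)\<lparr>carrier := ?N\<rparr>" by (simp add: AutGrp_norm_def AutGrp_def)
  show "group (AutGrp_norm F R Q)" unfolding eq by (rule subgroup.subgroup_is_group[OF sg A.is_group])
qed

end

text \<open>A commutative group of order p^2 and exponent p is a plane over the prime field, and e1,
  e2 form a basis because e2 is not a power of e1. Exponents are determined modulo p and hence
  define elements of k.\<close>

lemma (in comm_group) plane_coordinates:
  fixes k_type :: "'k::field itself"
  assumes p: "prime p" and char: "CHAR('k) = p"
    and card: "card (carrier G) = p * p" and exp: "\<And>x. x \<in> carrier G \<Longrightarrow> x [^] p = \<one>"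
    and e: "e1 \<in> carrier G" "e2 \<in> carrier G" "e1 \<noteq> \<one>" "\<And>i::nat. e2 \<noteq> e1 [^] i"
  obtains c1 c2 :: "'a \<Rightarrow> 'k" where
    "\<And>x y. x \<in> carrier G \<Longrightarrow> y \<in> carrier G \<Longrightarrow> c1 (x \<otimes> y) = c1 x + c1 y"
    "\<And>x y. x \<in> carrier G \<Longrightarrow> y \<in> carrier G \<Longrightarrow> c2 (x \<otimes> y) = c2 x + c2 y"
    "\<And>x. x \<in> carrier G \<Longrightarrow> c1 x \<in> \<int>" "\<And>x. x \<in> carrier G \<Longrightarrow> c2 x \<in> \<int>"
    "c1 e1 = 1" "c2 e1 = 0" "c1 e2 = 0" "c2 e2 = 1"
    "\<And>x. x \<in> carrier G \<Longrightarrow> c1 x = 0 \<Longrightarrow> c2 x = 0 \<Longrightarrow> x = \<one>"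
proof -
  have p0: "p > 0" "p > 1" using p prime_gt_0_nat prime_gt_1_nat by blast+
  have pmod: "x [^] n = x [^] (n mod p)" if x: "x \<in> carrier G" for x and n :: nat
  proof -
    have "x [^] n = x [^] (p * (n div p) + n mod p)" by simp
    also have "\<dots> = (x [^] p) [^] (n div p) \<otimes> x [^] (n mod p)" using x by (simp only: nat_pow_mult nat_pow_pow nat_pow_closed)
    finally show ?thesis using exp[OF x] x by simp
  qed
  have root: "\<exists>n::nat. x = (x [^] d) [^] n" if x: "x \<in> carrier G" and d: "0 < d" "d < p" for x and d :: nat
  proof -
    have "coprime d p" using p d by (metis coprime_commute nat_dvd_not_less prime_imp_coprime)
    then obtain a b where ab: "d * a = p * b + 1" using bezout_nat[of d p] d by auto
    have "(x [^] d) [^] a = x [^] (p * b + 1)" using x by (simp only: nat_pow_pow ab)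
    also have "\<dots> = (x [^] p) [^] b \<otimes> x" using x by (simp add: nat_pow_pow nat_pow_mult[symmetric])
    finally have "(x [^] d) [^] a = x" using exp[OF x] x by simp
    then show ?thesis by (intro exI[of _ a]) (rule sym)
  qed
  let ?f = "\<lambda>(i, j). e1 [^] (i::nat) \<otimes> e2 [^] (j::nat)"
  \<comment> \<open>Linear independence. A difference of exponents of e2 that is nonzero modulo p
    could be inverted there, making e2 a power of e1.\<close>
  have key: "i mod p = i' mod p \<and> j mod p = j' mod p" if eq: "e1 [^] i \<otimes> e2 [^] j = e1 [^] i' \<otimes> e2 [^] j'" for i j i' j' :: nat
  proof -
    have jj: "b mod p = b' mod p" if le: "b mod p \<le> b' mod p" and eq: "e1 [^] a \<otimes> e2 [^] b = e1 [^] a' \<otimes> e2 [^] b'" for a b a' b' :: nat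
    proof (rule ccontr)
      assume ne: "b mod p \<noteq> b' mod p"
      let ?d = "b' mod p - b mod p"
      have d: "0 < ?d" "?d < p" using ne le p0 by (auto simp: less_imp_diff_less)
      have "e1 [^] a \<otimes> e2 [^] (b mod p) = e1 [^] a' \<otimes> e2 [^] (b' mod p)" using eq by (simp only: pmod[OF e(2), of b, symmetric] pmod[OF e(2), of b', symmetric])
      also have "e2 [^] (b' mod p) = e2 [^] ?d \<otimes> e2 [^] (b mod p)" using le e by (simp add: nat_pow_mult)
      finally have "e1 [^] a \<otimes> e2 [^] (b mod p) = (e1 [^] a' \<otimes> e2 [^] ?d) \<otimes> e2 [^] (b mod p)" using e by (simp add: m_assoc)
      then have 1: "e1 [^] a = e1 [^] a' \<otimes> e2 [^] ?d" using e by simp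
      have 2: "e1 [^] (a' * (p - 1)) \<otimes> e1 [^] a' = \<one>"
      proof -
        have "a' * (p - 1) + a' = p * a'" using p0 by (simp add: algebra_simps)
        then have "e1 [^] (a' * (p - 1)) \<otimes> e1 [^] a' = (e1 [^] p) [^] a'" using e by (simp only: nat_pow_mult nat_pow_pow)
        then show ?thesis using exp e by simp
      qed
      have "e1 [^] (a' * (p - 1) + a) = e1 [^] (a' * (p - 1)) \<otimes> (e1 [^] a' \<otimes> e2 [^] ?d)" using e 1 by (simp add: nat_pow_mult[symmetric])
      also have "\<dots> = e2 [^] ?d" using e 2 by (simp add: m_assoc[symmetric])
      finally have 3: "e2 [^] ?d = e1 [^] (a' * (p - 1) + a)" by simp
      obtain n :: nat where "e2 = (e2 [^] ?d) [^] n" using root[OF e(2) d] by blast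
      also have "\<dots> = e1 [^] ((a' * (p - 1) + a) * n)" unfolding 3 using e by (simp only: nat_pow_pow)
      finally show False using e(4) by blast
    qed
    have j: "j mod p = j' mod p"
    proof (cases "j mod p \<le> j' mod p")
      case False
      then have "j' mod p \<le> j mod p" by simp
      then show ?thesis using jj[OF _ eq[symmetric]] by simp
    qed (rule jj[OF _ eq])
    then have "e2 [^] j = e2 [^] j'" using pmod[OF e(2), of j] pmod[OF e(2), of j'] by simp
    then have i: "e1 [^] i = e1 [^] i'" using eq e by simp
    have ii: "a mod p = b mod p" if le: "a mod p \<le> b mod p" and eq: "e1 [^] a = e1 [^] b" for a b :: nat
    proof (rule ccontr)
      assume ne: "a mod p \<noteq> b mod p"
      let ?d = "b mod p - a mod p"
      have d: "0 < ?d" "?d < p" using ne le p0 by (auto simp: less_imp_diff_less)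
      have "e1 [^] (a mod p) = e1 [^] (b mod p)" using eq by (simp only: pmod[OF e(1), of a, symmetric] pmod[OF e(1), of b, symmetric])
      also have "\<dots> = e1 [^] ?d \<otimes> e1 [^] (a mod p)" using le e by (simp add: nat_pow_mult)
      finally have "\<one> \<otimes> e1 [^] (a mod p) = e1 [^] ?d \<otimes> e1 [^] (a mod p)" using e by simp
      then have d1: "e1 [^] ?d = \<one>" using e by simp
      obtain n :: nat where "e1 = (e1 [^] ?d) [^] n" using root[OF e(1) d] by blast
      then show False unfolding d1 using e(3) by simp
    qed
    have "i mod p = i' mod p"
    proof (cases "i mod p \<le> i' mod p")
      case False
      then have "i' mod p \<le> i mod p" by simp
      then show ?thesis using ii[OF _ i[symmetric]] by simp
    qed (rule ii[OF _ i])
    then show ?thesis using j by blast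
  qed
  have inj: "inj_on ?f ({..<p} \<times> {..<p})"
  proof (rule inj_onI)
    fix x y assume "x \<in> {..<p} \<times> {..<p}" "y \<in> {..<p} \<times> {..<p}" "?f x = ?f y"
    then show "x = y" using key[of "fst x" "snd x" "fst y" "snd y"] by (cases x; cases y) auto
  qed
  have img: "?f ` ({..<p} \<times> {..<p}) = carrier G"
  proof (rule card_subset_eq)
    show "finite (carrier G)" using card p0 by (metis card.infinite mult_eq_0_iff not_less_zero)
    show "?f ` ({..<p} \<times> {..<p}) \<subseteq> carrier G" using e by auto
    show "card (?f ` ({..<p} \<times> {..<p})) = card (carrier G)" using card_image[OF inj] card by (simp add: card_cartesian_product)
  qed
  have ex: "\<exists>ij. x = e1 [^] (fst ij::nat) \<otimes> e2 [^] (snd ij::nat)" if "x \<in> carrier G" for x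
  proof -
    have "x \<in> ?f ` ({..<p} \<times> {..<p})" using that img by simp
    then obtain ij where "x = ?f ij" by blast
    then show ?thesis by (cases ij) auto
  qed
  define q where "q x = (SOME ij. x = e1 [^] (fst ij::nat) \<otimes> e2 [^] (snd ij::nat))" for x
  define I J where "I x = fst (q x)" and "J x = snd (q x)" for x
  have IJ: "x = e1 [^] I x \<otimes> e2 [^] J x" if "x \<in> carrier G" for x
    unfolding I_def J_def q_def by (rule someI_ex[OF ex[OF that]])
  define c1 c2 :: "'a \<Rightarrow> 'k" where "c1 x = of_nat (I x)" and "c2 x = of_nat (J x)" for x
  have c: "c1 x = of_nat i \<and> c2 x = of_nat j" if "x \<in> carrier G" "x = e1 [^] i \<otimes> e2 [^] j" for x i j
    using key[OF trans[OF sym[OF IJ[OF that(1)]] that(2)]] unfolding c1_def c2_def of_nat_eq_iff_mod_char[OF p char] .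
  have mult: "c1 (x \<otimes> y) = c1 x + c1 y \<and> c2 (x \<otimes> y) = c2 x + c2 y" if xy: "x \<in> carrier G" "y \<in> carrier G" for x y
  proof -
    have "x \<otimes> y = (e1 [^] I x \<otimes> e2 [^] J x) \<otimes> (e1 [^] I y \<otimes> e2 [^] J y)"
      by (rule arg_cong2[where f="(\<otimes>)", OF IJ[OF xy(1)] IJ[OF xy(2)]])
    also have "\<dots> = e1 [^] (I x + I y) \<otimes> e2 [^] (J x + J y)" using e by (simp add: nat_pow_mult[symmetric] m_ac)
    finally have eq: "x \<otimes> y = e1 [^] (I x + I y) \<otimes> e2 [^] (J x + J y)" .
    show ?thesis using c[OF m_closed[OF xy] eq] by (simp add: c1_def c2_def)
  qed
  have v: "c1 e1 = 1" "c2 e1 = 0" "c1 e2 = 0" "c2 e2 = 1" using c[of e1 1 0] c[of e2 0 1] e by auto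
  have ker: "x = \<one>" if x: "x \<in> carrier G" "c1 x = 0" "c2 x = 0" for x
  proof -
    have "I x mod p = 0" "J x mod p = 0" using x(2,3) of_nat_eq_iff_mod_char[OF p char, of "I x" 0] of_nat_eq_iff_mod_char[OF p char, of "J x" 0] unfolding c1_def c2_def by simp_all
    then have "e1 [^] I x = \<one>" "e2 [^] J x = \<one>" using pmod[OF e(1), of "I x"] pmod[OF e(2), of "J x"] by simp_all
    then show ?thesis using IJ[OF x(1)] by simp
  qed
  have "c1 x \<in> \<int>" "c2 x \<in> \<int>" for x unfolding c1_def c2_def by simp_all
  then show ?thesis using that[of c1 c2] mult v ker by blast
qed

section \<open>Extraspecial groups of exponent p\<close>

locale extraspecial_fusion = fusion +
  assumes p_odd: "odd p" and extraspecial: "extraspecial G p"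
    and card_S: "card (carrier G) = p ^ 3" and exponent: "has_exponent G p"
    and saturated: "saturated G p F"
begin

abbreviation Z where "Z \<equiv> grp_center G"

definition comm where "comm x y = x \<otimes> y \<otimes> inv x \<otimes> inv y"

lemma p_gt_1: "p > 1" "p > 0" using p prime_gt_0_nat prime_gt_1_nat by blast+

lemma pow_p: assumes x: "x \<in> carrier G" shows "x [^] p = \<one>"
proof -
  have "ord x dvd Lcm {ord. \<exists>x\<in>carrier G. ord = group.ord G x}" by (rule dvd_Lcm) (use x in blast)
  then have "ord x dvd p" using exponent unfolding has_exponent_def by simp
  then show ?thesis using pow_eq_id[OF x] by blast
qed

lemma Z_subset: "x \<in> Z \<Longrightarrow> x \<in> carrier G"
  and Z_comm: "z \<in> Z \<Longrightarrow> x \<in> carrier G \<Longrightarrow> z \<otimes> x = x \<otimes> z"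
  and Z_I: "z \<in> carrier G \<Longrightarrow> (\<And>x. x \<in> carrier G \<Longrightarrow> z \<otimes> x = x \<otimes> z) \<Longrightarrow> z \<in> Z"
  unfolding grp_center_def centralizer_def by auto

lemma card_Z: "card Z = p" and derived_Z: "derived G (carrier G) = Z"
  using extraspecial unfolding extraspecial_def by simp_all

lemma subgroup_centralizer:
  assumes P: "P \<subseteq> carrier G" shows "subgroup (centralizer G P) G"
proof (rule subgroupI)
  show "centralizer G P \<subseteq> carrier G" unfolding centralizer_def by blast
  have "\<one> \<in> centralizer G P" unfolding centralizer_def using P by auto
  then show "centralizer G P \<noteq> {}" by blast
  fix a assume a: "a \<in> centralizer G P"
  then have aG: "a \<in> carrier G" unfolding centralizer_def by blast
  have "inv a \<otimes> x = x \<otimes> inv a" if "x \<in> P" for x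
  proof -
    have x: "x \<in> carrier G" using that P by blast
    have "a \<otimes> x = x \<otimes> a" using a that unfolding centralizer_def by blast
    then have "inv a \<otimes> (a \<otimes> x) \<otimes> inv a = inv a \<otimes> (x \<otimes> a) \<otimes> inv a" by simp
    then show ?thesis using aG x by (simp add: m_assoc)
  qed
  then show "inv a \<in> centralizer G P" unfolding centralizer_def using aG by auto
  fix b assume b: "b \<in> centralizer G P"
  then have bG: "b \<in> carrier G" unfolding centralizer_def by blast
  have "a \<otimes> b \<otimes> x = x \<otimes> (a \<otimes> b)" if "x \<in> P" for x
  proof -
    have x: "x \<in> carrier G" using that P by blast
    have 1: "a \<otimes> x = x \<otimes> a" "b \<otimes> x = x \<otimes> b" using a b that unfolding centralizer_def by blast+
    have "a \<otimes> b \<otimes> x = a \<otimes> (x \<otimes> b)" using 1(2) aG bG x by (simp add: m_assoc)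
    also have "\<dots> = (a \<otimes> x) \<otimes> b" using aG bG x by (simp add: m_assoc)
    also have "\<dots> = x \<otimes> (a \<otimes> b)" unfolding 1(1) using aG bG x by (simp add: m_assoc)
    finally show ?thesis .
  qed
  then show "a \<otimes> b \<in> centralizer G P" unfolding centralizer_def using aG bG by auto
qed

lemma Z_subgroup: "subgroup Z G"
  unfolding grp_center_def by (rule subgroup_centralizer) simp

lemma comm_closed: "x \<in> carrier G \<Longrightarrow> y \<in> carrier G \<Longrightarrow> comm x y \<in> carrier G"
  unfolding comm_def by simp

lemma comm_Z: assumes "x \<in> carrier G" "y \<in> carrier G" shows "comm x y \<in> Z"
  unfolding derived_Z[symmetric] derived_def comm_def by (rule generate.incl) (use assms in blast)

lemma comm_conj: "x \<in> carrier G \<Longrightarrow> y \<in> carrier G \<Longrightarrow> x \<otimes> y \<otimes> inv x = comm x y \<otimes> y"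
  unfolding comm_def by (simp add: m_assoc)

lemma comm_unique: "\<lbrakk>x \<in> carrier G; y \<in> carrier G; z \<in> carrier G; x \<otimes> y \<otimes> inv x = z \<otimes> y\<rbrakk> \<Longrightarrow> comm x y = z"
  using comm_conj[of x y] comm_closed[of x y] by simp

lemma comm_one_iff: assumes x: "x \<in> carrier G" "y \<in> carrier G" shows "comm x y = \<one> \<longleftrightarrow> x \<otimes> y = y \<otimes> x"
proof
  assume "comm x y = \<one>"
  then have "x \<otimes> y \<otimes> inv x \<otimes> x = y \<otimes> x" using comm_conj[OF x] x by simp
  then show "x \<otimes> y = y \<otimes> x" using x by (simp add: m_assoc)
next
  assume "x \<otimes> y = y \<otimes> x"
  then show "comm x y = \<one>" using x unfolding comm_def by (simp add: m_assoc)
qed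

text \<open>Commutators are central because the derived subgroup is Z, and this makes the commutator
  multiplicative in each argument: it is the symplectic pairing of S/Z with values in Z.\<close>

lemma comm_mult_left:
  assumes x: "x \<in> carrier G" "x' \<in> carrier G" "y \<in> carrier G"
  shows "comm (x \<otimes> x') y = comm x y \<otimes> comm x' y"
proof (rule comm_unique)
  have c: "comm x' y \<in> carrier G" "comm x y \<in> carrier G" using x comm_closed by blast+
  have "x \<otimes> x' \<otimes> y \<otimes> inv (x \<otimes> x') = x \<otimes> (x' \<otimes> y \<otimes> inv x') \<otimes> inv x" using x by (simp add: m_assoc inv_mult_group)
  also have "\<dots> = (x \<otimes> comm x' y) \<otimes> y \<otimes> inv x" unfolding comm_conj[OF x(2,3)] using x c by (simp add: m_assoc)
  also have "\<dots> = (comm x' y \<otimes> x) \<otimes> y \<otimes> inv x" using Z_comm[OF comm_Z[OF x(2,3)] x(1)] by simp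
  also have "\<dots> = comm x' y \<otimes> (x \<otimes> y \<otimes> inv x)" using x c by (simp add: m_assoc)
  also have "\<dots> = (comm x' y \<otimes> comm x y) \<otimes> y" unfolding comm_conj[OF x(1,3)] using x c by (simp add: m_assoc)
  also have "\<dots> = (comm x y \<otimes> comm x' y) \<otimes> y" using Z_comm[OF comm_Z[OF x(2,3)] c(2)] by simp
  finally show "x \<otimes> x' \<otimes> y \<otimes> inv (x \<otimes> x') = comm x y \<otimes> comm x' y \<otimes> y" .
qed (use x comm_closed in auto)

lemma comm_mult_right:
  assumes x: "x \<in> carrier G" "y \<in> carrier G" "y' \<in> carrier G"
  shows "comm x (y \<otimes> y') = comm x y \<otimes> comm x y'"
proof (rule comm_unique)
  have c: "comm x y \<in> carrier G" "comm x y' \<in> carrier G" using x comm_closed by blast+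
  have "x \<otimes> (y \<otimes> y') \<otimes> inv x = (x \<otimes> y \<otimes> inv x) \<otimes> (x \<otimes> y' \<otimes> inv x)"
    using x by (simp add: m_assoc inv_solve_left)
  also have "\<dots> = comm x y \<otimes> (y \<otimes> comm x y') \<otimes> y'" unfolding comm_conj[OF x(1,2)] comm_conj[OF x(1,3)] using x c by (simp add: m_assoc)
  also have "\<dots> = comm x y \<otimes> (comm x y' \<otimes> y) \<otimes> y'" using Z_comm[OF comm_Z[OF x(1,3)] x(2)] by simp
  finally show "x \<otimes> (y \<otimes> y') \<otimes> inv x = comm x y \<otimes> comm x y' \<otimes> (y \<otimes> y')" using x c by (simp add: m_assoc)
qed (use x comm_closed in auto)

lemma comm_central: "z \<in> Z \<Longrightarrow> x \<in> carrier G \<Longrightarrow> comm x z = \<one>" "z \<in> Z \<Longrightarrow> x \<in> carrier G \<Longrightarrow> comm z x = \<one>"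
  using comm_one_iff Z_comm Z_subset by auto

lemma comm_pow_left: assumes "x \<in> carrier G" "y \<in> carrier G" shows "comm (x [^] (n::nat)) y = comm x y [^] n"
proof (induction n)
  case 0 show ?case using assms comm_one_iff[of \<one> y] by simp
next
  case (Suc n) then show ?case using assms comm_mult_left[of "x [^] n" x y] by simp
qed

lemma comm_pow_right: assumes "x \<in> carrier G" "y \<in> carrier G" shows "comm x (y [^] (n::nat)) = comm x y [^] n"
proof (induction n)
  case 0 show ?case using assms comm_one_iff[of x \<one>] by simp
next
  case (Suc n) then show ?case using assms comm_mult_right[of x "y [^] n" y] by simp
qed

lemma F_comm:
  assumes a: "a \<in> F P Q" and x: "x \<in> P" "y \<in> P" shows "a (comm x y) = comm (a x) (a y)"
proof -
  have P: "subgroup P G" using F_subgroup[OF a] by blast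
  note i = subgroup.m_inv_closed[OF P] and m = subgroup.m_closed[OF P]
  show ?thesis unfolding comm_def using x F_mult[OF a] F_invm[OF a] by (simp add: i m)
qed

text \<open>All elements have exponent p and d is invertible modulo p, so x is a power of
  \<open>x [^] d\<close>.\<close>

lemma pow_mod_root:
  assumes H: "subgroup H G" and x: "x \<in> carrier G" and d: "0 < d" "d < p" "x [^] d \<in> H" shows "x \<in> H"
proof -
  have "coprime d p" using p d by (metis coprime_commute nat_dvd_not_less prime_imp_coprime)
  then obtain a b where ab: "d * a = p * b + 1" using bezout_nat[of d p] d by auto
  have "(x [^] d) [^] a = x [^] (p * b + 1)" using x by (simp only: nat_pow_pow ab)
  also have "\<dots> = (x [^] p) [^] b \<otimes> x" using x by (simp add: nat_pow_pow nat_pow_mult[symmetric])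
  finally have "(x [^] d) [^] a = x" using pow_p[OF x] x by simp
  then show ?thesis using pow_closed[OF H d(3), of a] by simp
qed

text \<open>The cosets of H by the first p powers of s are distinct, so counting shows that they
  fill K.\<close>

lemma index_p_decomp:
  assumes H: "subgroup H G" and K: "subgroup K G" and HK: "H \<subseteq> K" "card K = p * card H"
    and s: "s \<in> K" "s \<notin> H" and x: "x \<in> K"
  obtains h n where "h \<in> H" "x = h \<otimes> s [^] (n::nat)"
proof -
  let ?f = "\<lambda>(h, n::nat). h \<otimes> s [^] n"
  have sG: "s \<in> carrier G" using K s sub_carrier by blast
  have HG: "h \<in> carrier G" if "h \<in> H" for h using H that sub_carrier by blast
  have key: "n = m" if hk: "h \<in> H" "k \<in> H" "h \<otimes> s [^] n = k \<otimes> s [^] m" "n \<le> m" "m < p" for h k and n m :: nat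
  proof (rule ccontr)
    assume "n \<noteq> m"
    then have d: "0 < m - n" "m - n < p" using hk by auto
    have "s [^] m = s [^] (m - n) \<otimes> s [^] n" using sG hk by (simp add: nat_pow_mult)
    then have "h \<otimes> s [^] n = (k \<otimes> s [^] (m - n)) \<otimes> s [^] n" using hk HG sG by (simp add: m_assoc)
    then have "h = k \<otimes> s [^] (m - n)" using hk HG sG by simp
    then have "s [^] (m - n) = inv k \<otimes> h" using hk HG sG by (simp add: inv_solve_left)
    then have "s [^] (m - n) \<in> H" using hk subgroup.m_closed[OF H] subgroup.m_inv_closed[OF H] by simp
    then show False using pow_mod_root[OF H sG d] s by blast
  qed
  have inj: "inj_on ?f (H \<times> {..<p})"
  proof (rule inj_onI)
    fix a b assume ab: "a \<in> H \<times> {..<p}" "b \<in> H \<times> {..<p}" "?f a = ?f b"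
    obtain h n k m where e: "a = (h, n)" "b = (k, m)" by (cases a, cases b)
    have 1: "h \<in> H" "k \<in> H" "n < p" "m < p" "h \<otimes> s [^] n = k \<otimes> s [^] m" using ab unfolding e by auto
    have nm: "n = m"
    proof (cases "n \<le> m")
      case True then show ?thesis using key[of h k n m] 1 by blast
    next
      case False then show ?thesis using key[of k h m n] 1 by simp
    qed
    then have "h = k" using 1 HG sG by simp
    then show "a = b" using nm e by simp
  qed
  have "?f ` (H \<times> {..<p}) = K"
  proof (rule card_subset_eq[OF sub_finite[OF K]])
    show "?f ` (H \<times> {..<p}) \<subseteq> K" using HK(1) s(1) subgroup.m_closed[OF K] pow_closed[OF K] by auto
    show "card (?f ` (H \<times> {..<p})) = card K" using card_image[OF inj] HK(2) by (simp add: card_cartesian_product)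
  qed
  then obtain a where "a \<in> H \<times> {..<p}" "x = ?f a" using x by blast
  then show ?thesis using that by (cases a) auto
qed

lemma prime_order_pow:
  assumes K: "subgroup K G" "card K = p" and a: "a \<in> K" "a \<noteq> \<one>" and b: "b \<in> K"
  obtains n :: nat where "b = a [^] n"
proof -
  have aG: "a \<in> carrier G" using a K sub_carrier by blast
  obtain h and n :: nat where "h \<in> {\<one>}" "b = h \<otimes> a [^] n"
    using index_p_decomp[OF triv_subgroup K(1), of a b] a b K subgroup.one_closed[OF K(1)] by auto
  then show ?thesis using that[of n] aG by simp
qed

lemma prime_order_meet:
  assumes K: "subgroup K G" "card K = p" and H: "subgroup H G" and a: "a \<in> K" "a \<in> H" "a \<noteq> \<one>"
  shows "K \<subseteq> H"
proof
  fix b assume "b \<in> K"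
  then obtain n :: nat where "b = a [^] n" using prime_order_pow[OF K a(1,3)] by blast
  then show "b \<in> H" using pow_closed[OF H a(2)] by simp
qed

text \<open>Z has prime order, so one nontrivial commutator with v generates it, and its powers are
  again commutators with v.\<close>

lemma comm_surj:
  assumes v: "v \<in> carrier G" "v \<notin> Z" and z: "z \<in> Z"
  obtains h where "h \<in> carrier G" "comm h v = z"
proof -
  obtain s where s: "s \<in> carrier G" "comm s v \<noteq> \<one>"
  proof -
    have "\<exists>s\<in>carrier G. comm s v \<noteq> \<one>"
    proof (rule ccontr)
      assume "\<not> ?thesis"
      then have "v \<otimes> x = x \<otimes> v" if "x \<in> carrier G" for x using comm_one_iff[OF that v(1)] that by auto
      then show False using Z_I v by blast
    qed
    then show ?thesis using that by blast
  qed
  obtain n :: nat where "z = comm s v [^] n" using prime_order_pow[OF Z_subgroup card_Z comm_Z[OF s(1) v(1)] s(2) z] by blast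
  then show ?thesis using that[of "s [^] n"] comm_pow_left[OF s(1) v(1)] s(1) by simp
qed

lemma Aut_Z: assumes a: "a \<in> F (carrier G) (carrier G)" shows "a ` Z = Z"
proof (rule card_subset_eq)
  show "finite Z" using sub_finite Z_subgroup by blast
  show "a ` Z \<subseteq> Z"
  proof
    fix y assume "y \<in> a ` Z"
    then obtain z where z: "z \<in> Z" "y = a z" by blast
    show "y \<in> Z"
    proof (rule Z_I)
      show "y \<in> carrier G" using F_carrier(2)[OF a] z Z_subset by blast
      fix x assume "x \<in> carrier G"
      then obtain w where w: "w \<in> carrier G" "x = a w" using F_surj[OF a] by blast
      show "y \<otimes> x = x \<otimes> y" unfolding z(2) w(2) using F_mult[OF a] Z_comm[OF z(1) w(1)] Z_subset[OF z(1)] w(1) by metis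
    qed
  qed
  show "card (a ` Z) = card Z" using card_image inj_on_subset[OF F_inj[OF a]] Z_subset by blast
qed

text \<open>As the facts below show, planes are abelian and contain Z, so they correspond to the
  lines of S/Z.\<close>

definition "plane V \<longleftrightarrow> subgroup V G \<and> card V = p\<^sup>2"

lemma planeD: "plane V \<Longrightarrow> subgroup V G" "plane V \<Longrightarrow> card V = p\<^sup>2" "plane V \<Longrightarrow> x \<in> V \<Longrightarrow> x \<in> carrier G"
  unfolding plane_def using sub_carrier by blast+

text \<open>Otherwise V and Z meet trivially and S is their product. Commutators of V then lie in
  both, so V is abelian and hence central, which is absurd.\<close>

lemma plane_Z: assumes V: "plane V" shows "Z \<subseteq> V"
proof (rule ccontr)
  assume n: "\<not> Z \<subseteq> V"
  note Vs = planeD(1)[OF V] and VG = planeD(3)[OF V]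
  have t: "a = \<one>" if "a \<in> Z" "a \<in> V" for a using prime_order_meet[OF Z_subgroup card_Z Vs that] n by blast
  let ?f = "\<lambda>(v, z). v \<otimes> z"
  have inj: "inj_on ?f (V \<times> Z)"
  proof (rule inj_onI)
    fix a b assume ab: "a \<in> V \<times> Z" "b \<in> V \<times> Z" "?f a = ?f b"
    obtain v z w y where e: "a = (v, z)" "b = (w, y)" by (cases a, cases b)
    have 1: "v \<in> V" "w \<in> V" "z \<in> Z" "y \<in> Z" "v \<otimes> z = w \<otimes> y" using ab unfolding e by auto
    have G: "v \<in> carrier G" "w \<in> carrier G" "z \<in> carrier G" "y \<in> carrier G" using 1 VG Z_subset by blast+
    have "inv w \<otimes> (v \<otimes> z) \<otimes> inv z = inv w \<otimes> (w \<otimes> y) \<otimes> inv z" using 1 by simp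
    then have 2: "inv w \<otimes> v = y \<otimes> inv z" using G by (simp add: m_assoc)
    have "inv w \<otimes> v \<in> V" using 1 subgroup.m_closed[OF Vs] subgroup.m_inv_closed[OF Vs] by simp
    moreover have "inv w \<otimes> v \<in> Z" unfolding 2 using 1 subgroup.m_closed[OF Z_subgroup] subgroup.m_inv_closed[OF Z_subgroup] by simp
    ultimately have 3: "inv w \<otimes> v = \<one>" using t by blast
    then have "w \<otimes> (inv w \<otimes> v) = w" using G by simp
    then have vw: "v = w" using G by simp
    then have "z = y" using 1(5) G by simp
    then show "a = b" using vw e by simp
  qed
  have img: "?f ` (V \<times> Z) = carrier G"
  proof (rule card_subset_eq[OF fin])
    show "?f ` (V \<times> Z) \<subseteq> carrier G" using VG Z_subset by auto
    show "card (?f ` (V \<times> Z)) = card (carrier G)"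
      using card_image[OF inj] card_S planeD(2)[OF V] card_Z by (simp add: card_cartesian_product power2_eq_square power3_eq_cube)
  qed
  have ab: "v \<otimes> w = w \<otimes> v" if "v \<in> V" "w \<in> V" for v w
  proof -
    have "comm v w \<in> V" unfolding comm_def using that subgroup.m_closed[OF Vs] subgroup.m_inv_closed[OF Vs] by simp
    then have "comm v w = \<one>" using t comm_Z that VG by blast
    then show ?thesis using comm_one_iff that VG by blast
  qed
  have "V \<subseteq> {\<one>}"
  proof
    fix v assume v: "v \<in> V"
    have "v \<in> Z"
    proof (rule Z_I)
      show vG: "v \<in> carrier G" using v VG by blast
      fix x assume "x \<in> carrier G"
      then have "x \<in> ?f ` (V \<times> Z)" unfolding img .
      then obtain w z where x: "w \<in> V" "z \<in> Z" "x = w \<otimes> z" by auto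
      have G: "w \<in> carrier G" "z \<in> carrier G" using x VG Z_subset by auto
      have "v \<otimes> (w \<otimes> z) = (v \<otimes> w) \<otimes> z" using vG G by (simp add: m_assoc)
      also have "\<dots> = w \<otimes> (v \<otimes> z)" unfolding ab[OF v x(1)] using vG G by (simp add: m_assoc)
      also have "\<dots> = w \<otimes> z \<otimes> v" unfolding Z_comm[OF x(2) vG, symmetric] using vG G by (simp add: m_assoc)
      finally show "v \<otimes> x = x \<otimes> v" unfolding x(3) .
    qed
    then show "v \<in> {\<one>}" using t v by blast
  qed
  then have "card V \<le> 1" using card_mono[of "{\<one>}" V] by simp
  moreover have "1 < p * p" using less_1_mult[OF p_gt_1(1) p_gt_1(1)] .
  ultimately show False using planeD(2)[OF V] by (simp add: power2_eq_square)
qed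

lemma plane_not_Z: assumes V: "plane V" obtains v where "v \<in> V" "v \<notin> Z"
proof -
  have "\<not> V \<subseteq> Z"
  proof
    assume "V \<subseteq> Z"
    then have "card V \<le> card Z" using card_mono sub_finite[OF Z_subgroup] by blast
    then show False using planeD(2)[OF V] p_gt_1 card_Z by (simp add: power2_eq_square)
  qed
  then show ?thesis using that by blast
qed

lemma plane_decomp:
  assumes V: "plane V" and v: "v \<in> V" "v \<notin> Z" and x: "x \<in> V"
  obtains z n where "z \<in> Z" "x = z \<otimes> v [^] (n::nat)"
  using index_p_decomp[OF Z_subgroup planeD(1)[OF V] plane_Z[OF V] _ v x] planeD(2)[OF V] card_Z
  by (auto simp: power2_eq_square)

lemma S_decomp:
  assumes V: "plane V" and s: "s \<in> carrier G" "s \<notin> V" and x: "x \<in> carrier G"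
  obtains w n where "w \<in> V" "x = w \<otimes> s [^] (n::nat)"
  using index_p_decomp[OF planeD(1)[OF V] subgroup_self _ _ s x] planeD[OF V] card_S
  by (auto simp: power2_eq_square power3_eq_cube)

lemma plane_abelian: assumes V: "plane V" and xy: "x \<in> V" "y \<in> V" shows "x \<otimes> y = y \<otimes> x"
proof -
  obtain v where v: "v \<in> V" "v \<notin> Z" using plane_not_Z[OF V] by blast
  have vG: "v \<in> carrier G" using planeD(3)[OF V v(1)] .
  obtain z and n :: nat where z: "z \<in> Z" "x = z \<otimes> v [^] n" using plane_decomp[OF V v xy(1)] by blast
  obtain z' and n' :: nat where z': "z' \<in> Z" "y = z' \<otimes> v [^] n'" using plane_decomp[OF V v xy(2)] by blast
  have "comm (v [^] n) (v [^] n') = \<one>" using comm_pow_left[OF vG, of "v [^] n'" n] comm_pow_right[OF vG vG, of n'] comm_one_iff[OF vG vG] vG by simp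
  then have "comm x y = \<one>" unfolding z(2) z'(2)
    using comm_mult_left comm_mult_right comm_central z(1) z'(1) Z_subset vG by simp
  then show ?thesis using comm_one_iff planeD(3)[OF V] xy by blast
qed

lemma plane_conj: assumes V: "plane V" and x: "x \<in> V" "g \<in> carrier G" shows "g \<otimes> x \<otimes> inv g \<in> V"
  using comm_conj[OF x(2) planeD(3)[OF V x(1)]] comm_Z[OF x(2) planeD(3)[OF V x(1)]] plane_Z[OF V] x(1) subgroup.m_closed[OF planeD(1)[OF V]] by auto

lemma plane_proper: assumes V: "plane V" obtains s where "s \<in> carrier G" "s \<notin> V"
proof -
  have "V \<noteq> carrier G" using planeD(2)[OF V] card_S p_gt_1 by (auto simp: power2_eq_square power3_eq_cube)
  then show ?thesis using that planeD(3)[OF V] by blast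
qed

text \<open>An element outside V generates S together with V. If it centralised V, a noncentral
  element of V would become central.\<close>

lemma plane_centralizer: assumes V: "plane V" shows "centralizer G V = V"
proof
  show "V \<subseteq> centralizer G V" unfolding centralizer_def using planeD(3)[OF V] plane_abelian[OF V] by blast
  show "centralizer G V \<subseteq> V"
  proof (rule ccontr)
    assume "\<not> ?thesis"
    then obtain c where c: "c \<in> carrier G" "c \<notin> V" "\<And>x. x \<in> V \<Longrightarrow> c \<otimes> x = x \<otimes> c" unfolding centralizer_def by blast
    obtain v where v: "v \<in> V" "v \<notin> Z" using plane_not_Z[OF V] by blast
    have vG: "v \<in> carrier G" using planeD(3)[OF V v(1)] .
    have "v \<in> Z"
    proof (rule Z_I[OF vG])
      fix x assume "x \<in> carrier G"
      then obtain w and n :: nat where x: "w \<in> V" "x = w \<otimes> c [^] n" using S_decomp[OF V c(1,2)] by blast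
      have wG: "w \<in> carrier G" using planeD(3)[OF V x(1)] .
      have "comm w v = \<one>" using comm_one_iff[OF wG vG] plane_abelian[OF V x(1) v(1)] by simp
      moreover have "comm c v = \<one>" using comm_one_iff[OF c(1) vG] c(3)[OF v(1)] by simp
      ultimately have "comm x v = \<one>" unfolding x(2) using comm_mult_left[OF wG _ vG, of "c [^] n"] comm_pow_left[OF c(1) vG] c(1) by simp
      then show "v \<otimes> x = x \<otimes> v" using comm_one_iff[of x v] vG x(2) wG c(1) by simp
    qed
    then show False using v by blast
  qed
qed

lemma plane_normalizer: assumes V: "plane V" shows "Defs.normalizer G V = carrier G"
proof -
  have "(\<lambda>x. g \<otimes> x \<otimes> inv g) ` V = V" if g: "g \<in> carrier G" for g
  proof (rule endo_inj_surj)
    show "finite V" using sub_finite planeD(1)[OF V] by blast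
    show "(\<lambda>x. g \<otimes> x \<otimes> inv g) ` V \<subseteq> V" using plane_conj[OF V _ g] by blast
    show "inj_on (\<lambda>x. g \<otimes> x \<otimes> inv g) V" using planeD(3)[OF V] g by (auto intro!: inj_onI)
  qed
  then show ?thesis unfolding Defs.normalizer_def by blast
qed

lemma subgroup_card_cases:
  assumes P: "subgroup P G"
  obtains "P = {\<one>}" | "card P = p" | "plane P" | "P = carrier G"
proof -
  have "card (rcosets P) * card P = p ^ 3" using lagrange[OF P] card_S by (simp add: Coset.order_def)
  then have "card P dvd p ^ 3" by (metis dvd_triv_right)
  then obtain i where i: "i \<le> 3" "card P = p ^ i" using divides_primepow_nat[OF p] by blast
  then consider "i = 0" | "i = 1" | "i = 2" | "i = 3" by linarith
  then show ?thesis
  proof cases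
    case 1
    then obtain a where "P = {a}" using i card_1_singletonE[of P] by auto
    then have "P = {\<one>}" using subgroup.one_closed[OF P] by auto
    then show ?thesis using that by blast
  next
    case 2 then show ?thesis using that i by simp
  next
    case 3 then show ?thesis using that i P unfolding plane_def by simp
  next
    case 4
    then have "P = carrier G" using card_subset_eq[OF fin subgroup.subset[OF P]] i card_S by simp
    then show ?thesis using that by blast
  qed
qed

end

section \<open>Extension of morphisms and the constrained case\<close>

context extraspecial_fusion
begin

lemma F_image_plane:
  assumes a: "a \<in> F P Q" and P: "plane P" shows "plane (a ` P)"
  unfolding plane_def using F_image_subgroup[OF a planeD(1)[OF P] subset_refl] card_image[OF F_inj[OF a]] planeD(2)[OF P] by simp

lemma F_conj_card: assumes "F_conj F P Q" shows "card Q = card P" "subgroup Q G"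
  using assms card_image[OF F_inj] F_subgroup(2) unfolding F_conj_def by metis+

text \<open>Conjugates of a plane are planes, and every plane is its own centraliser.\<close>

lemma plane_fully_centralized: assumes P: "plane P" shows "fully_centralized G F P"
proof -
  have "card (centralizer G Q) = card (centralizer G P)" if "F_conj F P Q" for Q
  proof -
    have "plane Q" using F_conj_card[OF that] P unfolding plane_def by simp
    then show ?thesis using plane_centralizer P unfolding plane_def by simp
  qed
  then show ?thesis unfolding fully_centralized_def using planeD(1)[OF P] by simp
qed

lemma saturated_extend:
  assumes a: "a \<in> F P (carrier G)" and fc: "fully_centralized G F (a ` P)"
  obtains b where "b \<in> F (N_phi G P a) (carrier G)" "\<And>x. x \<in> P \<Longrightarrow> b x = a x"
proof -
  have P: "subgroup P G" using F_subgroup[OF a] by blast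
  have "\<forall>P \<phi>. subgroup P G \<longrightarrow> \<phi> \<in> F P (carrier G) \<longrightarrow> fully_centralized G F (\<phi> ` P) \<longrightarrow>
         (\<exists>\<psi>\<in>F (N_phi G P \<phi>) (carrier G). \<forall>x\<in>P. \<psi> x = \<phi> x)"
    using saturated[unfolded saturated_def, THEN conjunct2, THEN conjunct2] .
  from this[rule_format, OF P a fc] show ?thesis using that by blast
qed

lemma F_to_S: "a \<in> F P Q \<Longrightarrow> a \<in> F P (carrier G)"
  using F_codomain[OF _ subgroup_self, of a P Q] F_carrier(2)[of a P Q] by blast

text \<open>Conjugation by g acts on P through its commutator with one noncentral e. As a preserves
  Z, some h has the transported commutator with a e, so conjugation by g on P corresponds to
  conjugation by h on the image. Hence \<open>N_phi\<close> is all of S and saturation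
  applies.\<close>

lemma plane_extend:
  assumes a: "a \<in> F P Q" and P: "plane P" and aZ: "a ` Z = Z"
  obtains b where "b \<in> F (carrier G) (carrier G)" "\<And>x. x \<in> P \<Longrightarrow> b x = a x"
proof -
  have aS: "a \<in> F P (carrier G)" using F_to_S[OF a] .
  note Ps = planeD(1)[OF P] and PG = planeD(3)[OF P]
  obtain e where e: "e \<in> P" "e \<notin> Z" using plane_not_Z[OF P] by blast
  have eG: "e \<in> carrier G" using PG e by blast
  have aeG: "a e \<in> carrier G" using F_carrier(2)[OF a e(1)] .
  have ZP: "z \<in> P" if "z \<in> Z" for z using plane_Z[OF P] that by blast
  have aZ': "a z \<in> Z" if "z \<in> Z" for z using aZ that by blast
  have aeZ: "a e \<notin> Z"
  proof
    assume "a e \<in> Z"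
    then obtain z where "z \<in> Z" "a e = a z" using aZ by blast
    then show False using inj_onD[OF F_inj[OF a], of e z] e ZP by blast
  qed
  have nP: "Defs.normalizer G (a ` P) = carrier G" using plane_normalizer[OF F_image_plane[OF a P]] .
  have "g \<in> N_phi G P a" if g: "g \<in> carrier G" for g
  proof -
    have cZ: "comm g e \<in> Z" using comm_Z[OF g eG] .
    obtain h where h: "h \<in> carrier G" "comm h (a e) = a (comm g e)" using comm_surj[OF aeG aeZ aZ'[OF cZ]] by blast
    have "a (g \<otimes> y \<otimes> inv g) = h \<otimes> a y \<otimes> inv h" if y: "y \<in> P" for y
    proof -
      have yG: "y \<in> carrier G" using PG y by blast
      have ayG: "a y \<in> carrier G" using F_carrier(2)[OF a y] .
      obtain z and n :: nat where z: "z \<in> Z" "y = z \<otimes> e [^] n" using plane_decomp[OF P e y] by blast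
      have enP: "e [^] n \<in> P" using pow_closed[OF Ps e(1)] .
      have "comm g y = comm g e [^] n" unfolding z(2)
        using comm_mult_right[OF g Z_subset[OF z(1)], of "e [^] n"] comm_central(1)[OF z(1) g] comm_pow_right[OF g eG] eG comm_closed[OF g eG] by simp
      then have 1: "a (comm g y) = a (comm g e) [^] n" using F_pow[OF a ZP[OF cZ]] by simp
      have "a y = a z \<otimes> a e [^] n" unfolding z(2) using F_mult[OF a ZP[OF z(1)] enP] F_pow[OF a e(1)] by simp
      then have "comm h (a y) = comm h (a e) [^] n"
        using comm_mult_right[OF h(1) Z_subset[OF aZ'[OF z(1)]], of "a e [^] n"] comm_central(1)[OF aZ'[OF z(1)] h(1)] comm_pow_right[OF h(1) aeG] aeG comm_closed[OF h(1) aeG] by simp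
      then have 2: "comm h (a y) = a (comm g y)" using 1 h(2) by simp
      have "a (g \<otimes> y \<otimes> inv g) = a (comm g y) \<otimes> a y" unfolding comm_conj[OF g yG] using F_mult[OF a ZP[OF comm_Z[OF g yG]] y] .
      then show ?thesis unfolding comm_conj[OF h(1) ayG] 2 .
    qed
    then show ?thesis unfolding N_phi_def nP plane_normalizer[OF P] using g h(1) by blast
  qed
  then have N: "N_phi G P a = carrier G" unfolding N_phi_def Defs.normalizer_def by blast
  from saturated_extend[OF aS plane_fully_centralized[OF F_image_plane[OF a P]]]
  show ?thesis using that unfolding N by blast
qed

text \<open>Comparing \<open>a\<close> with its conjugates by inner automorphisms shows that it can only move the
  centre if some automorphism of its image does.\<close>
lemma plane_fixes_Z:
  assumes a: "a \<in> F P Q" and P: "plane P"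
    and ne: "\<And>V b. plane V \<Longrightarrow> b \<in> F V V \<Longrightarrow> b ` Z = Z"
  shows "a ` Z = Z"
proof -
  let ?Q = "a ` P"
  have Q: "plane ?Q" using F_image_plane[OF a P] .
  have aQ: "a \<in> F P ?Q" using F_codomain[OF a planeD(1)[OF Q] subset_refl] .
  have iQ: "restrict (inv_into P a) ?Q \<in> F ?Q P" using F_inv[OF aQ refl] .
  have inv: "inv_into P a (a w) = w" if "w \<in> P" for w using inv_into_f_f[OF F_inj[OF a] that] .
  have key: "a (comm g w) \<in> Z" if g: "g \<in> carrier G" and w: "w \<in> P" "a w \<in> Z" for g w
  proof -
    have cF: "conjm G g P \<in> F P P" using conjm_F[OF planeD(1)[OF P] g] plane_conj[OF P _ g] by blast
    \<comment> \<open>Conjugation by g on P, carried over by a, is an automorphism of the plane a(P)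
      and so preserves Z by assumption.\<close>
    define t where "t = restrict (a \<circ> restrict (conjm G g P \<circ> restrict (inv_into P a) ?Q) ?Q) ?Q"
    have tF: "t \<in> F ?Q ?Q" unfolding t_def by (rule F_comp[OF F_comp[OF iQ cF] aQ])
    have "t (a w) = a (g \<otimes> w \<otimes> inv g)" unfolding t_def using w(1) inv[OF w(1)] by (simp add: conjm_apply)
    also have "\<dots> = a (comm g w) \<otimes> a w"
      using comm_conj[OF g] planeD(3)[OF P w(1)] F_mult[OF a _ w(1)] plane_Z[OF P] comm_Z[OF g] by auto
    finally have 1: "t (a w) = a (comm g w) \<otimes> a w" .
    have "t (a w) \<in> Z" using ne[OF Q tF] w(2) by blast
    then have 2: "t (a w) \<otimes> inv (a w) \<in> Z" using subgroup.m_closed[OF Z_subgroup] subgroup.m_inv_closed[OF Z_subgroup] w(2) by blast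
    have "comm g w \<in> P" using plane_Z[OF P] comm_Z[OF g planeD(3)[OF P w(1)]] by blast
    then have "a (comm g w) \<in> carrier G" "a w \<in> carrier G" using F_carrier(2)[OF a] w by blast+
    then have "t (a w) \<otimes> inv (a w) = a (comm g w)" unfolding 1 by (simp add: m_assoc)
    then show ?thesis using 2 by simp
  qed
  have ca: "card (a ` Z) = card Z" using card_image inj_on_subset[OF F_inj[OF a] plane_Z[OF P]] by blast
  have fZ: "finite Z" using sub_finite Z_subgroup by blast
  \<comment> \<open>Either some w with a w in Z is noncentral, and then its commutators generate Z
    and are sent into Z by \<open>key\<close>; or everything mapped into Z is central.\<close>
  show ?thesis
  proof (cases "\<exists>g\<in>carrier G. \<exists>w\<in>P. a w \<in> Z \<and> comm g w \<noteq> \<one>")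
    case True
    then obtain g w where gw: "g \<in> carrier G" "w \<in> P" "a w \<in> Z" "comm g w \<noteq> \<one>" by blast
    have cz: "comm g w \<in> Z" using comm_Z gw planeD(3)[OF P] by blast
    have "a ` Z \<subseteq> Z"
    proof
      fix y assume "y \<in> a ` Z"
      then obtain z where z: "z \<in> Z" "y = a z" by blast
      obtain n :: nat where "z = comm g w [^] n" using prime_order_pow[OF Z_subgroup card_Z cz gw(4) z(1)] by blast
      then have "y = a (comm g w) [^] n" using z F_pow[OF a] plane_Z[OF P] cz by auto
      then show "y \<in> Z" using pow_closed[OF Z_subgroup key[OF gw(1,2,3)]] by simp
    qed
    then show ?thesis using card_subset_eq[OF fZ] ca by blast
  next
    case False
    have "Z \<subseteq> a ` Z"
    proof
      fix z assume z: "z \<in> Z"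
      then obtain w where w: "w \<in> P" "z = a w" using plane_Z[OF Q] by blast
      have wG: "w \<in> carrier G" using planeD(3)[OF P w(1)] .
      have "w \<in> Z"
      proof (rule Z_I[OF wG])
        fix x assume x: "x \<in> carrier G"
        then have "comm x w = \<one>" using False w z by blast
        then show "w \<otimes> x = x \<otimes> w" using comm_one_iff[OF x wG] by simp
      qed
      then show "z \<in> a ` Z" using w by blast
    qed
    then show ?thesis using card_subset_eq[of "a ` Z" Z] ca fZ by auto
  qed
qed

text \<open>The centraliser contains the distinct subgroups P and Z of order p, and it is proper
  because P is not central.\<close>

lemma line_centralizer:
  assumes P: "subgroup P G" "card P = p" "P \<noteq> Z" shows "plane (centralizer G P)"
proof -
  let ?C = "centralizer G P"
  have PG: "P \<subseteq> carrier G" using subgroup.subset[OF P(1)] .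
  have C: "subgroup ?C G" using subgroup_centralizer[OF PG] .
  have "\<not> P \<subseteq> {\<one>}"
  proof
    assume "P \<subseteq> {\<one>}"
    then have "card P \<le> 1" using card_mono[of "{\<one>}" P] by simp
    then show False using P p_gt_1 by simp
  qed
  then obtain a where a: "a \<in> P" "a \<noteq> \<one>" by blast
  have PC: "P \<subseteq> ?C"
  proof
    fix b assume b: "b \<in> P"
    have "b \<otimes> x = x \<otimes> b" if x: "x \<in> P" for x
    proof -
      obtain n m :: nat where "b = a [^] n" "x = a [^] m" using prime_order_pow[OF P(1,2) a] b x by metis
      then show ?thesis using a PG by (auto simp: nat_pow_mult add.commute)
    qed
    then show "b \<in> ?C" unfolding centralizer_def using b PG by blast
  qed
  have ZC: "Z \<subseteq> ?C" unfolding centralizer_def using Z_subset Z_comm PG by blast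
  have eqZ: "P = Z" if "P \<subseteq> Z" using card_subset_eq[OF sub_finite[OF Z_subgroup] that] P card_Z by simp
  from subgroup_card_cases[OF C] show ?thesis
  proof cases
    case 1 then show ?thesis using PC a by blast
  next
    case 2
    have "P = ?C" using card_subset_eq[OF sub_finite[OF C] PC] P 2 by simp
    moreover have "Z = ?C" using card_subset_eq[OF sub_finite[OF C] ZC] card_Z 2 by simp
    ultimately show ?thesis using P by simp
  next
    case 4
    have "P \<subseteq> Z"
    proof
      fix x assume x: "x \<in> P"
      show "x \<in> Z"
      proof (rule Z_I)
        show "x \<in> carrier G" using x PG by blast
        fix y assume "y \<in> carrier G"
        then have "y \<in> ?C" using 4 by simp
        then show "x \<otimes> y = y \<otimes> x" using x unfolding centralizer_def by simp
      qed
    qed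
    then show ?thesis using eqZ P by blast
  qed
qed

lemma centralizer_Z: "centralizer G Z = carrier G"
  unfolding centralizer_def using Z_comm by fastforce

lemma centralizer_N_phi:
  assumes a: "a \<in> F P Q" shows "centralizer G P \<subseteq> N_phi G P a"
proof
  fix g assume g: "g \<in> centralizer G P"
  then have gG: "g \<in> carrier G" unfolding centralizer_def by blast
  have 1: "g \<otimes> y \<otimes> inv g = y" if "y \<in> P" for y
    using g that gG F_carrier(1)[OF a that] unfolding centralizer_def by (simp add: m_assoc)
  have "(\<lambda>x. g \<otimes> x \<otimes> inv g) ` P = P" using 1 by simp
  then have n: "g \<in> Defs.normalizer G P" unfolding Defs.normalizer_def using gG by simp
  have "(\<lambda>x. \<one> \<otimes> x \<otimes> inv \<one>) ` (a ` P) = a ` P" using F_carrier(2)[OF a] by (auto simp: image_iff)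
  then have m: "\<one> \<in> Defs.normalizer G (a ` P)" unfolding Defs.normalizer_def by blast
  have "a (g \<otimes> y \<otimes> inv g) = \<one> \<otimes> a y \<otimes> inv \<one>" if "y \<in> P" for y using 1[OF that] F_carrier(2)[OF a that] by simp
  then show "g \<in> N_phi G P a" unfolding N_phi_def using n m by blast
qed

text \<open>The normal subgroup is S itself, so every morphism has to extend to S. Planes extend
  because Z is preserved; a subgroup of order p extends first to its centraliser, which is a plane
  or S.\<close>

lemma constrainedI:
  assumes ne: "\<And>V b. plane V \<Longrightarrow> b \<in> F V V \<Longrightarrow> b ` Z = Z"
  shows "constrained G F"
proof -
  have large: "\<exists>b\<in>F (carrier G) (carrier G). \<forall>x\<in>P. b x = a x"
    if a: "a \<in> F P Q" and P: "plane P \<or> P = carrier G" for P Q a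
    using P
  proof
    assume P: "plane P"
    have aZ: "a ` Z = Z" by (rule plane_fixes_Z[OF a P]) (rule ne)
    obtain b where "b \<in> F (carrier G) (carrier G)" "\<And>x. x \<in> P \<Longrightarrow> b x = a x" using plane_extend[OF a P aZ] by blast
    then show ?thesis by blast
  next
    assume "P = carrier G"
    then show ?thesis using F_to_S[OF a] by auto
  qed
  have Z_cent_large: "plane (centralizer G P) \<or> centralizer G P = carrier G" if "subgroup P G" "card P = p" for P
    using line_centralizer[OF that] centralizer_Z by (cases "P = Z") auto
  have Pcent: "x \<in> centralizer G P" if P: "subgroup P G" "card P = p" and x: "x \<in> P" for x P
  proof (cases "P = Z")
    case True then show ?thesis using x centralizer_Z Z_subset by auto
  next
    case False
    have "x \<in> carrier G" using P x sub_carrier by blast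
    have "\<exists>a\<in>P. a \<noteq> \<one>"
    proof (rule ccontr)
      assume "\<not> ?thesis"
      then have "card P \<le> 1" using card_mono[of "{\<one>}" P] by auto
      then show False using P p_gt_1 by simp
    qed
    then obtain a where a: "a \<in> P" "a \<noteq> \<one>" by blast
    have "x \<otimes> y = y \<otimes> x" if y: "y \<in> P" for y
    proof -
      obtain n m :: nat where "x = a [^] n" "y = a [^] m" using prime_order_pow[OF P a] x y by metis
      then show ?thesis using a P sub_carrier by (auto simp: nat_pow_mult add.commute)
    qed
    then show ?thesis unfolding centralizer_def using \<open>x \<in> carrier G\<close> by blast
  qed
  \<comment> \<open>The centraliser of P lies in \<open>N_phi\<close>, so saturation extends the
    morphism to it, and from there \<open>large\<close> takes over.\<close>
  have line: "\<exists>b\<in>F (carrier G) (carrier G). \<forall>x\<in>P. b x = a x"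
    if a: "a \<in> F P Q" and P: "card P = p" and fc: "fully_centralized G F (a ` P)" for P Q a
  proof -
    have Ps: "subgroup P G" using F_subgroup[OF a] by blast
    obtain b where b: "b \<in> F (N_phi G P a) (carrier G)" "\<And>x. x \<in> P \<Longrightarrow> b x = a x"
      using saturated_extend[OF F_to_S[OF a] fc] by blast
    let ?C = "centralizer G P"
    have C: "subgroup ?C G" using subgroup_centralizer subgroup.subset[OF Ps] by blast
    have CN: "?C \<subseteq> N_phi G P a" using centralizer_N_phi[OF a] .
    have rF: "restrict b ?C \<in> F ?C (carrier G)"
      by (rule F_restrict[OF b(1) C CN subgroup_self]) (use F_carrier(2)[OF b(1)] CN in blast)
    obtain c where c: "c \<in> F (carrier G) (carrier G)" "\<forall>x\<in>?C. c x = restrict b ?C x"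
      using large[OF rF Z_cent_large[OF Ps P]] by blast
    have "c x = a x" if "x \<in> P" for x using c(2) Pcent[OF Ps P that] b(2)[OF that] by simp
    then show ?thesis using c(1) by blast
  qed
  have Zfc: "fully_centralized G F Z"
    unfolding fully_centralized_def using Z_subgroup centralizer_Z card_mono[OF fin] unfolding centralizer_def by auto
  \<comment> \<open>No other subgroup is conjugate to Z. The remaining subgroups of order p all have
    centralisers of order p^2, so images of morphisms between them are fully centralised.\<close>
  have notconj: "P = Z" if "F_conj F P Z" for P
  proof -
    obtain a where a: "a \<in> F P Z" "a ` P = Z" using \<open>F_conj F P Z\<close> unfolding F_conj_def by blast
    have cP: "card P = p" using F_conj_card(1)[OF that] card_Z by simp
    obtain b where b: "b \<in> F (carrier G) (carrier G)" "\<forall>x\<in>P. b x = a x" using line[OF a(1) cP] a(2) Zfc by auto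
    have PG: "P \<subseteq> carrier G" using F_carrier(1)[OF a(1)] by blast
    have "b ` P = b ` Z" using Aut_Z[OF b(1)] a(2) b(2) by force
    then show ?thesis using inj_on_image_eq_iff[OF F_inj[OF b(1)] PG] Z_subset by blast
  qed
  have all: "\<exists>b\<in>F (carrier G) (carrier G). \<forall>x\<in>P. b x = a x" if a: "a \<in> F P Q" for P Q a
  proof -
    have Ps: "subgroup P G" using F_subgroup[OF a] by blast
    from subgroup_card_cases[OF Ps] show ?thesis
    proof cases
      case 1
      show ?thesis by (rule bexI[OF _ id_F[OF subgroup_self]]) (use 1 F_one[OF a] in simp)
    next
      case 2
      have aP: "subgroup (a ` P) G" using F_image_subgroup[OF a Ps subset_refl] .
      have caP: "card (a ` P) = p" using card_image[OF F_inj[OF a]] 2 by simp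
      have "card (centralizer G Q') \<le> card (centralizer G (a ` P))" if Q': "F_conj F (a ` P) Q'" for Q'
      proof (cases "a ` P = Z")
        case True
        then show ?thesis using centralizer_Z card_mono[OF fin, of "centralizer G Q'"] unfolding centralizer_def by auto
      next
        case False
        have "Q' \<noteq> Z" using notconj[of "a ` P"] Q' False by blast
        then show ?thesis
          using line_centralizer[OF F_conj_card(2)[OF Q']] line_centralizer[OF aP caP False] F_conj_card(1)[OF Q'] caP
          unfolding plane_def by simp
      qed
      then show ?thesis using line[OF a 2] aP unfolding fully_centralized_def by blast
    next
      case 3 then show ?thesis using large[OF a] by blast
    next
      case 4 then show ?thesis using large[OF a] by blast
    qed
  qed
  have mS: "P <#> carrier G = carrier G" if P: "subgroup P G" for P
  proof
    show "P <#> carrier G \<subseteq> carrier G" using sub_carrier[OF P] unfolding set_mult_def by auto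
    show "carrier G \<subseteq> P <#> carrier G"
    proof
      fix x assume "x \<in> carrier G"
      moreover from this have "x = \<one> \<otimes> x" by simp
      ultimately show "x \<in> P <#> carrier G" unfolding set_mult_def using subgroup.one_closed[OF P] by blast
    qed
  qed
  have "F_normal G F (carrier G)" unfolding F_normal_def
  proof (intro conjI allI impI)
    show "normal (carrier G) G" by (rule normal_self)
    fix P R a assume a: "a \<in> F P R"
    obtain b where b: "b \<in> F (carrier G) (carrier G)" "\<forall>x\<in>P. b x = a x" using all[OF a] by blast
    show "\<exists>\<psi>\<in>F (P <#> carrier G) (R <#> carrier G). (\<forall>x\<in>P. \<psi> x = a x) \<and> \<psi> ` carrier G = carrier G"
      unfolding mS[OF F_subgroup(1)[OF a]] mS[OF F_subgroup(2)[OF a]] using b F_surj[OF b(1)] by blast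
  qed
  then show ?thesis unfolding constrained_def centralizer_def by blast
qed

text \<open>A centric subgroup contains Z, and Z is not centric because all of S centralises
  it.\<close>

lemma centric_cases: assumes Q: "F_centric G F Q" shows "plane Q \<or> Q = carrier G"
proof -
  have Qs: "subgroup Q G" using Q unfolding F_centric_def by blast
  have "F_conj F Q Q" unfolding F_conj_def using id_F[OF Qs] F_surj[OF id_F[OF Qs]] by blast
  then have c: "centralizer G Q \<subseteq> Q" using Q unfolding F_centric_def by blast
  have "Z \<subseteq> centralizer G Q" unfolding centralizer_def using Z_subset Z_comm sub_carrier[OF Qs] by blast
  then have ZQ: "Z \<subseteq> Q" using c by blast
  from subgroup_card_cases[OF Qs] show ?thesis
  proof cases
    case 1
    then have "card Z \<le> 1" using card_mono[of "{\<one>}" Z] ZQ by simp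
    then show ?thesis using card_Z p_gt_1 by simp
  next
    case 2
    then have "Z = Q" using card_subset_eq[OF sub_finite[OF Qs] ZQ] card_Z by simp
    then have "carrier G \<subseteq> Z" using c centralizer_Z by simp
    then have "card (carrier G) \<le> card Z" using card_mono sub_finite[OF Z_subgroup] by blast
    then have "p * (p * p) \<le> p * 1" using card_S card_Z by (simp add: power3_eq_cube mult.assoc)
    then have "p * p \<le> 1" using p_gt_1 by (simp only: mult_le_cancel1)
    moreover have "1 < p * p" using less_1_mult[OF p_gt_1(1) p_gt_1(1)] .
    ultimately show ?thesis by simp
  qed auto
qed

lemma plane_centric: assumes P: "plane P" shows "F_centric G F P"
proof -
  have "centralizer G Q \<subseteq> Q" if "F_conj F P Q" for Q
  proof -
    have "plane Q" using F_conj_card[OF that] P unfolding plane_def by simp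
    then show ?thesis using plane_centralizer by simp
  qed
  then show ?thesis unfolding F_centric_def using planeD(1)[OF P] by blast
qed

lemma S_centric: "F_centric G F (carrier G)"
proof -
  have "centralizer G Q \<subseteq> Q" if "F_conj F (carrier G) Q" for Q
  proof -
    have "Q = carrier G" using F_conj_card[OF that] card_subset_eq[OF fin] subgroup.subset by blast
    then show ?thesis unfolding centralizer_def by blast
  qed
  then show ?thesis unfolding F_centric_def using subgroup_self by blast
qed

lemma finite_F: assumes P: "subgroup P G" shows "finite (F P P)"
proof (rule finite_subset)
  show "F P P \<subseteq> P \<rightarrow>\<^sub>E P"
  proof
    fix a assume "a \<in> F P P"
    then show "a \<in> P \<rightarrow>\<^sub>E P" using F_ext F_image unfolding PiE_def Pi_def by blast
  qed
  show "finite (P \<rightarrow>\<^sub>E P)" using sub_finite[OF P] by (intro finite_PiE) auto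
qed

lemma finite_Out: "subgroup P G \<Longrightarrow> finite (carrier (OutGrp G F P))"
  using out_cls_surj finite_F by (metis finite_imageI)

text \<open>S is fully normalised and \<open>Aut_S\<close> consists of its inner automorphisms,
  which saturation makes a Sylow subgroup of the automorphism group.\<close>

lemma p_not_dvd_Out: "\<not> p dvd card (carrier (OutGrp G F (carrier G)))"
proof -
  let ?S = "carrier G"
  have nS: "Defs.normalizer G ?S = ?S"
  proof -
    have "(\<lambda>x. g \<otimes> x \<otimes> inv g) ` ?S = ?S" if g: "g \<in> ?S" for g
      by (rule endo_inj_surj[OF fin]) (use g in \<open>auto intro!: inj_onI\<close>)
    then show ?thesis unfolding Defs.normalizer_def by blast
  qed
  have "card (Defs.normalizer G Q) \<le> card (Defs.normalizer G ?S)" for Q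
    unfolding nS by (rule card_mono[OF fin]) (auto simp: Defs.normalizer_def)
  then have "fully_normalized G F ?S" unfolding fully_normalized_def using subgroup_self by blast
  then have "sylow_in p (Aut_S G ?S) (F ?S ?S)"
    using saturated[unfolded saturated_def, THEN conjunct2, THEN conjunct1] subgroup_self by blast
  moreover have "Aut_S G ?S = Inn G ?S" unfolding Aut_S_def Inn_def nS ..
  ultimately have nd: "\<not> p dvd (card (F ?S ?S) div card (Inn G ?S))" unfolding sylow_in_def by simp
  interpret A: group "AutGrp F ?S" by (rule AutGrp_group[OF subgroup_self])
  interpret N: normal "Inn G ?S" "AutGrp F ?S" by (rule Inn_normal[OF subgroup_self])
  have fA: "finite (carrier (AutGrp F ?S))" using finite_F[OF subgroup_self] unfolding AutGrp_simps .
  have "finite (Inn G ?S)" using finite_subset[OF N.subset fA] .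
  moreover have "Inn G ?S \<noteq> {}" using N.one_closed by blast
  ultimately have "card (Inn G ?S) > 0" by (simp add: card_gt_0_iff)
  moreover have "card (carrier (OutGrp G F ?S)) * card (Inn G ?S) = card (F ?S ?S)"
    using A.lagrange[OF N.subgroup_axioms] unfolding OutGrp_def FactGroup_def by (simp add: Coset.order_def AutGrp_simps)
  ultimately have "card (F ?S ?S) div card (Inn G ?S) = card (carrier (OutGrp G F ?S))" by (metis nonzero_mult_div_cancel_right less_numeral_extra(3))
  then show ?thesis using nd by simp
qed

end

section \<open>Coordinates and matrices of automorphisms\<close>

definition mat2 :: "('g \<Rightarrow> 'k::field) \<Rightarrow> ('g \<Rightarrow> 'k) \<Rightarrow> 'g \<Rightarrow> 'g \<Rightarrow> ('g \<Rightarrow> 'g) \<Rightarrow> 'k m2" where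
  "mat2 c1 c2 e1 e2 a = M2 (c1 (a e1)) (c1 (a e2)) (c2 (a e1)) (c2 (a e2))"

text \<open>Coordinates on a plane over the prime field, realised as \<open>P/K\<close> with \<open>K\<close> invariant
  under \<open>F P P\<close>.\<close>
locale coordinates = fusion G p F
  for G :: "'g monoid" (structure) and p and F +
  fixes P K :: "'g set" and e1 e2 :: 'g and c1 c2 :: "'g \<Rightarrow> 'k::alg_closed_field"
  assumes char: "CHAR('k) = p" and P: "subgroup P G" and K: "K \<subseteq> P"
    and c_mult: "x \<in> P \<Longrightarrow> y \<in> P \<Longrightarrow> c1 (x \<otimes> y) = c1 x + c1 y" "x \<in> P \<Longrightarrow> y \<in> P \<Longrightarrow> c2 (x \<otimes> y) = c2 x + c2 y"
    and c_Ints: "x \<in> P \<Longrightarrow> c1 x \<in> \<int>" "x \<in> P \<Longrightarrow> c2 x \<in> \<int>"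
    and e: "e1 \<in> P" "e2 \<in> P" and c_e: "c1 e1 = 1" "c2 e1 = 0" "c1 e2 = 0" "c2 e2 = 1"
    and c_K: "x \<in> K \<Longrightarrow> c1 x = 0" "x \<in> K \<Longrightarrow> c2 x = 0"
    and c_ker: "x \<in> P \<Longrightarrow> c1 x = 0 \<Longrightarrow> c2 x = 0 \<Longrightarrow> x \<in> K"
    and F_K: "a \<in> F P P \<Longrightarrow> x \<in> K \<Longrightarrow> a x \<in> K"
begin

lemma PG: "x \<in> P \<Longrightarrow> x \<in> carrier G" using P sub_carrier by blast

lemma c_one: "c1 \<one> = 0" "c2 \<one> = 0"
  using c_mult[OF subgroup.one_closed[OF P] subgroup.one_closed[OF P]]
  by (simp_all only: r_one one_closed add_cancel_right_right)

lemma c_inv: assumes x: "x \<in> P" shows "c1 (inv x) = - c1 x" "c2 (inv x) = - c2 x"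
proof -
  have "c1 (inv x) + c1 x = 0" "c2 (inv x) + c2 x = 0"
    using c_mult[OF subgroup.m_inv_closed[OF P x] x] c_one PG[OF x] by simp_all
  then show "c1 (inv x) = - c1 x" "c2 (inv x) = - c2 x" by (simp_all add: eq_neg_iff_add_eq_0)
qed

lemma c_pow: assumes x: "x \<in> P" shows "c1 (x [^] (n::nat)) = of_nat n * c1 x" "c2 (x [^] (n::nat)) = of_nat n * c2 x"
proof -
  have "c1 (x [^] n) = of_nat n * c1 x \<and> c2 (x [^] n) = of_nat n * c2 x"
  proof (induction n)
    case 0 then show ?case using c_one by simp
  next
    case (Suc n) then show ?case using c_mult[OF pow_closed[OF P x, of n] x] by (simp add: algebra_simps)
  qed
  then show "c1 (x [^] n) = of_nat n * c1 x" "c2 (x [^] n) = of_nat n * c2 x" by blast+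
qed

lemma c_eq: assumes xy: "x \<in> P" "y \<in> P" "c1 x = c1 y" "c2 x = c2 y" shows "x \<otimes> inv y \<in> K"
proof (rule c_ker)
  have iy: "inv y \<in> P" using subgroup.m_inv_closed[OF P xy(2)] .
  show "x \<otimes> inv y \<in> P" using subgroup.m_closed[OF P xy(1) iy] .
  show "c1 (x \<otimes> inv y) = 0" "c2 (x \<otimes> inv y) = 0" using c_mult[OF xy(1) iy] c_inv[OF xy(2)] xy(3,4) by simp_all
qed

text \<open>Additive maps are linear over the prime field: modulo K every x is a product of natural
  powers of e1 and e2.\<close>

lemma c_linear:
  assumes a: "a \<in> F P P" and x: "x \<in> P"
  shows "c1 (a x) = c1 (a e1) * c1 x + c1 (a e2) * c2 x" "c2 (a x) = c2 (a e1) * c1 x + c2 (a e2) * c2 x"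
proof -
  obtain n where n: "c1 x = of_nat n" using Ints_char_p_E[OF p char c_Ints(1)[OF x]] by blast
  obtain m where m: "c2 x = of_nat m" using Ints_char_p_E[OF p char c_Ints(2)[OF x]] by blast
  let ?y = "e1 [^] n \<otimes> e2 [^] m"
  have 1: "e1 [^] n \<in> P" "e2 [^] m \<in> P" using pow_closed[OF P] e by blast+
  have yP: "?y \<in> P" using subgroup.m_closed[OF P 1] .
  have "c1 ?y = c1 x" "c2 ?y = c2 x" using c_mult[OF 1] c_pow[OF e(1), of n] c_pow[OF e(2), of m] c_e n m by simp_all
  then have k: "x \<otimes> inv ?y \<in> K" using c_eq[OF x yP] by simp
  then have kP: "x \<otimes> inv ?y \<in> P" using K by blast
  have "x = (x \<otimes> inv ?y) \<otimes> ?y" using PG[OF x] PG[OF yP] by (simp add: m_assoc)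
  then have "a x = a (x \<otimes> inv ?y) \<otimes> a ?y" using F_mult[OF a kP yP] by simp
  then have 2: "a x = a (x \<otimes> inv ?y) \<otimes> (a e1 [^] n \<otimes> a e2 [^] m)" using F_mult[OF a 1] F_pow[OF a] e by simp
  have aP: "a (x \<otimes> inv ?y) \<in> P" "a e1 \<in> P" "a e2 \<in> P" using F_image[OF a] kP e by blast+
  have 3: "a e1 [^] n \<in> P" "a e2 [^] m \<in> P" using pow_closed[OF P] aP by blast+
  have 4: "c1 (a (x \<otimes> inv ?y)) = 0" "c2 (a (x \<otimes> inv ?y)) = 0" using c_K F_K[OF a k] by blast+
  show "c1 (a x) = c1 (a e1) * c1 x + c1 (a e2) * c2 x" "c2 (a x) = c2 (a e1) * c1 x + c2 (a e2) * c2 x"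
    unfolding 2 n m using c_mult[OF aP(1) subgroup.m_closed[OF P 3]] c_mult[OF 3] 4 c_pow[OF aP(2), of n] c_pow[OF aP(3), of m]
    by (simp_all add: mult.commute)
qed

abbreviation mt where "mt \<equiv> mat2 c1 c2 e1 e2"

lemma mt_comp: assumes a: "a \<in> F P P" and b: "b \<in> F P P" shows "mt (restrict (a \<circ> b) P) = mt a \<star> mt b"
  unfolding mat2_def using c_linear[OF a F_image[OF b e(1)]] c_linear[OF a F_image[OF b e(2)]] e by simp

lemma mt_id: "mt (restrict id P) = M2 1 0 0 1"
  unfolding mat2_def using e c_e by simp

lemma mt_Ints: "a \<in> F P P \<Longrightarrow> m2_Ints (mt a)"
  unfolding mat2_def using c_Ints F_image e by simp

text \<open>Coordinates are additive, so inner automorphisms do not change them and the matrix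
  depends on the outer class only.\<close>

lemma mt_cls: assumes a: "a \<in> F P P" "b \<in> F P P" "out_cls G F P a = out_cls G F P b" shows "mt a = mt b"
proof -
  obtain q where q: "q \<in> P" "\<And>x. x \<in> P \<Longrightarrow> a x = q \<otimes> b x \<otimes> inv q" using out_cls_eq[OF P a] by blast
  have iq: "inv q \<in> P" using subgroup.m_inv_closed[OF P q(1)] .
  have "c1 (a x) = c1 (b x)" "c2 (a x) = c2 (b x)" if x: "x \<in> P" for x
    unfolding q(2)[OF x] using F_image[OF a(2) x] q(1) iq c_mult c_inv[OF q(1)] subgroup.m_closed[OF P] by simp_all
  then show ?thesis unfolding mat2_def using e by simp
qed

definition rep where "rep X = mt (SOME a. a \<in> F P P \<and> out_cls G F P a = X)"

lemma rep_cls: assumes a: "a \<in> F P P" shows "rep (out_cls G F P a) = mt a"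
proof -
  let ?b = "SOME b. b \<in> F P P \<and> out_cls G F P b = out_cls G F P a"
  have "?b \<in> F P P \<and> out_cls G F P ?b = out_cls G F P a" by (rule someI[of _ a]) (use a in simp)
  then show ?thesis unfolding rep_def using mt_cls[OF _ a] by blast
qed

lemma Out_E: assumes "X \<in> carrier (OutGrp G F P)" obtains a where "a \<in> F P P" "X = out_cls G F P a"
  using assms out_cls_surj[OF P] by blast

lemma cls_mult: "a \<in> F P P \<Longrightarrow> b \<in> F P P \<Longrightarrow>
    out_cls G F P a \<otimes>\<^bsub>OutGrp G F P\<^esub> out_cls G F P b = out_cls G F P (restrict (a \<circ> b) P)"
  using hom_mult[OF out_cls_hom[OF P], of a b] unfolding AutGrp_simps by simp

lemma cls_one: "out_cls G F P (restrict id P) = \<one>\<^bsub>OutGrp G F P\<^esub>"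
  using hom_one[OF out_cls_hom[OF P] AutGrp_group[OF P] OutGrp_group[OF P]] unfolding AutGrp_simps .

text \<open>\<open>ker\<close> is what makes the representation of outer classes faithful. It holds
  for different reasons on a plane, which is abelian, and on S, whose outer automorphism group has
  order prime to p.\<close>

lemma matrix_ext:
  assumes f: "cocycle2 (OutGrp G F P) f" and odd: "odd p"
    and ker: "\<And>a. a \<in> F P P \<Longrightarrow> mt a = M2 1 0 0 1 \<Longrightarrow> a \<in> Inn G P"
  shows "matrix_extension (cocycle_extension (OutGrp G F P) f) (OutGrp G F P) snd
     (\<lambda>u. (u / f \<one>\<^bsub>OutGrp G F P\<^esub> \<one>\<^bsub>OutGrp G F P\<^esub>, \<one>\<^bsub>OutGrp G F P\<^esub>)) rep p"
proof (intro matrix_extension.intro matrix_extension_axioms.intro)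
  let ?A = "OutGrp G F P"
  interpret A: group ?A by (rule OutGrp_group[OF P])
  show "central_extension (cocycle_extension ?A f) ?A snd (\<lambda>u. (u / f \<one>\<^bsub>?A\<^esub> \<one>\<^bsub>?A\<^esub>, \<one>\<^bsub>?A\<^esub>))"
    by (rule central_extension_cocycle[OF A.is_group f])
  show "prime p" "odd p" "CHAR('k) = p" by (rule p, rule odd, rule char)
  show mult: "rep (x \<otimes>\<^bsub>?A\<^esub> y) = rep x \<star> rep y" if x: "x \<in> carrier ?A" and y: "y \<in> carrier ?A" for x y
  proof -
    obtain a where a: "a \<in> F P P" "x = out_cls G F P a" using Out_E[OF x] by blast
    obtain b where b: "b \<in> F P P" "y = out_cls G F P b" using Out_E[OF y] by blast
    show ?thesis unfolding a(2) b(2) cls_mult[OF a(1) b(1)] rep_cls[OF a(1)] rep_cls[OF b(1)] rep_cls[OF F_comp[OF b(1) a(1)]]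
      by (rule mt_comp[OF a(1) b(1)])
  qed
  show one: "rep \<one>\<^bsub>?A\<^esub> = M2 1 0 0 1" unfolding cls_one[symmetric] rep_cls[OF id_F[OF P]] by (rule mt_id)
  show "inj_on rep (carrier ?A)"
  proof (rule inj_onI)
    fix x y assume x: "x \<in> carrier ?A" and y: "y \<in> carrier ?A" and eq: "rep x = rep y"
    have "rep (x \<otimes>\<^bsub>?A\<^esub> inv\<^bsub>?A\<^esub> y) = rep y \<star> rep (inv\<^bsub>?A\<^esub> y)" using mult[OF x A.inv_closed[OF y]] eq by simp
    also have "\<dots> = rep \<one>\<^bsub>?A\<^esub>" using mult[OF y A.inv_closed[OF y]] y by simp
    finally have 1: "rep (x \<otimes>\<^bsub>?A\<^esub> inv\<^bsub>?A\<^esub> y) = M2 1 0 0 1" using one by simp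
    have "x \<otimes>\<^bsub>?A\<^esub> inv\<^bsub>?A\<^esub> y \<in> carrier ?A" using x y by simp
    then obtain a where a: "a \<in> F P P" "x \<otimes>\<^bsub>?A\<^esub> inv\<^bsub>?A\<^esub> y = out_cls G F P a" using Out_E by blast
    have "a \<in> Inn G P" using ker[OF a(1)] 1 unfolding a(2) rep_cls[OF a(1)] by blast
    then have "x \<otimes>\<^bsub>?A\<^esub> inv\<^bsub>?A\<^esub> y = \<one>\<^bsub>?A\<^esub>" unfolding a(2) using out_cls_one_iff[OF P a(1)] by blast
    then have "(x \<otimes>\<^bsub>?A\<^esub> inv\<^bsub>?A\<^esub> y) \<otimes>\<^bsub>?A\<^esub> y = y" using y by simp
    then show "x = y" using x y by (simp add: A.m_assoc)
  qed
  show "m2_Ints (rep x)" if x: "x \<in> carrier ?A" for x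
  proof -
    obtain a where a: "a \<in> F P P" "x = out_cls G F P a" using Out_E[OF x] by blast
    show ?thesis unfolding a(2) rep_cls[OF a(1)] by (rule mt_Ints[OF a(1)])
  qed
qed

lemma rep_image: "a \<in> F P P \<Longrightarrow> mt a \<in> rep ` carrier (OutGrp G F P)"
  using rep_cls[of a] out_cls_surj[OF P] by (metis image_eqI)

end

section \<open>Essential planes and their torus\<close>

context extraspecial_fusion
begin

text \<open>The basis consists of a central z and its image w z outside Z. Conjugation by elements
  of S fixes z and moves w z by any element of Z, which gives the upper unipotent matrices;
  conjugating these by w, which sends the first basis vector to the second, gives the lower
  ones.\<close>

lemma essential_coordinates:
  fixes k_type :: "'k::alg_closed_field itself"
  assumes char: "CHAR('k) = p" and V: "plane V" and w: "w \<in> F V V" "w ` Z \<noteq> Z"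
  obtains e1 e2 and c1 c2 :: "'a \<Rightarrow> 'k" where "coordinates G p F V {\<one>} e1 e2 c1 c2" "e1 \<in> Z" "e2 \<notin> Z"
    "\<And>s. s \<in> \<int> \<Longrightarrow> \<exists>a\<in>F V V. mat2 c1 c2 e1 e2 a = M2 1 s 0 1"
    "\<And>s. s \<in> \<int> \<Longrightarrow> \<exists>a\<in>F V V. mat2 c1 c2 e1 e2 a = M2 1 0 s 1"
proof -
  note Vs = planeD(1)[OF V] and VG = planeD(3)[OF V]
  have "\<exists>z\<in>Z. w z \<notin> Z"
  proof (rule ccontr)
    assume "\<not> ?thesis"
    then have "w ` Z \<subseteq> Z" by blast
    moreover have "card (w ` Z) = card Z" using card_image inj_on_subset[OF F_inj[OF w(1)] plane_Z[OF V]] by blast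
    ultimately show False using card_subset_eq[OF sub_finite[OF Z_subgroup]] w(2) by blast
  qed
  then obtain z where z: "z \<in> Z" "w z \<notin> Z" by blast
  have z1: "z \<noteq> \<one>" using z F_one[OF w(1)] subgroup.one_closed[OF Z_subgroup] by metis
  have zV: "z \<in> V" using plane_Z[OF V] z by blast
  have wzV: "w z \<in> V" using F_image[OF w(1) zV] .
  let ?H = "G\<lparr>carrier := V\<rparr>"
  interpret H: comm_group ?H
    by (rule group.group_comm_groupI[OF subgroup.subgroup_is_group[OF Vs is_group]]) (use plane_abelian[OF V] in simp)
  have cH: "card (carrier ?H) = p * p" using planeD(2)[OF V] by (simp add: power2_eq_square)
  have eH: "x [^]\<^bsub>?H\<^esub> p = \<one>\<^bsub>?H\<^esub>" if "x \<in> carrier ?H" for x using pow_p[of x] VG that by (simp add: nat_pow_consistent[symmetric])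
  have nH: "w z \<noteq> z [^]\<^bsub>?H\<^esub> (i::nat)" for i
    using pow_closed[OF Z_subgroup z(1), of i] z(2) by (auto simp: nat_pow_consistent[symmetric])
  have zH: "z \<in> carrier ?H" "w z \<in> carrier ?H" "z \<noteq> \<one>\<^bsub>?H\<^esub>" using zV wzV z1 by simp_all
  show ?thesis
  proof (rule H.plane_coordinates[OF p char cH eH zH nH])
    fix c1 c2 :: "'a \<Rightarrow> 'k"
    assume c: "\<And>x y. x \<in> carrier ?H \<Longrightarrow> y \<in> carrier ?H \<Longrightarrow> c1 (x \<otimes>\<^bsub>?H\<^esub> y) = c1 x + c1 y"
      "\<And>x y. x \<in> carrier ?H \<Longrightarrow> y \<in> carrier ?H \<Longrightarrow> c2 (x \<otimes>\<^bsub>?H\<^esub> y) = c2 x + c2 y"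
      "\<And>x. x \<in> carrier ?H \<Longrightarrow> c1 x \<in> \<int>" "\<And>x. x \<in> carrier ?H \<Longrightarrow> c2 x \<in> \<int>"
      "c1 z = 1" "c2 z = 0" "c1 (w z) = 0" "c2 (w z) = 1"
      "\<And>x. x \<in> carrier ?H \<Longrightarrow> c1 x = 0 \<Longrightarrow> c2 x = 0 \<Longrightarrow> x = \<one>\<^bsub>?H\<^esub>"
    have V1: "\<one> \<in> carrier ?H" using subgroup.one_closed[OF Vs] by simp
    have "\<one> \<otimes>\<^bsub>?H\<^esub> \<one> = \<one>" by simp
    then have c10: "c1 \<one> = 0" "c2 \<one> = 0" using c(1)[OF V1 V1] c(2)[OF V1 V1] by (simp_all only: add_cancel_right_right)
    interpret C: coordinates G p F V "{\<one>}" z "w z" c1 c2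
    proof (intro coordinates.intro coordinates_axioms.intro)
      show "fusion G p F" by (rule fusion_axioms)
      show "CHAR('k) = p" by (rule char)
      show "subgroup V G" by (rule Vs)
      show "{\<one>} \<subseteq> V" using subgroup.one_closed[OF Vs] by simp
      show "a x \<in> {\<one>}" if "a \<in> F V V" "x \<in> {\<one>}" for a x using F_one[OF that(1)] that(2) by simp
    qed (use c c10 zV wzV in simp_all)
    have up: "\<exists>a\<in>F V V. C.mt a = M2 1 s 0 1" if s: "s \<in> \<int>" for s
    proof -
      obtain n where n: "s = of_nat n" using Ints_char_p_E[OF p char s] by blast
      have znZ: "z [^] n \<in> Z" using pow_closed[OF Z_subgroup z(1)] .
      obtain h where h: "h \<in> carrier G" "comm h (w z) = z [^] n" using comm_surj[OF VG[OF wzV] z(2) znZ] by blast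
      have a: "conjm G h V \<in> F V V" using conjm_F[OF Vs h(1)] plane_conj[OF V _ h(1)] by blast
      have 1: "conjm G h V z = z" using conjm_apply[OF zV, of h] comm_conj[OF h(1) VG[OF zV]] comm_central(1)[OF z(1) h(1)] VG[OF zV] by simp
      have 2: "conjm G h V (w z) = z [^] n \<otimes> w z" using conjm_apply[OF wzV, of h] comm_conj[OF h(1) VG[OF wzV]] h(2) by simp
      have 3: "z [^] n \<in> V" using plane_Z[OF V] znZ by blast
      have "C.mt (conjm G h V) = M2 1 s 0 1" unfolding mat2_def 1 2 n
        using C.c_mult[OF 3 wzV] C.c_pow[OF zV, of n] C.c_e by simp
      then show ?thesis using a by blast
    qed
    have low: "\<exists>a\<in>F V V. C.mt a = M2 1 0 s 1" if s: "s \<in> \<int>" for s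
    proof -
      interpret A: group "AutGrp F V" by (rule AutGrp_group[OF Vs])
      let ?b = "c1 (w (w z))" and ?d = "c2 (w (w z))"
      have mw: "C.mt w = M2 0 ?b 1 ?d" unfolding mat2_def using C.c_e by simp
      \<comment> \<open>The factor \<open>?b\<close>, an entry of the matrix of w, makes the lower
        entry of the conjugate exactly s.\<close>
      have "s * ?b \<in> \<int>" using s C.c_Ints(1)[OF F_image[OF w(1) wzV]] by (rule Ints_mult)
      then obtain a where a: "a \<in> F V V" "C.mt a = M2 1 (s * ?b) 0 1" using up by blast
      have wA: "w \<in> carrier (AutGrp F V)" using w(1) unfolding AutGrp_simps .
      let ?i = "inv\<^bsub>AutGrp F V\<^esub> w"
      have i: "?i \<in> F V V" using A.inv_closed[OF wA] unfolding AutGrp_simps .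
      have "restrict (w \<circ> ?i) V = restrict id V" using A.r_inv[OF wA] unfolding AutGrp_simps .
      then have wi: "C.mt w \<star> C.mt ?i = M2 1 0 0 1" using C.mt_comp[OF w(1) i] C.mt_id by simp
      have wa: "C.mt w \<star> C.mt a = M2 1 0 s 1 \<star> C.mt w" unfolding mw a(2) by simp
      have F1: "restrict (w \<circ> a) V \<in> F V V" using F_comp[OF a(1) w(1)] .
      have "C.mt (restrict (restrict (w \<circ> a) V \<circ> ?i) V) = C.mt w \<star> C.mt a \<star> C.mt ?i"
        unfolding C.mt_comp[OF F1 i] C.mt_comp[OF w(1) a(1)] ..
      also have "\<dots> = M2 1 0 s 1" unfolding wa mtimes_assoc wi by (simp add: mtimes_one)
      finally show ?thesis using F_comp[OF i F1] by blast
    qed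
    show ?thesis by (rule that[OF C.coordinates_axioms z up low])
  qed
qed

lemma essential_trivial:
  fixes f :: "_ \<Rightarrow> _ \<Rightarrow> 'k::alg_closed_field"
  assumes char: "CHAR('k) = p" and V: "plane V" and w: "w \<in> F V V" "w ` Z \<noteq> Z"
    and f: "cocycle2 (OutGrp G F V) f"
  shows "trivial_class (OutGrp G F V) f"
proof (rule essential_coordinates[OF char V w])
  fix e1 e2 and c1 c2 :: "'a \<Rightarrow> 'k"
  assume C: "coordinates G p F V {\<one>} e1 e2 c1 c2"
    and up: "\<And>s. s \<in> \<int> \<Longrightarrow> \<exists>a\<in>F V V. mat2 c1 c2 e1 e2 a = M2 1 s 0 1"
    and low: "\<And>s. s \<in> \<int> \<Longrightarrow> \<exists>a\<in>F V V. mat2 c1 c2 e1 e2 a = M2 1 0 s 1"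
  interpret C: coordinates G p F V "{\<one>}" e1 e2 c1 c2 by (rule C)
  let ?A = "OutGrp G F V"
  \<comment> \<open>An automorphism with identity matrix is the identity, because on a plane the
    subgroup K is trivial.\<close>
  have ker: "a \<in> Inn G V" if a: "a \<in> F V V" "C.mt a = M2 1 0 0 1" for a
  proof -
    have "a x = x" if x: "x \<in> V" for x
    proof -
      have "c1 (a x) = c1 x" "c2 (a x) = c2 x" using C.c_linear[OF a(1) x] a(2) unfolding mat2_def by simp_all
      then have "a x \<otimes> inv x = \<one>" using C.c_eq[OF F_image[OF a(1) x] x] by simp
      then have "a x \<otimes> inv x \<otimes> x = x" using planeD(3)[OF V x] by simp
      then show ?thesis using F_carrier[OF a(1) x] by (simp add: m_assoc)
    qed
    then have "a = conjm G \<one> V" using F_ext[OF a(1)] planeD(3)[OF V]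
      by (auto simp: conjm_def restrict_def extensional_def fun_eq_iff)
    then show ?thesis unfolding Inn_def using subgroup.one_closed[OF planeD(1)[OF V]] by blast
  qed
  interpret M: matrix_extension "cocycle_extension ?A f" ?A snd "\<lambda>u. (u / f \<one>\<^bsub>?A\<^esub> \<one>\<^bsub>?A\<^esub>, \<one>\<^bsub>?A\<^esub>)" C.rep p
    by (rule C.matrix_ext[OF f p_odd ker])
  interpret M: sl2_extension "cocycle_extension ?A f" ?A snd "\<lambda>u. (u / f \<one>\<^bsub>?A\<^esub> \<one>\<^bsub>?A\<^esub>, \<one>\<^bsub>?A\<^esub>)" C.rep p
  proof unfold_locales
    fix s :: 'k assume s: "s \<in> \<int>"
    show "M2 1 s 0 1 \<in> C.rep ` carrier ?A" using up[OF s] C.rep_image by metis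
    show "M2 1 0 s 1 \<in> C.rep ` carrier ?A" using low[OF s] C.rep_image by metis
  qed
  show ?thesis using splits_imp_trivial_class[OF OutGrp_group[OF planeD(1)[OF V]] f M.sl2_splits] .
qed

text \<open>The matrix diag(g, 1/g) has determinant one and preserves the line Z, so its
  automorphism extends to S. \<mu> is the coordinate on Z and identifies Z with the prime
  field.\<close>

lemma essential_torus:
  fixes g :: "'k::alg_closed_field"
  assumes char: "CHAR('k) = p" and V: "plane V" and w: "w \<in> F V V" "w ` Z \<noteq> Z"
    and g: "g \<in> \<int>" "g \<noteq> 0"
  obtains t v and l :: nat and \<mu> :: "'a \<Rightarrow> 'k" where "t \<in> F (carrier G) (carrier G)" "t ` V = V" "v \<in> V" "v \<notin> Z"
    "t v = v [^] l" "of_nat l = 1 / g" "\<And>x y. x \<in> Z \<Longrightarrow> y \<in> Z \<Longrightarrow> \<mu> (x \<otimes> y) = \<mu> x + \<mu> y"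
    "\<And>x. x \<in> Z \<Longrightarrow> \<mu> x \<in> \<int>" "\<And>x. x \<in> Z \<Longrightarrow> \<mu> x = 0 \<Longrightarrow> x = \<one>" "\<And>x. x \<in> Z \<Longrightarrow> \<mu> (t x) = g * \<mu> x"
proof (rule essential_coordinates[OF char V w])
  fix e1 e2 and c1 c2 :: "'a \<Rightarrow> 'k"
  assume C: "coordinates G p F V {\<one>} e1 e2 c1 c2" and e: "e1 \<in> Z" "e2 \<notin> Z"
    and up: "\<And>s. s \<in> \<int> \<Longrightarrow> \<exists>a\<in>F V V. mat2 c1 c2 e1 e2 a = M2 1 s 0 1"
    and low: "\<And>s. s \<in> \<int> \<Longrightarrow> \<exists>a\<in>F V V. mat2 c1 c2 e1 e2 a = M2 1 0 s 1"
  interpret C: coordinates G p F V "{\<one>}" e1 e2 c1 c2 by (rule C)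
  note Vs = planeD(1)[OF V] and VG = planeD(3)[OF V]
  let ?I = "C.mt ` F V V"
  have cl: "m \<star> m' \<in> ?I" if "m \<in> ?I" "m' \<in> ?I" for m m'
  proof -
    obtain a b where ab: "a \<in> F V V" "b \<in> F V V" "m = C.mt a" "m' = C.mt b" using \<open>m \<in> ?I\<close> \<open>m' \<in> ?I\<close> by blast
    then show ?thesis using C.mt_comp[OF ab(1,2)] F_comp[OF ab(2,1)] by (metis image_eqI)
  qed
  have U: "M2 1 s 0 1 \<in> ?I" "M2 1 0 s 1 \<in> ?I" if "s \<in> \<int>" for s
    using up[OF that] low[OF that] by (metis image_eqI)+
  have gi: "1 / g \<in> \<int>" using Ints_divide[OF p char Ints_1 g(1)] .
  \<comment> \<open>Steinberg's word for the torus element, evaluated in matrices: a Weyl element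
    with parameter g times one with parameter -1.\<close>
  have "M2 1 g 0 1 \<star> M2 1 0 (- (1 / g)) 1 \<star> M2 1 g 0 1 \<star> (M2 1 (-1) 0 1 \<star> M2 1 0 1 1 \<star> M2 1 (-1) 0 1) \<in> ?I"
    by (intro cl U) (use g gi in auto)
  moreover have "M2 1 g 0 1 \<star> M2 1 0 (- (1 / g)) 1 \<star> M2 1 g 0 1 \<star> (M2 1 (-1) 0 1 \<star> M2 1 0 1 1 \<star> M2 1 (-1) 0 1) = M2 g 0 0 (1 / g)"
    using g(2) by simp
  ultimately obtain a where a: "a \<in> F V V" "C.mt a = M2 g 0 0 (1 / g)" by auto
  obtain m where m: "g = of_nat m" using Ints_char_p_E[OF p char g(1)] by blast
  obtain l where l: "1 / g = of_nat l" using Ints_char_p_E[OF p char gi] by blast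
  have eq: "x = y" if xy: "x \<in> V" "y \<in> V" "c1 x = c1 y" "c2 x = c2 y" for x y
  proof -
    have "x \<otimes> inv y = \<one>" using C.c_eq[OF xy] by simp
    then have "x \<otimes> inv y \<otimes> y = y" using VG[OF xy(2)] by simp
    then show ?thesis using VG xy by (simp add: m_assoc)
  qed
  have co: "c1 (a e1) = g" "c2 (a e1) = 0" "c1 (a e2) = 0" "c2 (a e2) = 1 / g" using a(2) unfolding mat2_def by simp_all
  have a1: "a e1 = e1 [^] m" by (rule eq[OF F_image[OF a(1) C.e(1)] pow_closed[OF Vs C.e(1)]]) (use co C.c_pow[OF C.e(1), of m] C.c_e m in simp_all)
  have a2: "a e2 = e2 [^] l" by (rule eq[OF F_image[OF a(1) C.e(2)] pow_closed[OF Vs C.e(2)]]) (use co C.c_pow[OF C.e(2), of l] C.c_e l in simp_all)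
  have e11: "e1 \<noteq> \<one>" using C.c_e(1) C.c_one(1) by auto
  have Zp: "\<exists>n::nat. x = e1 [^] n" if "x \<in> Z" for x using prime_order_pow[OF Z_subgroup card_Z e(1) e11 that] by blast
  have aZ1: "a x \<in> Z \<and> c1 (a x) = g * c1 x" if x: "x \<in> Z" for x
  proof -
    obtain n :: nat where n: "x = e1 [^] n" using Zp[OF x] by blast
    have 1: "a x = (e1 [^] m) [^] n" unfolding n F_pow[OF a(1) C.e(1)] a1 ..
    have 2: "e1 [^] m \<in> Z" using pow_closed[OF Z_subgroup e(1)] .
    have 3: "e1 [^] m \<in> V" using pow_closed[OF Vs C.e(1)] .
    have "c1 (a x) = of_nat n * (of_nat m * 1)" unfolding 1 C.c_pow[OF 3] C.c_pow[OF C.e(1)] C.c_e ..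
    moreover have "c1 x = of_nat n" unfolding n C.c_pow[OF C.e(1)] C.c_e by simp
    ultimately show ?thesis using pow_closed[OF Z_subgroup 2, of n] 1 m by simp
  qed
  have "a ` Z = Z"
  proof (rule card_subset_eq[OF sub_finite[OF Z_subgroup]])
    show "a ` Z \<subseteq> Z" using aZ1 by blast
    show "card (a ` Z) = card Z" using card_image inj_on_subset[OF F_inj[OF a(1)] plane_Z[OF V]] by blast
  qed
  from plane_extend[OF a(1) V this]
  obtain t where t: "t \<in> F (carrier G) (carrier G)" "\<And>x. x \<in> V \<Longrightarrow> t x = a x" by blast
  have tV: "t ` V = V" using F_surj[OF a(1)] t(2) by (metis image_cong)
  have ZV: "x \<in> V" if "x \<in> Z" for x using plane_Z[OF V] that by blast
  have k0: "x = \<one>" if x: "x \<in> Z" "c1 x = 0" for x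
  proof -
    obtain n :: nat where n: "x = e1 [^] n" using Zp[OF x(1)] by blast
    have "c2 x = 0" unfolding n C.c_pow[OF C.e(1)] C.c_e by simp
    then show ?thesis using C.c_ker[OF ZV[OF x(1)] x(2)] by simp
  qed
  show ?thesis
  proof (rule that[OF t(1) tV C.e(2) e(2), of l c1])
    show "t e2 = e2 [^] l" using t(2)[OF C.e(2)] a2 by simp
    show "of_nat l = 1 / g" using l by simp
  qed (use C.c_mult(1) C.c_Ints(1) ZV k0 aZ1 t(2) in auto)
qed

end

section \<open>From the essential plane to S and to the other planes\<close>

text \<open>The trivialising cochain is the comparing cochain times the pullback of the one that
  trivialises h.\<close>

lemma cohomologous_trivial_left:
  fixes f :: "'a \<Rightarrow> 'a \<Rightarrow> 'k::field"
  assumes fg: "cohomologous N f (\<lambda>a b. h (\<pi> a) (\<pi> b))" and \<pi>: "\<pi> \<in> hom N A" and h: "trivial_class A h"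
    and N: "group N"
  shows "trivial_class N f"
proof -
  interpret N: group N by (rule N)
  obtain c where c: "\<forall>x\<in>carrier N. c x \<noteq> 0"
    "\<forall>x\<in>carrier N. \<forall>y\<in>carrier N. f x y * c (x \<otimes>\<^bsub>N\<^esub> y) = h (\<pi> x) (\<pi> y) * c x * c y"
    using fg unfolding cohomologous_def by blast
  obtain d where d: "\<forall>x\<in>carrier A. d x \<noteq> 0" "\<forall>x\<in>carrier A. \<forall>y\<in>carrier A. h x y * d (x \<otimes>\<^bsub>A\<^esub> y) = d x * d y"
    using h unfolding trivial_class_iff trivial_on_def by blast
  have \<pi>c: "\<pi> x \<in> carrier A" if "x \<in> carrier N" for x using hom_in_carrier[OF \<pi> that] .
  have "f x y * (c (x \<otimes>\<^bsub>N\<^esub> y) * d (\<pi> (x \<otimes>\<^bsub>N\<^esub> y))) = (c x * d (\<pi> x)) * (c y * d (\<pi> y))"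
    if xy: "x \<in> carrier N" "y \<in> carrier N" for x y
  proof -
    have "f x y * (c (x \<otimes>\<^bsub>N\<^esub> y) * d (\<pi> (x \<otimes>\<^bsub>N\<^esub> y))) = (f x y * c (x \<otimes>\<^bsub>N\<^esub> y)) * d (\<pi> x \<otimes>\<^bsub>A\<^esub> \<pi> y)"
      using hom_mult[OF \<pi> xy] by simp
    also have "\<dots> = (h (\<pi> x) (\<pi> y) * d (\<pi> x \<otimes>\<^bsub>A\<^esub> \<pi> y)) * (c x * c y)" using c(2) xy by (simp add: mult_ac)
    also have "\<dots> = d (\<pi> x) * d (\<pi> y) * (c x * c y)" using d(2) \<pi>c xy by simp
    finally show ?thesis by (simp add: mult_ac)
  qed
  then show ?thesis unfolding trivial_class_iff trivial_on_def
    using c(1) d(1) \<pi>c by (intro exI[of _ "\<lambda>x. c x * d (\<pi> x)"]) simp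
qed

lemma cohomologous_trivial_right:
  fixes f :: "'a \<Rightarrow> 'a \<Rightarrow> 'k::field"
  assumes fg: "cohomologous N (\<lambda>a b. h (\<pi> a) (\<pi> b)) f" and \<pi>: "\<pi> \<in> hom N A" and h: "trivial_class A h"
    and N: "group N"
  shows "trivial_class N f"
proof (rule cohomologous_trivial_left[OF _ \<pi> h N])
  interpret N: group N by (rule N)
  obtain c where c: "\<forall>x\<in>carrier N. c x \<noteq> 0"
    "\<forall>x\<in>carrier N. \<forall>y\<in>carrier N. h (\<pi> x) (\<pi> y) * c (x \<otimes>\<^bsub>N\<^esub> y) = f x y * c x * c y"
    using fg unfolding cohomologous_def by blast
  have "f x y * (1 / c (x \<otimes>\<^bsub>N\<^esub> y)) = h (\<pi> x) (\<pi> y) * (1 / c x) * (1 / c y)" if xy: "x \<in> carrier N" "y \<in> carrier N" for x y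
  proof -
    have "c x \<noteq> 0" "c y \<noteq> 0" "c (x \<otimes>\<^bsub>N\<^esub> y) \<noteq> 0" using c(1) xy by simp_all
    moreover have "h (\<pi> x) (\<pi> y) * c (x \<otimes>\<^bsub>N\<^esub> y) = f x y * c x * c y" using c(2) xy by blast
    ultimately show ?thesis by (simp add: field_simps)
  qed
  then show "cohomologous N f (\<lambda>a b. h (\<pi> a) (\<pi> b))" unfolding cohomologous_def
    using c(1) by (intro exI[of _ "\<lambda>x. 1 / c x"]) simp
qed

context extraspecial_fusion
begin

lemma comm_self: "x \<in> carrier G \<Longrightarrow> comm x x = \<one>"
  using comm_one_iff by simp

lemma comm_plane: assumes V: "plane V" and xy: "x \<in> V" "y \<in> V" shows "comm x y = \<one>"
  using comm_one_iff[OF planeD(3)[OF V xy(1)] planeD(3)[OF V xy(2)]] plane_abelian[OF V xy] by simp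

lemma comm_trivial_plane:
  assumes V: "plane V" and v: "v \<in> V" "v \<notin> Z" and x: "x \<in> carrier G" "comm v x = \<one>" shows "x \<in> V"
proof -
  have vG: "v \<in> carrier G" using planeD(3)[OF V v(1)] .
  have "x \<otimes> w = w \<otimes> x" if w: "w \<in> V" for w
  proof -
    obtain z and n :: nat where z: "z \<in> Z" "w = z \<otimes> v [^] n" using plane_decomp[OF V v w] by blast
    have "comm w x = \<one>" unfolding z(2)
      using comm_mult_left[OF Z_subset[OF z(1)] nat_pow_closed[OF vG] x(1)] comm_central(2)[OF z(1) x(1)] comm_pow_left[OF vG x(1)] x(2) by simp
    then show ?thesis using comm_one_iff[OF planeD(3)[OF V w] x(1)] by simp
  qed
  then have "x \<in> centralizer G V" unfolding centralizer_def using x(1) by blast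
  then show ?thesis using plane_centralizer[OF V] by simp
qed

text \<open>The coordinates on \<open>S/Z\<close> are the commutator pairings with two non-commuting elements; the second
  one is corrected by a power of \<open>v\<close> to become an eigenvector of \<open>t\<close>.\<close>
lemma torus_coordinates:
  fixes g :: "'k::alg_closed_field"
  assumes char: "CHAR('k) = p" and V: "plane V" and g: "g \<in> \<int>" "g \<noteq> 0" "g ^ 3 \<noteq> 1"
    and t: "t \<in> F (carrier G) (carrier G)" and v: "v \<in> V" "v \<notin> Z" "t v = v [^] l" "of_nat l = 1 / g"
    and \<mu>: "\<And>x y. x \<in> Z \<Longrightarrow> y \<in> Z \<Longrightarrow> \<mu> (x \<otimes> y) = \<mu> x + \<mu> y" "\<And>x. x \<in> Z \<Longrightarrow> \<mu> x \<in> \<int>"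
      "\<And>x. x \<in> Z \<Longrightarrow> \<mu> x = 0 \<Longrightarrow> x = \<one>" "\<And>x. x \<in> Z \<Longrightarrow> \<mu> (t x) = g * \<mu> x"
  obtains s c1 c2 where "coordinates G p F (carrier G) Z v s c1 c2" "mat2 c1 c2 v s t = M2 (1 / g) 0 0 (g\<^sup>2)"
    "\<And>x. x \<in> carrier G \<Longrightarrow> c2 x = 0 \<longleftrightarrow> x \<in> V"
proof -
  let ?S = "carrier G"
  \<comment> \<open>The commutator pairing with values in the prime field, bilinear and
    alternating.\<close>
  define L where "L x y = \<mu> (comm x y)" for x y
  have vG: "v \<in> ?S" using planeD(3)[OF V v(1)] .
  have Z1: "\<one> \<in> Z" using subgroup.one_closed[OF Z_subgroup] .
  have \<mu>1: "\<mu> \<one> = 0" using \<mu>(1)[OF Z1 Z1] by (simp only: r_one one_closed add_cancel_right_right)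
  have L1: "L (x \<otimes> x') y = L x y + L x' y" if "x \<in> ?S" "x' \<in> ?S" "y \<in> ?S" for x x' y
    unfolding L_def comm_mult_left[OF that] by (rule \<mu>(1)[OF comm_Z comm_Z]) (use that in blast)+
  have L2: "L x (y \<otimes> y') = L x y + L x y'" if "x \<in> ?S" "y \<in> ?S" "y' \<in> ?S" for x y y'
    unfolding L_def comm_mult_right[OF that] by (rule \<mu>(1)[OF comm_Z comm_Z]) (use that in blast)+
  have L0: "L x y = 0 \<longleftrightarrow> comm x y = \<one>" if "x \<in> ?S" "y \<in> ?S" for x y
    unfolding L_def using \<mu>(3)[OF comm_Z[OF that]] \<mu>1 by auto
  have LI: "L x y \<in> \<int>" if "x \<in> ?S" "y \<in> ?S" for x y unfolding L_def by (rule \<mu>(2)[OF comm_Z[OF that]])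
  have Lxx: "L x x = 0" if "x \<in> ?S" for x using L0[OF that that] comm_self[OF that] by simp
  have La: "L y x = - L x y" if xy: "x \<in> ?S" "y \<in> ?S" for x y
  proof -
    have m: "x \<otimes> y \<in> ?S" using xy by simp
    have "0 = L (x \<otimes> y) (x \<otimes> y)" using Lxx[OF m] by simp
    also have "\<dots> = L x y + L y x" using L1[OF xy m] L2[OF xy(1) xy] L2[OF xy(2) xy] Lxx xy by simp
    finally show ?thesis by (simp add: eq_neg_iff_add_eq_0 add.commute)
  qed
  have Lp1: "L (x [^] (n::nat)) y = of_nat n * L x y" if xy: "x \<in> ?S" "y \<in> ?S" for x y n
  proof (induction n)
    case 0 then show ?case using L0[of \<one> y] comm_central(2)[OF Z1 xy(2)] xy by simp
  next
    case (Suc n) then show ?case using L1[of "x [^] n" x y] xy by (simp add: algebra_simps)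
  qed
  have Lp2: "L x (y [^] (n::nat)) = of_nat n * L x y" if xy: "x \<in> ?S" "y \<in> ?S" for x y n
    using La[of "y [^] n" x] Lp1[OF xy(2,1), of n] La[OF xy] xy by simp
  have tS: "t x \<in> ?S" if "x \<in> ?S" for x using F_image[OF t that] .
  \<comment> \<open>t multiplies values of the pairing by g and v by 1 / g, which leaves the factor
    g^2 for the other argument.\<close>
  have Lv: "L v (t x) = g\<^sup>2 * L v x" if x: "x \<in> ?S" for x
  proof -
    have "L (t v) (t x) = g * L v x" unfolding L_def F_comm[OF t vG x, symmetric] by (rule \<mu>(4)[OF comm_Z[OF vG x]])
    moreover have "L (t v) (t x) = 1 / g * L v (t x)" unfolding v(3) Lp1[OF vG tS[OF x]] v(4) ..
    ultimately show ?thesis using g(2) by (simp add: field_simps power2_eq_square)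
  qed
  have LV: "L v x = 0 \<longleftrightarrow> x \<in> V" if x: "x \<in> ?S" for x
    using L0[OF vG x] comm_trivial_plane[OF V v(1,2) x] comm_plane[OF V v(1), of x] by blast
  obtain s0 where s0: "s0 \<in> ?S" "s0 \<notin> V" using plane_proper[OF V] by blast
  have D0: "L v s0 \<noteq> 0" using LV[OF s0(1)] s0(2) by blast
  \<comment> \<open>The eigenvalues 1 / g and g^2 differ because g^3 \<noteq> 1, so an eigenvector
    outside V can be found.\<close>
  have gg: "g\<^sup>2 - 1 / g \<noteq> 0"
  proof
    assume "g\<^sup>2 - 1 / g = 0"
    then have "g ^ 3 = 1" using g(2) by (simp add: field_simps power2_eq_square power3_eq_cube)
    then show False using g(3) by blast
  qed
  \<comment> \<open>Replacing s0 by s0 v^n lowers \<open>L (t s) s\<close> by n times the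
    denominator here. The quotient is the n for which it vanishes, which says that t s is a multiple
    of s modulo Z.\<close>
  let ?q = "L (t s0) s0 / (L v s0 * (g\<^sup>2 - 1 / g))"
  have "?q \<in> \<int>"
    by (intro Ints_divide[OF p char] Ints_mult Ints_diff Ints_power LI tS) (use vG s0 g in auto)
  then obtain n where n: "?q = of_nat n" using Ints_char_p_E[OF p char] by blast
  define s where "s = s0 \<otimes> v [^] n"
  have vn: "v [^] n \<in> ?S" using vG by simp
  have sS: "s \<in> ?S" unfolding s_def using s0 vn by simp
  have Lvs: "L v s = L v s0" unfolding s_def using L2[OF vG s0(1) vn] Lp2[OF vG vG] Lxx[OF vG] by simp
  have D: "L v s \<noteq> 0" using Lvs D0 by simp
  have "t s = t s0 \<otimes> (v [^] l) [^] n" unfolding s_def using F_mult[OF t s0(1) vn] F_pow[OF t vG] v(3) by simp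
  then have "L (t s) s = L (t s0) s + of_nat n * (of_nat l * L v s)"
    using L1[OF tS[OF s0(1)] _ sS, of "(v [^] l) [^] n"] Lp1[OF _ sS, of "v [^] l" n] Lp1[OF vG sS, of l] vG by simp
  also have "L (t s0) s = L (t s0) s0 + of_nat n * L (t s0) v"
    unfolding s_def using L2[OF tS[OF s0(1)] s0(1) vn] Lp2[OF tS[OF s0(1)] vG, of n] by simp
  also have "L (t s0) v = - (g\<^sup>2 * L v s0)" using La[OF vG tS[OF s0(1)]] Lv[OF s0(1)] by simp
  finally have "L (t s) s = L (t s0) s0 - of_nat n * (L v s0 * (g\<^sup>2 - 1 / g))"
    unfolding Lvs v(4) by (simp add: algebra_simps)
  also have "\<dots> = 0" unfolding n[symmetric] using D0 gg by simp
  finally have Lts: "L (t s) s = 0" .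
  \<comment> \<open>Pairing with s reads off the coordinate along v, pairing with v the coordinate
    along s; \<open>L v s\<close> normalises both.\<close>
  define c1 c2 where "c1 x = L x s / L v s" and "c2 x = L v x / L v s" for x
  interpret C: coordinates G p F ?S Z v s c1 c2
  proof (intro coordinates.intro coordinates_axioms.intro)
    show "fusion G p F" by (rule fusion_axioms)
    show "CHAR('k) = p" by (rule char)
    show "subgroup ?S G" by (rule subgroup_self)
    show "Z \<subseteq> ?S" using Z_subset by blast
    show "v \<in> ?S" "s \<in> ?S" by (rule vG, rule sS)
    show "a x \<in> Z" if "a \<in> F ?S ?S" "x \<in> Z" for a x using Aut_Z[OF that(1)] that(2) by blast
    show "c1 x \<in> \<int>" "c2 x \<in> \<int>" if "x \<in> ?S" for x unfolding c1_def c2_def by (intro Ints_divide[OF p char] LI that vG sS)+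
    show "c1 (x \<otimes> y) = c1 x + c1 y" "c2 (x \<otimes> y) = c2 x + c2 y" if "x \<in> ?S" "y \<in> ?S" for x y
      unfolding c1_def c2_def L1[OF that sS] L2[OF vG that] by (simp_all add: add_divide_distrib)
    show "c1 v = 1" "c2 v = 0" "c1 s = 0" "c2 s = 1" unfolding c1_def c2_def using D Lxx[OF vG] Lxx[OF sS] by simp_all
    show "c1 x = 0" "c2 x = 0" if x: "x \<in> Z" for x
      unfolding c1_def c2_def using L0[OF Z_subset[OF x] sS] L0[OF vG Z_subset[OF x]] comm_central[OF x vG] comm_central[OF x sS] by simp_all
    show "x \<in> Z" if x: "x \<in> ?S" "c1 x = 0" "c2 x = 0" for x
    proof (rule Z_I[OF x(1)])
      have Ls: "L x s = 0" "L v x = 0" using x(2,3) D unfolding c1_def c2_def by simp_all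
      have xV: "x \<in> V" using LV[OF x(1)] Ls(2) by blast
      have sV: "s \<notin> V" using LV[OF sS] D by blast
      fix y assume y: "y \<in> ?S"
      obtain u and m :: nat where u: "u \<in> V" "y = u \<otimes> s [^] m" using S_decomp[OF V sS sV y] by blast
      have uG: "u \<in> ?S" using planeD(3)[OF V u(1)] .
      have "L x y = L x u + of_nat m * L x s" unfolding u(2) using L2[OF x(1) uG, of "s [^] m"] Lp2[OF x(1) sS, of m] sS by simp
      also have "\<dots> = 0" using Ls L0[OF x(1) uG] comm_plane[OF V xV u(1)] by simp
      finally have "comm x y = \<one>" using L0[OF x(1) y] by blast
      then show "x \<otimes> y = y \<otimes> x" using comm_one_iff[OF x(1) y] by blast
    qed
  qed
  have m1: "c1 (t v) = 1 / g" unfolding c1_def v(3) Lp1[OF vG sS] v(4) using D by simp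
  have m2: "c2 (t v) = 0" unfolding c2_def v(3) Lp2[OF vG vG] Lxx[OF vG] by simp
  have m3: "c1 (t s) = 0" unfolding c1_def Lts by simp
  have m4: "c2 (t s) = g\<^sup>2" unfolding c2_def Lv[OF sS] using D by simp
  have "mat2 c1 c2 v s t = M2 (1 / g) 0 0 (g\<^sup>2)" unfolding mat2_def m1 m2 m3 m4 ..
  moreover have "c2 x = 0 \<longleftrightarrow> x \<in> V" if "x \<in> ?S" for x using LV[OF that] D unfolding c2_def by simp
  ultimately show ?thesis using that C.coordinates_axioms by blast
qed

text \<open>If a x = x q with q fixed by a, the n-th power of a sends x to x q^n, and q^p = 1. M is
  abstract so that the computation serves the full automorphism group of S and the normaliser of a
  plane alike.\<close>

lemma twist_pow:
  assumes M: "group M" "\<And>a b. a \<otimes>\<^bsub>M\<^esub> b = restrict (a \<circ> b) (carrier G)" "\<one>\<^bsub>M\<^esub> = restrict id (carrier G)"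
    and a: "a \<in> F (carrier G) (carrier G)"
    and tw: "\<And>x. x \<in> carrier G \<Longrightarrow> \<exists>q\<in>carrier G. a q = q \<and> a x = x \<otimes> q"
  shows "a [^]\<^bsub>M\<^esub> p = \<one>\<^bsub>M\<^esub>"
proof (rule ext)
  interpret M: group M by (rule M(1))
  fix x
  obtain r where r: "p = Suc r" using p_gt_1 by (cases p) auto
  show "(a [^]\<^bsub>M\<^esub> p) x = \<one>\<^bsub>M\<^esub> x"
  proof (cases "x \<in> carrier G")
    case False
    then show ?thesis unfolding r M.nat_pow_Suc M by simp
  next
    case True
    obtain q where q: "q \<in> carrier G" "a q = q" "a x = x \<otimes> q" using tw[OF True] by blast
    have "(a [^]\<^bsub>M\<^esub> (n::nat)) y = y \<otimes> q [^] n" if "y \<in> carrier G" "a y = y \<otimes> q" for y n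
      using that
    proof (induction n arbitrary: y)
      case 0 then show ?case using M(3) by simp
    next
      case (Suc n)
      have 1: "y \<otimes> q \<in> carrier G" "a (y \<otimes> q) = y \<otimes> q \<otimes> q" using Suc.prems q F_mult[OF a] by simp_all
      have "(a [^]\<^bsub>M\<^esub> Suc n) y = (a [^]\<^bsub>M\<^esub> n) (y \<otimes> q)" unfolding M.nat_pow_Suc M(2) using Suc.prems by simp
      also have "\<dots> = y \<otimes> (q \<otimes> q [^] n)" using Suc.IH[OF 1] Suc.prems q by (simp add: m_assoc)
      also have "q \<otimes> q [^] n = q [^] Suc n" using nat_pow_Suc2[OF q(1)] by simp
      finally show ?case .
    qed
    from this[OF True q(3), of p] show ?thesis using pow_p[OF q(1)] M(3) True by simp
  qed
qed

text \<open>Trivial action on S/Z forces trivial action on Z, whose elements are commutators. Then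
  the p-th power of a is trivial, and the outer automorphism group of S has order prime to
  p.\<close>

lemma S_kernel:
  fixes c1 c2 :: "'a \<Rightarrow> 'k::alg_closed_field"
  assumes C: "coordinates G p F (carrier G) Z e1 e2 c1 c2"
    and a: "a \<in> F (carrier G) (carrier G)" "mat2 c1 c2 e1 e2 a = M2 1 0 0 1"
  shows "a \<in> Inn G (carrier G)"
proof -
  let ?S = "carrier G" and ?A = "OutGrp G F (carrier G)"
  interpret C: coordinates G p F ?S Z e1 e2 c1 c2 by (rule C)
  interpret A: group ?A by (rule OutGrp_group[OF subgroup_self])
  interpret U: group "AutGrp F ?S" by (rule AutGrp_group[OF subgroup_self])
  have ax: "\<exists>z\<in>Z. a x = x \<otimes> z" if x: "x \<in> ?S" for x
  proof -
    have "c1 (a x) = c1 x" "c2 (a x) = c2 x" using C.c_linear[OF a(1) x] a(2) unfolding mat2_def by simp_all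
    then have z: "a x \<otimes> inv x \<in> Z" using C.c_eq[OF F_image[OF a(1) x] x] by simp
    have "a x = a x \<otimes> inv x \<otimes> x" using F_carrier[OF a(1) x] by (simp add: m_assoc)
    also have "\<dots> = x \<otimes> (a x \<otimes> inv x)" using Z_comm[OF z x] .
    finally show ?thesis using z by blast
  qed
  have fixZ: "a z = z" if z: "z \<in> Z" for z
  proof -
    have "\<not> ?S \<subseteq> Z"
    proof
      assume "?S \<subseteq> Z"
      then have "e1 \<in> Z" using C.e(1) by blast
      then show False using C.c_K(1) C.c_e(1) by force
    qed
    then obtain v where v: "v \<in> ?S" "v \<notin> Z" by blast
    obtain h where h: "h \<in> ?S" "comm h v = z" using comm_surj[OF v z] by blast
    obtain y where y: "y \<in> Z" "a h = h \<otimes> y" using ax[OF h(1)] by blast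
    obtain y' where y': "y' \<in> Z" "a v = v \<otimes> y'" using ax[OF v(1)] by blast
    have yG: "y \<in> ?S" "y' \<in> ?S" using y y' Z_subset by blast+
    have "a z = comm (h \<otimes> y) (v \<otimes> y')" unfolding h(2)[symmetric] F_comm[OF a(1) h(1) v(1)] y(2) y'(2) ..
    also have "\<dots> = comm h v"
      using comm_mult_left[OF h(1) yG(1), of "v \<otimes> y'"] comm_mult_right[OF h(1) v(1) yG(2)] comm_central(1)[OF y'(1) h(1)]
        comm_central(2)[OF y(1), of "v \<otimes> y'"] v(1) yG h(1) comm_closed[OF h(1) v(1)] by simp
    finally show ?thesis using h(2) by simp
  qed
  have ap: "a [^]\<^bsub>AutGrp F ?S\<^esub> p = \<one>\<^bsub>AutGrp F ?S\<^esub>"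
  proof (rule twist_pow[OF U.is_group AutGrp_simps(2,3) a(1)])
    fix x assume "x \<in> ?S"
    then obtain z where "z \<in> Z" "a x = x \<otimes> z" using ax by blast
    then show "\<exists>q\<in>?S. a q = q \<and> a x = x \<otimes> q" using fixZ Z_subset by blast
  qed
  have aU: "a \<in> carrier (AutGrp F ?S)" using a(1) unfolding AutGrp_simps .
  interpret h: group_hom "AutGrp F ?S" ?A "out_cls G F ?S"
    by unfold_locales (rule out_cls_hom[OF subgroup_self])
  have 1: "out_cls G F ?S a [^]\<^bsub>?A\<^esub> p = \<one>\<^bsub>?A\<^esub>" using h.hom_nat_pow[OF aU, of p] unfolding ap h.hom_one by (rule sym)
  let ?X = "out_cls G F ?S a"
  have X: "?X \<in> carrier ?A" using h.hom_closed[OF aU] .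
  have "A.ord ?X dvd p" using A.pow_eq_id[OF X] 1 by blast
  then have "A.ord ?X = 1 \<or> A.ord ?X = p" using p unfolding prime_nat_iff by blast
  moreover have "A.ord ?X dvd card (carrier ?A)" using A.ord_dvd_group_order[OF X] unfolding Coset.order_def .
  ultimately have "A.ord ?X = 1" using p_not_dvd_Out by metis
  then have "?X = \<one>\<^bsub>?A\<^esub>" using A.ord_eq_1[OF X] by simp
  then show ?thesis using out_cls_one_iff[OF subgroup_self a(1)] by blast
qed

lemma restrict_hom:
  assumes Q: "subgroup Q G"
  shows "(\<lambda>a. out_cls G F Q (restrict a Q)) \<in> hom (AutGrp_norm F (carrier G) Q) (OutGrp G F Q)"
proof (rule homI)
  let ?S = "carrier G"
  have QS: "Q \<subseteq> ?S" using subgroup.subset[OF Q] .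
  have r: "restrict a Q \<in> F Q Q" if "a \<in> carrier (AutGrp_norm F ?S Q)" for a
    using F_restrict[of a ?S ?S Q Q] that Q QS unfolding AutGrp_norm_simps by blast
  show "out_cls G F Q (restrict a Q) \<in> carrier (OutGrp G F Q)" if "a \<in> carrier (AutGrp_norm F ?S Q)" for a
    using out_cls_surj[OF Q] r[OF that] by blast
  show "out_cls G F Q (restrict (a \<otimes>\<^bsub>AutGrp_norm F ?S Q\<^esub> b) Q) =
      out_cls G F Q (restrict a Q) \<otimes>\<^bsub>OutGrp G F Q\<^esub> out_cls G F Q (restrict b Q)"
    if a: "a \<in> carrier (AutGrp_norm F ?S Q)" and b: "b \<in> carrier (AutGrp_norm F ?S Q)" for a b
  proof -
    have bQ: "b x \<in> Q" if "x \<in> Q" for x using b that unfolding AutGrp_norm_simps by blast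
    have "restrict (a \<otimes>\<^bsub>AutGrp_norm F ?S Q\<^esub> b) Q = restrict (restrict a Q \<circ> restrict b Q) Q"
      unfolding AutGrp_norm_simps using QS bQ by (auto simp: restrict_def fun_eq_iff)
    then show ?thesis using hom_mult[OF out_cls_hom[OF Q], of "restrict a Q" "restrict b Q"] r[OF a] r[OF b] unfolding AutGrp_simps by simp
  qed
qed

lemma out_cls_norm_hom:
  assumes Q: "subgroup Q G"
  shows "out_cls G F (carrier G) \<in> hom (AutGrp_norm F (carrier G) Q) (OutGrp G F (carrier G))"
proof -
  have "out_cls G F (carrier G) \<in> hom (AutGrp F (carrier G)) (OutGrp G F (carrier G))" using out_cls_hom[OF subgroup_self] .
  then show ?thesis unfolding hom_def AutGrp_simps AutGrp_norm_simps by blast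
qed

text \<open>The upper triangular classes are exactly those of automorphisms normalising V, since the
  lower left entry is the coordinate of the image of v outside V. The assumption N gives triviality
  on them, because the kernel of the map to outer classes consists of inner automorphisms and is
  p-torsion. This is the splitting that \<open>torus_extension\<close> asks for.\<close>

lemma S_trivial:
  fixes f :: "_ \<Rightarrow> _ \<Rightarrow> 'k::alg_closed_field"
  assumes char: "CHAR('k) = p" and V: "plane V" and w: "w \<in> F V V" "w ` Z \<noteq> Z"
    and f: "cocycle2 (OutGrp G F (carrier G)) f"
    and N: "trivial_class (AutGrp_norm F (carrier G) V) (\<lambda>a b. f (out_cls G F (carrier G) a) (out_cls G F (carrier G) b))"
  shows "trivial_class (OutGrp G F (carrier G)) f"
proof -
  let ?S = "carrier G" and ?A = "OutGrp G F (carrier G)" and ?N = "AutGrp_norm F (carrier G) V"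
  note Vs = planeD(1)[OF V]
  have VS: "V \<subseteq> ?S" using planeD(3)[OF V] by blast
  interpret A: group ?A by (rule OutGrp_group[OF subgroup_self])
  interpret Ng: group ?N by (rule AutGrp_norm_group(1)[OF subgroup_self Vs VS])
  obtain g :: 'k where g: "g \<in> \<int>" "g \<noteq> 0" "\<And>a. a \<in> \<int> \<Longrightarrow> a \<noteq> 0 \<Longrightarrow> \<exists>n. a = g ^ n" "\<And>n. g ^ n = 1 \<longleftrightarrow> (p - 1) dvd n"
  proof (rule Ints_primitive_root[OF p char])
    fix h :: 'k
    assume h: "h \<in> \<int>" "h \<noteq> 0" "\<And>a. a \<in> \<int> \<Longrightarrow> a \<noteq> 0 \<Longrightarrow> \<exists>n. a = h ^ n" "\<And>n. h ^ n = 1 \<longleftrightarrow> (p - 1) dvd n"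
    show thesis by (rule that[OF h])
  qed
  \<comment> \<open>p - 1 is even and so does not divide 3.\<close>
  have g3: "g ^ 3 \<noteq> 1"
  proof
    assume "g ^ 3 = 1"
    then have d: "(p - 1) dvd 3" using g(4) by blast
    have "even (p - 1)" using p_odd p_gt_1 by simp
    then have "even (3::nat)" using d dvd_trans by blast
    then show False by simp
  qed
  show ?thesis
  proof (rule essential_torus[OF char V w g(1,2)])
    fix t v and l :: nat and \<mu> :: "'a \<Rightarrow> 'k"
    assume t: "t \<in> F ?S ?S" "t ` V = V" and v: "v \<in> V" "v \<notin> Z" "t v = v [^] l" "of_nat l = 1 / g"
      and \<mu>: "\<And>x y. x \<in> Z \<Longrightarrow> y \<in> Z \<Longrightarrow> \<mu> (x \<otimes> y) = \<mu> x + \<mu> y" "\<And>x. x \<in> Z \<Longrightarrow> \<mu> x \<in> \<int>"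
        "\<And>x. x \<in> Z \<Longrightarrow> \<mu> x = 0 \<Longrightarrow> x = \<one>" "\<And>x. x \<in> Z \<Longrightarrow> \<mu> (t x) = g * \<mu> x"
    show ?thesis
    proof (rule torus_coordinates[OF char V g(1,2) g3 t(1) v \<mu>])
      fix s c1 c2
      assume C: "coordinates G p F ?S Z v s c1 c2" and mt: "mat2 c1 c2 v s t = M2 (1 / g) 0 0 (g\<^sup>2)"
        and c2V: "\<And>x. x \<in> ?S \<Longrightarrow> c2 x = 0 \<longleftrightarrow> x \<in> V"
      interpret C: coordinates G p F ?S Z v s c1 c2 by (rule C)
      interpret M: matrix_extension "cocycle_extension ?A f" ?A snd "\<lambda>u. (u / f \<one>\<^bsub>?A\<^esub> \<one>\<^bsub>?A\<^esub>, \<one>\<^bsub>?A\<^esub>)" C.rep p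
        by (rule C.matrix_ext[OF f p_odd S_kernel[OF C]])
      let ?H = "out_cls G F ?S ` carrier ?N"
      have ker: "\<exists>n. a [^]\<^bsub>?N\<^esub> (p ^ n) = \<one>\<^bsub>?N\<^esub>" if a: "a \<in> carrier ?N" "out_cls G F ?S a = \<one>\<^bsub>?A\<^esub>" for a
      proof -
        have aF: "a \<in> F ?S ?S" using a(1) unfolding AutGrp_norm_simps by blast
        obtain q where q: "q \<in> ?S" "a = conjm G q ?S" using out_cls_one_iff[OF subgroup_self aF] a(2) unfolding Inn_def by blast
        have "a [^]\<^bsub>?N\<^esub> p = \<one>\<^bsub>?N\<^esub>"
        proof (rule twist_pow[OF Ng.is_group AutGrp_norm_simps(2,3) aF])
          fix x assume x: "x \<in> ?S"
          have z: "comm q x \<in> Z" using comm_Z[OF q(1) x] .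
          have zS: "comm q x \<in> ?S" using Z_subset[OF z] .
          have "a (comm q x) = comm q x" unfolding q(2) conjm_apply[OF zS] comm_conj[OF q(1) zS] comm_central(1)[OF z q(1)] using zS by simp
          moreover have "a x = x \<otimes> comm q x" unfolding q(2) conjm_apply[OF x] comm_conj[OF q(1) x] using Z_comm[OF z x] .
          ultimately show "\<exists>q\<in>?S. a q = q \<and> a x = x \<otimes> q" using zS by blast
        qed
        then show ?thesis by (intro exI[of _ 1]) simp
      qed
      have trH: "trivial_on ?A f ?H"
        by (rule trivial_on_image[OF p char Ng.is_group A.is_group out_cls_norm_hom[OF Vs] f ker N])
      have sgH: "subgroup ?H ?A"
      proof -
        interpret h: group_hom ?N ?A "out_cls G F ?S" by unfold_locales (rule out_cls_norm_hom[OF Vs])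
        show ?thesis by (rule h.subgroup_img_is_subgroup[OF Ng.subgroup_self])
      qed
      have Heq: "{x \<in> carrier ?A. \<exists>a b d. C.rep x = M2 a b 0 d} = ?H"
      proof (intro equalityI subsetI)
        fix x assume "x \<in> {x \<in> carrier ?A. \<exists>a b d. C.rep x = M2 a b 0 d}"
        then have x: "x \<in> carrier ?A" "\<exists>a b d. C.rep x = M2 a b 0 d" by blast+
        obtain a where a: "a \<in> F ?S ?S" "x = out_cls G F ?S a" using C.Out_E[OF x(1)] by blast
        have "c2 (a v) = 0" using x(2) unfolding a(2) C.rep_cls[OF a(1)] mat2_def by auto
        then have avV: "a v \<in> V" using c2V F_image[OF a(1) C.e(1)] by blast
        have "a y \<in> V" if y: "y \<in> V" for y
        proof -
          obtain z and n :: nat where z: "z \<in> Z" "y = z \<otimes> v [^] n" using plane_decomp[OF V v(1,2) y] by blast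
          have "a y = a z \<otimes> a v [^] n" unfolding z(2) using F_mult[OF a(1) Z_subset[OF z(1)], of "v [^] n"] F_pow[OF a(1) C.e(1), of n] C.e(1) by simp
          moreover have "a z \<in> V" using Aut_Z[OF a(1)] z(1) plane_Z[OF V] by blast
          ultimately show ?thesis using subgroup.m_closed[OF Vs] pow_closed[OF Vs avV] by simp
        qed
        then have "a ` V = V" using endo_inj_surj[OF sub_finite[OF Vs]] inj_on_subset[OF F_inj[OF a(1)] VS] by blast
        then show "x \<in> ?H" unfolding a(2) AutGrp_norm_simps using a(1) by blast
      next
        fix x assume "x \<in> ?H"
        then obtain a where a: "a \<in> F ?S ?S" "a ` V = V" "x = out_cls G F ?S a" unfolding AutGrp_norm_simps by blast
        have "a v \<in> V" using a(2) v(1) by blast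
        then have "c2 (a v) = 0" using c2V F_image[OF a(1) C.e(1)] by blast
        then have "C.rep x = M2 (c1 (a v)) (c1 (a s)) 0 (c2 (a s))" unfolding a(3) C.rep_cls[OF a(1)] mat2_def by simp
        moreover have "x \<in> carrier ?A" unfolding a(3) using out_cls_surj[OF subgroup_self] a(1) by blast
        ultimately show "x \<in> {x \<in> carrier ?A. \<exists>a b d. C.rep x = M2 a b 0 d}" by blast
      qed
      have tA: "out_cls G F ?S t \<in> carrier ?A" using out_cls_surj[OF subgroup_self] t(1) by blast
      have spl: "M.splits {x \<in> carrier ?A. \<exists>a b d. C.rep x = M2 a b 0 d}"
        unfolding Heq by (rule trivial_on_imp_splits[OF A.is_group f sgH trH])
      have T: "torus_extension (cocycle_extension ?A f) ?A snd (\<lambda>u. (u / f \<one>\<^bsub>?A\<^esub> \<one>\<^bsub>?A\<^esub>, \<one>\<^bsub>?A\<^esub>)) C.rep p (out_cls G F ?S t) g"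
      proof (intro torus_extension.intro torus_extension_axioms.intro M.matrix_extension_axioms)
        show "C.rep (out_cls G F ?S t) = M2 (1 / g) 0 0 (g\<^sup>2)" unfolding C.rep_cls[OF t(1)] by (rule mt)
      qed (rule finite_Out[OF subgroup_self] p_not_dvd_Out g tA spl; assumption?)+
      show ?thesis by (rule splits_imp_trivial_class[OF A.is_group f torus_extension.torus_splits[OF T]])
    qed
  qed
qed

text \<open>Every automorphism of Q preserves Z and extends to S, so restriction from the normaliser
  is onto. An automorphism of S that is inner on Q is trivial there, as Q is abelian; it then moves
  each x by an element of the centraliser of Q, which is Q and is fixed. So the kernel is
  p-torsion.\<close>

lemma nonessential_trivial:
  fixes f :: "_ \<Rightarrow> _ \<Rightarrow> 'k::alg_closed_field"
  assumes char: "CHAR('k) = p" and Q: "plane Q" and ne: "\<And>b. b \<in> F Q Q \<Longrightarrow> b ` Z = Z"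
    and f: "cocycle2 (OutGrp G F Q) f"
    and N: "trivial_class (AutGrp_norm F (carrier G) Q)
      (\<lambda>a b. f (out_cls G F Q (restrict a Q)) (out_cls G F Q (restrict b Q)))"
  shows "trivial_class (OutGrp G F Q) f"
proof -
  let ?S = "carrier G" and ?A = "OutGrp G F Q" and ?N = "AutGrp_norm F (carrier G) Q"
  let ?h = "\<lambda>a. out_cls G F Q (restrict a Q)"
  note Qs = planeD(1)[OF Q]
  have QS: "Q \<subseteq> ?S" using planeD(3)[OF Q] by blast
  interpret Ng: group ?N by (rule AutGrp_norm_group(1)[OF subgroup_self Qs QS])
  have ker: "\<exists>n. a [^]\<^bsub>?N\<^esub> (p ^ n) = \<one>\<^bsub>?N\<^esub>" if a: "a \<in> carrier ?N" "?h a = \<one>\<^bsub>?A\<^esub>" for a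
  proof -
    have aF: "a \<in> F ?S ?S" "a ` Q = Q" using a(1) unfolding AutGrp_norm_simps by blast+
    have rF: "restrict a Q \<in> F Q Q" by (rule F_restrict[OF aF(1) Qs QS Qs]) (use aF(2) in simp)
    obtain q where q: "q \<in> Q" "restrict a Q = conjm G q Q" using out_cls_one_iff[OF Qs rF] a(2) unfolding Inn_def by blast
    have fixQ: "a y = y" if y: "y \<in> Q" for y
    proof -
      have "a y = restrict a Q y" using y by simp
      also have "\<dots> = q \<otimes> y \<otimes> inv q" unfolding q(2) by (rule conjm_apply[OF y])
      also have "\<dots> = y" unfolding plane_abelian[OF Q q(1) y] using planeD(3)[OF Q] q(1) y by (simp add: m_assoc)
      finally show ?thesis .
    qed
    have "a [^]\<^bsub>?N\<^esub> p = \<one>\<^bsub>?N\<^esub>"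
    proof (rule twist_pow[OF Ng.is_group AutGrp_norm_simps(2,3) aF(1)])
      fix x assume x: "x \<in> ?S"
      have ax: "a x \<in> ?S" using F_image[OF aF(1) x] .
      let ?q = "inv x \<otimes> a x"
      have qS: "?q \<in> ?S" using x ax by simp
      have e: "a x = x \<otimes> ?q" using x ax by (simp add: m_assoc[symmetric])
      have "?q \<otimes> y = y \<otimes> ?q" if y: "y \<in> Q" for y
      proof -
        have yS: "y \<in> ?S" using QS y by blast
        have "comm x y \<in> Q" using comm_Z[OF x yS] plane_Z[OF Q] by blast
        then have "comm x y = a (comm x y)" using fixQ by simp
        also have "\<dots> = comm (a x) y" using F_comm[OF aF(1) x yS] fixQ[OF y] by simp
        also have "\<dots> = comm (x \<otimes> ?q) y" using e by simp
        also have "\<dots> = comm x y \<otimes> comm ?q y" by (rule comm_mult_left[OF x qS yS])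
        finally have "comm ?q y = \<one>" using comm_closed[OF x yS] comm_closed[OF qS yS] by simp
        then show ?thesis using comm_one_iff[OF qS yS] by blast
      qed
      then have "?q \<in> centralizer G Q" unfolding centralizer_def using qS by blast
      then have "?q \<in> Q" using plane_centralizer[OF Q] by simp
      then show "\<exists>q\<in>?S. a q = q \<and> a x = x \<otimes> q" using fixQ e qS by blast
    qed
    then show ?thesis by (intro exI[of _ 1]) simp
  qed
  have "trivial_on ?A f (?h ` carrier ?N)"
    by (rule trivial_on_image[OF p char Ng.is_group OutGrp_group[OF Qs] restrict_hom[OF Qs] f ker N])
  moreover have "?h ` carrier ?N = carrier ?A"
  proof
    show "?h ` carrier ?N \<subseteq> carrier ?A" using hom_in_carrier[OF restrict_hom[OF Qs]] by blast
    show "carrier ?A \<subseteq> ?h ` carrier ?N"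
    proof
      fix x assume "x \<in> carrier ?A"
      then obtain a where a: "a \<in> F Q Q" "x = out_cls G F Q a" using out_cls_surj[OF Qs] by blast
      obtain b where b: "b \<in> F ?S ?S" "\<And>y. y \<in> Q \<Longrightarrow> b y = a y" using plane_extend[OF a(1) Q ne[OF a(1)]] by blast
      have "restrict b Q = a" using F_ext[OF a(1)] b(2) by (auto simp: restrict_def extensional_def fun_eq_iff)
      moreover have "b ` Q = Q" using F_surj[OF a(1)] b(2) by (metis image_cong)
      ultimately show "x \<in> ?h ` carrier ?N" unfolding AutGrp_norm_simps a(2) using b(1) by blast
    qed
  qed
  ultimately show ?thesis unfolding trivial_class_iff by simp
qed

theorem compatible_family_trivial:
  fixes \<alpha> :: "'a set \<Rightarrow> ('a \<Rightarrow> 'a) set \<Rightarrow> ('a \<Rightarrow> 'a) set \<Rightarrow> 'k::alg_closed_field"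
  assumes char: "CHAR('k) = p" and nc: "\<not> constrained G F" and \<alpha>: "compatible_family G F \<alpha>"
    and Q: "F_centric G F Q"
  shows "trivial_class (OutGrp G F Q) (\<alpha> Q)"
proof -
  let ?S = "carrier G"
  have co: "cocycle2 (OutGrp G F Q) (\<alpha> Q)" if "F_centric G F Q" for Q
    using \<alpha> that unfolding compatible_family_def by blast
  have res: "cohomologous (AutGrp_norm F ?S P) (\<lambda>a b. \<alpha> ?S (out_cls G F ?S a) (out_cls G F ?S b))
          (\<lambda>a b. \<alpha> P (out_cls G F P (restrict a P)) (out_cls G F P (restrict b P)))" if P: "plane P" for P
  proof -
    have "P \<subseteq> ?S" using planeD(3)[OF P] by blast
    then show ?thesis using \<alpha>[unfolded compatible_family_def, THEN conjunct2, THEN conjunct2] plane_centric[OF P] S_centric by blast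
  qed
  have grN: "group (AutGrp_norm F ?S P)" if P: "plane P" for P
    by (rule AutGrp_norm_group(1)[OF subgroup_self planeD(1)[OF P]]) (use planeD(3)[OF P] in blast)
  obtain V w where V: "plane V" and w: "w \<in> F V V" "w ` Z \<noteq> Z"
  proof -
    have "\<exists>V w. plane V \<and> w \<in> F V V \<and> w ` Z \<noteq> Z"
    proof (rule ccontr)
      assume "\<not> ?thesis"
      then have "constrained G F" by (intro constrainedI) blast
      then show False using nc by blast
    qed
    then show ?thesis using that by blast
  qed
  have tV: "trivial_class (OutGrp G F V) (\<alpha> V)" by (rule essential_trivial[OF char V w co[OF plane_centric[OF V]]])
  have tS: "trivial_class (OutGrp G F ?S) (\<alpha> ?S)"
    by (rule S_trivial[OF char V w co[OF S_centric] cohomologous_trivial_left[OF res[OF V] restrict_hom[OF planeD(1)[OF V]] tV grN[OF V]]])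
  from centric_cases[OF Q] show ?thesis
  proof
    assume P: "plane Q"
    show ?thesis
    proof (cases "\<exists>b\<in>F Q Q. b ` Z \<noteq> Z")
      case True
      then show ?thesis using essential_trivial[OF char P _ _ co[OF Q]] by blast
    next
      case False
      show ?thesis
        by (rule nonessential_trivial[OF char P _ co[OF Q]
              cohomologous_trivial_right[OF res[OF P] out_cls_norm_hom[OF planeD(1)[OF P]] tS grN[OF P]]])
          (use False in blast)
    qed
  next
    assume "Q = ?S"
    then show ?thesis using tS by simp
  qed
qed

end

theorem theorem4p4:
  fixes G :: "'g monoid" and p :: nat
    and F :: "'g set \<Rightarrow> 'g set \<Rightarrow> ('g \<Rightarrow> 'g) set"
    and k_type :: "'k::alg_closed_field itself"
  assumes "prime p" and "odd p"
    and "CHAR('k) = p"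
    and "extraspecial G p" and "card (carrier G) = p ^ 3" and "has_exponent G p"
    and "saturated G p F" and "\<not> constrained G F"
  shows "\<forall>\<alpha> :: 'g set \<Rightarrow> ('g \<Rightarrow> 'g) set \<Rightarrow> ('g \<Rightarrow> 'g) set \<Rightarrow> 'k.
           compatible_family G F \<alpha> \<longrightarrow>
           (\<forall>Q. F_centric G F Q \<longrightarrow> trivial_class (OutGrp G F Q) (\<alpha> Q))"
proof (intro allI impI)
  fix \<alpha> :: "'g set \<Rightarrow> ('g \<Rightarrow> 'g) set \<Rightarrow> ('g \<Rightarrow> 'g) set \<Rightarrow> 'k" and Q
  assume \<alpha>: "compatible_family G F \<alpha>" and Q: "F_centric G F Q"
  have "fusion_system G p F" using assms(7) unfolding saturated_def by blast
  then interpret extraspecial_fusion G p F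
    using assms(2,4-7) by (intro extraspecial_fusion.intro fusion.intro fusion_axioms.intro extraspecial_fusion_axioms.intro)
      (auto simp: extraspecial_def)
  show "trivial_class (OutGrp G F Q) (\<alpha> Q)" by (rule compatible_family_trivial[OF assms(3,8) \<alpha> Q])
qed

end
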